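(* Let $X$ be a spectrally negative L\'evy process and let $\omega:\mathbb{R}\to[0,\infty)$ be measurable and locally bounded. Assume that there is a constant $\phi\ge0$ with $\omega(x)=\phi$ for all $x\le 0$. Let $\mathcal{H}^{(\omega)}$ be the locally bounded function on $\mathbb{R}$ satisfying $$\mathcal{H}^{(\omega)}(x)=e^{\Phi(\phi)x}+\int_0^x W^{(\phi)}(x-z)(\omega(z)-\phi)\mathcal{H}^{(\omega)}(z)\,dz,\qquad x\in\mathbb{R}$$ (so $\mathcal{H}^{(\omega)}(x)=e^{\Phi(\phi)x}$ for $x\le0$). Then for all $x,c\in\mathbb{R}$ with $x\le c$, $$\mathbb{E}_x\left[\exp\left(-\int_0^{\tau_c^+}\omega(X_s)\,ds\right);\ \tau_c^+<\infty\right]=\frac{\mathcal{H}^{(\omega)}(x)}{\mathcal{H}^{(\omega)}(c)}.$$ Moreover, for $x,y\le c$, $$\int_0^\infty\mathbb{E}_x\left[\exp\left(-\int_0^t\omega(X_s)\,ds\right);\ t<\tau_c^+,\ X_t\in dy\right]dt=\left(\frac{\mathcal{H}^{(\omega)}(x)}{\mathcal{H}^{(\omega)}(c)}\,\mathcal{W}^{(\omega)}(c,y)-\mathcal{W}^{(\omega)}(x,y)\right)dy,$$ as an identity of measures in $dy$ on $(-\infty,c]$.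
   Context: $X=\{X_t,t\ge 0\}$ is a spectrally negative L\'evy process (a c\`adl\`ag process with stationary independent increments and no positive jumps) that is not the negative of a subordinator. Its Laplace exponent $\psi$, defined by $\mathbb{E}[e^{\theta X_t}]=e^{t\psi(\theta)}$ for $\theta\ge 0$, is continuous and strictly convex on $[0,\infty)$ and tends to $\infty$ at $\infty$. $\mathbb{P}_x$ is the law of $X$ with $X_0=x$, and $\mathbb{E}_x$ its expectation. $\mathbb{E}[\,\cdot\,;A]$ means $\mathbb{E}[\,\cdot\,\mathbf 1_A]$. $\Phi(\theta)=\inf\{s>0:\psi(s)>\theta\}$, $\theta\ge0$. For $q\ge 0$ the scale function $W^{(q)}:\mathbb{R}\to[0,\infty)$ vanishes on $(-\infty,0)$, is continuous and increasing on $[0,\infty)$, and satisfies $\int_0^\infty e^{-\theta y}W^{(q)}(y)\,dy=1/(\psi(\theta)-q)$ for $\theta>\Phi(q)$. $W:=W^{(0)}$. First passage time: $\tau_c^+=\inf\{t>0:X_t>c\}$, with $\inf\emptyset=\infty$. For each $y\in\mathbb{R}$, $\mathcal{W}^{(\omega)}(\cdot,y)$ is the unique locally bounded function on $\mathbb{R}$ satisfying $\mathcal{W}^{(\omega)}(x,y)=W(x-y)+\int_y^x W(x-z)\omega(z)\mathcal{W}^{(\omega)}(z,y)\,dz$ (so $\mathcal{W}^{(\omega)}(x,y)=0$ for $x<y$). *)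

theory Defs
  imports "HOL-Probability.Probability"
begin

definition cadlag_path :: "(real \<Rightarrow> real) \<Rightarrow> bool" where
  "cadlag_path p \<longleftrightarrow>
     (\<forall>t\<ge>0. continuous (at_right t) p) \<and> (\<forall>t>0. \<exists>l. (p \<longlongrightarrow> l) (at_left t))"

definition no_positive_jumps :: "(real \<Rightarrow> real) \<Rightarrow> bool" where
  "no_positive_jumps p \<longleftrightarrow> (\<forall>t>0. \<forall>l. (p \<longlongrightarrow> l) (at_left t) \<longrightarrow> p t \<le> l)"

text \<open>
  Only the times \<open>t \<ge> 0\<close> matter. All paths are cadlag, not merely almost all of them, so that
  first passage times are measurable without completing the probability space.
\<close>

definition levy_process :: "'a measure \<Rightarrow> (real \<Rightarrow> 'a \<Rightarrow> real) \<Rightarrow> bool" where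
  "levy_process M X \<longleftrightarrow>
     prob_space M \<and>
     (\<forall>t\<ge>0. X t \<in> borel_measurable M) \<and>
     (AE \<xi> in M. X 0 \<xi> = 0) \<and>
     (\<forall>s\<ge>0. \<forall>h\<ge>0. distr M borel (\<lambda>\<xi>. X (s + h) \<xi> - X s \<xi>) =
                        distr M borel (\<lambda>\<xi>. X h \<xi> - X 0 \<xi>)) \<and>
     (\<forall>n (t :: nat \<Rightarrow> real). 0 \<le> t 0 \<longrightarrow> (\<forall>i<n. t i \<le> t (Suc i)) \<longrightarrow>
        prob_space.indep_vars M (\<lambda>_. borel) (\<lambda>i \<xi>. X (t (Suc i)) \<xi> - X (t i) \<xi>) {..<n}) \<and>
     (\<forall>\<xi>\<in>space M. cadlag_path (\<lambda>t. X t \<xi>))"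

definition subordinator :: "'a measure \<Rightarrow> (real \<Rightarrow> 'a \<Rightarrow> real) \<Rightarrow> bool" where
  "subordinator M X \<longleftrightarrow>
     levy_process M X \<and> (AE \<xi> in M. mono_on {0..} (\<lambda>t. X t \<xi>))"

definition spectrally_negative_levy :: "'a measure \<Rightarrow> (real \<Rightarrow> 'a \<Rightarrow> real) \<Rightarrow> bool" where
  "spectrally_negative_levy M X \<longleftrightarrow>
     levy_process M X \<and>
     (AE \<xi> in M. no_positive_jumps (\<lambda>t. X t \<xi>)) \<and>
     \<not> subordinator M (\<lambda>t \<xi>. - X t \<xi>)"

text \<open>
  The law \<open>P\<^sub>x\<close> is that of the process started at \<open>x\<close>, where \<open>X\<close> itself starts at 0 under \<open>M\<close>.
\<close>

definition started_at :: "real \<Rightarrow> (real \<Rightarrow> 'a \<Rightarrow> real) \<Rightarrow> real \<Rightarrow> 'a \<Rightarrow> real" where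
  "started_at x X t \<xi> = x + X t \<xi>"

definition first_passage_above :: "(real \<Rightarrow> 'a \<Rightarrow> real) \<Rightarrow> real \<Rightarrow> 'a \<Rightarrow> ereal" where
  "first_passage_above Y c \<xi> = Inf (ereal ` {t. 0 < t \<and> c < Y t \<xi>})"

text \<open>
  The Bochner integral of a non-integrable function is 0 and \<open>exp\<close> is positive, so the
  equation below includes the finiteness of the exponential moments.
\<close>

definition is_laplace_exponent ::
    "'a measure \<Rightarrow> (real \<Rightarrow> 'a \<Rightarrow> real) \<Rightarrow> (real \<Rightarrow> real) \<Rightarrow> bool" where
  "is_laplace_exponent M X \<psi> \<longleftrightarrow>
     (\<forall>\<theta>\<ge>0. \<forall>t\<ge>0. (LINT \<xi>|M. exp (\<theta> * X t \<xi>)) = exp (t * \<psi> \<theta>))"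

definition right_inverse :: "(real \<Rightarrow> real) \<Rightarrow> real \<Rightarrow> real" where
  "right_inverse \<psi> \<theta> = Inf {s. 0 < s \<and> \<theta> < \<psi> s}"

text \<open>
  As \<open>\<psi> \<theta> > q\<close> for \<open>\<theta> > right_inverse \<psi> q\<close>, the transform is nonzero, so the last clause
  includes the integrability of its integrand.
\<close>

definition is_scale_function :: "(real \<Rightarrow> real) \<Rightarrow> real \<Rightarrow> (real \<Rightarrow> real) \<Rightarrow> bool" where
  "is_scale_function \<psi> q W \<longleftrightarrow>
     (\<forall>x. 0 \<le> W x) \<and>
     (\<forall>x<0. W x = 0) \<and>
     continuous_on {0..} W \<and>
     mono_on {0..} W \<and>
     (\<forall>\<theta>>right_inverse \<psi> q. (LBINT y:{0..}. exp (- \<theta> * y) * W y) = 1 / (\<psi> \<theta> - q))"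

definition locally_bounded :: "(real \<Rightarrow> real) \<Rightarrow> bool" where
  "locally_bounded f \<longleftrightarrow> (\<forall>K. compact K \<longrightarrow> bounded (f ` K))"

text \<open>
  Solutions of the two renewal-type equations are understood to be Borel functions, so that the
  integrals make sense. The integrals \<open>LBINT z=a..b\<close> are oriented; as \<open>W\<close> vanishes on the
  negative half-line, they are 0 for \<open>b < a\<close>.
\<close>

definition is_omega_scale_function ::
    "(real \<Rightarrow> real) \<Rightarrow> (real \<Rightarrow> real) \<Rightarrow> (real \<Rightarrow> real \<Rightarrow> real) \<Rightarrow> bool" where
  "is_omega_scale_function W \<omega> \<W> \<longleftrightarrow>
     (\<forall>y. (\<lambda>x. \<W> x y) \<in> borel_measurable borel \<and>
          locally_bounded (\<lambda>x. \<W> x y) \<and>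
          (\<forall>x. \<W> x y = W (x - y) + (LBINT z=ereal y..ereal x. W (x - z) * \<omega> z * \<W> z y)))"

definition is_omega_H_function ::
    "(real \<Rightarrow> real) \<Rightarrow> (real \<Rightarrow> real) \<Rightarrow> real \<Rightarrow> (real \<Rightarrow> real) \<Rightarrow> (real \<Rightarrow> real) \<Rightarrow> bool" where
  "is_omega_H_function \<psi> W\<phi> \<phi> \<omega> \<H> \<longleftrightarrow>
     \<H> \<in> borel_measurable borel \<and>
     locally_bounded \<H> \<and>
     (\<forall>x. \<H> x = exp (right_inverse \<psi> \<phi> * x)
              + (LBINT z=0..ereal x. W\<phi> (x - z) * (\<omega> z - \<phi>) * \<H> z))"

end

theory Submission
  imports Defs
begin

text \<open>
  Optional stopping of \<open>exp (\<theta> X\<^sub>t - q t)\<close>, observed on a grid of times whose mesh is sent to 0, yields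
  the Laplace transform of the potential of the process killed at rate \<open>q\<close> and at its passage above
  \<open>c\<close>; uniqueness of Laplace transforms identifies its density through \<open>W\<^sup>(\<^sup>q\<^sup>)\<close>, the case \<open>q = 0\<close> being
  reached as a limit. A pathwise Feynman-Kac identity and the Markov property at fixed times
  perturb the rate \<open>\<phi>\<close> into \<open>\<omega>\<close>. As \<open>\<omega> - \<phi>\<close> vanishes on the negative half-line, the functionals of the
  theorem solve Volterra equations on bounded intervals. These have unique solutions, so the functionals
  are multiples of \<open>\<H>\<close> up to a term in \<open>\<W>\<close>; the value at \<open>c\<close> fixes the multiple.
\<close>

section \<open>Uniqueness of Laplace transforms\<close>

text \<open>The Markov property is proved at deterministic times only, so the passage time is
  approached by stopping on a grid. The absence of positive jumps serves to place the process
  exactly at \<open>c\<close> at its passage. The squares of the stopped exponentials are of the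
  same type, with \<open>\<theta>\<close> and \<open>q\<close> doubled; this gives the uniform
  integrability for the limit. The rate is perturbed from \<open>\<phi>\<close> because the
  correction \<open>\<omega> - \<phi>\<close> then lives on \<open>[0, c]\<close>. With
  \<open>W = W\<^sup>(\<^sup>\<phi>\<^sup>)\<close> the potential has the density
  \<open>exp (- \<Phi> (c - x)) W(c - y) - W(x - y)\<close>; its first part contributes only an
  unknown multiple of \<open>exp (\<Phi> x)\<close>, the forcing term in the equation of
  \<open>\<H>\<close>. At \<open>x = c\<close> the density vanishes, and the boundary value (1 for
  the exit, 0 for the occupation) determines the multiple. As the potential is a difference of
  measures and \<open>\<omega> - \<phi>\<close> may change sign, identities are kept as sums in
  \<open>ennreal\<close>, negative parts standing on the other side, until finiteness permits
  subtraction.\<close>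

lemma nn_integral_emeasure_add:
  assumes s: "sets M1 = sets N" "sets M2 = sets N"
    and eq: "\<And>A. A \<in> sets N \<Longrightarrow> emeasure M1 A + emeasure M2 A = emeasure N A"
    and g: "g \<in> borel_measurable N"
  shows "(\<integral>\<^sup>+z. g z \<partial>M1) + (\<integral>\<^sup>+z. g z \<partial>M2) = (\<integral>\<^sup>+z. g z \<partial>N)"
proof -
  note [measurable_cong] = s
  have sp: "space M1 = space N" "space M2 = space N"
    using s by (auto dest: sets_eq_imp_space_eq)
  show ?thesis using g
  proof (induction rule: borel_measurable_induct)
    case (cong f g)
    then have "(\<integral>\<^sup>+z. f z \<partial>K) = (\<integral>\<^sup>+z. g z \<partial>K)" if "space K = space N" for K
      using that by (intro nn_integral_cong) auto
    with cong sp show ?case by auto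
  next
    case (set A) with eq s show ?case by simp
  next
    case (mult u v) then show ?case by (simp add: nn_integral_cmult flip: distrib_left)
  next
    case (add u v)
    then show ?case by (simp add: nn_integral_add ac_simps flip: add.IH)
  next
    case (seq U)
    have [measurable]: "\<And>i. U i \<in> borel_measurable N" by (rule seq)
    have *: "(\<lambda>i. \<integral>\<^sup>+z. U i z \<partial>K) \<longlonglongrightarrow> (\<integral>\<^sup>+z. (SUP i. U i z) \<partial>K)" if "sets K = sets N" for K
    proof -
      have [measurable_cong]: "sets K = sets N" by fact
      have "(\<integral>\<^sup>+z. (SUP i. U i z) \<partial>K) = (SUP i. \<integral>\<^sup>+z. U i z \<partial>K)"
        using seq by (intro nn_integral_monotone_convergence_SUP) auto
      moreover have "incseq (\<lambda>i. \<integral>\<^sup>+z. U i z \<partial>K)"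
        using seq(3) by (auto simp: incseq_def le_fun_def intro!: nn_integral_mono)
      ultimately show ?thesis by (simp add: LIMSEQ_SUP)
    qed
    have "(\<lambda>i. (\<integral>\<^sup>+z. U i z \<partial>M1) + (\<integral>\<^sup>+z. U i z \<partial>M2)) \<longlonglongrightarrow>
        (\<integral>\<^sup>+z. (SUP i. U i z) \<partial>M1) + (\<integral>\<^sup>+z. (SUP i. U i z) \<partial>M2)"
      by (intro tendsto_add * s)
    moreover have "(\<lambda>i. (\<integral>\<^sup>+z. U i z \<partial>M1) + (\<integral>\<^sup>+z. U i z \<partial>M2)) \<longlonglongrightarrow> (\<integral>\<^sup>+z. (SUP i. U i z) \<partial>N)"
      using *[OF refl] seq.IH by simp
    ultimately show ?case by (simp add: LIMSEQ_unique image_comp)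
  qed
qed

text \<open>Moments determine the integrals of polynomials, Weierstrass extends this to continuous
  functions on the unit interval, ramps reach the half-lines, and these form an intersection-stable
  generator of the Borel sets.\<close>

lemma moments_unique_add:
  fixes M1 M2 N :: "real measure"
  assumes fin: "finite_measure M1" "finite_measure M2" "finite_measure N"
    and s: "sets M1 = sets borel" "sets M2 = sets borel" "sets N = sets borel"
    and supp: "AE u in M1. u \<in> {0..1}" "AE u in M2. u \<in> {0..1}" "AE u in N. u \<in> {0..1}"
    and mom: "\<And>n. (\<integral>u. u ^ n \<partial>M1) + (\<integral>u. u ^ n \<partial>M2) = (\<integral>u. u ^ n \<partial>N)"
    and A: "A \<in> sets borel"
  shows "emeasure M1 A + emeasure M2 A = emeasure N A"
proof -
  interpret m1: finite_measure M1 by fact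
  interpret m2: finite_measure M2 by fact
  interpret n: finite_measure N by fact
  note [measurable_cong] = s
  have sp: "space M1 = UNIV" "space M2 = UNIV" "space N = UNIV"
    using s by (auto dest: sets_eq_imp_space_eq)
  define I where "I f = (\<integral>u. f u \<partial>M1) + (\<integral>u. f u \<partial>M2) - (\<integral>u. f u \<partial>N)" for f :: "real \<Rightarrow> real"
  have int: "integrable K f"
    if "finite_measure K" "sets K = sets borel" "AE u in K. u \<in> {0..1}" "f \<in> borel_measurable borel"
      "\<And>u. u \<in> {0..1} \<Longrightarrow> \<bar>f u\<bar> \<le> C" for K and f :: "real \<Rightarrow> real" and C
  proof (rule finite_measure.integrable_const_bound[OF that(1), of _ C])
    show "AE x in K. norm (f x) \<le> C" using that(3) by eventually_elim (simp add: that(5))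
    show "f \<in> borel_measurable K" using that(4) by (subst measurable_cong_sets[OF that(2) refl])
  qed
  note ints = int[OF fin(1) s(1) supp(1)] int[OF fin(2) s(2) supp(2)] int[OF fin(3) s(3) supp(3)]
  have poly: "I (\<lambda>x. \<Sum>i\<le>m. a i * x ^ i) = 0" for a m
  proof -
    have p: "\<bar>u ^ i\<bar> \<le> (1::real)" if "u \<in> {0..1}" for u i using that by (auto intro: power_le_one)
    have ii: "integrable M1 (\<lambda>u. u ^ i)" "integrable M2 (\<lambda>u. u ^ i)" "integrable N (\<lambda>u. u ^ i)" for i
      by (rule ints[where C=1]; use p in simp)+
    have "I (\<lambda>x. \<Sum>i\<le>m. a i * x ^ i) = (\<Sum>i\<le>m. a i * ((\<integral>u. u ^ i \<partial>M1) + (\<integral>u. u ^ i \<partial>M2) - (\<integral>u. u ^ i \<partial>N)))"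
      unfolding I_def using ii
      by (simp add: sum_distrib_left algebra_simps sum.distrib sum_subtractf)
    also have "\<dots> = 0" using mom by simp
    finally show ?thesis .
  qed
  define S where "S = measure M1 UNIV + measure M2 UNIV + measure N UNIV"
  have S: "0 \<le> S" by (simp add: S_def)
  have cont0: "I f = 0" if f: "continuous_on UNIV f" for f
  proof -
    have fm: "f \<in> borel_measurable borel" using f by (rule borel_measurable_continuous_onI)
    have "bounded (f ` {0..1})"
      by (intro compact_imp_bounded compact_continuous_image continuous_on_subset[OF f]) auto
    then obtain C where C: "\<And>u. u \<in> {0..1} \<Longrightarrow> \<bar>f u\<bar> \<le> C"
      unfolding bounded_iff by fastforce
    \<comment> \<open>The polynomial is taken within \<open>e / (S + 1)\<close>, so that the three
      errors, weighted by total masses with sum \<open>S\<close>, stay below \<open>e\<close>; the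
      added 1 covers \<open>S = 0\<close>.\<close>
    have "\<bar>I f\<bar> \<le> e" if e: "0 < e" for e
    proof -
      have e': "0 < e / (S + 1)" using e S by simp
      obtain g where g: "real_polynomial_function g" "\<And>x. x \<in> {0..1} \<Longrightarrow> \<bar>f x - g x\<bar> < e / (S + 1)"
        using Stone_Weierstrass_real_polynomial_function[OF compact_Icc[of 0 1] continuous_on_subset[OF f subset_UNIV] e']
        by blast
      obtain a m where gm: "g = (\<lambda>x. \<Sum>i\<le>m. a i * x ^ i)"
        using g(1) unfolding real_polynomial_function_iff_sum by blast
      have gmeas: "g \<in> borel_measurable borel" unfolding gm by measurable
      have gb: "\<bar>g u\<bar> \<le> C + e / (S + 1)" if "u \<in> {0..1}" for u
        using C[OF that] g(2)[OF that] by linarith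
      have fi: "integrable M1 f" "integrable M2 f" "integrable N f" by (rule ints[OF fm C]; assumption)+
      have gi: "integrable M1 g" "integrable M2 g" "integrable N g" by (rule ints[OF gmeas gb]; assumption)+
      have bd: "\<bar>\<integral>u. f u - g u \<partial>K\<bar> \<le> e / (S + 1) * measure K UNIV"
        if K: "finite_measure K" "sets K = sets borel" "AE u in K. u \<in> {0..1}" and i: "integrable K f" "integrable K g" for K
      proof -
        have "\<bar>\<integral>u. f u - g u \<partial>K\<bar> \<le> (\<integral>u. \<bar>f u - g u\<bar> \<partial>K)"
          using integral_norm_bound[of K "\<lambda>u. f u - g u"] by simp
        also have "\<dots> \<le> (\<integral>u. e / (S + 1) \<partial>K)"
        proof (rule integral_mono_AE)
          show "integrable K (\<lambda>u. \<bar>f u - g u\<bar>)" using i by simp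
          show "integrable K (\<lambda>u. e / (S + 1))" using finite_measure.integrable_const[OF K(1)] .
          show "AE u in K. \<bar>f u - g u\<bar> \<le> e / (S + 1)" using K(3) by eventually_elim (use g(2) less_imp_le in blast)
        qed
        also have "\<dots> = e / (S + 1) * measure K UNIV"
          using sets_eq_imp_space_eq[OF K(2)] by simp
        finally show ?thesis .
      qed
      have "I f = I f - I g" using poly by (simp add: gm)
      also have "\<dots> = (\<integral>u. f u - g u \<partial>M1) + (\<integral>u. f u - g u \<partial>M2) - (\<integral>u. f u - g u \<partial>N)"
        unfolding I_def using fi gi by simp
      finally have "\<bar>I f\<bar> \<le> e / (S + 1) * S"
        using bd[OF fin(1) s(1) supp(1) fi(1) gi(1)] bd[OF fin(2) s(2) supp(2) fi(2) gi(2)]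
          bd[OF fin(3) s(3) supp(3) fi(3) gi(3)]
        unfolding S_def by (simp add: distrib_left)
      also have "\<dots> \<le> e" using e S by (simp add: field_simps)
      finally show ?thesis .
    qed
    then have "\<bar>I f\<bar> \<le> 0" by (rule field_le_epsilon) auto
    then show ?thesis by simp
  qed
  have half: "measure M1 {..a} + measure M2 {..a} = measure N {..a}" for a
  proof -
    \<comment> \<open>A continuous ramp, 1 up to \<open>a\<close> and for \<open>k > 0\<close> equal
      to 0 from \<open>a + 1/k\<close> on.\<close>
    define f where "f k u = max 0 (min 1 (1 - real k * (u - a)))" for k u
    have fb: "\<bar>f k u\<bar> \<le> 1" for k u by (auto simp: f_def)
    have fc: "continuous_on UNIV (f k)" for k unfolding f_def by (intro continuous_intros)
    have lim: "(\<lambda>k. f k u) \<longlonglongrightarrow> indicator {..a} u" for u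
    proof (cases "u \<le> a")
      case True
      have "f k u = 1" for k
      proof -
        have "real k * (u - a) \<le> 0" using True by (simp add: mult_nonneg_nonpos)
        then show ?thesis by (simp add: f_def)
      qed
      then show ?thesis using True by simp
    next
      case False
      obtain k0 :: nat where k0: "1 / (u - a) < real k0" using reals_Archimedean2 by blast
      have "f k u = 0" if "k0 \<le> k" for k
      proof -
        have "1 / (u - a) < real k" using k0 that by linarith
        then have "1 < real k * (u - a)" using False by (simp add: field_simps)
        then show ?thesis by (simp add: f_def)
      qed
      then have "eventually (\<lambda>k. f k u = 0) sequentially" using eventually_sequentially by blast
      then show ?thesis using False by (simp add: tendsto_eventually)
    qed
    have conv: "(\<lambda>k. \<integral>u. f k u \<partial>K) \<longlonglongrightarrow> measure K {..a}" if "finite_measure K" "sets K = sets borel" for K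
    proof -
      note [measurable_cong] = that(2)
      have fmeas: "f k \<in> borel_measurable K" for k
        using borel_measurable_continuous_onI[OF fc] by (subst measurable_cong_sets[OF that(2) refl])
      have "(\<lambda>k. \<integral>u. f k u \<partial>K) \<longlonglongrightarrow> (\<integral>u. indicator {..a} u \<partial>K)"
        using fmeas fb lim finite_measure.integrable_const[OF that(1)]
        by (intro integral_dominated_convergence[where w="\<lambda>_. 1"]) auto
      then show ?thesis using sets_eq_imp_space_eq[OF that(2)] by simp
    qed
    have "(\<lambda>k. I (f k)) \<longlonglongrightarrow> measure M1 {..a} + measure M2 {..a} - measure N {..a}"
      unfolding I_def by (intro tendsto_intros conv fin s)
    then show ?thesis using cont0[OF fc] by (simp add: LIMSEQ_const_iff)
  qed
  have tot: "measure M1 UNIV + measure M2 UNIV = measure N UNIV"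
    using mom[of 0] sp by simp
  have gen: "sigma_sets UNIV (range (\<lambda>a::real. {..a})) = sets borel"
    by (subst borel_eq_atMost) simp
  have "A \<in> sigma_sets UNIV (range (\<lambda>a::real. {..a}))" using A gen by simp
  from _ _ this have "measure M1 A + measure M2 A = measure N A"
  proof (induct rule: sigma_sets_induct_disjoint)
    show "Int_stable (range (\<lambda>a::real. {..a}))" by (auto simp: Int_stable_def)
    show "range (\<lambda>a::real. {..a}) \<subseteq> Pow UNIV" by simp
    show "measure M1 {} + measure M2 {} = measure N {}" by simp
    fix A :: "real set" assume "A \<in> range (\<lambda>a::real. {..a})"
    then show "measure M1 A + measure M2 A = measure N A" using half by auto
  next
    fix A assume A: "A \<in> sigma_sets UNIV (range (\<lambda>a::real. {..a}))" and IH: "measure M1 A + measure M2 A = measure N A"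
    have "A \<in> sets M1" "A \<in> sets M2" "A \<in> sets N" using A s unfolding gen by auto
    then show "measure M1 (UNIV - A) + measure M2 (UNIV - A) = measure N (UNIV - A)"
      using IH tot m1.finite_measure_compl[of A] m2.finite_measure_compl[of A] n.finite_measure_compl[of A]
      by (simp add: sp)
  next
    fix A :: "nat \<Rightarrow> real set" assume d: "disjoint_family A"
      and r: "range A \<subseteq> sigma_sets UNIV (range (\<lambda>a::real. {..a}))"
      and IH: "\<And>i. measure M1 (A i) + measure M2 (A i) = measure N (A i)"
    have r': "range A \<subseteq> sets M1" "range A \<subseteq> sets M2" "range A \<subseteq> sets N"
      using r s unfolding gen by auto
    have "(\<lambda>i. measure M1 (A i) + measure M2 (A i)) sums (measure M1 (\<Union>i. A i) + measure M2 (\<Union>i. A i))"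
      by (intro sums_add m1.finite_measure_UNION m2.finite_measure_UNION r' d)
    moreover have "(\<lambda>i. measure N (A i)) sums measure N (\<Union>i. A i)"
      by (intro n.finite_measure_UNION r' d)
    ultimately show "measure M1 (\<Union>i. A i) + measure M2 (\<Union>i. A i) = measure N (\<Union>i. A i)"
      using IH by (simp add: sums_unique2)
  qed
  then show ?thesis
    by (simp add: m1.emeasure_eq_measure m2.emeasure_eq_measure n.emeasure_eq_measure flip: ennreal_plus)
qed

text \<open>Tilting and the substitution \<open>u = exp (- z)\<close> turn the transforms into moments on the unit interval.\<close>

lemma laplace_unique_add:
  fixes M1 M2 N :: "real measure"
  assumes s: "sets M1 = sets borel" "sets M2 = sets borel" "sets N = sets borel"
    and supp: "AE z in M1. 0 \<le> z" "AE z in M2. 0 \<le> z" "AE z in N. 0 \<le> z"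
    and L: "\<And>\<theta>. \<theta>0 < \<theta> \<Longrightarrow> (\<integral>\<^sup>+z. ennreal (exp (- \<theta> * z)) \<partial>M1) + (\<integral>\<^sup>+z. ennreal (exp (- \<theta> * z)) \<partial>M2)
               = (\<integral>\<^sup>+z. ennreal (exp (- \<theta> * z)) \<partial>N)"
    and fin: "\<And>\<theta>. \<theta>0 < \<theta> \<Longrightarrow> (\<integral>\<^sup>+z. ennreal (exp (- \<theta> * z)) \<partial>N) < \<infinity>"
    and A: "A \<in> sets borel"
  shows "emeasure M1 A + emeasure M2 A = emeasure N A"
proof -
  \<comment> \<open>Past the threshold the tilted measures are finite, and the n-th moment of
    \<open>P K\<close> is the transform of \<open>K\<close> at \<open>\<theta>1 + n\<close>, again
    an admissible point.\<close>
  define \<theta>1 where "\<theta>1 = \<theta>0 + 1"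
  define P where "P K = distr (density K (\<lambda>z. ennreal (exp (- \<theta>1 * z)))) borel (\<lambda>z::real. exp (- z))" for K :: "real measure"
  have nnP: "(\<integral>\<^sup>+u. g u \<partial>P K) = (\<integral>\<^sup>+z. ennreal (exp (- \<theta>1 * z)) * g (exp (- z)) \<partial>K)"
    if "sets K = sets borel" "g \<in> borel_measurable borel" for K g
  proof -
    note [measurable_cong] = that(1) and [measurable] = that(2)
    show ?thesis unfolding P_def by (simp add: nn_integral_distr nn_integral_density)
  qed
  have pw: "(\<integral>\<^sup>+u. ennreal (u ^ n) \<partial>P K) = (\<integral>\<^sup>+z. ennreal (exp (- (\<theta>1 + real n) * z)) \<partial>K)"
    if "sets K = sets borel" for K n
  proof -
    have "ennreal (exp (- \<theta>1 * z)) * ennreal (exp (- z) ^ n) = ennreal (exp (- (\<theta>1 + real n) * z))" for z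
    proof -
      have "exp (- z) ^ n = exp (- (real n * z))" by (simp flip: exp_of_nat_mult)
      then show ?thesis by (simp add: algebra_simps flip: ennreal_mult exp_add)
    qed
    then show ?thesis by (subst nnP[OF that]) auto
  qed
  have fi: "(\<integral>\<^sup>+z. ennreal (exp (- (\<theta>1 + real n) * z)) \<partial>N) < \<infinity>"
     "(\<integral>\<^sup>+z. ennreal (exp (- (\<theta>1 + real n) * z)) \<partial>M1) < \<infinity>"
     "(\<integral>\<^sup>+z. ennreal (exp (- (\<theta>1 + real n) * z)) \<partial>M2) < \<infinity>" for n
  proof -
    have t: "\<theta>0 < \<theta>1 + real n" by (simp add: \<theta>1_def)
    show "(\<integral>\<^sup>+z. ennreal (exp (- (\<theta>1 + real n) * z)) \<partial>N) < \<infinity>" by (rule fin[OF t])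
    then show "(\<integral>\<^sup>+z. ennreal (exp (- (\<theta>1 + real n) * z)) \<partial>M1) < \<infinity>"
      "(\<integral>\<^sup>+z. ennreal (exp (- (\<theta>1 + real n) * z)) \<partial>M2) < \<infinity>"
      unfolding L[OF t, symmetric] by (auto simp: less_top)
  qed
  have finP: "finite_measure (P K)"
    if "sets K = sets borel" "(\<integral>\<^sup>+z. ennreal (exp (- (\<theta>1 + real 0) * z)) \<partial>K) < \<infinity>" for K
  proof
    have "emeasure (P K) (space (P K)) = (\<integral>\<^sup>+u. ennreal (u ^ 0) \<partial>P K)" by simp
    then show "emeasure (P K) (space (P K)) \<noteq> \<infinity>" using that pw[OF that(1), of 0] by simp
  qed
  have suppP: "AE u in P K. u \<in> {0..1}" if "sets K = sets borel" "AE z in K. 0 \<le> z" for K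
  proof -
    note [measurable_cong] = that(1)
    have "AE z in K. exp (- z) \<in> {0..1::real}" using that(2) by eventually_elim simp
    then have "AE z in density K (\<lambda>z. ennreal (exp (- \<theta>1 * z))). exp (- z) \<in> {0..1::real}"
      by (subst AE_density) auto
    then show ?thesis unfolding P_def by (subst AE_distr_iff) auto
  qed
  have momP: "(\<integral>u. u ^ n \<partial>P K) = enn2real (\<integral>\<^sup>+z. ennreal (exp (- (\<theta>1 + real n) * z)) \<partial>K)"
    if "sets K = sets borel" "AE z in K. 0 \<le> z" for K n
  proof -
    have "(\<integral>u. u ^ n \<partial>P K) = enn2real (\<integral>\<^sup>+u. ennreal (u ^ n) \<partial>P K)"
    proof (rule integral_eq_nn_integral)
      show "(\<lambda>u. u ^ n) \<in> borel_measurable (P K)" by (simp add: P_def)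
      show "AE u in P K. 0 \<le> u ^ n" using suppP[OF that] by eventually_elim simp
    qed
    then show ?thesis by (simp add: pw[OF that(1)])
  qed
  have eqP: "emeasure (P M1) B + emeasure (P M2) B = emeasure (P N) B" if "B \<in> sets borel" for B
  proof (rule moments_unique_add[OF _ _ _ _ _ _ _ _ _ _ that])
    show "finite_measure (P M1)" "finite_measure (P M2)" "finite_measure (P N)"
      using finP[OF s(1)] finP[OF s(2)] finP[OF s(3)] fi[of 0] by auto
    show "sets (P M1) = sets borel" "sets (P M2) = sets borel" "sets (P N) = sets borel" by (auto simp: P_def)
    show "AE u in P M1. u \<in> {0..1}" "AE u in P M2. u \<in> {0..1}" "AE u in P N. u \<in> {0..1}"
      using suppP s supp by auto
    show "(\<integral>u. u ^ n \<partial>P M1) + (\<integral>u. u ^ n \<partial>P M2) = (\<integral>u. u ^ n \<partial>P N)" for n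
      unfolding momP[OF s(1) supp(1)] momP[OF s(2) supp(2)] momP[OF s(3) supp(3)]
      by (subst L[symmetric]) (use fi[of n] in \<open>auto simp: \<theta>1_def enn2real_plus\<close>)
  qed
  \<comment> \<open>The weight \<open>exp (\<theta>1 * z)\<close> and the point
    \<open>- ln u = z\<close> undo the tilt and the substitution, so that integrating
    \<open>g\<close> against \<open>P K\<close> returns the measure of \<open>A\<close> under
    \<open>K\<close>.\<close>
  define g where "g u = ennreal (exp (\<theta>1 * (- ln u))) * indicator A (- ln u)" for u
  have [measurable]: "g \<in> borel_measurable borel" using A unfolding g_def by measurable
  have gA: "(\<integral>\<^sup>+u. g u \<partial>P K) = emeasure K A" if "sets K = sets borel" for K
  proof -
    have "(\<integral>\<^sup>+u. g u \<partial>P K) = (\<integral>\<^sup>+z. indicator A z \<partial>K)"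
      by (subst nnP[OF that])
         (auto intro!: nn_integral_cong simp: g_def algebra_simps simp flip: ennreal_mult exp_add mult.assoc split: split_indicator)
    then show ?thesis using A that by simp
  qed
  have "(\<integral>\<^sup>+u. g u \<partial>P M1) + (\<integral>\<^sup>+u. g u \<partial>P M2) = (\<integral>\<^sup>+u. g u \<partial>P N)"
    using eqP by (intro nn_integral_emeasure_add) (auto simp: P_def)
  then show ?thesis using gA s by simp
qed

text \<open>Bounded second moments give uniform integrability: the excess of \<open>V\<close> over
  \<open>K\<close> is at most \<open>V\<^sup>2 / K\<close>, so truncation at \<open>K\<close>
  changes a mean by at most \<open>D / K\<close>. Fatou's lemma hands the moment bound on to the
  limit \<open>Z\<close>. Used for stopped exponentials in place of a dominating function.\<close>

lemma (in prob_space) tendsto_expectation_bounded_square: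
  fixes Y :: "nat \<Rightarrow> 'a \<Rightarrow> real"
  assumes Y: "\<And>n. Y n \<in> borel_measurable M" "Z \<in> borel_measurable M"
    and nonneg: "\<And>n \<xi>. 0 \<le> Y n \<xi>"
    and lim: "AE \<xi> in M. (\<lambda>n. Y n \<xi>) \<longlonglongrightarrow> Z \<xi>"
    and sq: "\<And>n. (\<integral>\<^sup>+\<xi>. ennreal ((Y n \<xi>)\<^sup>2) \<partial>M) \<le> ennreal C"
  shows "integrable M Z" "(\<lambda>n. expectation (Y n)) \<longlonglongrightarrow> expectation Z"
proof -
  note [measurable] = Y
  have Z0: "AE \<xi> in M. 0 \<le> Z \<xi>" using lim by eventually_elim (use nonneg LIMSEQ_le_const in blast)
  have "(\<integral>\<^sup>+\<xi>. ennreal ((Z \<xi>)\<^sup>2) \<partial>M) = (\<integral>\<^sup>+\<xi>. liminf (\<lambda>n. ennreal ((Y n \<xi>)\<^sup>2)) \<partial>M)"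
  proof (rule nn_integral_cong_AE, use lim in eventually_elim)
    fix \<xi> assume "(\<lambda>n. Y n \<xi>) \<longlonglongrightarrow> Z \<xi>"
    then have "(\<lambda>n. ennreal ((Y n \<xi>)\<^sup>2)) \<longlonglongrightarrow> ennreal ((Z \<xi>)\<^sup>2)" by (intro tendsto_ennrealI tendsto_intros)
    then show "ennreal ((Z \<xi>)\<^sup>2) = liminf (\<lambda>n. ennreal ((Y n \<xi>)\<^sup>2))" by (rule lim_imp_Liminf[OF trivial_limit_sequentially, symmetric])
  qed
  also have "\<dots> \<le> liminf (\<lambda>n. \<integral>\<^sup>+\<xi>. ennreal ((Y n \<xi>)\<^sup>2) \<partial>M)" by (intro nn_integral_liminf) simp
  also have "\<dots> \<le> ennreal C" using sq by (intro Liminf_le) (auto intro: always_eventually)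
  finally have Zsq: "(\<integral>\<^sup>+\<xi>. ennreal ((Z \<xi>)\<^sup>2) \<partial>M) \<le> ennreal C" .
  \<comment> \<open>\<open>ennreal C\<close> is 0 for negative \<open>C\<close>, so the real bound
    that it expresses is the positive part.\<close>
  define D where "D = max C 0"
  have trunc: "integrable M V \<and> \<bar>expectation V - expectation (\<lambda>\<xi>. min (V \<xi>) K)\<bar> \<le> D / K"
    if V: "V \<in> borel_measurable M" "AE \<xi> in M. 0 \<le> V \<xi>" "(\<integral>\<^sup>+\<xi>. ennreal ((V \<xi>)\<^sup>2) \<partial>M) \<le> ennreal C" and K: "0 < K" for V K
  proof -
    note [measurable] = V(1)
    have isq: "integrable M (\<lambda>\<xi>. (V \<xi>)\<^sup>2)"
      using V(3) by (intro integrableI_nonneg) (auto simp: le_less_trans ennreal_less_top)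
    have "(\<integral>\<xi>. (V \<xi>)\<^sup>2 \<partial>M) = enn2real (\<integral>\<^sup>+\<xi>. ennreal ((V \<xi>)\<^sup>2) \<partial>M)" by (rule integral_eq_nn_integral) auto
    also have "\<dots> \<le> enn2real (ennreal C)" using V(3) by (intro enn2real_mono) auto
    also have "\<dots> = D" by (simp add: D_def enn2real_ennreal max_def ennreal_neg)
    finally have E2: "(\<integral>\<xi>. (V \<xi>)\<^sup>2 \<partial>M) \<le> D" .
    have iV: "integrable M V"
    proof (rule Bochner_Integration.integrable_bound[of M "\<lambda>\<xi>. 1 + (V \<xi>)\<^sup>2"])
      show "integrable M (\<lambda>\<xi>. 1 + (V \<xi>)\<^sup>2)" using isq by simp
      show "AE x in M. norm (V x) \<le> norm (1 + (V x)\<^sup>2)"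
      proof (rule AE_I2)
        fix x have "0 \<le> (\<bar>V x\<bar> - 1)\<^sup>2" by simp
        then have "2 * \<bar>V x\<bar> \<le> 1 + (V x)\<^sup>2" by (simp add: power2_diff)
        moreover have "0 \<le> (V x)\<^sup>2" by simp
        ultimately show "norm (V x) \<le> norm (1 + (V x)\<^sup>2)" unfolding real_norm_def by linarith
      qed
    qed (use V in auto)
    have im: "integrable M (\<lambda>\<xi>. min (V \<xi>) K)"
      using iV by (intro integrable_min) auto
    have "\<bar>expectation V - expectation (\<lambda>\<xi>. min (V \<xi>) K)\<bar> = \<bar>\<integral>\<xi>. V \<xi> - min (V \<xi>) K \<partial>M\<bar>"
      using iV im by simp
    also have "\<dots> \<le> (\<integral>\<xi>. (V \<xi>)\<^sup>2 / K \<partial>M)"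
    proof (rule order_trans[OF integral_abs_bound], rule integral_mono_AE)
      show "integrable M (\<lambda>\<xi>. \<bar>V \<xi> - min (V \<xi>) K\<bar>)" using iV im by simp
      show "integrable M (\<lambda>\<xi>. (V \<xi>)\<^sup>2 / K)" using isq by simp
      show "AE \<xi> in M. \<bar>V \<xi> - min (V \<xi>) K\<bar> \<le> (V \<xi>)\<^sup>2 / K" using V(2)
      proof eventually_elim
        fix \<xi> assume v: "0 \<le> V \<xi>"
        show "\<bar>V \<xi> - min (V \<xi>) K\<bar> \<le> (V \<xi>)\<^sup>2 / K"
        proof (cases "V \<xi> \<le> K")
          case True then show ?thesis using K by simp
        next
          case False
          then have "V \<xi> * K \<le> V \<xi> * V \<xi>" using v by (intro mult_left_mono) auto
          then have "V \<xi> \<le> (V \<xi>)\<^sup>2 / K" using K by (simp add: field_simps power2_eq_square)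
          then show ?thesis using False K v by simp
        qed
      qed
    qed
    also have "\<dots> \<le> D / K" using E2 K by (simp add: divide_right_mono)
    finally show ?thesis using iV by simp
  qed
  show iZ: "integrable M Z" using trunc[OF Y(2) Z0 Zsq, of 1] by simp
  show "(\<lambda>n. expectation (Y n)) \<longlonglongrightarrow> expectation Z"
  proof (rule LIMSEQ_I)
    fix e :: real assume e: "0 < e"
    \<comment> \<open>The error has three parts below \<open>e / 3\<close>: truncating
      \<open>Y n\<close>, truncating \<open>Z\<close>, and the difference of the truncated means.
      With \<open>D + 1\<close> the inequality \<open>D / K < e / 3\<close> is strict and
      \<open>K\<close> is positive.\<close>
    define K where "K = 3 * (D + 1) / e"
    have K: "0 < K" using e by (simp add: K_def D_def max_def)
    have DK: "D / K < e / 3"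
      using e K unfolding K_def by (simp add: field_simps D_def max_def)
    have "(\<lambda>n. expectation (\<lambda>\<xi>. min (Y n \<xi>) K)) \<longlonglongrightarrow> expectation (\<lambda>\<xi>. min (Z \<xi>) K)"
    proof (rule integral_dominated_convergence[where w="\<lambda>_. K"])
      show "AE x in M. (\<lambda>i. min (Y i x) K) \<longlonglongrightarrow> min (Z x) K"
        using lim by eventually_elim (intro tendsto_intros)
      show "AE x in M. norm (min (Y i x) K) \<le> K" for i using nonneg K by (auto simp: min_def)
    qed auto
    from LIMSEQ_D[OF this, of "e/3"] e obtain N where
      N: "\<And>n. n \<ge> N \<Longrightarrow> \<bar>expectation (\<lambda>\<xi>. min (Y n \<xi>) K) - expectation (\<lambda>\<xi>. min (Z \<xi>) K)\<bar> < e / 3"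
      by auto
    have "norm (expectation (Y n) - expectation Z) < e" if "n \<ge> N" for n
    proof -
      have "\<bar>expectation (Y n) - expectation (\<lambda>\<xi>. min (Y n \<xi>) K)\<bar> \<le> D / K"
        using trunc[OF Y(1) _ sq K] nonneg by auto
      moreover have "\<bar>expectation Z - expectation (\<lambda>\<xi>. min (Z \<xi>) K)\<bar> \<le> D / K"
        using trunc[OF Y(2) Z0 Zsq K] by auto
      ultimately show ?thesis using N[OF that] DK unfolding real_norm_def by linarith
    qed
    then show "\<exists>no. \<forall>n\<ge>no. norm (expectation (Y n) - expectation Z) < e" by blast
  qed
qed

section \<open>Volterra inequalities and the Feynman-Kac identity\<close>

text \<open>Integrating the weight \<open>exp (2 * C * (x - a))\<close> gains a factor
  \<open>1 / (2 * C)\<close>, so in the weighted norm \<open>C\<close> times the integral from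
  \<open>a\<close> contracts by 1/2.\<close>

lemma volterra_iteration_bound:
  fixes d :: "nat \<Rightarrow> real \<Rightarrow> real"
  assumes C: "0 < C" and S: "0 \<le> S"
    and d0: "\<And>x. x \<in> {a..b} \<Longrightarrow> d 0 x \<le> S"
    and step: "\<And>n x. x \<in> {a..b} \<Longrightarrow> d (Suc n) x \<le> C * (LBINT z:{a..x}. d n z)"
    and x: "x \<in> {a..b}"
  shows "d n x \<le> S / 2 ^ n * exp (2 * C * (x - a))"
  using x
proof (induction n arbitrary: x)
  case 0
  have "S * 1 \<le> S * exp (2 * C * (x - a))" using S C 0 by (intro mult_left_mono) auto
  then show ?case using d0[OF 0] by simp
next
  case (Suc n)
  let ?f = "\<lambda>z. S / 2 ^ n * exp (2 * C * (z - a))"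
  have ax: "a \<le> x" using Suc.prems by simp
  have I: "has_bochner_integral lborel (\<lambda>z. indicator {a..x} z *\<^sub>R ?f z)
     (S / 2 ^ n / (2 * C) * exp (2 * C * (x - a)) - S / 2 ^ n / (2 * C) * exp (2 * C * (a - a)))"
    by (rule has_bochner_integral_FTC_Icc[OF ax])
       (use C in \<open>auto intro!: derivative_eq_intros continuous_intros simp: has_real_derivative_iff_has_vector_derivative[symmetric]\<close>)
  have fi: "set_integrable lborel {a..x} ?f"
    using integrable.intros[OF I] by (simp add: set_integrable_def)
  have "(LBINT z:{a..x}. d n z) \<le> (LBINT z:{a..x}. ?f z)"
  proof (cases "set_integrable lborel {a..x} (d n)")
    case True
    then show ?thesis using Suc.IH Suc.prems by (intro set_integral_mono fi) auto
  next
    \<comment> \<open>The integral of a non-integrable function is 0 by convention, and the bounding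
      integral is nonnegative.\<close>
    case False
    then have "(LBINT z:{a..x}. d n z) = 0"
      unfolding set_integrable_def set_lebesgue_integral_def by (rule not_integrable_integral_eq)
    also have "0 \<le> (LBINT z:{a..x}. ?f z)"
      unfolding set_lebesgue_integral_def using S by (intro integral_nonneg_AE) (auto split: split_indicator)
    finally show ?thesis .
  qed
  also have "\<dots> = S / 2 ^ n / (2 * C) * exp (2 * C * (x - a)) - S / 2 ^ n / (2 * C)"
    using has_bochner_integral_integral_eq[OF I] unfolding set_lebesgue_integral_def by (simp only: diff_self mult_zero_right exp_zero mult_1_right)
  also have "\<dots> \<le> S / 2 ^ n / (2 * C) * exp (2 * C * (x - a))" using S C by simp
  finally have "C * (LBINT z:{a..x}. d n z) \<le> C * (S / 2 ^ n / (2 * C) * exp (2 * C * (x - a)))"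
    using C by (intro mult_left_mono) auto
  also have "\<dots> = S / 2 ^ Suc n * exp (2 * C * (x - a))" using C by simp
  finally show ?case using step[OF Suc.prems, of n] by simp
qed

text \<open>The constant sequence \<open>\<bar>d x\<bar>\<close> satisfies the recursion of
  \<open>volterra_iteration_bound\<close>, hence lies below a geometric sequence.\<close>

lemma volterra_homogeneous_zero:
  fixes d :: "real \<Rightarrow> real"
  assumes C: "0 < C" and S: "0 \<le> S"
    and d0: "\<And>x. x \<in> {a..b} \<Longrightarrow> \<bar>d x\<bar> \<le> S"
    and step: "\<And>x. x \<in> {a..b} \<Longrightarrow> \<bar>d x\<bar> \<le> C * (LBINT z:{a..x}. \<bar>d z\<bar>)"
    and x: "x \<in> {a..b}"
  shows "d x = 0"
proof -
  have "\<bar>d x\<bar> \<le> S / 2 ^ n * exp (2 * C * (x - a))" for n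
    by (rule volterra_iteration_bound[where d="\<lambda>_ x. \<bar>d x\<bar>", OF C S d0 step x])
  then have *: "\<bar>d x\<bar> \<le> S * exp (2 * C * (x - a)) * (1 / 2) ^ n" for n by (simp add: power_one_over field_simps)
  have "(\<lambda>n. S * exp (2 * C * (x - a)) * (1 / 2) ^ n) \<longlonglongrightarrow> S * exp (2 * C * (x - a)) * 0"
    by (intro tendsto_mult_left LIMSEQ_power_zero) simp
  then have "\<bar>d x\<bar> \<le> S * exp (2 * C * (x - a)) * 0"
    using * by (intro LIMSEQ_le_const) auto
  then show ?thesis by simp
qed

lemma set_integrable_bounded:
  fixes f :: "real \<Rightarrow> real"
  assumes [measurable]: "f \<in> borel_measurable borel" "A \<in> sets borel" and A: "bounded A"
    and f: "\<And>x. x \<in> A \<Longrightarrow> \<bar>f x\<bar> \<le> C"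
  shows "set_integrable lborel A f"
  unfolding set_integrable_def
proof (rule Bochner_Integration.integrable_bound[of lborel "\<lambda>x. indicator A x * \<bar>C\<bar>"])
  have "emeasure lborel A < \<infinity>" using emeasure_bounded_finite[OF A] .
  then show "integrable lborel (\<lambda>x. indicator A x * \<bar>C\<bar>)" by simp
  show "AE x in lborel. norm (indicator A x *\<^sub>R f x) \<le> norm (indicator A x * \<bar>C\<bar>)"
    using f by (intro AE_I2) (fastforce split: split_indicator)
qed simp

lemma set_integral_abs_bound:
  fixes f :: "real \<Rightarrow> real"
  assumes [measurable]: "f \<in> borel_measurable borel"
    and f: "\<And>x. x \<in> {s<..t} \<Longrightarrow> \<bar>f x\<bar> \<le> C" and st: "s \<le> t"
  shows "\<bar>LBINT x:{s<..t}. f x\<bar> \<le> C * (t - s)"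
proof -
  have i: "set_integrable lborel {s<..t} f" by (rule set_integrable_bounded) (use f in auto)
  have "\<bar>LBINT x:{s<..t}. f x\<bar> \<le> (LBINT x:{s<..t}. \<bar>f x\<bar>)"
    using set_integral_norm_bound[OF i] by simp
  also have "\<dots> \<le> (LBINT x:{s<..t}. C)"
    by (rule set_integral_mono[OF set_integrable_abs[OF i] set_integrable_bounded[where C="\<bar>C\<bar>"]]) (use f in auto)
  also have "\<dots> = C * (t - s)" using st by (simp add: set_lebesgue_integral_def)
  finally show ?thesis .
qed

section \<open>Exponentials of integrals and the pathwise Feynman-Kac identity\<close>

lemma exp_diff_le: "\<bar>exp u - exp v\<bar> \<le> exp M * \<bar>u - v\<bar>" if "u \<le> M" "v \<le> M" for u v M :: real
proof -
  have *: "\<bar>exp u - exp v\<bar> \<le> exp M * \<bar>u - v\<bar>" if "v \<le> u" "u \<le> M" for u v :: real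
  proof -
    have "1 + (v - u) \<le> exp (v - u)" by (rule exp_ge_add_one_self)
    then have "exp u * (1 + (v - u)) \<le> exp u * exp (v - u)" by (intro mult_left_mono) auto
    then have "exp u - exp v \<le> exp u * (u - v)" by (simp add: algebra_simps flip: exp_add)
    also have "\<dots> \<le> exp M * (u - v)" using that by (intro mult_right_mono) auto
    finally show ?thesis using that by simp
  qed
  show ?thesis using *[of u v] *[of v u] that by (cases "u \<le> v") (auto simp: abs_minus_commute)
qed

text \<open>Multiplying \<open>1 - x \<le> exp (- x)\<close> by \<open>exp x\<close> bounds the
  remainder by \<open>x * (exp x - 1)\<close>, which is of second order.\<close>

lemma exp_minus_linear_le: "\<bar>exp x - 1 - x\<bar> \<le> exp \<bar>x\<bar> * x\<^sup>2" for x :: real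
proof -
  have "1 + - x \<le> exp (- x)" by (rule exp_ge_add_one_self)
  then have "exp x * (1 + - x) \<le> exp x * exp (- x)" by (intro mult_left_mono) auto
  then have "exp x - 1 - x \<le> x * (exp x - 1)" by (simp add: algebra_simps flip: exp_add)
  also have "\<dots> \<le> \<bar>x\<bar> * \<bar>exp x - exp 0\<bar>" by (simp flip: abs_mult)
  also have "\<dots> \<le> \<bar>x\<bar> * (exp \<bar>x\<bar> * \<bar>x - 0\<bar>)" by (intro mult_left_mono exp_diff_le) auto
  finally have "exp x - 1 - x \<le> exp \<bar>x\<bar> * \<bar>x\<bar>\<^sup>2" by (simp only: power2_eq_square diff_zero ac_simps)
  moreover have "0 \<le> exp x - 1 - x" using exp_ge_add_one_self[of x] by linarith
  ultimately show ?thesis by (simp only: abs_of_nonneg power2_abs)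
qed

text \<open>
  For a merely measurable rate \<open>a\<close> the difference of the two sides, as a function of the upper
  limit, has increments of quadratic order, hence is constant.
\<close>

lemma exp_set_integral:
  fixes a :: "real \<Rightarrow> real"
  assumes [measurable]: "a \<in> borel_measurable borel" and aK: "\<And>s. \<bar>a s\<bar> \<le> K" and T: "0 \<le> T"
  shows "exp (LBINT s:{0<..T}. a s) = 1 + (LBINT s:{0<..T}. a s * exp (LBINT r:{0<..s}. a r))"
proof -
  define I where "I t = (LBINT s:{0<..t}. a s)" for t
  have K: "0 \<le> K" using aK[of 0] by linarith
  have ai: "set_integrable lborel {s<..t} a" for s t
    by (rule set_integrable_bounded) (use aK in auto)
  have split: "(LBINT u:{0<..t}. f u) = (LBINT u:{0<..s}. f u) + (LBINT u:{s<..t}. f u)"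
    if "0 \<le> s" "s \<le> t" "\<And>u v. set_integrable lborel {u<..v} f" for s t and f :: "real \<Rightarrow> real"
  proof -
    have "{0<..t} = {0<..s} \<union> {s<..t}" using that by auto
    then show ?thesis using set_integral_Un[of "{0<..s}" "{s<..t}" lborel f] that by auto
  qed
  have Idiff: "I t - I s = (LBINT u:{s<..t}. a u)" if "0 \<le> s" "s \<le> t" for s t
    using split[OF that ai] by (simp add: I_def)
  have I_lip: "\<bar>I t - I s\<bar> \<le> K * (t - s)" if "0 \<le> s" "s \<le> t" for s t
    unfolding Idiff[OF that] by (rule set_integral_abs_bound) (use aK that in auto)
  have I_meas[measurable]: "I \<in> borel_measurable borel"
  proof -
    have "I t = I (max 0 t)" for t by (auto simp: I_def max_def)
    moreover have "K-lipschitz_on UNIV (\<lambda>t. I (max 0 t))"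
    proof (rule lipschitz_onI[OF _ K])
      fix x y :: real
      have *: "\<bar>I (max 0 u) - I (max 0 v)\<bar> \<le> K * \<bar>u - v\<bar>" if "v \<le> u" for u v
      proof -
        have "\<bar>I (max 0 u) - I (max 0 v)\<bar> \<le> K * (max 0 u - max 0 v)" using that by (intro I_lip) auto
        also have "\<dots> \<le> K * \<bar>u - v\<bar>" using K that by (intro mult_left_mono) auto
        finally show ?thesis .
      qed
      show "dist (I (max 0 x)) (I (max 0 y)) \<le> K * dist x y"
        using *[of x y] *[of y x] by (cases "x \<le> y") (auto simp: dist_real_def abs_minus_commute)
    qed
    ultimately have "continuous_on UNIV I"
      using lipschitz_on_continuous_on by (metis (no_types, lifting) continuous_on_cong)
    then show ?thesis by (rule borel_measurable_continuous_onI)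
  qed
  define B where "B = K * T"
  have B: "0 \<le> B" using K T by (simp add: B_def)
  have IB: "\<bar>I s\<bar> \<le> B" if "s \<in> {0..T}" for s
  proof -
    have "\<bar>I s - I 0\<bar> \<le> K * (s - 0)" using that by (intro I_lip) auto
    also have "\<dots> \<le> K * T" using that K by (intro mult_left_mono) auto
    finally show ?thesis by (simp add: I_def B_def set_lebesgue_integral_def)
  qed
  \<comment> \<open>The cut-off changes nothing on \<open>{0..T}\<close> and makes the integrand
    bounded on the whole line.\<close>
  define g where "g u = a u * exp (I u) * indicator {0..T} u" for u
  have [measurable]: "g \<in> borel_measurable borel" unfolding g_def by measurable
  have gb: "\<bar>g u\<bar> \<le> K * exp B" for u
    using aK[of u] IB[of u] K by (auto simp: g_def abs_mult split: split_indicator intro!: mult_mono)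
  have gi: "set_integrable lborel {s<..t} g" for s t
    by (rule set_integrable_bounded) (use gb in auto)
  define D where "D t = exp (I t) - 1 - (LBINT u:{0<..t}. g u)" for t
  define C where "C = exp B * (exp B * K\<^sup>2) + K * (exp B * K)"
  have C: "0 \<le> C" using K by (simp add: C_def)
  \<comment> \<open>Both \<open>exp (I t) - exp (I s)\<close> and the integral of \<open>g\<close>
    over \<open>{s<..t}\<close> have the first-order term \<open>exp (I s) * \<Delta>\<close>. What
    is left is the remainder of the exponential and the error of freezing \<open>exp (I u)\<close>
    at \<open>u = s\<close>.\<close>
  have D_quad: "\<bar>D t - D s\<bar> \<le> C * (t - s)\<^sup>2" if st: "0 \<le> s" "s \<le> t" "t \<le> T" for s t
  proof -
    define \<Delta> where "\<Delta> = I t - I s"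
    have \<Delta>K: "\<bar>\<Delta>\<bar> \<le> K * (t - s)" unfolding \<Delta>_def using st by (intro I_lip) auto
    have \<Delta>B: "\<bar>\<Delta>\<bar> \<le> B"
    proof -
      have "K * (t - s) \<le> K * T" using K st by (intro mult_left_mono) auto
      then show ?thesis using \<Delta>K by (simp add: B_def)
    qed
    have ci: "set_integrable lborel {s<..t} (\<lambda>u. a u * exp (I s))" using ai by simp
    have "D t - D s = exp (I t) - exp (I s) - (LBINT u:{s<..t}. g u)"
      using split[OF st(1,2) gi] by (simp add: D_def)
    also have "(LBINT u:{s<..t}. g u) = (LBINT u:{s<..t}. g u - a u * exp (I s)) + \<Delta> * exp (I s)"
      using set_integral_diff(2)[OF gi ci] Idiff[OF st(1,2)] by (simp add: \<Delta>_def)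
    also have "exp (I t) = exp (I s) * exp \<Delta>" by (simp add: \<Delta>_def flip: exp_add)
    finally have eq: "D t - D s = exp (I s) * (exp \<Delta> - 1 - \<Delta>) - (LBINT u:{s<..t}. g u - a u * exp (I s))"
      by (simp add: algebra_simps)
    have "\<bar>exp (I s) * (exp \<Delta> - 1 - \<Delta>)\<bar> \<le> exp B * (exp B * (K * (t - s))\<^sup>2)"
    proof -
      have "\<bar>exp \<Delta> - 1 - \<Delta>\<bar> \<le> exp \<bar>\<Delta>\<bar> * \<Delta>\<^sup>2" by (rule exp_minus_linear_le)
      also have "\<dots> \<le> exp B * (K * (t - s))\<^sup>2"
        using \<Delta>B power_mono[OF \<Delta>K, of 2] by (intro mult_mono) auto
      finally have 1: "\<bar>exp \<Delta> - 1 - \<Delta>\<bar> \<le> exp B * (K * (t - s))\<^sup>2" .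
      have 2: "exp (I s) \<le> exp B" using IB[of s] st by auto
      show ?thesis unfolding abs_mult using mult_mono[OF 2 1] by simp
    qed
    moreover have "\<bar>LBINT u:{s<..t}. g u - a u * exp (I s)\<bar> \<le> K * (exp B * (K * (t - s))) * (t - s)"
    proof (rule set_integral_abs_bound[OF _ _ st(2)])
      fix u assume u: "u \<in> {s<..t}"
      have "\<bar>exp (I u) - exp (I s)\<bar> \<le> exp B * \<bar>I u - I s\<bar>"
        using IB[of u] IB[of s] u st by (intro exp_diff_le) auto
      also have "\<dots> \<le> exp B * (K * (t - s))"
      proof -
        have "\<bar>I u - I s\<bar> \<le> K * (u - s)" using u st by (intro I_lip) auto
        also have "\<dots> \<le> K * (t - s)" using K u by (intro mult_left_mono) auto
        finally show ?thesis by simp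
      qed
      finally have 1: "\<bar>exp (I u) - exp (I s)\<bar> \<le> exp B * (K * (t - s))" .
      have "g u - a u * exp (I s) = a u * (exp (I u) - exp (I s))"
        using u st by (simp add: g_def algebra_simps)
      then show "\<bar>g u - a u * exp (I s)\<bar> \<le> K * (exp B * (K * (t - s)))"
        using mult_mono[OF aK[of u] 1] K by (simp add: abs_mult)
    qed simp
    ultimately have "\<bar>D t - D s\<bar> \<le> exp B * (exp B * (K * (t - s))\<^sup>2) + K * (exp B * (K * (t - s))) * (t - s)"
      unfolding eq by linarith
    also have "\<dots> = C * (t - s)\<^sup>2" by (simp add: C_def power2_eq_square algebra_simps)
    finally show ?thesis .
  qed
  have D0: "D 0 = 0" by (simp add: D_def I_def set_lebesgue_integral_def)
  \<comment> \<open>Cutting \<open>{0..T}\<close> into \<open>Suc n\<close> equal pieces leaves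
    \<open>Suc n\<close> quadratic errors, in total of order \<open>1 / Suc n\<close>.\<close>
  have "\<bar>D T\<bar> \<le> C * T\<^sup>2 * (1 / real (Suc n))" for n
  proof -
    define h where "h = T / real (Suc n)"
    have h: "0 \<le> h" using T by (simp add: h_def)
    have hT: "real (Suc n) * h = T" by (simp add: h_def)
    have "\<bar>D (real k * h)\<bar> \<le> real k * (C * h\<^sup>2)" if "k \<le> Suc n" for k
      using that
    proof (induction k)
      case (Suc k)
      have "real (Suc k) * h \<le> real (Suc n) * h" using Suc.prems h by (intro mult_right_mono) auto
      then have "\<bar>D (real (Suc k) * h) - D (real k * h)\<bar> \<le> C * (real (Suc k) * h - real k * h)\<^sup>2"
        using h hT by (intro D_quad) (auto simp: mult_right_mono)
      also have "real (Suc k) * h - real k * h = h" by (simp add: algebra_simps)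
      finally have "\<bar>D (real (Suc k) * h) - D (real k * h)\<bar> \<le> C * h\<^sup>2" .
      moreover have "\<bar>D (real k * h)\<bar> \<le> real k * (C * h\<^sup>2)" using Suc by simp
      ultimately have "\<bar>D (real (Suc k) * h)\<bar> \<le> real k * (C * h\<^sup>2) + C * h\<^sup>2" by linarith
      then show ?case by (simp add: algebra_simps)
    qed (simp add: D0)
    from this[of "Suc n"] have "\<bar>D T\<bar> \<le> real (Suc n) * (C * h\<^sup>2)" unfolding hT by simp
    also have "real (Suc n) * (C * h\<^sup>2) = C * T\<^sup>2 * (1 / real (Suc n))"
    proof -
      have "real (Suc n) * (C * h\<^sup>2) = C * h * (real (Suc n) * h)" by (simp add: power2_eq_square)
      also have "\<dots> = C * h * T" unfolding hT ..
      finally show ?thesis by (simp add: h_def power2_eq_square)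
    qed
    finally show ?thesis .
  qed
  moreover have "(\<lambda>n. C * T\<^sup>2 * (1 / real (Suc n))) \<longlonglongrightarrow> C * T\<^sup>2 * 0"
    by (intro tendsto_mult_left) (use LIMSEQ_inverse_real_of_nat in \<open>simp add: inverse_eq_divide\<close>)
  ultimately have "\<bar>D T\<bar> \<le> C * T\<^sup>2 * 0" by (intro LIMSEQ_le_const) auto
  then have "D T = 0" by simp
  moreover have "(LBINT u:{0<..T}. g u) = (LBINT s:{0<..T}. a s * exp (LBINT r:{0<..s}. a r))"
    by (intro set_lebesgue_integral_cong) (auto simp: g_def I_def)
  ultimately show ?thesis by (simp add: D_def I_def)
qed

text \<open>Duhamel's formula with discount \<open>\<phi>\<close> before \<open>s\<close> and
  \<open>a\<close> after it: the factor after \<open>s\<close> is then a functional of the shifted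
  path, as the Markov property at \<open>s\<close> wants it. It is \<open>exp_set_integral\<close>
  for the rate \<open>a - \<phi>\<close>, multiplied by the exponential of minus the integral of
  \<open>a\<close>.\<close>

lemma feynman_kac_real:
  fixes a :: "real \<Rightarrow> real"
  assumes [measurable]: "a \<in> borel_measurable borel" and aK: "\<And>s. \<bar>a s\<bar> \<le> K" and T: "0 \<le> T"
  shows "exp (- (LBINT s:{0<..T}. a s))
     + (LBINT s:{0<..T}. exp (- \<phi> * s) * (a s - \<phi>) * exp (- (LBINT r:{s<..T}. a r))) = exp (- \<phi> * T)"
proof -
  define k where "k s = a s - \<phi>" for s
  have km[measurable]: "k \<in> borel_measurable borel" unfolding k_def by measurable
  have kK: "\<bar>k s\<bar> \<le> K + \<bar>\<phi>\<bar>" for s using aK[of s] unfolding k_def by linarith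
  have ai: "set_integrable lborel {s<..t} a" for s t
    by (rule set_integrable_bounded) (use aK in auto)
  have ci: "set_integrable lborel {s<..t} (\<lambda>_. \<phi>)" for s t :: real
    by (rule set_integrable_bounded[where C="\<bar>\<phi>\<bar>"]) auto
  have ki: "(LBINT r:{0<..s}. k r) = (LBINT r:{0<..s}. a r) - \<phi> * s" if "0 \<le> s" for s
    unfolding k_def using that by (subst set_integral_diff(2)[OF ai ci]) (simp add: set_lebesgue_integral_def)
  let ?A = "LBINT s:{0<..T}. a s"
  have "exp (- \<phi> * T) = exp (- ?A) * exp (LBINT s:{0<..T}. k s)"
    using ki[OF T] by (simp flip: exp_add)
  also have "exp (LBINT s:{0<..T}. k s) = 1 + (LBINT s:{0<..T}. k s * exp (LBINT r:{0<..s}. k r))"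
    by (rule exp_set_integral[OF km kK T])
  also have "exp (- ?A) * \<dots> = exp (- ?A) + (LBINT s:{0<..T}. exp (- ?A) * (k s * exp (LBINT r:{0<..s}. k r)))"
    by (simp add: distrib_left)
  also have "(LBINT s:{0<..T}. exp (- ?A) * (k s * exp (LBINT r:{0<..s}. k r)))
     = (LBINT s:{0<..T}. exp (- \<phi> * s) * (a s - \<phi>) * exp (- (LBINT r:{s<..T}. a r)))"
  proof (intro set_lebesgue_integral_cong ballI allI impI)
    fix s assume s: "s \<in> {0<..T}"
    have "{0<..T} = {0<..s} \<union> {s<..T}" using s by auto
    then have "?A = (LBINT r:{0<..s}. a r) + (LBINT r:{s<..T}. a r)"
      using set_integral_Un[of "{0<..s}" "{s<..T}" lborel a] ai by auto
    then have "exp (- ?A) * exp (LBINT r:{0<..s}. k r) = exp (- \<phi> * s) * exp (- (LBINT r:{s<..T}. a r))"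
      using ki[of s] s by (simp flip: exp_add)
    then show "exp (- ?A) * (k s * exp (LBINT r:{0<..s}. k r)) = exp (- \<phi> * s) * (a s - \<phi>) * exp (- (LBINT r:{s<..T}. a r))"
      unfolding k_def by (simp add: ac_simps)
  qed simp
  finally show ?thesis by simp
qed

lemma set_integral_Ioo_Ioc:
  fixes f :: "real \<Rightarrow> real"
  assumes [measurable]: "f \<in> borel_measurable borel"
  shows "(LBINT r:{s<..<t}. f r) = (LBINT r:{s<..t}. f r)"
  unfolding set_lebesgue_integral_def
proof (rule integral_cong_AE)
  have "AE r in lborel. r \<noteq> t" by (rule AE_lborel_singleton)
  then show "AE r in lborel. indicator {s<..<t} r *\<^sub>R f r = indicator {s<..t} r *\<^sub>R f r"
    by eventually_elim (auto split: split_indicator)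
qed measurable

lemma borel_measurable_interval_integral[measurable (raw)]:
  fixes a :: "real \<Rightarrow> real"
  assumes [measurable]: "a \<in> borel_measurable borel" "g \<in> borel_measurable N" "h \<in> borel_measurable N"
  shows "(\<lambda>z. LBINT r:{g z<..<h z}. a r) \<in> borel_measurable N"
proof -
  have "(LBINT r:{g z<..<h z}. a r) = (\<integral>r. (if g z < r \<and> r < h z then a r else 0) \<partial>lborel)" for z
    unfolding set_lebesgue_integral_def by (intro Bochner_Integration.integral_cong) auto
  then show ?thesis by simp
qed

text \<open>\<open>ennreal\<close> sends negative reals to 0, so
  \<open>ennreal (a s - \<phi>)\<close> and \<open>ennreal (\<phi> - a s)\<close> are the positive
  and the negative part of \<open>a - \<phi>\<close>. With one on each side no subtraction is
  left.\<close>

lemma feynman_kac_nn: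
  fixes a :: "real \<Rightarrow> real"
  assumes [measurable]: "a \<in> borel_measurable borel" and aK: "\<And>s. \<bar>a s\<bar> \<le> K" and T: "0 \<le> T"
  shows "ennreal (exp (- (LBINT s:{0<..<T}. a s)))
     + (\<integral>\<^sup>+s\<in>{0<..<T}. ennreal (exp (- \<phi> * s)) * (ennreal (a s - \<phi>) * ennreal (exp (- (LBINT r:{s<..<T}. a r)))) \<partial>lborel)
     = ennreal (exp (- \<phi> * T))
     + (\<integral>\<^sup>+s\<in>{0<..<T}. ennreal (exp (- \<phi> * s)) * (ennreal (\<phi> - a s) * ennreal (exp (- (LBINT r:{s<..<T}. a r)))) \<partial>lborel)"
proof -
  have K: "0 \<le> K" using aK[of 0] by linarith
  define E where "E s = exp (- \<phi> * s) * exp (- (LBINT r:{s<..<T}. a r))" for s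
  have [measurable]: "E \<in> borel_measurable borel"
    unfolding E_def by measurable
  have E0: "0 < E s" for s by (simp add: E_def)
  have EB: "E s \<le> exp (\<bar>\<phi>\<bar> * T) * exp (K * T)" if "s \<in> {0<..<T}" for s
  proof -
    have "\<bar>LBINT r:{s<..T}. a r\<bar> \<le> K * (T - s)"
      by (rule set_integral_abs_bound) (use that aK in auto)
    also have "\<dots> \<le> K * T" using that K by (intro mult_left_mono) auto
    finally have 1: "- (LBINT r:{s<..<T}. a r) \<le> K * T" unfolding set_integral_Ioo_Ioc[OF assms(1)] by linarith
    have "- \<phi> * s \<le> \<bar>\<phi>\<bar> * s" using that by (intro mult_right_mono) auto
    also have "\<dots> \<le> \<bar>\<phi>\<bar> * T" using that by (intro mult_left_mono) auto
    finally have 2: "- \<phi> * s \<le> \<bar>\<phi>\<bar> * T" .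
    show ?thesis unfolding E_def using 1 2 by (intro mult_mono) auto
  qed
  define P where "P g = (LBINT s:{0<..<T}. g s * E s)" for g
  have gi: "set_integrable lborel {0<..<T} (\<lambda>s. g s * E s)"
    if [measurable]: "g \<in> borel_measurable borel" and gb: "\<And>s. \<bar>g s\<bar> \<le> B" for g B
  proof (rule set_integrable_bounded)
    have "0 \<le> B" using gb[of 0] by linarith
    then show "\<bar>g x * E x\<bar> \<le> B * (exp (\<bar>\<phi>\<bar> * T) * exp (K * T))" if "x \<in> {0<..<T}" for x
      using gb[of x] EB[OF that] E0[of x] by (auto simp: abs_mult intro!: mult_mono)
  qed auto
  define gp gm where "gp s = max 0 (a s - \<phi>)" and "gm s = max 0 (\<phi> - a s)" for s
  have [measurable]: "gp \<in> borel_measurable borel" "gm \<in> borel_measurable borel" unfolding gp_def gm_def by measurable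
  have gpb: "\<bar>gp s\<bar> \<le> K + \<bar>\<phi>\<bar>" and gmb: "\<bar>gm s\<bar> \<le> K + \<bar>\<phi>\<bar>" for s
    using aK[of s] unfolding gp_def gm_def by linarith+
  note ip = gi[of gp, OF _ gpb] and im = gi[of gm, OF _ gmb]
  have nn: "(\<integral>\<^sup>+s\<in>{0<..<T}. ennreal (exp (- \<phi> * s)) * (ennreal (h s) * ennreal (exp (- (LBINT r:{s<..<T}. a r)))) \<partial>lborel)
      = ennreal (LBINT s:{0<..<T}. g s * E s)"
    if h: "\<And>s. ennreal (h s) = ennreal (g s)" and i: "set_integrable lborel {0<..<T} (\<lambda>s. g s * E s)" and g0: "\<And>s. 0 \<le> g s" for g h
  proof -
    have "(\<integral>\<^sup>+s\<in>{0<..<T}. ennreal (exp (- \<phi> * s)) * (ennreal (h s) * ennreal (exp (- (LBINT r:{s<..<T}. a r)))) \<partial>lborel)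
       = (\<integral>\<^sup>+s. ennreal (indicator {0<..<T} s *\<^sub>R (g s * E s)) \<partial>lborel)"
    proof (intro nn_integral_cong)
      fix s
      have "ennreal (exp (- \<phi> * s)) * (ennreal (h s) * ennreal (exp (- (LBINT r:{s<..<T}. a r)))) = ennreal (g s * E s)"
        unfolding h E_def using g0[of s] by (simp add: ac_simps flip: ennreal_mult)
      then show "ennreal (exp (- \<phi> * s)) * (ennreal (h s) * ennreal (exp (- (LBINT r:{s<..<T}. a r)))) * indicator {0<..<T} s
         = ennreal (indicator {0<..<T} s *\<^sub>R (g s * E s))"
        by (auto split: split_indicator)
    qed
    also have "\<dots> = ennreal (LBINT s:{0<..<T}. g s * E s)"
      using i g0 E0 unfolding set_lebesgue_integral_def set_integrable_def
      by (intro nn_integral_eq_integral) (auto simp: less_imp_le split: split_indicator intro!: AE_I2)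
    finally show ?thesis .
  qed
  have "(LBINT s:{0<..T}. exp (- \<phi> * s) * (a s - \<phi>) * exp (- (LBINT r:{s<..T}. a r)))
      = (LBINT s:{0<..<T}. gp s * E s - gm s * E s)"
    unfolding set_integral_Ioo_Ioc[OF assms(1), symmetric]
    by (subst set_integral_Ioo_Ioc[symmetric], measurable, intro set_lebesgue_integral_cong)
       (auto simp: E_def gp_def gm_def max_def algebra_simps)
  also have "\<dots> = P gp - P gm" unfolding P_def by (rule set_integral_diff(2)) (use ip im in auto)
  finally have "exp (- (LBINT s:{0<..<T}. a s)) + P gp = exp (- \<phi> * T) + P gm"
    using feynman_kac_real[OF assms, of \<phi>] by (simp add: set_integral_Ioo_Ioc[OF assms(1)])
  moreover have "0 \<le> P gp" "0 \<le> P gm"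
    using E0 unfolding P_def set_lebesgue_integral_def gp_def gm_def
    by (auto intro!: integral_nonneg_AE AE_I2 mult_nonneg_nonneg simp: less_imp_le split: split_indicator)
  ultimately have "ennreal (exp (- (LBINT s:{0<..<T}. a s))) + ennreal (P gp) = ennreal (exp (- \<phi> * T)) + ennreal (P gm)"
    by (simp flip: ennreal_plus)
  moreover have "ennreal (a s - \<phi>) = ennreal (gp s)" "ennreal (\<phi> - a s) = ennreal (gm s)" for s
    by (auto simp: gp_def gm_def max_def ennreal_neg)
  ultimately show ?thesis
    using nn[of "\<lambda>s. a s - \<phi>" gp] nn[of "\<lambda>s. \<phi> - a s" gm] ip im by (simp add: P_def gp_def gm_def)
qed

section \<open>Convolutions on the line\<close>

definition nn_conv :: "(real \<Rightarrow> ennreal) \<Rightarrow> (real \<Rightarrow> ennreal) \<Rightarrow> real \<Rightarrow> ennreal" where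
  "nn_conv f g x = (\<integral>\<^sup>+z. f (x - z) * g z \<partial>lborel)"

lemma borel_measurable_nn_conv[measurable]:
  assumes [measurable]: "f \<in> borel_measurable borel" "g \<in> borel_measurable borel"
  shows "nn_conv f g \<in> borel_measurable borel"
  unfolding nn_conv_def by measurable

lemma nn_integral_lborel_shift:
  fixes f :: "real \<Rightarrow> ennreal"
  assumes "f \<in> borel_measurable borel"
  shows "(\<integral>\<^sup>+x. f (x + t) \<partial>lborel) = (\<integral>\<^sup>+x. f x \<partial>lborel)"
  using nn_integral_real_affine[OF assms, of 1 t] by (simp add: add.commute)

text \<open>Fubini after the translation \<open>v = u + z\<close>.\<close>

lemma nn_conv_assoc:
  assumes [measurable]: "f \<in> borel_measurable borel" "g \<in> borel_measurable borel" "h \<in> borel_measurable borel"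
  shows "nn_conv (nn_conv f g) h x = nn_conv f (nn_conv g h) x"
proof -
  have "nn_conv (nn_conv f g) h x = (\<integral>\<^sup>+z. (\<integral>\<^sup>+u. f (x - z - u) * g u * h z \<partial>lborel) \<partial>lborel)"
    unfolding nn_conv_def by (intro nn_integral_cong) (simp add: nn_integral_multc)
  also have "\<dots> = (\<integral>\<^sup>+z. (\<integral>\<^sup>+v. f (x - v) * g (v - z) * h z \<partial>lborel) \<partial>lborel)"
  proof (rule nn_integral_cong)
    fix z
    have "(\<integral>\<^sup>+u. f (x - z - u) * g u * h z \<partial>lborel) = (\<integral>\<^sup>+u. (\<lambda>v. f (x - v) * g (v - z) * h z) (u + z) \<partial>lborel)"
      by (simp add: algebra_simps)
    also have "\<dots> = (\<integral>\<^sup>+v. f (x - v) * g (v - z) * h z \<partial>lborel)" by (rule nn_integral_lborel_shift) measurable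
    finally show "(\<integral>\<^sup>+u. f (x - z - u) * g u * h z \<partial>lborel) = (\<integral>\<^sup>+v. f (x - v) * g (v - z) * h z \<partial>lborel)" .
  qed
  also have "\<dots> = (\<integral>\<^sup>+v. (\<integral>\<^sup>+z. f (x - v) * g (v - z) * h z \<partial>lborel) \<partial>lborel)"
    by (rule lborel_pair.Fubini') measurable
  also have "\<dots> = nn_conv f (nn_conv g h) x"
    unfolding nn_conv_def by (intro nn_integral_cong) (simp add: nn_integral_cmult mult.assoc)
  finally show ?thesis .
qed

lemma nn_conv_add:
  assumes [measurable]: "f \<in> borel_measurable borel" "g \<in> borel_measurable borel" "h \<in> borel_measurable borel"
  shows "nn_conv (\<lambda>x. f x + g x) h x = nn_conv f h x + nn_conv g h x"
    and "nn_conv f (\<lambda>x. g x + h x) x = nn_conv f g x + nn_conv f h x"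
  unfolding nn_conv_def by (simp_all add: distrib_right distrib_left nn_integral_add)

lemma nn_conv_cmult:
  assumes [measurable]: "f \<in> borel_measurable borel" "g \<in> borel_measurable borel"
  shows "nn_conv (\<lambda>x. c * f x) g x = c * nn_conv f g x"
    and "nn_conv f (\<lambda>x. c * g x) x = c * nn_conv f g x"
  unfolding nn_conv_def by (simp_all add: ac_simps flip: nn_integral_cmult)

lemma AE_lborel_reflect:
  fixes x :: real
  assumes "AE u in lborel. P u"
  shows "AE z in lborel. P (x - z)"
proof -
  obtain N where N: "{u. \<not> P u} \<subseteq> N" "N \<in> null_sets lborel" using assms by (auto elim!: AE_E2 simp: eventually_ae_filter)
  have [measurable]: "N \<in> sets borel" using N by auto
  have "(\<integral>\<^sup>+z. indicator N (x - z) \<partial>lborel) = (\<integral>\<^sup>+z. indicator N z \<partial>lborel)"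
    using nn_integral_real_affine[of "indicator N :: real \<Rightarrow> ennreal" "-1" x] by simp
  also have "\<dots> = 0" using N by auto
  finally have "AE z in lborel. indicator N (x - z) = (0::ennreal)" by (subst (asm) nn_integral_0_iff_AE) auto
  then show ?thesis by eventually_elim (use N(1) in \<open>auto split: split_indicator_asm\<close>)
qed

text \<open>Reflections and translations preserve null sets. This lets convolutions use
  \<open>scale_function_change\<close>, an identity that holds almost everywhere.\<close>

lemma nn_conv_cong_AE:
  assumes "AE u in lborel. f u = g u"
  shows "nn_conv f h x = nn_conv g h x"
  unfolding nn_conv_def by (rule nn_integral_cong_AE, use AE_lborel_reflect[OF assms, of x] in eventually_elim) simp

text \<open>The convolution theorem: \<open>exp (- \<theta> * x)\<close> is the product of its
  values at \<open>x - z\<close> and at \<open>z\<close>.\<close>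

lemma nn_integral_exp_nn_conv:
  assumes [measurable]: "f \<in> borel_measurable borel" "g \<in> borel_measurable borel"
  shows "(\<integral>\<^sup>+x. ennreal (exp (- \<theta> * x)) * nn_conv f g x \<partial>lborel)
     = (\<integral>\<^sup>+x. ennreal (exp (- \<theta> * x)) * f x \<partial>lborel) * (\<integral>\<^sup>+x. ennreal (exp (- \<theta> * x)) * g x \<partial>lborel)"
proof -
  let ?e = "\<lambda>x. ennreal (exp (- \<theta> * x))"
  have e: "?e x = ?e (x - z) * ?e z" for x z by (simp add: algebra_simps flip: ennreal_mult exp_add)
  have "(\<integral>\<^sup>+x. ?e x * nn_conv f g x \<partial>lborel) = (\<integral>\<^sup>+x. (\<integral>\<^sup>+z. (?e (x - z) * f (x - z)) * (?e z * g z) \<partial>lborel) \<partial>lborel)"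
    unfolding nn_conv_def
  proof (rule nn_integral_cong)
    fix x
    have "?e x * (\<integral>\<^sup>+z. f (x - z) * g z \<partial>lborel) = (\<integral>\<^sup>+z. ?e x * (f (x - z) * g z) \<partial>lborel)"
      by (rule nn_integral_cmult[symmetric]) measurable
    also have "\<dots> = (\<integral>\<^sup>+z. (?e (x - z) * f (x - z)) * (?e z * g z) \<partial>lborel)"
    proof (rule nn_integral_cong)
      fix z show "?e x * (f (x - z) * g z) = (?e (x - z) * f (x - z)) * (?e z * g z)"
        unfolding e[of x z] by (simp add: ac_simps)
    qed
    finally show "?e x * (\<integral>\<^sup>+z. f (x - z) * g z \<partial>lborel) = (\<integral>\<^sup>+z. (?e (x - z) * f (x - z)) * (?e z * g z) \<partial>lborel)" .
  qed
  also have "\<dots> = (\<integral>\<^sup>+z. (\<integral>\<^sup>+x. (?e (x - z) * f (x - z)) * (?e z * g z) \<partial>lborel) \<partial>lborel)"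
    by (rule lborel_pair.Fubini') measurable
  also have "\<dots> = (\<integral>\<^sup>+z. (\<integral>\<^sup>+x. ?e x * f x \<partial>lborel) * (?e z * g z) \<partial>lborel)"
  proof (rule nn_integral_cong)
    fix z
    have "(\<integral>\<^sup>+x. (?e (x - z) * f (x - z)) * (?e z * g z) \<partial>lborel) = (\<integral>\<^sup>+x. ?e (x - z) * f (x - z) \<partial>lborel) * (?e z * g z)"
      by (rule nn_integral_multc) measurable
    also have "(\<integral>\<^sup>+x. ?e (x - z) * f (x - z) \<partial>lborel) = (\<integral>\<^sup>+x. ?e x * f x \<partial>lborel)"
      using nn_integral_lborel_shift[of "\<lambda>x. ?e x * f x" "- z"] by simp
    finally show "(\<integral>\<^sup>+x. (?e (x - z) * f (x - z)) * (?e z * g z) \<partial>lborel) = (\<integral>\<^sup>+x. ?e x * f x \<partial>lborel) * (?e z * g z)" .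
  qed
  also have "\<dots> = (\<integral>\<^sup>+x. ?e x * f x \<partial>lborel) * (\<integral>\<^sup>+x. ?e x * g x \<partial>lborel)"
    by (rule nn_integral_cmult) measurable
  finally show ?thesis .
qed

section \<open>Path functionals\<close>

definition path_space :: "(real \<Rightarrow> real) measure" where
  "path_space = PiM {0..} (\<lambda>_. borel)"

definition right_cont :: "(real \<Rightarrow> real) \<Rightarrow> bool" where
  "right_cont p \<longleftrightarrow> (\<forall>t\<ge>0. (p \<longlongrightarrow> p t) (at_right t))"

text \<open>For \<open>s \<ge> 0\<close> this is the first multiple of \<open>1 / (n + 1)\<close>
  strictly beyond \<open>s\<close>. Strictness matters because limits \<open>at_right s\<close>
  ignore the value at \<open>s\<close>.\<close>

definition grid_above :: "nat \<Rightarrow> real \<Rightarrow> real" where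
  "grid_above n s = (real (nat \<lfloor>s * real (Suc n)\<rfloor>) + 1) / real (Suc n)"

text \<open>
  Coordinates of the product space are not jointly measurable with time. Right-continuous paths
  are recovered from countably many coordinates by this limit, which is jointly measurable.
\<close>

definition reg :: "(real \<Rightarrow> real) \<Rightarrow> real \<Rightarrow> real" where
  "reg p s = lim (\<lambda>n. p (grid_above n s))"

lemma measurable_coordinate:
  "0 \<le> r \<Longrightarrow> (\<lambda>p. p r) \<in> borel_measurable path_space"
  unfolding path_space_def by (rule measurable_component_singleton) simp

text \<open>For fixed \<open>n\<close> the grid point takes countably many values, so the path at
  that point is pieced together from countably many coordinates.\<close>

lemma measurable_reg[measurable (raw)]:
  assumes [measurable]: "f \<in> borel_measurable N" and g: "g \<in> measurable N path_space"
  shows "(\<lambda>z. reg (g z) (f z)) \<in> borel_measurable N"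
  unfolding reg_def
proof (rule borel_measurable_lim_metric)
  fix n
  have 1: "(\<lambda>z. g z ((real i + 1) / real (Suc n))) \<in> borel_measurable N" for i :: nat
    by (rule measurable_compose[OF g measurable_coordinate]) simp
  have 2: "(\<lambda>z. nat \<lfloor>f z * real (Suc n)\<rfloor>) \<in> measurable N (count_space UNIV)" by measurable
  show "(\<lambda>z. g z (grid_above n (f z))) \<in> borel_measurable N"
    unfolding grid_above_def by (rule measurable_compose_countable[OF 1 2])
qed

lemma borel_measurable_reg[measurable]: "reg p \<in> borel_measurable borel"
proof -
  have "(\<lambda>s. lim (\<lambda>n. p (grid_above n s))) \<in> borel_measurable borel"
  proof (rule borel_measurable_lim_metric)
    fix n
    show "(\<lambda>s. p (grid_above n s)) \<in> borel_measurable borel"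
      unfolding grid_above_def
      by (rule measurable_compose_countable[of "\<lambda>i s. p ((real i + 1) / real (Suc n))" _ _ "\<lambda>s. nat \<lfloor>s * real (Suc n)\<rfloor>"]) measurable
  qed
  then show ?thesis by (simp add: reg_def[abs_def])
qed

lemma grid_above_gt: "0 \<le> s \<Longrightarrow> s < grid_above n s"
  unfolding grid_above_def
proof -
  assume s: "0 \<le> s"
  have "s * real (Suc n) < real_of_int \<lfloor>s * real (Suc n)\<rfloor> + 1" by linarith
  also have "real_of_int \<lfloor>s * real (Suc n)\<rfloor> = real (nat \<lfloor>s * real (Suc n)\<rfloor>)" using s by simp
  finally show "s < (real (nat \<lfloor>s * real (Suc n)\<rfloor>) + 1) / real (Suc n)" by (simp add: pos_less_divide_eq)
qed

lemma grid_above_le: "0 \<le> s \<Longrightarrow> grid_above n s \<le> s + 1 / real (Suc n)"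
proof -
  assume s: "0 \<le> s"
  have "real (nat \<lfloor>s * real (Suc n)\<rfloor>) \<le> s * real (Suc n)" using s by simp
  then have "grid_above n s \<le> (s * real (Suc n) + 1) / real (Suc n)"
    unfolding grid_above_def by (intro divide_right_mono) auto
  then show ?thesis by (simp add: add_divide_distrib)
qed

lemma filterlim_grid_above: "0 \<le> s \<Longrightarrow> filterlim (\<lambda>n. grid_above n s) (at_right s) sequentially"
proof -
  assume s: "0 \<le> s"
  have "(\<lambda>n. s + 1 / real (Suc n)) \<longlonglongrightarrow> s + 0"
    using tendsto_add[OF tendsto_const LIMSEQ_inverse_real_of_nat] by (simp only: inverse_eq_divide)
  then have up: "(\<lambda>n. s + 1 / real (Suc n)) \<longlonglongrightarrow> s" by simp
  have "(\<lambda>n. grid_above n s) \<longlonglongrightarrow> s"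
  proof (rule tendsto_sandwich[OF _ _ tendsto_const up])
    show "eventually (\<lambda>n. s \<le> grid_above n s) sequentially"
      using grid_above_gt[OF s] by (intro always_eventually allI less_imp_le)
    show "eventually (\<lambda>n. grid_above n s \<le> s + 1 / real (Suc n)) sequentially"
      using grid_above_le[OF s] by (intro always_eventually allI)
  qed
  moreover have "grid_above n s \<noteq> s" for n using grid_above_gt[OF s, of n] by simp
  ultimately show ?thesis
    using grid_above_gt[OF s] by (simp add: filterlim_at)
qed

lemma reg_eq: "right_cont p \<Longrightarrow> 0 \<le> s \<Longrightarrow> reg p s = p s"
  unfolding reg_def right_cont_def
  by (intro limI filterlim_compose[OF _ filterlim_grid_above]) auto

lemma right_cont_gtD:
  assumes p: "right_cont p" and t: "0 \<le> t" and c: "c < p t"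
  obtains e where "0 < e" "\<And>u. t \<le> u \<Longrightarrow> u < t + e \<Longrightarrow> c < p u"
proof -
  have "eventually (\<lambda>u. c < p u) (at_right t)"
    using p t c unfolding right_cont_def by (intro order_tendstoD(1)) auto
  then obtain b where b: "t < b" "\<And>u. t < u \<Longrightarrow> u < b \<Longrightarrow> c < p u"
    unfolding eventually_at_right_field by auto
  show ?thesis
    by (rule that[of "b - t"]) (use b c in \<open>auto simp: order_le_less\<close>)
qed

text \<open>Rational times only, which makes it measurable on the product space; on right-continuous
  paths it is the infimum over all positive times (\<open>passage_eq_Inf\<close>).\<close>

definition passage :: "real \<Rightarrow> real \<Rightarrow> (real \<Rightarrow> real) \<Rightarrow> ereal" where
  "passage c x p = (INF r\<in>{r\<in>\<rat>. 0 < r}. if c < x + p r then ereal r else \<infinity>)"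

lemma passage_nonneg: "0 \<le> passage c x p"
  unfolding passage_def by (rule INF_greatest) auto

lemma le_passage_rat: "ereal u \<le> passage c x p \<longleftrightarrow> (\<forall>r\<in>\<rat>. 0 < r \<and> r < u \<longrightarrow> x + p r \<le> c)"
  unfolding passage_def le_INF_iff by (auto simp: not_le not_less)

text \<open>On a right-continuous path a value above \<open>c\<close> persists for a while to the
  right, hence also occurs at a rational time.\<close>

lemma le_passage:
  assumes p: "right_cont p"
  shows "ereal u \<le> passage c x p \<longleftrightarrow> (\<forall>r. 0 < r \<and> r < u \<longrightarrow> x + p r \<le> c)"
  unfolding le_passage_rat
proof (intro iffI allI impI)
  fix r assume *: "\<forall>r\<in>\<rat>. 0 < r \<and> r < u \<longrightarrow> x + p r \<le> c" and r: "0 < r \<and> r < u"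
  show "x + p r \<le> c"
  proof (rule ccontr)
    assume "\<not> x + p r \<le> c"
    then obtain e where e: "0 < e" "\<And>v. r \<le> v \<Longrightarrow> v < r + e \<Longrightarrow> c - x < p v"
      using right_cont_gtD[OF p, of r "c - x"] r by auto
    obtain v where v: "v \<in> \<rat>" "r < v" "v < min u (r + e)"
      using Rats_dense_in_real[of r "min u (r + e)"] r e by auto
    then show False using e(2)[of v] * r by fastforce
  qed
qed auto

text \<open>Passage times are compared through their real lower bounds, because
  \<open>le_passage\<close> turns these into statements about the path.\<close>

lemma ereal_eqI_le:
  assumes "\<And>u. ereal u \<le> a \<longleftrightarrow> ereal u \<le> b"
  shows "a = b"
proof -
  have "x \<le> y" if *: "\<And>u. ereal u \<le> x \<Longrightarrow> ereal u \<le> y" for x y :: ereal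
  proof (cases x)
    case (real r) then show ?thesis using *[of r] by simp
  next
    case PInf
    then have "ereal u \<le> y" for u using *[of u] by simp
    then show ?thesis using ereal_top[of y] by simp
  qed simp
  from this[of a b] this[of b a] show ?thesis using assms by (simp add: order_antisym)
qed

lemma passage_eq_Inf:
  assumes "right_cont p"
  shows "passage c x p = Inf (ereal ` {t. 0 < t \<and> c < x + p t})"
proof (rule ereal_eqI_le)
  fix u
  have "(0 < r \<and> r < u \<longrightarrow> x + p r \<le> c) \<longleftrightarrow> (0 < r \<and> c < x + p r \<longrightarrow> u \<le> r)" for r
    by linarith
  then show "ereal u \<le> passage c x p \<longleftrightarrow> ereal u \<le> Inf (ereal ` {t. 0 < t \<and> c < x + p t})"
    unfolding le_passage[OF assms] le_Inf_iff by simp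
qed

lemma borel_measurable_passage[measurable (raw)]:
  assumes [measurable]: "f \<in> borel_measurable N" and g: "g \<in> measurable N path_space"
  shows "(\<lambda>z. passage c (f z) (g z)) \<in> borel_measurable N"
  unfolding passage_def
proof (rule borel_measurable_INF)
  show "countable {r \<in> \<rat>. 0 < (r::real)}" by (rule countable_subset[OF _ countable_rat]) auto
  fix r :: real assume "r \<in> {r \<in> \<rat>. 0 < r}"
  then have [measurable]: "(\<lambda>z. g z r) \<in> borel_measurable N"
    by (intro measurable_compose[OF g measurable_coordinate]) auto
  show "(\<lambda>z. if c < f z + g z r then ereal r else \<infinity>) \<in> borel_measurable N" by measurable
qed

definition path_shift :: "real \<Rightarrow> (real \<Rightarrow> real) \<Rightarrow> real \<Rightarrow> real" where
  "path_shift s p = restrict (\<lambda>u. p (s + u) - p s) {0..}"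

lemma path_shift_apply: "0 \<le> u \<Longrightarrow> path_shift s p u = p (s + u) - p s"
  by (simp add: path_shift_def)

lemma right_cont_shift:
  assumes p: "right_cont p" and s: "0 \<le> s"
  shows "right_cont (path_shift s p)"
  unfolding right_cont_def
proof (intro allI impI)
  fix t :: real assume t: "0 \<le> t"
  have "(p \<longlongrightarrow> p (t + s)) (at_right (t + s))" using p s t by (auto simp: right_cont_def)
  then have "((\<lambda>u. p (u + s)) \<longlongrightarrow> p (t + s)) (at_right t)"
    by (subst (asm) at_right_to_0) (subst at_right_to_0, simp add: filterlim_filtermap ac_simps)
  then have "((\<lambda>u. p (s + u) - p s) \<longlongrightarrow> p (s + t) - p s) (at_right t)"
    by (intro tendsto_intros) (simp add: ac_simps)
  moreover have "eventually (\<lambda>u. p (s + u) - p s = path_shift s p u) (at_right t)"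
    unfolding eventually_at_right_field using t by (intro exI[of _ "t + 1"]) (auto simp: path_shift_apply)
  ultimately have "(path_shift s p \<longlongrightarrow> p (s + t) - p s) (at_right t)"
    by (rule Lim_transform_eventually)
  then show "(path_shift s p \<longlongrightarrow> path_shift s p t) (at_right t)" using t by (simp add: path_shift_def)
qed

text \<open>Nothing above \<open>c\<close> occurs up to \<open>s\<close>, so watching the path on
  all of \<open>(0, u)\<close> or only after \<open>s\<close> amounts to the same.\<close>

lemma passage_shift:
  assumes p: "right_cont p" and s: "0 \<le> s" and less: "ereal s < passage c x p"
  shows "passage c x p = ereal s + passage c (x + p s) (path_shift s p)"
proof (rule ereal_eqI_le)
  fix u
  have "ereal u \<le> ereal s + passage c (x + p s) (path_shift s p) \<longleftrightarrow> ereal (u - s) \<le> passage c (x + p s) (path_shift s p)"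
    by (cases "passage c (x + p s) (path_shift s p)") auto
  also have "\<dots> \<longleftrightarrow> (\<forall>r. 0 < r \<and> r < u - s \<longrightarrow> x + p (s + r) \<le> c)"
    unfolding le_passage[OF right_cont_shift[OF p s]]
  proof -
    have "(0 < r \<and> r < u - s \<longrightarrow> x + p s + path_shift s p r \<le> c) \<longleftrightarrow> (0 < r \<and> r < u - s \<longrightarrow> x + p (s + r) \<le> c)" for r
      by (cases "0 < r") (simp_all add: path_shift_apply)
    then show "(\<forall>r. 0 < r \<and> r < u - s \<longrightarrow> x + p s + path_shift s p r \<le> c) \<longleftrightarrow>
        (\<forall>r. 0 < r \<and> r < u - s \<longrightarrow> x + p (s + r) \<le> c)" by simp
  qed
  also have "\<dots> \<longleftrightarrow> (\<forall>r. s < r \<and> r < u \<longrightarrow> x + p r \<le> c)"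
  proof (intro iffI allI impI)
    fix r assume "\<forall>r. 0 < r \<and> r < u - s \<longrightarrow> x + p (s + r) \<le> c" "s < r \<and> r < u"
    then show "x + p r \<le> c" by (auto dest!: spec[of _ "r - s"])
  next
    fix r assume "\<forall>r. s < r \<and> r < u \<longrightarrow> x + p r \<le> c" "0 < r \<and> r < u - s"
    then show "x + p (s + r) \<le> c" by (auto dest!: spec[of _ "s + r"])
  qed
  also have "\<dots> \<longleftrightarrow> (\<forall>r. 0 < r \<and> r < u \<longrightarrow> x + p r \<le> c)"
  proof (intro iffI allI impI)
    \<comment> \<open>A time \<open>v > s\<close> still not beyond the passage. It is needed for
      \<open>r = s\<close> itself, since \<open>le_passage\<close> speaks about open
      intervals.\<close>
    obtain v where v: "s < v" "ereal v \<le> passage c x p"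
      using ereal_dense2[OF less] by (auto intro: less_imp_le)
    fix r assume *: "\<forall>r. s < r \<and> r < u \<longrightarrow> x + p r \<le> c" and r: "0 < r \<and> r < u"
    show "x + p r \<le> c"
    proof (cases "r \<le> s")
      case True
      then show ?thesis using v r unfolding le_passage[OF p] by auto
    qed (use * r in auto)
  qed (use s in auto)
  also have "\<dots> \<longleftrightarrow> ereal u \<le> passage c x p" unfolding le_passage[OF p] ..
  finally show "ereal u \<le> passage c x p \<longleftrightarrow> ereal u \<le> ereal s + passage c (x + p s) (path_shift s p)" by simp
qed

section \<open>Discounted functionals of a path up to its passage\<close>

definition cost :: "(real \<Rightarrow> real) \<Rightarrow> real \<Rightarrow> (real \<Rightarrow> real) \<Rightarrow> ereal \<Rightarrow> real" where
  "cost \<omega> x p T = (LBINT s:{s. 0 < s \<and> ereal s < T}. \<omega> (x + reg p s))"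

lemma borel_measurable_cost[measurable (raw)]:
  assumes [measurable]: "\<omega> \<in> borel_measurable borel" "f \<in> borel_measurable N" "g \<in> measurable N path_space" "h \<in> borel_measurable N"
  shows "(\<lambda>z. cost \<omega> (f z) (g z) (h z)) \<in> borel_measurable N"
proof -
  have "cost \<omega> (f z) (g z) (h z) = (\<integral>s. (if 0 < s \<and> ereal s < h z then \<omega> (f z + reg (g z) s) else 0) \<partial>lborel)" for z
    unfolding cost_def set_lebesgue_integral_def by (intro Bochner_Integration.integral_cong) auto
  then show ?thesis by simp
qed

definition exit_functional :: "(real \<Rightarrow> real) \<Rightarrow> real \<Rightarrow> real \<Rightarrow> (real \<Rightarrow> real) \<Rightarrow> ennreal" where
  "exit_functional \<omega> c x p =
     (if passage c x p < \<infinity> then ennreal (exp (- cost \<omega> x p (passage c x p))) else 0)"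

definition occupation_functional ::
    "(real \<Rightarrow> real) \<Rightarrow> (real \<Rightarrow> ennreal) \<Rightarrow> real \<Rightarrow> real \<Rightarrow> (real \<Rightarrow> real) \<Rightarrow> ennreal" where
  "occupation_functional \<omega> f c x p =
     (\<integral>\<^sup>+t\<in>{t. 0 < t \<and> ereal t < passage c x p}. ennreal (exp (- cost \<omega> x p t)) * f (x + reg p t) \<partial>lborel)"

lemma borel_measurable_exit_functional[measurable (raw)]:
  assumes [measurable]: "\<omega> \<in> borel_measurable borel" "f \<in> borel_measurable N" "g \<in> measurable N path_space"
  shows "(\<lambda>z. exit_functional \<omega> c (f z) (g z)) \<in> borel_measurable N"
  unfolding exit_functional_def by measurable

lemma borel_measurable_occupation_functional[measurable (raw)]:
  assumes [measurable]: "\<omega> \<in> borel_measurable borel" "h \<in> borel_measurable borel" "f \<in> borel_measurable N" "g \<in> measurable N path_space"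
  shows "(\<lambda>z. occupation_functional \<omega> h c (f z) (g z)) \<in> borel_measurable N"
proof -
  have "occupation_functional \<omega> h c (f z) (g z) = (\<integral>\<^sup>+t. (if 0 < t \<and> ereal t < passage c (f z) (g z) then
      ennreal (exp (- cost \<omega> (f z) (g z) t)) * h (f z + reg (g z) t) else 0) \<partial>lborel)" for z
    unfolding occupation_functional_def by (intro nn_integral_cong) auto
  then show ?thesis by simp
qed

lemma cost_ereal: "cost \<omega> x p (ereal t) = (LBINT r:{0<..<t}. \<omega> (x + reg p r))"
  unfolding cost_def by (rule arg_cong[where f="\<lambda>A. set_lebesgue_integral lborel A _"]) auto

lemma reg_path_shift:
  assumes "right_cont p" "0 \<le> s" "0 \<le> r"
  shows "reg (path_shift s p) r = reg p (s + r) - p s"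
  using reg_eq[OF right_cont_shift[OF assms(1,2)] assms(3)] reg_eq[OF assms(1), of "s + r"] assms
  by (simp add: path_shift_apply)

lemma cost_path_shift:
  assumes p: "right_cont p" and s: "0 \<le> s"
  shows "cost \<omega> (x + p s) (path_shift s p) (ereal t) = (LBINT r:{s<..<s + t}. \<omega> (x + reg p r))"
proof -
  have "(LBINT r:{s<..<s + t}. \<omega> (x + reg p r)) = (\<integral>r. indicator {s<..<s + t} (s + 1 * r) *\<^sub>R \<omega> (x + reg p (s + 1 * r)) \<partial>lborel)"
    unfolding set_lebesgue_integral_def by (subst lborel_integral_real_affine[of 1 _ s]) auto
  also have "\<dots> = cost \<omega> (x + p s) (path_shift s p) (ereal t)"
    unfolding cost_ereal set_lebesgue_integral_def
    by (intro Bochner_Integration.integral_cong) (auto simp: reg_path_shift[OF p s] split: split_indicator)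
  finally show ?thesis by simp
qed

lemma less_passage_le:
  assumes p: "right_cont p" and r: "0 < r" "ereal r < passage c x p"
  shows "x + reg p r \<le> c"
proof -
  obtain u where u: "ereal r < ereal u" "ereal u \<le> passage c x p"
    using ereal_dense2[OF r(2)] by (auto intro: less_imp_le)
  then have "x + p r \<le> c" using r(1) unfolding le_passage[OF p] by auto
  then show ?thesis using reg_eq[OF p, of r] r(1) by simp
qed

text \<open>The rate is controlled only at levels up to \<open>c\<close>. Set to 0 outside the
  lifetime of the path, it becomes bounded on the whole line, as the Feynman-Kac lemmas
  demand.\<close>

definition alive_rate :: "(real \<Rightarrow> real) \<Rightarrow> real \<Rightarrow> real \<Rightarrow> (real \<Rightarrow> real) \<Rightarrow> real \<Rightarrow> real" where
  "alive_rate \<omega> c x p r = (if 0 < r \<and> ereal r < passage c x p then \<omega> (x + reg p r) else 0)"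

lemma borel_measurable_alive_rate[measurable]:
  assumes [measurable]: "\<omega> \<in> borel_measurable borel"
  shows "alive_rate \<omega> c x p \<in> borel_measurable borel"
  unfolding alive_rate_def[abs_def] by measurable

lemma alive_rate_integral:
  assumes "0 \<le> s" "ereal t \<le> passage c x p"
  shows "(LBINT r:{s<..<t}. \<omega> (x + reg p r)) = (LBINT r:{s<..<t}. alive_rate \<omega> c x p r)"
  unfolding set_lebesgue_integral_def
proof (rule Bochner_Integration.integral_cong[OF refl])
  fix r
  have "r < t \<Longrightarrow> ereal r < passage c x p" using assms(2) by (metis less_ereal.simps(1) order_less_le_trans)
  then show "indicator {s<..<t} r *\<^sub>R \<omega> (x + reg p r) = indicator {s<..<t} r *\<^sub>R alive_rate \<omega> c x p r"
    using assms(1) by (auto simp: alive_rate_def split: split_indicator)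
qed

lemma alive_rate_bound:
  assumes "right_cont p" "\<And>y. y \<le> c \<Longrightarrow> \<bar>\<omega> y\<bar> \<le> K"
  shows "\<bar>alive_rate \<omega> c x p r\<bar> \<le> K"
  using less_passage_le[OF assms(1), of r c x] assms(2)[of "x + reg p r"] assms(2)[of c]
  by (auto simp: alive_rate_def)

text \<open>If the path passes at \<open>T\<close>, its shift by \<open>s\<close> passes at
  \<open>T - s\<close>, and the claim is \<open>feynman_kac_nn\<close> at \<open>T\<close>. If it
  never passes, neither do its shifts and every term vanishes.\<close>

lemma exit_functional_feynman_kac:
  assumes p: "right_cont p" and [measurable]: "\<omega> \<in> borel_measurable borel"
    and K: "\<And>y. y \<le> c \<Longrightarrow> \<bar>\<omega> y\<bar> \<le> K"
  shows "exit_functional \<omega> c x p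
     + (\<integral>\<^sup>+s\<in>{s. 0 < s \<and> ereal s < passage c x p}. ennreal (exp (- \<phi> * s)) *
           (ennreal (\<omega> (x + p s) - \<phi>) * exit_functional \<omega> c (x + p s) (path_shift s p)) \<partial>lborel)
   = exit_functional (\<lambda>_. \<phi>) c x p
     + (\<integral>\<^sup>+s\<in>{s. 0 < s \<and> ereal s < passage c x p}. ennreal (exp (- \<phi> * s)) *
           (ennreal (\<phi> - \<omega> (x + p s)) * exit_functional \<omega> c (x + p s) (path_shift s p)) \<partial>lborel)"
proof (cases "passage c x p")
  case PInf
  have "exit_functional \<omega> c (x + p s) (path_shift s p) = 0" if "0 < s" for s
  proof -
    have "passage c (x + p s) (path_shift s p) = \<infinity>"
      using passage_shift[OF p, of s c x] that PInf by (cases "passage c (x + p s) (path_shift s p)") auto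
    then show ?thesis by (simp add: exit_functional_def)
  qed
  then have "(\<integral>\<^sup>+s\<in>{s. 0 < s \<and> ereal s < passage c x p}. g s * (h s * exit_functional \<omega> c (x + p s) (path_shift s p)) \<partial>lborel) = 0" for g h
    by (intro nn_integral_zero' AE_I2) (simp split: split_indicator)
  then show ?thesis by (simp add: exit_functional_def PInf)
next
  case (real T)
  have T: "0 \<le> T" using passage_nonneg[of c x p] real by simp
  let ?a = "alive_rate \<omega> c x p"
  have ex: "exit_functional \<omega> c (x + p s) (path_shift s p) = ennreal (exp (- (LBINT r:{s<..<T}. ?a r)))"
    if s: "0 < s" "s < T" for s
  proof -
    have "passage c (x + p s) (path_shift s p) = ereal (T - s)"
      using passage_shift[OF p, of s c x] s real by (cases "passage c (x + p s) (path_shift s p)") auto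
    then show ?thesis
      using s real cost_path_shift[OF p, of s \<omega> x "T - s"] alive_rate_integral[of s T c x p \<omega>]
      by (simp add: exit_functional_def)
  qed
  have r: "\<omega> (x + p s) = ?a s" if "0 < s" "s < T" for s
    using that real reg_eq[OF p, of s] by (simp add: alive_rate_def)
  have eq: "(\<integral>\<^sup>+s\<in>{s. 0 < s \<and> ereal s < passage c x p}. ennreal (exp (- \<phi> * s)) * (ennreal (h (\<omega> (x + p s))) * exit_functional \<omega> c (x + p s) (path_shift s p)) \<partial>lborel)
     = (\<integral>\<^sup>+s\<in>{0<..<T}. ennreal (exp (- \<phi> * s)) * (ennreal (h (?a s)) * ennreal (exp (- (LBINT r:{s<..<T}. ?a r)))) \<partial>lborel)" for h
    by (rule nn_integral_cong) (auto simp: real ex r split: split_indicator)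
  have e0: "exit_functional \<omega> c x p = ennreal (exp (- (LBINT s:{0<..<T}. ?a s)))"
    using alive_rate_integral[of 0 T c x p \<omega>] by (simp add: exit_functional_def real cost_ereal)
  have e1: "exit_functional (\<lambda>_. \<phi>) c x p = ennreal (exp (- \<phi> * T))"
    using T by (simp add: exit_functional_def real cost_ereal set_lebesgue_integral_def)
  show ?thesis
    unfolding eq[of "\<lambda>w. w - \<phi>"] eq[of "\<lambda>w. \<phi> - w"] e0 e1
    by (rule feynman_kac_nn[OF _ alive_rate_bound[OF p K] T]) measurable
next
  case MInf
  then show ?thesis using passage_nonneg[of c x p] by simp
qed

lemma occupation_functional_shift:
  assumes p: "right_cont p" and s: "0 \<le> s" "ereal s < passage c x p"
    and [measurable]: "\<omega> \<in> borel_measurable borel" "f \<in> borel_measurable borel"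
  shows "occupation_functional \<omega> f c (x + p s) (path_shift s p)
     = (\<integral>\<^sup>+t. (if s < t \<and> ereal t < passage c x p then ennreal (exp (- (LBINT r:{s<..<t}. alive_rate \<omega> c x p r))) * f (x + reg p t) else 0) \<partial>lborel)"
proof -
  have P: "ereal t < passage c (x + p s) (path_shift s p) \<longleftrightarrow> ereal (t + s) < passage c x p" for t
    using passage_shift[OF p s] by (cases "passage c (x + p s) (path_shift s p)") (auto simp: add.commute)
  have "occupation_functional \<omega> f c (x + p s) (path_shift s p)
      = (\<integral>\<^sup>+t. (\<lambda>t. if s < t \<and> ereal t < passage c x p then ennreal (exp (- (LBINT r:{s<..<t}. alive_rate \<omega> c x p r))) * f (x + reg p t) else 0) (t + s) \<partial>lborel)"
    unfolding occupation_functional_def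
  proof (rule nn_integral_cong)
    fix t
    show "ennreal (exp (- cost \<omega> (x + p s) (path_shift s p) (ereal t))) * f (x + p s + reg (path_shift s p) t) *
          indicator {t. 0 < t \<and> ereal t < passage c (x + p s) (path_shift s p)} t =
       (\<lambda>t. if s < t \<and> ereal t < passage c x p then ennreal (exp (- (LBINT r:{s<..<t}. alive_rate \<omega> c x p r))) * f (x + reg p t) else 0) (t + s)"
    proof (cases "0 < t \<and> ereal (t + s) < passage c x p")
      case True
      then have "(LBINT r:{s<..<s + t}. \<omega> (x + reg p r)) = (LBINT r:{s<..<s + t}. alive_rate \<omega> c x p r)"
        using s by (intro alive_rate_integral) (auto simp: add.commute intro: less_imp_le)
      then show ?thesis using True P[of t] s
        by (simp add: cost_path_shift[OF p s(1)] reg_path_shift[OF p s(1)] add.commute)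
    next
      case False
      then show ?thesis using P[of t] by auto
    qed
  qed
  also have "\<dots> = (\<integral>\<^sup>+t. (if s < t \<and> ereal t < passage c x p then ennreal (exp (- (LBINT r:{s<..<t}. alive_rate \<omega> c x p r))) * f (x + reg p t) else 0) \<partial>lborel)"
    by (rule nn_integral_lborel_shift) measurable
  finally show ?thesis .
qed

text \<open>\<open>feynman_kac_nn\<close> at every \<open>t\<close> before the passage, integrated
  over \<open>t\<close> against \<open>f\<close> along the path.\<close>

lemma occupation_functional_feynman_kac:
  assumes p: "right_cont p" and [measurable]: "\<omega> \<in> borel_measurable borel" "f \<in> borel_measurable borel"
    and K: "\<And>y. y \<le> c \<Longrightarrow> \<bar>\<omega> y\<bar> \<le> K"
  shows "occupation_functional \<omega> f c x p
     + (\<integral>\<^sup>+s\<in>{s. 0 < s \<and> ereal s < passage c x p}. ennreal (exp (- \<phi> * s)) *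
           (ennreal (\<omega> (x + p s) - \<phi>) * occupation_functional \<omega> f c (x + p s) (path_shift s p)) \<partial>lborel)
   = occupation_functional (\<lambda>_. \<phi>) f c x p
     + (\<integral>\<^sup>+s\<in>{s. 0 < s \<and> ereal s < passage c x p}. ennreal (exp (- \<phi> * s)) *
           (ennreal (\<phi> - \<omega> (x + p s)) * occupation_functional \<omega> f c (x + p s) (path_shift s p)) \<partial>lborel)"
proof -
  let ?a = "alive_rate \<omega> c x p" and ?P = "passage c x p"
  define E where "E s t = ennreal (exp (- (LBINT r:{s<..<t}. ?a r)))" for s t
  have [measurable]: "(\<lambda>z. E (g z) (h z)) \<in> borel_measurable N"
    if [measurable]: "g \<in> borel_measurable N" "h \<in> borel_measurable N" for g h and N :: "'b measure"
    unfolding E_def by measurable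
  \<comment> \<open>Fubini on the triangle \<open>0 < s < t\<close>: on the left the occupation of
    the path shifted by \<open>s\<close> is inside, on the right the perturbation of the discount up
    to a fixed \<open>t\<close>. The factor \<open>h\<close> stands for either part of
    \<open>\<omega> - \<phi>\<close>.\<close>
  have sw: "(\<integral>\<^sup>+s\<in>{s. 0 < s \<and> ereal s < ?P}. ennreal (exp (- \<phi> * s)) *
           (ennreal (h (\<omega> (x + p s))) * occupation_functional \<omega> f c (x + p s) (path_shift s p)) \<partial>lborel)
    = (\<integral>\<^sup>+t\<in>{t. 0 < t \<and> ereal t < ?P}. (\<integral>\<^sup>+s\<in>{0<..<t}. ennreal (exp (- \<phi> * s)) * (ennreal (h (?a s)) * E s t) \<partial>lborel) * f (x + reg p t) \<partial>lborel)"
    (is "?L = ?R") if [measurable]: "h \<in> borel_measurable borel" for h :: "real \<Rightarrow> real"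
  proof -
    define G where "G s t = (if 0 < s \<and> s < t \<and> ereal t < ?P then
        ennreal (exp (- \<phi> * s)) * (ennreal (h (?a s)) * E s t) * f (x + reg p t) else 0)" for s t
    have Gm: "(\<lambda>(s, t). G s t) \<in> borel_measurable (lborel \<Otimes>\<^sub>M lborel)" unfolding G_def by measurable
    have "?L = (\<integral>\<^sup>+s. (\<integral>\<^sup>+t. G s t \<partial>lborel) \<partial>lborel)"
    proof (rule nn_integral_cong)
      fix s
      show "ennreal (exp (- \<phi> * s)) * (ennreal (h (\<omega> (x + p s))) * occupation_functional \<omega> f c (x + p s) (path_shift s p)) *
          indicator {s. 0 < s \<and> ereal s < ?P} s = (\<integral>\<^sup>+t. G s t \<partial>lborel)"
      proof (cases "0 < s \<and> ereal s < ?P")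
        case True
        have a: "\<omega> (x + p s) = ?a s" using True reg_eq[OF p, of s] by (simp add: alive_rate_def)
        have "(\<integral>\<^sup>+t. G s t \<partial>lborel) = (\<integral>\<^sup>+t. (ennreal (exp (- \<phi> * s)) * ennreal (h (?a s))) * (if s < t \<and> ereal t < ?P then E s t * f (x + reg p t) else 0) \<partial>lborel)"
          using True by (intro nn_integral_cong) (auto simp: G_def ac_simps)
        also have "\<dots> = (ennreal (exp (- \<phi> * s)) * ennreal (h (?a s))) * occupation_functional \<omega> f c (x + p s) (path_shift s p)"
          using True by (subst nn_integral_cmult) (simp_all add: occupation_functional_shift[OF p] E_def cong: if_cong)
        finally show ?thesis using True a by (simp add: ac_simps)
      next
        case False
        have "G s t = 0" for t
        proof -
          have "s < t \<Longrightarrow> ereal t < ?P \<Longrightarrow> ereal s < ?P" by (meson less_ereal.simps(1) order_less_trans)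
          then show ?thesis using False by (auto simp: G_def)
        qed
        then show ?thesis using False by simp
      qed
    qed
    also have "\<dots> = (\<integral>\<^sup>+t. (\<integral>\<^sup>+s. G s t \<partial>lborel) \<partial>lborel)"
      by (rule lborel_pair.Fubini'[symmetric]) (use Gm in \<open>simp add: case_prod_beta'\<close>)
    also have "\<dots> = ?R"
    proof (rule nn_integral_cong)
      fix t
      show "(\<integral>\<^sup>+s. G s t \<partial>lborel) = (\<integral>\<^sup>+s\<in>{0<..<t}. ennreal (exp (- \<phi> * s)) * (ennreal (h (?a s)) * E s t) \<partial>lborel) * f (x + reg p t) *
          indicator {t. 0 < t \<and> ereal t < ?P} t"
      proof (cases "0 < t \<and> ereal t < ?P")
        case True
        have "(\<integral>\<^sup>+s. G s t \<partial>lborel) = (\<integral>\<^sup>+s. ennreal (exp (- \<phi> * s)) * (ennreal (h (?a s)) * E s t) * indicator {0<..<t} s * f (x + reg p t) \<partial>lborel)"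
          using True by (intro nn_integral_cong) (auto simp: G_def split: split_indicator)
        also have "\<dots> = (\<integral>\<^sup>+s\<in>{0<..<t}. ennreal (exp (- \<phi> * s)) * (ennreal (h (?a s)) * E s t) \<partial>lborel) * f (x + reg p t)"
          by (rule nn_integral_multc) measurable
        finally show ?thesis using True by simp
      next
        case False
        then have "G s t = 0" for s by (auto simp: G_def)
        then show ?thesis using False by simp
      qed
    qed
    finally show ?thesis .
  qed
  have o1: "occupation_functional \<omega> f c x p = (\<integral>\<^sup>+t\<in>{t. 0 < t \<and> ereal t < ?P}. E 0 t * f (x + reg p t) \<partial>lborel)"
    unfolding occupation_functional_def
  proof (rule nn_integral_cong)
    fix t
    have "ereal t < ?P \<Longrightarrow> ennreal (exp (- cost \<omega> x p (ereal t))) = E 0 t"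
      using alive_rate_integral[of 0 t c x p \<omega>] by (simp add: cost_ereal E_def)
    then show "ennreal (exp (- cost \<omega> x p (ereal t))) * f (x + reg p t) * indicator {t. 0 < t \<and> ereal t < ?P} t =
         E 0 t * f (x + reg p t) * indicator {t. 0 < t \<and> ereal t < ?P} t"
      by (auto split: split_indicator)
  qed
  have o2: "occupation_functional (\<lambda>_. \<phi>) f c x p = (\<integral>\<^sup>+t\<in>{t. 0 < t \<and> ereal t < ?P}. ennreal (exp (- \<phi> * t)) * f (x + reg p t) \<partial>lborel)"
    unfolding occupation_functional_def
    by (rule nn_integral_cong) (auto simp: cost_ereal set_lebesgue_integral_def mult.commute[of \<phi>] split: split_indicator)
  have fk: "E 0 t + (\<integral>\<^sup>+s\<in>{0<..<t}. ennreal (exp (- \<phi> * s)) * (ennreal (?a s - \<phi>) * E s t) \<partial>lborel)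
      = ennreal (exp (- \<phi> * t)) + (\<integral>\<^sup>+s\<in>{0<..<t}. ennreal (exp (- \<phi> * s)) * (ennreal (\<phi> - ?a s) * E s t) \<partial>lborel)"
    if "0 < t" for t
  proof -
    have "?a \<in> borel_measurable borel" by measurable
    moreover have "\<bar>?a r\<bar> \<le> K" for r by (rule alive_rate_bound[OF p K])
    ultimately show ?thesis using feynman_kac_nn[of ?a K t \<phi>] that unfolding E_def by simp
  qed
  have minus: "(\<lambda>w. w - \<phi>) \<in> borel_measurable borel" "(\<lambda>w. \<phi> - w) \<in> borel_measurable borel"
    by measurable
  show ?thesis
    unfolding sw[OF minus(1)] sw[OF minus(2)] o1 o2
  proof -
    let ?Q = "\<lambda>h t. (\<integral>\<^sup>+s\<in>{0<..<t}. ennreal (exp (- \<phi> * s)) * (ennreal (h (?a s)) * E s t) \<partial>lborel)"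
    have add: "(\<integral>\<^sup>+t\<in>{t. 0 < t \<and> ereal t < ?P}. v t * f (x + reg p t) \<partial>lborel)
        + (\<integral>\<^sup>+t\<in>{t. 0 < t \<and> ereal t < ?P}. ?Q h t * f (x + reg p t) \<partial>lborel)
       = (\<integral>\<^sup>+t\<in>{t. 0 < t \<and> ereal t < ?P}. (v t + ?Q h t) * f (x + reg p t) \<partial>lborel)"
      if [measurable]: "h \<in> borel_measurable borel" "v \<in> borel_measurable borel" for h v
    proof (subst nn_integral_add[symmetric])
      have [measurable]: "(\<lambda>t. ?Q h t) \<in> borel_measurable borel"
      proof -
        have "?Q h t = (\<integral>\<^sup>+s. (if 0 < s \<and> s < t then ennreal (exp (- \<phi> * s)) * (ennreal (h (?a s)) * E s t) else 0) \<partial>lborel)" for t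
          by (rule nn_integral_cong) auto
        then show ?thesis by simp
      qed
      show "(\<lambda>t. v t * f (x + reg p t) * indicator {t. 0 < t \<and> ereal t < ?P} t) \<in> borel_measurable lborel"
        "(\<lambda>t. ?Q h t * f (x + reg p t) * indicator {t. 0 < t \<and> ereal t < ?P} t) \<in> borel_measurable lborel"
        by measurable
      show "(\<integral>\<^sup>+t. v t * f (x + reg p t) * indicator {t. 0 < t \<and> ereal t < ?P} t
          + ?Q h t * f (x + reg p t) * indicator {t. 0 < t \<and> ereal t < ?P} t \<partial>lborel)
        = (\<integral>\<^sup>+t\<in>{t. 0 < t \<and> ereal t < ?P}. (v t + ?Q h t) * f (x + reg p t) \<partial>lborel)"
        by (rule nn_integral_cong) (simp add: distrib_right)
    qed
    have "(\<integral>\<^sup>+t\<in>{t. 0 < t \<and> ereal t < ?P}. E 0 t * f (x + reg p t) \<partial>lborel)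
        + (\<integral>\<^sup>+t\<in>{t. 0 < t \<and> ereal t < ?P}. ?Q (\<lambda>w. w - \<phi>) t * f (x + reg p t) \<partial>lborel)
       = (\<integral>\<^sup>+t\<in>{t. 0 < t \<and> ereal t < ?P}. (E 0 t + ?Q (\<lambda>w. w - \<phi>) t) * f (x + reg p t) \<partial>lborel)"
      by (rule add) measurable
    also have "\<dots> = (\<integral>\<^sup>+t\<in>{t. 0 < t \<and> ereal t < ?P}. (ennreal (exp (- \<phi> * t)) + ?Q (\<lambda>w. \<phi> - w) t) * f (x + reg p t) \<partial>lborel)"
      by (rule nn_integral_cong) (use fk in \<open>auto split: split_indicator\<close>)
    also have "\<dots> = (\<integral>\<^sup>+t\<in>{t. 0 < t \<and> ereal t < ?P}. ennreal (exp (- \<phi> * t)) * f (x + reg p t) \<partial>lborel)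
        + (\<integral>\<^sup>+t\<in>{t. 0 < t \<and> ereal t < ?P}. ?Q (\<lambda>w. \<phi> - w) t * f (x + reg p t) \<partial>lborel)"
      by (rule add[symmetric]) measurable
    finally show "(\<integral>\<^sup>+t\<in>{t. 0 < t \<and> ereal t < ?P}. E 0 t * f (x + reg p t) \<partial>lborel)
        + (\<integral>\<^sup>+t\<in>{t. 0 < t \<and> ereal t < ?P}. ?Q (\<lambda>w. w - \<phi>) t * f (x + reg p t) \<partial>lborel)
      = (\<integral>\<^sup>+t\<in>{t. 0 < t \<and> ereal t < ?P}. ennreal (exp (- \<phi> * t)) * f (x + reg p t) \<partial>lborel)
        + (\<integral>\<^sup>+t\<in>{t. 0 < t \<and> ereal t < ?P}. ?Q (\<lambda>w. \<phi> - w) t * f (x + reg p t) \<partial>lborel)" .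
  qed
qed

section \<open>The Markov property at fixed times\<close>

lemma sets_Collect_vimage:
  "f \<in> measurable M N \<Longrightarrow> A \<in> sets N \<Longrightarrow> {x \<in> space M. f x \<in> A} \<in> sets M"
  using measurable_sets[of f M N A] by (simp add: vimage_def Int_def conj_commute)

locale levy = prob_space M for M :: "'a measure" +
  fixes X :: "real \<Rightarrow> 'a \<Rightarrow> real"
  assumes levy: "levy_process M X"
begin

lemma X_measurable[measurable]: "0 \<le> t \<Longrightarrow> X t \<in> borel_measurable M"
  using levy by (simp add: levy_process_def)

lemma X_zero: "AE \<xi> in M. X 0 \<xi> = 0"
  using levy by (simp add: levy_process_def)

lemma stationary:
  "0 \<le> s \<Longrightarrow> 0 \<le> h \<Longrightarrow> distr M borel (\<lambda>\<xi>. X (s + h) \<xi> - X s \<xi>) = distr M borel (\<lambda>\<xi>. X h \<xi> - X 0 \<xi>)"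
  using levy by (simp add: levy_process_def)

lemma indep_increments:
  "0 \<le> t 0 \<Longrightarrow> (\<And>i. i < n \<Longrightarrow> t i \<le> t (Suc i)) \<Longrightarrow>
    indep_vars (\<lambda>_. borel) (\<lambda>i \<xi>. X (t (Suc i)) \<xi> - X (t i) \<xi>) {..<n}" for t :: "nat \<Rightarrow> real"
  using levy by (simp add: levy_process_def)

definition path :: "'a \<Rightarrow> real \<Rightarrow> real" where
  "path \<xi> = restrict (\<lambda>t. X t \<xi>) {0..}"

lemma path_apply: "0 \<le> t \<Longrightarrow> path \<xi> t = X t \<xi>"
  by (simp add: path_def)

lemma right_cont_path: "\<xi> \<in> space M \<Longrightarrow> right_cont (path \<xi>)"
  unfolding right_cont_def
proof (intro allI impI)
  fix t :: real assume xi: "\<xi> \<in> space M" and t: "0 \<le> t"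
  then have "((\<lambda>t. X t \<xi>) \<longlongrightarrow> X t \<xi>) (at_right t)"
    using levy by (simp add: levy_process_def cadlag_path_def continuous_within)
  moreover have "eventually (\<lambda>u. X u \<xi> = path \<xi> u) (at_right t)"
    unfolding eventually_at_right_field using t by (intro exI[of _ "t + 1"]) (auto simp: path_def)
  ultimately have "(path \<xi> \<longlongrightarrow> X t \<xi>) (at_right t)" by (rule Lim_transform_eventually)
  then show "(path \<xi> \<longlongrightarrow> path \<xi> t) (at_right t)" using t by (simp add: path_apply)
qed

lemma measurable_path[measurable]: "path \<in> measurable M path_space"
  unfolding path_def path_space_def by (rule measurable_restrict) simp

lemma measurable_path_shift[measurable]:
  "0 \<le> s \<Longrightarrow> (\<lambda>\<xi>. path_shift s (path \<xi>)) \<in> measurable M path_space"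
  unfolding path_shift_def path_space_def by (rule measurable_restrict) (simp add: path_apply)

lemma reg_path: "\<xi> \<in> space M \<Longrightarrow> 0 \<le> t \<Longrightarrow> reg (path \<xi>) t = X t \<xi>"
  by (simp add: reg_eq right_cont_path path_apply)

lemma path_measurable_rectangle:
  assumes "finite J" "J \<subseteq> {0..}" "\<And>j. j \<in> J \<Longrightarrow> B j \<in> sets borel"
  shows "{\<xi> \<in> space M. \<forall>j\<in>J. X j \<xi> \<in> B j} \<in> events"
    "0 \<le> t \<Longrightarrow> {\<xi> \<in> space M. \<forall>j\<in>J. X (t + j) \<xi> - X t \<xi> \<in> B j} \<in> events"
proof -
  have "{\<xi> \<in> space M. X j \<xi> \<in> B j} \<in> events" if "j \<in> J" for j
    using assms that by (intro sets_Collect_vimage[of _ M borel]) auto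
  then show "{\<xi> \<in> space M. \<forall>j\<in>J. X j \<xi> \<in> B j} \<in> events"
    using assms(1) by (intro sets.sets_Collect_finite_All)
  assume t: "0 \<le> t"
  have "{\<xi> \<in> space M. X (t + j) \<xi> - X t \<xi> \<in> B j} \<in> events" if "j \<in> J" for j
    using assms that t by (intro sets_Collect_vimage[of _ M borel] borel_measurable_diff X_measurable) auto
  then show "{\<xi> \<in> space M. \<forall>j\<in>J. X (t + j) \<xi> - X t \<xi> \<in> B j} \<in> events"
    using assms(1) by (intro sets.sets_Collect_finite_All)
qed

text \<open>All times involved are merged into one sorted list containing 0 and \<open>t\<close>.
  The past event is a function of the increments up to \<open>t\<close>, the future event of those
  after it, and stationarity replaces the latter by increments started at time 0.\<close>

lemma prob_past_future_rectangle:
  assumes J1: "finite J1" "J1 \<subseteq> {0..t}" and J2: "finite J2" "J2 \<subseteq> {0..}" and t: "0 \<le> t"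
    and A[measurable]: "\<And>j. A j \<in> sets borel" and B[measurable]: "\<And>j. B j \<in> sets borel"
  shows "prob {\<xi> \<in> space M. (\<forall>j\<in>J1. X j \<xi> \<in> A j) \<and> (\<forall>j\<in>J2. X (t + j) \<xi> - X t \<xi> \<in> B j)}
    = prob {\<xi> \<in> space M. \<forall>j\<in>J1. X j \<xi> \<in> A j} * prob {\<xi> \<in> space M. \<forall>j\<in>J2. X j \<xi> \<in> B j}"
proof -
  define S where "S = insert 0 (insert t (J1 \<union> (\<lambda>j. t + j) ` J2))"
  have S: "finite S" "0 \<in> S" "t \<in> S" "\<And>u. u \<in> S \<Longrightarrow> 0 \<le> u" using J1 J2 t by (auto simp: S_def)
  define l where "l = sorted_list_of_set S"
  have l: "sorted l" "set l = S" using S(1) by (simp_all add: l_def)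
  define n where "n = length l"
  have n: "0 < n" using l(2) S(2) by (auto simp: n_def)
  \<comment> \<open>Constant beyond the last index, so that the time \<open>s n\<close> used by
    \<open>D (n - 1)\<close> exists; that increment is 0.\<close>
  define s where "s i = l ! min i (n - 1)" for i
  have s_mono: "s i \<le> s j" if "i \<le> j" for i j
  proof -
    have "min j (n - 1) < length l" using n unfolding n_def[symmetric] by linarith
    then show ?thesis unfolding s_def using l(1) that by (intro sorted_nth_mono) auto
  qed
  have s_in: "s i \<in> S" for i
  proof -
    have "min i (n - 1) < length l" using n unfolding n_def[symmetric] by linarith
    then show ?thesis unfolding s_def l(2)[symmetric] by (rule nth_mem)
  qed
  have s_pos: "0 \<le> s i" for i using S(4)[OF s_in] .
  have s_ex: "\<exists>i<n. s i = u" if "u \<in> S" for u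
  proof -
    have "u \<in> set l" using that l(2) by simp
    then obtain i where "i < length l" "l ! i = u" unfolding in_set_conv_nth by blast
    then show ?thesis by (intro exI[of _ i]) (auto simp: s_def n_def min_def)
  qed
  define ix where "ix u = (LEAST i. s i = u)" for u
  have s_ix: "s (ix u) = u" if u: "u \<in> S" for u
  proof -
    obtain i where "s i = u" using s_ex[OF u] by auto
    then show ?thesis unfolding ix_def by (rule LeastI)
  qed
  have ix_n: "ix u < n" if u: "u \<in> S" for u
  proof -
    obtain i where i: "i < n" "s i = u" using s_ex[OF u] by auto
    then have "ix u \<le> i" unfolding ix_def by (intro Least_le)
    then show ?thesis using i by simp
  qed
  have ix_mono: "ix u \<le> ix v" if uv: "u \<in> S" "v \<in> S" "u \<le> v" for u v
  proof (rule ccontr)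
    assume *: "\<not> ix u \<le> ix v"
    then have "s (ix v) \<le> s (ix u)" by (intro s_mono) simp
    then have "u = v" using s_ix uv by fastforce
    then show False using * by simp
  qed
  have ix0: "ix 0 = 0"
  proof -
    have "s 0 \<le> s (ix 0)" by (rule s_mono) simp
    then have "s 0 = 0" using s_ix[OF S(2)] s_pos[of 0] by simp
    then show ?thesis unfolding ix_def by (intro Least_eq_0)
  qed
  define m where "m = ix t"
  have m: "m < n" "s m = t" using ix_n s_ix S(3) by (auto simp: m_def)
  define D where "D i \<xi> = X (s (Suc i)) \<xi> - X (s i) \<xi>" for i \<xi>
  \<comment> \<open>The same times counted from \<open>t\<close>. From index \<open>m\<close> on,
    \<open>D' i\<close> has the law of \<open>D i\<close>, but it belongs to the process started at
    time 0.\<close>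
  define s' where "s' i = max 0 (s i - t)" for i
  define D' where "D' i \<xi> = X (s' (Suc i)) \<xi> - X (s' i) \<xi>" for i \<xi>
  have s'_pos: "0 \<le> s' i" for i by (simp add: s'_def)
  have s'_mono: "s' i \<le> s' (Suc i)" for i using s_mono[of i "Suc i"] by (simp add: s'_def)
  have Dm[measurable]: "D i \<in> borel_measurable M" "D' i \<in> borel_measurable M" for i
    using X_measurable[OF s_pos] X_measurable[OF s'_pos] unfolding D_def[abs_def] D'_def[abs_def] by measurable
  have iD: "indep_vars (\<lambda>_. borel) D {..<n}"
    using indep_increments[of s n] s_pos s_mono unfolding D_def[abs_def] by simp
  have iD': "indep_vars (\<lambda>_. borel) D' {..<n}"
    using indep_increments[of s' n] s'_pos s'_mono unfolding D'_def[abs_def] by simp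
  have iD_sub: "indep_vars (\<lambda>_. borel) D {m..<n}" by (rule indep_vars_subset[OF iD]) auto
  have iD'_sub: "indep_vars (\<lambda>_. borel) D' {m..<n}" by (rule indep_vars_subset[OF iD']) auto
  have dD: "distr M borel (D i) = distr M borel (D' i)" if "m \<le> i" for i
  proof -
    have *: "t \<le> s i" "s i \<le> s (Suc i)" using s_mono[OF that] s_mono[of i "Suc i"] m by auto
    have "distr M borel (D i) = distr M borel (\<lambda>\<xi>. X (s (Suc i) - s i) \<xi> - X 0 \<xi>)"
      unfolding D_def[abs_def] using stationary[of "s i" "s (Suc i) - s i"] * s_pos by simp
    also have "\<dots> = distr M borel (D' i)"
      unfolding D'_def[abs_def] using stationary[of "s' i" "s (Suc i) - s i"] * s'_pos by (simp add: s'_def)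
    finally show ?thesis .
  qed
  have tel: "(\<Sum>k\<in>{i..<j}. D k \<xi>) = X (s j) \<xi> - X (s i) \<xi>" if "i \<le> j" for i j \<xi>
    unfolding D_def using sum_Suc_diff'[OF that, of "\<lambda>k. X (s k) \<xi>"] .
  have tel': "(\<Sum>k\<in>{i..<j}. D' k \<xi>) = X (s' j) \<xi> - X (s' i) \<xi>" if "i \<le> j" for i j \<xi>
    unfolding D'_def using sum_Suc_diff'[OF that, of "\<lambda>k. X (s' k) \<xi>"] .
  let ?P1 = "PiM {..<m} (\<lambda>_. borel) :: (nat \<Rightarrow> real) measure"
  let ?P2 = "PiM {m..<n} (\<lambda>_. borel) :: (nat \<Rightarrow> real) measure"
  define R1 where "R1 \<xi> = restrict (\<lambda>i. D i \<xi>) {..<m}" for \<xi>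
  define R2 where "R2 \<xi> = restrict (\<lambda>i. D i \<xi>) {m..<n}" for \<xi>
  define R2' where "R2' \<xi> = restrict (\<lambda>i. D' i \<xi>) {m..<n}" for \<xi>
  have Rm[measurable]: "R1 \<in> measurable M ?P1" "R2 \<in> measurable M ?P2" "R2' \<in> measurable M ?P2"
    unfolding R1_def R2_def R2'_def by (auto intro!: measurable_restrict)
  define E1 where "E1 = {y \<in> space ?P1. \<forall>j\<in>J1. (\<Sum>k\<in>{0..<ix j}. y k) \<in> A j}"
  define E2 where "E2 = {y \<in> space ?P2. \<forall>j\<in>J2. (\<Sum>k\<in>{m..<ix (t + j)}. y k) \<in> B j}"
  have J1S: "j \<in> S" "ix j \<le> m" if "j \<in> J1" for j
    using that J1 S(3) unfolding m_def by (auto simp: S_def intro!: ix_mono)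
  have J2S: "t + j \<in> S" "m \<le> ix (t + j)" "ix (t + j) < n" "0 \<le> j" if "j \<in> J2" for j
    using that J2 S(3) ix_n unfolding m_def by (auto simp: S_def intro!: ix_mono)
  have [measurable]: "E1 \<in> sets ?P1"
  proof -
    have "(\<lambda>y. \<Sum>k\<in>{0..<ix j}. y k) \<in> borel_measurable ?P1" if "j \<in> J1" for j
      using J1S[OF that] by (intro borel_measurable_sum measurable_component_singleton) auto
    then show ?thesis unfolding E1_def using J1(1) A by (intro sets.sets_Collect_finite_All sets_Collect_vimage[OF _ A]) auto
  qed
  have [measurable]: "E2 \<in> sets ?P2"
  proof -
    have "(\<lambda>y. \<Sum>k\<in>{m..<ix (t + j)}. y k) \<in> borel_measurable ?P2" if "j \<in> J2" for j
      using J2S[OF that] by (intro borel_measurable_sum measurable_component_singleton) auto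
    then show ?thesis unfolding E2_def using J2(1) B by (intro sets.sets_Collect_finite_All sets_Collect_vimage[OF _ B]) auto
  qed
  have R1E: "R1 \<xi> \<in> E1 \<longleftrightarrow> (\<forall>j\<in>J1. X j \<xi> - X 0 \<xi> \<in> A j)" for \<xi>
  proof -
    have "(\<Sum>k\<in>{0..<ix j}. R1 \<xi> k) = X j \<xi> - X 0 \<xi>" if "j \<in> J1" for j
    proof -
      have "(\<Sum>k\<in>{0..<ix j}. R1 \<xi> k) = (\<Sum>k\<in>{0..<ix j}. D k \<xi>)"
        using J1S[OF that] by (intro sum.cong) (auto simp: R1_def)
      also have "\<dots> = X j \<xi> - X 0 \<xi>"
        using tel[of 0 "ix j" \<xi>] s_ix[OF J1S(1)[OF that]] s_ix[OF S(2)] ix0 by simp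
      finally show ?thesis .
    qed
    then show ?thesis by (simp add: E1_def) (simp add: R1_def space_PiM)
  qed
  have R2E: "R2 \<xi> \<in> E2 \<longleftrightarrow> (\<forall>j\<in>J2. X (t + j) \<xi> - X t \<xi> \<in> B j)" for \<xi>
  proof -
    have "(\<Sum>k\<in>{m..<ix (t + j)}. R2 \<xi> k) = X (t + j) \<xi> - X t \<xi>" if "j \<in> J2" for j
    proof -
      have "(\<Sum>k\<in>{m..<ix (t + j)}. R2 \<xi> k) = (\<Sum>k\<in>{m..<ix (t + j)}. D k \<xi>)"
        using J2S[OF that] by (intro sum.cong) (auto simp: R2_def)
      also have "\<dots> = X (t + j) \<xi> - X t \<xi>"
        using tel[of m "ix (t + j)" \<xi>] J2S[OF that] s_ix m by simp
      finally show ?thesis .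
    qed
    then show ?thesis by (simp add: E2_def) (simp add: R2_def space_PiM)
  qed
  have R2'E: "R2' \<xi> \<in> E2 \<longleftrightarrow> (\<forall>j\<in>J2. X j \<xi> - X 0 \<xi> \<in> B j)" for \<xi>
  proof -
    have "(\<Sum>k\<in>{m..<ix (t + j)}. R2' \<xi> k) = X j \<xi> - X 0 \<xi>" if "j \<in> J2" for j
    proof -
      have "(\<Sum>k\<in>{m..<ix (t + j)}. R2' \<xi> k) = (\<Sum>k\<in>{m..<ix (t + j)}. D' k \<xi>)"
        using J2S[OF that] by (intro sum.cong) (auto simp: R2'_def)
      also have "\<dots> = X j \<xi> - X 0 \<xi>"
        using tel'[of m "ix (t + j)" \<xi>] J2S[OF that] s_ix m by (simp add: s'_def)
      finally show ?thesis .
    qed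
    then show ?thesis by (simp add: E2_def) (simp add: R2'_def space_PiM)
  qed
  \<comment> \<open>By independence both joint laws are products of their marginals, so equality of
    the marginals is enough.\<close>
  have "distr M ?P2 R2 = (\<Pi>\<^sub>M i\<in>{m..<n}. distr M borel (D i))"
    unfolding R2_def[abs_def]
    by (rule indep_vars_iff_distr_eq_PiM[THEN iffD1]) (use m iD_sub in auto)
  also have "\<dots> = (\<Pi>\<^sub>M i\<in>{m..<n}. distr M borel (D' i))"
    by (rule PiM_cong) (use dD in auto)
  also have "\<dots> = distr M ?P2 R2'"
    unfolding R2'_def[abs_def]
    by (rule indep_vars_iff_distr_eq_PiM[THEN iffD1, symmetric]) (use m iD'_sub in auto)
  finally have dR: "distr M ?P2 R2 = distr M ?P2 R2'" .
  have "prob (R2 -` E2 \<inter> space M) = measure (distr M ?P2 R2) E2" by (simp add: measure_distr)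
  also have "\<dots> = prob (R2' -` E2 \<inter> space M)" unfolding dR by (simp add: measure_distr)
  finally have p2: "prob (R2 -` E2 \<inter> space M) = prob (R2' -` E2 \<inter> space M)" .
  have iR: "indep_var ?P1 R1 ?P2 R2"
    unfolding R1_def[abs_def] R2_def[abs_def] using m by (intro indep_var_restrict[OF iD]) auto
  have pr: "prob {\<xi> \<in> space M. R1 \<xi> \<in> E1 \<and> R2 \<xi> \<in> E2} = prob (R1 -` E1 \<inter> space M) * prob (R2 -` E2 \<inter> space M)"
  proof -
    have "prob ((\<lambda>x. (R1 x, R2 x)) -` (E1 \<times> E2) \<inter> space M) = prob (R1 -` E1 \<inter> space M) * prob (R2 -` E2 \<inter> space M)"
      by (rule indep_varD[OF iR]) measurable
    moreover have "(\<lambda>x. (R1 x, R2 x)) -` (E1 \<times> E2) \<inter> space M = {\<xi> \<in> space M. R1 \<xi> \<in> E1 \<and> R2 \<xi> \<in> E2}" by auto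
    ultimately show ?thesis by simp
  qed
  have ev[measurable]: "{\<xi> \<in> space M. \<forall>j\<in>J1. X j \<xi> \<in> A j} \<in> events" "{\<xi> \<in> space M. \<forall>j\<in>J2. X j \<xi> \<in> B j} \<in> events"
    "{\<xi> \<in> space M. \<forall>j\<in>J2. X (t + j) \<xi> - X t \<xi> \<in> B j} \<in> events"
    using J1 J2 t by (auto intro!: path_measurable_rectangle)
  have ev': "{\<xi> \<in> space M. (\<forall>j\<in>J1. X j \<xi> \<in> A j) \<and> (\<forall>j\<in>J2. X (t + j) \<xi> - X t \<xi> \<in> B j)} \<in> events"
  proof -
    have "{\<xi> \<in> space M. (\<forall>j\<in>J1. X j \<xi> \<in> A j) \<and> (\<forall>j\<in>J2. X (t + j) \<xi> - X t \<xi> \<in> B j)}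
      = {\<xi> \<in> space M. \<forall>j\<in>J1. X j \<xi> \<in> A j} \<inter> {\<xi> \<in> space M. \<forall>j\<in>J2. X (t + j) \<xi> - X t \<xi> \<in> B j}" by auto
    then show ?thesis using sets.Int[OF ev(1,3)] by simp
  qed
  \<comment> \<open>The events written in increments concern \<open>X j - X 0\<close>, which is
    \<open>X j\<close> only almost surely; hence events are compared up to null sets here and
    below.\<close>
  have "prob {\<xi> \<in> space M. (\<forall>j\<in>J1. X j \<xi> \<in> A j) \<and> (\<forall>j\<in>J2. X (t + j) \<xi> - X t \<xi> \<in> B j)}
     = prob {\<xi> \<in> space M. R1 \<xi> \<in> E1 \<and> R2 \<xi> \<in> E2}"
  proof (rule finite_measure_eq_AE)
    show "AE \<xi> in M. \<xi> \<in> {\<xi> \<in> space M. (\<forall>j\<in>J1. X j \<xi> \<in> A j) \<and> (\<forall>j\<in>J2. X (t + j) \<xi> - X t \<xi> \<in> B j)} \<longleftrightarrow>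
        \<xi> \<in> {\<xi> \<in> space M. R1 \<xi> \<in> E1 \<and> R2 \<xi> \<in> E2}"
      using X_zero by eventually_elim (simp add: R1E R2E)
  qed (use ev' in measurable)
  moreover have "prob {\<xi> \<in> space M. \<forall>j\<in>J1. X j \<xi> \<in> A j} = prob (R1 -` E1 \<inter> space M)"
  proof (rule finite_measure_eq_AE)
    show "AE \<xi> in M. \<xi> \<in> {\<xi> \<in> space M. \<forall>j\<in>J1. X j \<xi> \<in> A j} \<longleftrightarrow> \<xi> \<in> R1 -` E1 \<inter> space M"
      using X_zero by eventually_elim (auto simp: R1E)
  qed measurable
  moreover have "prob {\<xi> \<in> space M. \<forall>j\<in>J2. X j \<xi> \<in> B j} = prob (R2' -` E2 \<inter> space M)"
  proof (rule finite_measure_eq_AE)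
    show "AE \<xi> in M. \<xi> \<in> {\<xi> \<in> space M. \<forall>j\<in>J2. X j \<xi> \<in> B j} \<longleftrightarrow> \<xi> \<in> R2' -` E2 \<inter> space M"
      using X_zero by eventually_elim (auto simp: R2'E)
  qed measurable
  ultimately show ?thesis using pr p2 by simp
qed

text \<open>Besides independence of the increments after \<open>t\<close> this contains
  stationarity, as the last factor is the law of the unshifted \<open>path\<close>.\<close>

definition indep_future :: "real \<Rightarrow> 'a set \<Rightarrow> bool" where
  "indep_future t E \<longleftrightarrow> E \<in> events \<and> (\<forall>C\<in>sets path_space.
     prob (E \<inter> ((\<lambda>\<xi>. path_shift t (path \<xi>)) -` C \<inter> space M)) = prob E * prob (path -` C \<inter> space M))"

text \<open>For a fixed event both sides are finite measures in \<open>C\<close>; they agree on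
  cylinders by \<open>prob_past_future_rectangle\<close>, hence on the whole product space.\<close>

lemma indep_future_cylinder:
  assumes J: "finite J" "J \<subseteq> {0..t}" and t: "0 \<le> t" and A: "\<And>j. A j \<in> sets borel"
  shows "indep_future t {\<xi> \<in> space M. \<forall>j\<in>J. X j \<xi> \<in> A j}"
proof -
  define E where "E = {\<xi> \<in> space M. \<forall>j\<in>J. X j \<xi> \<in> A j}"
  have E[measurable]: "E \<in> events" unfolding E_def using J A by (intro path_measurable_rectangle) auto
  let ?F = "\<lambda>\<xi>. path_shift t (path \<xi>)"
  have F[measurable]: "?F \<in> measurable M path_space" using t by measurable
  define P where "P = distr (density M (indicator E)) path_space ?F"
  define Q where "Q = density (distr M path_space path) (\<lambda>_. ennreal (prob E))"
  have eP: "emeasure P C = ennreal (prob (E \<inter> (?F -` C \<inter> space M)))" if [measurable]: "C \<in> sets path_space" for C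
  proof -
    have "emeasure P C = (\<integral>\<^sup>+\<xi>. indicator E \<xi> * indicator (?F -` C \<inter> space M) \<xi> \<partial>M)"
      unfolding P_def by (simp add: emeasure_distr emeasure_density)
    also have "\<dots> = emeasure M (E \<inter> (?F -` C \<inter> space M))"
    proof -
      have D: "?F -` C \<inter> space M \<in> events" by measurable
      show ?thesis
        by (subst indicator_inter_arith[symmetric]) (rule nn_integral_indicator[OF sets.Int[OF E D]])
    qed
    finally show ?thesis by (simp add: emeasure_eq_measure)
  qed
  have eQ: "emeasure Q C = ennreal (prob E * prob (path -` C \<inter> space M))" if [measurable]: "C \<in> sets path_space" for C
    unfolding Q_def by (simp add: emeasure_density nn_integral_cmult emeasure_distr emeasure_eq_measure ennreal_mult)
  have "P = Q"
  proof (rule measure_eqI_PiM_infinite[where I="{0..}" and M="\<lambda>_. borel"])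
    show "sets P = sets (PiM {0..} (\<lambda>_. borel))" "sets Q = sets (PiM {0..} (\<lambda>_. borel))"
      by (simp_all add: P_def Q_def path_space_def)
    show "finite_measure P"
    proof
      show "emeasure P (space P) \<noteq> \<infinity>" using eP[OF sets.top] by (simp add: P_def)
    qed
    fix B :: "real \<Rightarrow> real set" and K assume K: "finite K" "K \<subseteq> {0..}" and B: "\<And>i. i \<in> K \<Longrightarrow> B i \<in> sets borel"
    define B' where "B' j = (if j \<in> K then B j else UNIV)" for j
    have B': "B' j \<in> sets borel" for j using B by (simp add: B'_def)
    let ?C = "prod_emb {0..} (\<lambda>_. borel) K (Pi\<^sub>E K B) :: (real \<Rightarrow> real) set"
    have C[measurable]: "?C \<in> sets path_space" unfolding path_space_def by (rule sets_PiM_I) (use K B in auto)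
    have inC: "p \<in> ?C \<longleftrightarrow> (\<forall>j\<in>K. p j \<in> B' j)" if "p \<in> extensional {0..}" for p
      using that K by (auto simp: prod_emb_def B'_def PiE_def Pi_def)
    have ext: "?F \<xi> \<in> extensional {0..}" "path \<xi> \<in> extensional {0..}" for \<xi>
      by (auto simp: path_shift_def path_def)
    have KX: "X (t + j) \<xi> - X t \<xi> = ?F \<xi> j" "X j \<xi> = path \<xi> j" if "j \<in> K" for j \<xi>
      using that K t by (auto simp: path_shift_apply path_apply)
    have "E \<inter> (?F -` ?C \<inter> space M) = {\<xi> \<in> space M. (\<forall>j\<in>J. X j \<xi> \<in> A j) \<and> (\<forall>j\<in>K. X (t + j) \<xi> - X t \<xi> \<in> B' j)}"
      unfolding E_def by (auto simp: inC[OF ext(1)] KX)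
    moreover have "path -` ?C \<inter> space M = {\<xi> \<in> space M. \<forall>j\<in>K. X j \<xi> \<in> B' j}"
      by (auto simp: inC[OF ext(2)] KX)
    ultimately show "emeasure P ?C = emeasure Q ?C"
      unfolding eP[OF C] eQ[OF C] using prob_past_future_rectangle[OF J K t A B'] by (simp add: E_def)
  qed
  then have "prob (E \<inter> (?F -` C \<inter> space M)) = prob E * prob (path -` C \<inter> space M)" if "C \<in> sets path_space" for C
    using eP[OF that] eQ[OF that] by (simp add: mult_nonneg_nonneg)
  then show ?thesis unfolding indep_future_def E_def[symmetric] by simp
qed

text \<open>That no passage occurs before \<open>t\<close> is not a condition on finitely many
  times, only a decreasing limit of such conditions.\<close>

lemma indep_future_decseq:
  assumes E: "\<And>n::nat. indep_future t (E n)" "decseq E" and t: "0 \<le> t"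
  shows "indep_future t (\<Inter>n. E n)"
  unfolding indep_future_def
proof (intro conjI ballI)
  have Em: "E n \<in> events" for n using E(1)[of n] by (simp add: indep_future_def)
  then show "(\<Inter>n. E n) \<in> events" by auto
  fix C assume [measurable]: "C \<in> sets path_space"
  let ?F = "(\<lambda>\<xi>. path_shift t (path \<xi>)) -` C \<inter> space M"
  have Fm: "?F \<in> events" by (rule measurable_sets[OF measurable_path_shift[OF t]]) simp
  have "(\<lambda>n. prob (E n \<inter> ?F)) \<longlonglongrightarrow> prob (\<Inter>n. E n \<inter> ?F)"
    using Em Fm E(2) by (intro finite_Lim_measure_decseq) (auto simp: decseq_def)
  moreover have "(\<lambda>n. prob (E n) * prob (path -` C \<inter> space M)) \<longlonglongrightarrow> prob (\<Inter>n. E n) * prob (path -` C \<inter> space M)"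
    using Em E(2) by (intro tendsto_mult_right finite_Lim_measure_decseq) auto
  moreover have "prob (E n \<inter> ?F) = prob (E n) * prob (path -` C \<inter> space M)" for n
    using E(1)[of n] by (simp add: indep_future_def)
  moreover have "(\<Inter>n. E n \<inter> ?F) = (\<Inter>n. E n) \<inter> ?F" by auto
  ultimately have "(\<lambda>n. prob (E n \<inter> ?F)) \<longlonglongrightarrow> prob ((\<Inter>n. E n) \<inter> ?F)"
    "(\<lambda>n. prob (E n \<inter> ?F)) \<longlonglongrightarrow> prob (\<Inter>n. E n) * prob (path -` C \<inter> space M)"
    by (simp_all only:)
  then show "prob ((\<Inter>n. E n) \<inter> ?F) = prob (\<Inter>n. E n) * prob (path -` C \<inter> space M)"
    by (rule LIMSEQ_unique)
qed

text \<open>With \<open>\<le>\<close> the event restricts the path on the open interval before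
  \<open>t\<close> only, and by \<open>le_passage_rat\<close> only at rational times;
  \<open>X t\<close> stays free for the condition \<open>B\<close>.\<close>

lemma indep_future_alive:
  assumes t: "0 \<le> t" and B: "B \<in> sets borel"
  shows "indep_future t {\<xi> \<in> space M. ereal t \<le> passage c x (path \<xi>) \<and> X t \<xi> \<in> B}"
proof -
  \<comment> \<open>Those of the first \<open>n\<close> rationals of an enumeration that lie
    strictly between 0 and \<open>t\<close>, together with \<open>t\<close>, which carries
    \<open>B\<close>.\<close>
  define J where "J n = {t} \<union> (from_nat_into \<rat> ` {..<n} \<inter> {0<..<t})" for n :: nat
  define E where "E n = {\<xi> \<in> space M. \<forall>j\<in>J n. X j \<xi> \<in> (if j = t then B else {..c - x})}" for n
  have rng: "range (from_nat_into \<rat>) = (\<rat> :: real set)"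
    using range_from_nat_into[OF _ countable_rat] Rats_0 by blast
  have "indep_future t (E n)" for n
    unfolding E_def by (rule indep_future_cylinder) (use t B in \<open>auto simp: J_def\<close>)
  moreover have "decseq E"
  proof -
    have "J m \<subseteq> J n" if "m \<le> n" for m n using that by (fastforce simp: J_def)
    then show ?thesis unfolding decseq_def E_def by blast
  qed
  ultimately have "indep_future t (\<Inter>n. E n)" using t by (intro indep_future_decseq)
  moreover have "(\<Inter>n. E n) = {\<xi> \<in> space M. ereal t \<le> passage c x (path \<xi>) \<and> X t \<xi> \<in> B}"
  proof (intro set_eqI iffI)
    fix \<xi> assume xi: "\<xi> \<in> (\<Inter>n. E n)"
    then have sp: "\<xi> \<in> space M" by (auto simp: E_def)
    have "X t \<xi> \<in> B" using xi by (auto simp: E_def J_def)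
    moreover have "x + path \<xi> r \<le> c" if r: "r \<in> \<rat>" "0 < r" "r < t" for r
    proof -
      obtain i where i: "r = from_nat_into \<rat> i" using r(1) rng by blast
      have "\<xi> \<in> E (Suc i)" using xi by blast
      moreover have "r \<in> J (Suc i)" using r i by (auto simp: J_def)
      ultimately have "X r \<xi> \<in> (if r = t then B else {..c - x})" unfolding E_def by blast
      then show ?thesis using r by (simp add: path_apply)
    qed
    ultimately show "\<xi> \<in> {\<xi> \<in> space M. ereal t \<le> passage c x (path \<xi>) \<and> X t \<xi> \<in> B}"
      using sp by (auto simp: le_passage_rat)
  next
    fix \<xi> assume xi: "\<xi> \<in> {\<xi> \<in> space M. ereal t \<le> passage c x (path \<xi>) \<and> X t \<xi> \<in> B}"
    have "X j \<xi> \<in> (if j = t then B else {..c - x})" if j: "j \<in> J n" for j n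
    proof (cases "j = t")
      case False
      then have j': "j \<in> \<rat>" "0 < j" "j < t" using j rng by (auto simp: J_def)
      then have "x + path \<xi> j \<le> c" using xi by (auto simp: le_passage_rat)
      then show ?thesis using j' False by (simp add: path_apply)
    qed (use xi in auto)
    then show "\<xi> \<in> (\<Inter>n. E n)" using xi by (auto simp: E_def)
  qed
  ultimately show ?thesis by simp
qed

text \<open>Letting \<open>B\<close> vary shows that, on the event \<open>P\<close>, the joint law
  of \<open>X t\<close> and the shifted path is a product measure. The claim is Fubini's theorem for
  it.\<close>

lemma markov:
  assumes t: "0 \<le> t" and E: "\<And>B. B \<in> sets borel \<Longrightarrow> indep_future t {\<xi> \<in> space M. P \<xi> \<and> X t \<xi> \<in> B}"
    and F[measurable]: "(\<lambda>(y, p). F y p) \<in> borel_measurable (borel \<Otimes>\<^sub>M path_space)"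
  shows "(\<integral>\<^sup>+\<xi>\<in>{\<xi>. P \<xi>}. F (X t \<xi>) (path_shift t (path \<xi>)) \<partial>M)
     = (\<integral>\<^sup>+\<xi>\<in>{\<xi>. P \<xi>}. (\<integral>\<^sup>+\<xi>'. F (X t \<xi>) (path \<xi>') \<partial>M) \<partial>M)"
proof -
  define A where "A = {\<xi> \<in> space M. P \<xi>}"
  have A[measurable]: "A \<in> events" using E[of UNIV] by (simp add: indep_future_def A_def)
  have ind: "(indicator {\<xi>. P \<xi>} \<xi> :: ennreal) = indicator A \<xi>" if "\<xi> \<in> space M" for \<xi>
    using that by (auto simp: A_def split: split_indicator)
  define N where "N = density M (indicator A)"
  have [measurable_cong]: "sets N = sets M" by (simp add: N_def)
  have spN: "space N = space M" by (simp add: N_def)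
  let ?F = "\<lambda>\<xi>. path_shift t (path \<xi>)"
  have mX[measurable]: "X t \<in> borel_measurable M" and mF[measurable]: "?F \<in> measurable M path_space"
    using t by measurable
  have nnN: "(\<integral>\<^sup>+\<xi>. g \<xi> \<partial>N) = (\<integral>\<^sup>+\<xi>\<in>{\<xi>. P \<xi>}. g \<xi> \<partial>M)" if [measurable]: "g \<in> borel_measurable M" for g
  proof -
    have "(\<integral>\<^sup>+\<xi>. g \<xi> \<partial>N) = (\<integral>\<^sup>+\<xi>. indicator A \<xi> * g \<xi> \<partial>M)" unfolding N_def by (simp add: nn_integral_density)
    also have "\<dots> = (\<integral>\<^sup>+\<xi>\<in>{\<xi>. P \<xi>}. g \<xi> \<partial>M)" by (rule nn_integral_cong) (simp add: ind mult.commute)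
    finally show ?thesis .
  qed
  define NX where "NX = distr N borel (X t)"
  define L where "L = distr M path_space path"
  interpret L: prob_space L unfolding L_def by (rule prob_space_distr) simp
  interpret NX: finite_measure NX
  proof
    have "emeasure NX (space NX) = (\<integral>\<^sup>+\<xi>. 1 \<partial>N)" unfolding NX_def using spN by (simp add: emeasure_distr)
    also have "\<dots> = (\<integral>\<^sup>+\<xi>\<in>{\<xi>. P \<xi>}. 1 \<partial>M)" by (rule nnN) simp
    also have "\<dots> \<le> (\<integral>\<^sup>+\<xi>. 1 \<partial>M)" by (rule nn_integral_mono) (auto split: split_indicator)
    also have "\<dots> < \<infinity>" by (simp add: emeasure_space_1)
    finally show "emeasure NX (space NX) \<noteq> \<infinity>" by simp
  qed
  have "NX \<Otimes>\<^sub>M L = distr N (borel \<Otimes>\<^sub>M path_space) (\<lambda>\<xi>. (X t \<xi>, ?F \<xi>))"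
  proof (rule pair_measure_eqI)
    show "sigma_finite_measure NX" "sigma_finite_measure L" by unfold_locales
    show "sets (NX \<Otimes>\<^sub>M L) = sets (distr N (borel \<Otimes>\<^sub>M path_space) (\<lambda>\<xi>. (X t \<xi>, ?F \<xi>)))"
      by (simp add: NX_def L_def cong: sets_pair_measure_cong)
    fix B C assume "B \<in> sets NX" "C \<in> sets L"
    then have B[measurable]: "B \<in> sets borel" and C[measurable]: "C \<in> sets path_space" by (simp_all add: NX_def L_def)
    have em: "emeasure N D = emeasure M (A \<inter> D)" if [measurable]: "D \<in> events" for D
      unfolding N_def by (subst emeasure_density) (auto simp flip: indicator_inter_arith)
    have sB: "X t -` B \<inter> space M \<in> events" and sC: "?F -` C \<inter> space M \<in> events" by measurable
    have AB: "A \<inter> (X t -` B \<inter> space M) = {\<xi> \<in> space M. P \<xi> \<and> X t \<xi> \<in> B}" by (auto simp: A_def)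
    have "emeasure (distr N (borel \<Otimes>\<^sub>M path_space) (\<lambda>\<xi>. (X t \<xi>, ?F \<xi>))) (B \<times> C)
       = emeasure N ((X t -` B \<inter> space M) \<inter> (?F -` C \<inter> space M))"
      by (subst emeasure_distr) (auto simp: spN intro!: arg_cong2[where f=emeasure])
    also have "\<dots> = emeasure M ({\<xi> \<in> space M. P \<xi> \<and> X t \<xi> \<in> B} \<inter> (?F -` C \<inter> space M))"
      unfolding em[OF sets.Int[OF sB sC]] AB[symmetric] by (simp add: Int_assoc)
    also have "\<dots> = ennreal (prob {\<xi> \<in> space M. P \<xi> \<and> X t \<xi> \<in> B} * prob (path -` C \<inter> space M))"
      using E[OF B] C by (simp add: indep_future_def emeasure_eq_measure)
    also have "\<dots> = emeasure NX B * emeasure L C"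
      unfolding NX_def L_def using em[OF sB] AB
      by (simp add: emeasure_distr spN emeasure_eq_measure ennreal_mult)
    finally show "emeasure NX B * emeasure L C = emeasure (distr N (borel \<Otimes>\<^sub>M path_space) (\<lambda>\<xi>. (X t \<xi>, ?F \<xi>))) (B \<times> C)"
      by simp
  qed
  note pr = this
  have sL[measurable_cong]: "sets L = sets path_space" and sNX[measurable_cong]: "sets NX = sets borel" by (simp_all add: L_def NX_def)
  have "(\<integral>\<^sup>+\<xi>\<in>{\<xi>. P \<xi>}. F (X t \<xi>) (?F \<xi>) \<partial>M) = (\<integral>\<^sup>+\<xi>. F (X t \<xi>) (?F \<xi>) \<partial>N)"
    by (rule nnN[symmetric]) measurable
  also have "\<dots> = (\<integral>\<^sup>+z. (case z of (y, p) \<Rightarrow> F y p) \<partial>distr N (borel \<Otimes>\<^sub>M path_space) (\<lambda>\<xi>. (X t \<xi>, ?F \<xi>)))"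
    by (subst nn_integral_distr) auto
  also have "\<dots> = (\<integral>\<^sup>+y. (\<integral>\<^sup>+p. F y p \<partial>L) \<partial>NX)"
    unfolding pr[symmetric] by (subst L.nn_integral_fst[symmetric]) auto
  also have "\<dots> = (\<integral>\<^sup>+y. (\<integral>\<^sup>+\<xi>'. F y (path \<xi>') \<partial>M) \<partial>NX)"
    unfolding L_def by (subst nn_integral_distr) auto
  also have "\<dots> = (\<integral>\<^sup>+\<xi>. (\<integral>\<^sup>+\<xi>'. F (X t \<xi>) (path \<xi>') \<partial>M) \<partial>N)"
    unfolding NX_def by (subst nn_integral_distr) auto
  also have "\<dots> = (\<integral>\<^sup>+\<xi>\<in>{\<xi>. P \<xi>}. (\<integral>\<^sup>+\<xi>'. F (X t \<xi>) (path \<xi>') \<partial>M) \<partial>M)"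
    by (rule nnN) measurable
  finally show ?thesis .
qed

end

section \<open>The Laplace exponent and its right inverse\<close>

text \<open>\<open>subordinator\<close> includes the Levy property, so this is part of contradicting
  that \<open>- X\<close> is no subordinator.\<close>

lemma (in levy) levy_process_minus: "levy_process M (\<lambda>t \<xi>. - X t \<xi>)"
  unfolding levy_process_def
proof (intro conjI allI impI ballI)
  show "prob_space M" by unfold_locales
  show "0 \<le> t \<Longrightarrow> (\<lambda>\<xi>. - X t \<xi>) \<in> borel_measurable M" for t by simp
  show "AE \<xi> in M. - X 0 \<xi> = 0" using X_zero by eventually_elim simp
  show "distr M borel (\<lambda>\<xi>. - X (s + h) \<xi> - - X s \<xi>) = distr M borel (\<lambda>\<xi>. - X h \<xi> - - X 0 \<xi>)"
    if "0 \<le> s" "0 \<le> h" for s h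
  proof -
    have "distr (distr M borel (\<lambda>\<xi>. X (s + h) \<xi> - X s \<xi>)) borel uminus = distr (distr M borel (\<lambda>\<xi>. X h \<xi> - X 0 \<xi>)) borel uminus"
      using stationary[OF that] by simp
    then show ?thesis using that by (simp add: distr_distr comp_def)
  qed
  show "indep_vars (\<lambda>_. borel) (\<lambda>i \<xi>. - X (t (Suc i)) \<xi> - - X (t i) \<xi>) {..<n}"
    if "0 \<le> t 0" "\<forall>i<n. t i \<le> t (Suc i)" for n and t :: "nat \<Rightarrow> real"
    using indep_vars_compose2[OF indep_increments[of t n], of "\<lambda>_. uminus" "\<lambda>_. borel"] that by simp
  fix \<xi> assume "\<xi> \<in> space M"
  then have "cadlag_path (\<lambda>t. X t \<xi>)" using levy by (simp add: levy_process_def)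
  then show "cadlag_path (\<lambda>t. - X t \<xi>)"
    unfolding cadlag_path_def
  proof (intro conjI allI impI)
    fix t :: real
    assume c: "(\<forall>t\<ge>0. continuous (at_right t) (\<lambda>t. X t \<xi>)) \<and> (\<forall>t>0. \<exists>l. ((\<lambda>t. X t \<xi>) \<longlongrightarrow> l) (at_left t))"
    show "continuous (at_right t) (\<lambda>t. - X t \<xi>)" if "0 \<le> t"
      using c that by (intro continuous_minus) auto
    show "\<exists>l. ((\<lambda>t. - X t \<xi>) \<longlongrightarrow> l) (at_left t)" if "0 < t"
    proof -
      obtain l where "((\<lambda>t. X t \<xi>) \<longlongrightarrow> l) (at_left t)" using c \<open>0 < t\<close> by blast
      then show ?thesis by (intro exI[of _ "- l"] tendsto_minus)
    qed
  qed
qed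

locale spectrally_negative = levy M X for M :: "'a measure" and X :: "real \<Rightarrow> 'a \<Rightarrow> real" +
  fixes \<psi> :: "real \<Rightarrow> real"
  assumes spectrally_negative: "spectrally_negative_levy M X"
    and laplace: "is_laplace_exponent M X \<psi>"
begin

lemma expectation_exp: "0 \<le> \<theta> \<Longrightarrow> 0 \<le> t \<Longrightarrow> expectation (\<lambda>\<xi>. exp (\<theta> * X t \<xi>)) = exp (t * \<psi> \<theta>)"
  using laplace by (simp add: is_laplace_exponent_def)

lemma integrable_exp: "0 \<le> \<theta> \<Longrightarrow> 0 \<le> t \<Longrightarrow> integrable M (\<lambda>\<xi>. exp (\<theta> * X t \<xi>))"
  using expectation_exp[of \<theta> t] not_integrable_integral_eq[of M "\<lambda>\<xi>. exp (\<theta> * X t \<xi>)"]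
  by (metis exp_not_eq_zero)

lemma nn_integral_exp: "0 \<le> \<theta> \<Longrightarrow> 0 \<le> t \<Longrightarrow> (\<integral>\<^sup>+\<xi>. ennreal (exp (\<theta> * X t \<xi>)) \<partial>M) = ennreal (exp (t * \<psi> \<theta>))"
  using integrable_exp[of \<theta> t] expectation_exp[of \<theta> t] by (subst nn_integral_eq_integral) auto

lemma psi_zero: "\<psi> 0 = 0"
  using expectation_exp[of 0 1] by (simp add: prob_space)

text \<open>Convexity of \<open>\<psi>\<close> combined with \<open>\<psi> 0 = 0\<close>: take
  expectations in \<open>exp (l * u) \<le> 1 - l + l * exp u\<close> for
  \<open>u = \<theta> * X 1 - \<psi> \<theta>\<close>.\<close>

lemma psi_scale_le:
  assumes "0 \<le> s" "s \<le> \<theta>" "0 < \<theta>"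
  shows "\<psi> s \<le> s / \<theta> * \<psi> \<theta>"
proof -
  define l where "l = s / \<theta>"
  have l: "0 \<le> l" "l \<le> 1" using assms by (auto simp: l_def)
  \<comment> \<open>The tangent of \<open>exp\<close> at \<open>l * u\<close>, evaluated at
    \<open>u\<close> and at 0 and averaged with the weights \<open>l\<close> and
    \<open>1 - l\<close>.\<close>
  have conv: "exp (l * u) \<le> 1 - l + l * exp u" for u :: real
  proof -
    have "exp (l * u) * (1 + (u - l * u)) \<le> exp (l * u) * exp (u - l * u)"
      by (intro mult_left_mono exp_ge_add_one_self) auto
    then have 1: "l * (exp (l * u) * (1 + (u - l * u))) \<le> l * exp u"
      using l by (intro mult_left_mono) (auto simp flip: exp_add)
    have "exp (l * u) * (1 + (- (l * u))) \<le> exp (l * u) * exp (- (l * u))"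
      by (intro mult_left_mono exp_ge_add_one_self) auto
    then have 2: "(1 - l) * (exp (l * u) * (1 + (- (l * u)))) \<le> (1 - l) * 1"
      using l by (intro mult_left_mono) (auto simp flip: exp_add)
    have "exp (l * u) = (1 - l) * (exp (l * u) * (1 + (- (l * u)))) + l * (exp (l * u) * (1 + (u - l * u)))"
      by (simp add: algebra_simps)
    also have "\<dots> \<le> (1 - l) * 1 + l * exp u" by (rule add_mono[OF 2 1])
    finally show ?thesis by simp
  qed
  have "exp (s * X 1 \<xi>) \<le> exp (l * \<psi> \<theta>) * (1 - l + l * (exp (- \<psi> \<theta>) * exp (\<theta> * X 1 \<xi>)))" for \<xi>
  proof -
    have "exp (s * X 1 \<xi>) = exp (l * \<psi> \<theta>) * exp (l * (\<theta> * X 1 \<xi> - \<psi> \<theta>))"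
      using assms by (simp add: l_def right_diff_distrib flip: exp_add)
    also have "\<dots> \<le> exp (l * \<psi> \<theta>) * (1 - l + l * exp (\<theta> * X 1 \<xi> - \<psi> \<theta>))"
      by (intro mult_left_mono conv) auto
    finally show ?thesis by (simp add: exp_diff exp_minus field_simps)
  qed
  then have "expectation (\<lambda>\<xi>. exp (s * X 1 \<xi>)) \<le>
      expectation (\<lambda>\<xi>. exp (l * \<psi> \<theta>) * (1 - l + l * (exp (- \<psi> \<theta>) * exp (\<theta> * X 1 \<xi>))))"
    using integrable_exp[of s 1] integrable_exp[of \<theta> 1] assms by (intro integral_mono) auto
  also have "\<dots> = exp (l * \<psi> \<theta>)"
    using integrable_exp[of \<theta> 1] expectation_exp[of \<theta> 1] assms by (simp add: prob_space exp_minus)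
  finally show ?thesis using expectation_exp[of s 1] assms by (simp add: l_def)
qed

text \<open>Dominated convergence of the moments at time 1: for parameters in \<open>[0, B]\<close>
  the function \<open>1 + exp (B * X 1)\<close> dominates, its two terms covering negative and
  nonnegative values of \<open>X 1\<close>.\<close>

lemma continuous_on_psi: "continuous_on {0..} \<psi>"
proof -
  have "continuous_on {0..} (\<lambda>\<theta>. expectation (\<lambda>\<xi>. exp (\<theta> * X 1 \<xi>)))"
    unfolding continuous_on_sequentially
  proof (intro allI ballI impI)
    fix u :: "nat \<Rightarrow> real" and a :: real
    assume a: "a \<in> {0..}" and u: "(\<forall>n. u n \<in> {0..}) \<and> u \<longlonglongrightarrow> a"
    obtain B where B: "\<And>n. u n \<le> B" "0 \<le> B"
    proof -
      have "Bseq u" using u by (intro convergent_imp_Bseq) (auto simp: convergent_def)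
      then obtain K where "0 < K" "\<And>n. norm (u n) \<le> K" by (auto elim: BseqE)
      then show ?thesis using that[of K] by (force simp: abs_le_iff)
    qed
    show "((\<lambda>\<theta>. expectation (\<lambda>\<xi>. exp (\<theta> * X 1 \<xi>))) \<circ> u) \<longlonglongrightarrow> expectation (\<lambda>\<xi>. exp (a * X 1 \<xi>))"
      unfolding comp_def
    proof (rule integral_dominated_convergence[where w="\<lambda>\<xi>. 1 + exp (B * X 1 \<xi>)"])
      show "integrable M (\<lambda>\<xi>. 1 + exp (B * X 1 \<xi>))" using integrable_exp[of B 1] B by simp
      show "AE \<xi> in M. (\<lambda>i. exp (u i * X 1 \<xi>)) \<longlonglongrightarrow> exp (a * X 1 \<xi>)"
        using u by (intro AE_I2 tendsto_intros) auto
      show "AE \<xi> in M. norm (exp (u i * X 1 \<xi>)) \<le> 1 + exp (B * X 1 \<xi>)" for i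
      proof (rule AE_I2)
        fix \<xi>
        show "norm (exp (u i * X 1 \<xi>)) \<le> 1 + exp (B * X 1 \<xi>)"
        proof (cases "0 \<le> X 1 \<xi>")
          case True
          then have "exp (u i * X 1 \<xi>) \<le> exp (B * X 1 \<xi>)" using B(1)[of i] by (simp add: mult_right_mono)
          then have "exp (u i * X 1 \<xi>) \<le> 1 + exp (B * X 1 \<xi>)" by linarith
          then show ?thesis by (simp only: real_norm_def abs_exp_cancel)
        next
          case False
          then have "exp (u i * X 1 \<xi>) \<le> 1" using u by (simp add: mult_nonneg_nonpos)
          then have "exp (u i * X 1 \<xi>) \<le> 1 + exp (B * X 1 \<xi>)" using exp_gt_zero[of "B * X 1 \<xi>"] by linarith
          then show ?thesis by (simp only: real_norm_def abs_exp_cancel)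
        qed
      qed
    qed simp_all
  qed
  then have "continuous_on {0..} (\<lambda>\<theta>. exp (\<psi> \<theta>))"
    by (rule continuous_on_eq) (simp add: expectation_exp)
  then have "continuous_on {0..} (\<lambda>\<theta>. ln (exp (\<psi> \<theta>)))" by (intro continuous_on_ln) auto
  then show ?thesis by simp
qed

text \<open>Were \<open>\<psi>\<close> bounded by \<open>q\<close>, the exponential Markov
  inequality with large \<open>s\<close> would exclude positive values of \<open>X t\<close>.
  Stationary increments and right-continuity would then make almost all paths decreasing, so that
  \<open>- X\<close> would be a subordinator.\<close>

lemma psi_unbounded: "\<exists>s>0. q < \<psi> s"
proof (rule ccontr)
  assume "\<not> (\<exists>s>0. q < \<psi> s)"
  then have le: "\<psi> s \<le> q" if "0 < s" for s
    using that \<open>\<not> (\<exists>s>0. q < \<psi> s)\<close> by (meson not_le)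
  have small: "prob {\<xi> \<in> space M. 1 / real (Suc n) \<le> X t \<xi>} = 0" if t: "0 \<le> t" for t n
  proof -
    define e where "e = 1 / real (Suc n)"
    have e: "0 < e" by (simp add: e_def)
    have "prob {\<xi> \<in> space M. e \<le> X t \<xi>} \<le> exp (t * q) / exp (s * e)" if s: "0 < s" for s
    proof -
      have "prob {\<xi> \<in> space M. e \<le> X t \<xi>} = prob {\<xi> \<in> space M. exp (s * e) \<le> exp (s * X t \<xi>)}"
        using s by simp
      also have "\<dots> \<le> expectation (\<lambda>\<xi>. exp (s * X t \<xi>)) / exp (s * e)"
        by (rule integral_Markov_inequality_measure[where A="{}"]) (use integrable_exp[of s t] s t in auto)
      also have "\<dots> \<le> exp (t * q) / exp (s * e)"
        using expectation_exp[of s t] le[OF s] s t by (intro divide_right_mono) (auto intro: mult_left_mono)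
      finally show ?thesis .
    qed
    note bound = this
    have "prob {\<xi> \<in> space M. e \<le> X t \<xi>} = 0"
    proof (rule ccontr)
      let ?p = "prob {\<xi> \<in> space M. e \<le> X t \<xi>}"
      assume "?p \<noteq> 0"
      then have p: "0 < ?p" by (simp add: zero_less_measure_iff)
      \<comment> \<open>Chosen so that \<open>?p * (s * e)\<close> equals
        \<open>exp (t * q) + 1\<close>, which exceeds the bound \<open>exp (t * q)\<close>.\<close>
      define s where "s = (exp (t * q) + 1) / (?p * e)"
      have s: "0 < s" using p e by (simp add: s_def add_pos_pos)
      have "s * e \<le> exp (s * e)" using exp_ge_add_one_self[of "s * e"] by linarith
      then have "?p * (s * e) \<le> ?p * exp (s * e)" using p by (intro mult_left_mono) auto
      also have "\<dots> \<le> exp (t * q)" using bound[OF s] by (simp add: field_simps)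
      finally show False using p e by (simp add: s_def)
    qed
    then show ?thesis by (simp add: e_def)
  qed
  have neg: "AE \<xi> in M. X t \<xi> \<le> 0" if t: "0 \<le> t" for t
  proof -
    have "AE \<xi> in M. \<not> 1 / real (Suc n) \<le> X t \<xi>" for n
      using small[OF t, of n] t by (subst (asm) prob_eq_0) auto
    then have "AE \<xi> in M. \<forall>n. \<not> 1 / real (Suc n) \<le> X t \<xi>" by (simp add: AE_all_countable)
    then show ?thesis
    proof eventually_elim
      fix \<xi> assume *: "\<forall>n. \<not> 1 / real (Suc n) \<le> X t \<xi>"
      show "X t \<xi> \<le> 0"
      proof (rule ccontr)
        assume "\<not> X t \<xi> \<le> 0"
        then obtain n where "inverse (real (Suc n)) < X t \<xi>" using reals_Archimedean[of "X t \<xi>"] by auto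
        then show False using spec[OF *, of n] by (simp add: inverse_eq_divide)
      qed
    qed
  qed
  have incr: "AE \<xi> in M. X (s + h) \<xi> \<le> X s \<xi>" if sh: "0 \<le> s" "0 \<le> h" for s h
  proof -
    have "AE \<xi> in M. X h \<xi> - X 0 \<xi> \<le> 0" using neg[OF sh(2)] X_zero by eventually_elim simp
    then have "AE y in distr M borel (\<lambda>\<xi>. X h \<xi> - X 0 \<xi>). y \<le> 0" using sh by (subst AE_distr_iff) auto
    then have "AE y in distr M borel (\<lambda>\<xi>. X (s + h) \<xi> - X s \<xi>). y \<le> 0" by (simp only: stationary[OF sh])
    then have "AE \<xi> in M. X (s + h) \<xi> - X s \<xi> \<le> 0" using sh by (subst (asm) AE_distr_iff) auto
    then show ?thesis by eventually_elim simp
  qed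
  \<comment> \<open>Countably many pairs of times share one null set; right-continuity then passes
    from rational to real times.\<close>
  have "AE \<xi> in M. \<forall>s\<in>\<rat>. \<forall>h\<in>\<rat>. 0 \<le> s \<longrightarrow> 0 \<le> h \<longrightarrow> X (s + h) \<xi> \<le> X s \<xi>"
    using incr by (auto simp: AE_ball_countable countable_rat)
  then have "AE \<xi> in M. mono_on {0..} (\<lambda>t. - X t \<xi>)"
    using AE_space
  proof eventually_elim
    fix \<xi> assume *: "\<forall>s\<in>\<rat>. \<forall>h\<in>\<rat>. 0 \<le> s \<longrightarrow> 0 \<le> h \<longrightarrow> X (s + h) \<xi> \<le> X s \<xi>" and sp: "\<xi> \<in> space M"
    show "mono_on {0..} (\<lambda>t. - X t \<xi>)"
    proof (rule mono_onI)
      fix s t :: real assume st: "s \<in> {0..}" "t \<in> {0..}" "s \<le> t"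
      show "- X s \<xi> \<le> - X t \<xi>"
      proof (rule ccontr)
        assume "\<not> - X s \<xi> \<le> - X t \<xi>"
        then have ne: "X s \<xi> < X t \<xi>" by simp
        then have "s < t" using st by (cases "s = t") auto
        obtain y where y: "X s \<xi> < y" "y < X t \<xi>" using dense[OF ne] by auto
        have rc: "(path \<xi> \<longlongrightarrow> path \<xi> s) (at_right s)" "(path \<xi> \<longlongrightarrow> path \<xi> t) (at_right t)"
          using right_cont_path[OF sp] st by (auto simp: right_cont_def)
        have "eventually (\<lambda>u. path \<xi> u < y) (at_right s)"
          using order_tendstoD(2)[OF rc(1), of y] y st by (simp add: path_apply)
        then obtain a where a: "s < a" "\<And>u. s < u \<Longrightarrow> u < a \<Longrightarrow> path \<xi> u < y"
          unfolding eventually_at_right_field by auto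
        have "eventually (\<lambda>u. y < path \<xi> u) (at_right t)"
          using order_tendstoD(1)[OF rc(2), of y] y st by (simp add: path_apply)
        then obtain b where b: "t < b" "\<And>u. t < u \<Longrightarrow> u < b \<Longrightarrow> y < path \<xi> u"
          unfolding eventually_at_right_field by auto
        obtain u where u: "u \<in> \<rat>" "s < u" "u < min a t"
          using Rats_dense_in_real[of s "min a t"] a \<open>s < t\<close> by auto
        obtain v where v: "v \<in> \<rat>" "t < v" "v < b" using Rats_dense_in_real[OF b(1)] by auto
        have "X (u + (v - u)) \<xi> \<le> X u \<xi>"
          using *[rule_format, OF u(1) Rats_diff[OF v(1) u(1)]] u v st by auto
        moreover have "X u \<xi> < y" "y < X v \<xi>"
          using a(2)[of u] b(2)[of v] u v st by (auto simp: path_apply)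
        ultimately show False by simp
      qed
    qed
  qed
  then have "subordinator M (\<lambda>t \<xi>. - X t \<xi>)"
    using levy_process_minus by (simp add: subordinator_def)
  then show False using spectrally_negative by (simp add: spectrally_negative_levy_def)
qed

lemma right_inverse_nonneg: "0 \<le> right_inverse \<psi> q"
  unfolding right_inverse_def using psi_unbounded[of q] by (intro cInf_greatest) auto

lemma right_inverse_bdd: "bdd_below {s. 0 < s \<and> q < \<psi> s}"
  by (rule bdd_belowI[of _ 0]) auto

text \<open>Some \<open>s < \<theta>\<close> already has \<open>\<psi> s > q\<close>, and by
  \<open>psi_scale_le\<close> the quotient \<open>\<psi> s / s\<close> is at most
  \<open>\<psi> \<theta> / \<theta>\<close>.\<close>

lemma psi_gt:
  assumes "right_inverse \<psi> q < \<theta>" "0 \<le> q"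
  shows "0 < \<theta>" "q < \<psi> \<theta>"
proof -
  show \<theta>: "0 < \<theta>" using assms right_inverse_nonneg[of q] by simp
  obtain s where s: "0 < s" "q < \<psi> s" "s < \<theta>"
    using cInf_lessD[OF _ assms(1)[unfolded right_inverse_def]] psi_unbounded[of q] by auto
  have le: "\<psi> s \<le> s / \<theta> * \<psi> \<theta>" using s by (intro psi_scale_le) auto
  have "0 < s / \<theta> * \<psi> \<theta>" using le s assms by linarith
  then have "0 < \<psi> \<theta>" using s \<theta> zero_less_mult_pos[of "s / \<theta>" "\<psi> \<theta>"] by simp
  then have "s / \<theta> * \<psi> \<theta> \<le> 1 * \<psi> \<theta>" using s \<theta> by (intro mult_right_mono) auto
  then show "q < \<psi> \<theta>" using le s by simp
qed

text \<open>Approach from the right gives \<open>\<ge>\<close> by \<open>psi_gt\<close>, approach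
  from the left gives \<open>\<le>\<close> by minimality. There is room on the left because
  \<open>q > 0\<close> and \<open>\<psi> 0 = 0\<close> make the inverse positive.\<close>

lemma psi_right_inverse:
  assumes q: "0 < q"
  shows "\<psi> (right_inverse \<psi> q) = q"
proof -
  define a where "a = right_inverse \<psi> q"
  have a0: "0 \<le> a" using right_inverse_nonneg by (simp add: a_def)
  have lim: "(\<lambda>n. \<psi> (u n)) \<longlonglongrightarrow> \<psi> a" if "u \<longlonglongrightarrow> a" "\<And>n. 0 \<le> u n" for u :: "nat \<Rightarrow> real"
    using continuous_on_tendsto_compose[OF continuous_on_psi that(1)] a0 that(2) by auto
  have up: "(\<lambda>n. a + 1 / real (Suc n)) \<longlonglongrightarrow> a"
    using LIMSEQ_inverse_real_of_nat_add[of a] by (simp add: inverse_eq_divide)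
  have "q \<le> \<psi> (a + 1 / real (Suc n))" for n
    using psi_gt(2)[of q "a + 1 / real (Suc n)"] q by (simp add: a_def)
  then have ge: "q \<le> \<psi> a"
    using a0 by (intro LIMSEQ_le_const[OF lim[OF up]]) auto
  have "a \<noteq> 0" using ge q psi_zero by auto
  then have ap: "0 < a" using a0 by simp
  have dn: "(\<lambda>n. a * (1 + - inverse (real (Suc n)))) \<longlonglongrightarrow> a"
    by (rule LIMSEQ_inverse_real_of_nat_add_minus_mult)
  have dn0: "0 \<le> a * (1 + - inverse (real (Suc n)))" "a * (1 + - inverse (real (Suc n))) < a" for n
    using ap by (auto simp: field_simps)
  have "\<psi> (a * (1 + - inverse (real (Suc n)))) \<le> q" for n
  proof (rule ccontr)
    let ?u = "a * (1 + - inverse (real (Suc n)))"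
    assume *: "\<not> \<psi> ?u \<le> q"
    \<comment> \<open>For \<open>n = 0\<close> the point is 0, outside the set whose infimum is
      \<open>a\<close>; there \<open>\<psi> 0 = 0 < q\<close> contradicts the assumption.\<close>
    have "?u \<noteq> 0"
    proof
      assume "?u = 0"
      then have "\<psi> ?u = 0" by (simp only: psi_zero)
      then show False using * q by linarith
    qed
    then have "0 < ?u" using dn0(1)[of n] by linarith
    then have "a \<le> ?u"
      unfolding a_def right_inverse_def using * by (intro cInf_lower right_inverse_bdd) (auto simp: a_def right_inverse_def)
    with dn0(2)[of n] show False by simp
  qed
  then have "\<psi> a \<le> q"
    using dn0(1) by (intro LIMSEQ_le_const2[OF lim[OF dn]]) auto
  with ge show ?thesis by (simp add: a_def)
qed

text \<open>Right-continuity of the inverse at 0, for carrying formulas with \<open>q > 0\<close>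
  over to \<open>q = 0\<close>.\<close>

lemma right_inverse_tendsto: "(\<lambda>n. right_inverse \<psi> (1 / real (Suc n))) \<longlonglongrightarrow> right_inverse \<psi> 0"
proof (rule LIMSEQ_I)
  fix e :: real assume e: "0 < e"
  have "right_inverse \<psi> 0 < right_inverse \<psi> 0 + e" using e by simp
  then obtain s where s: "0 < s" "0 < \<psi> s" "s < right_inverse \<psi> 0 + e"
    using cInf_lessD[of "{s. 0 < s \<and> 0 < \<psi> s}"] psi_unbounded[of 0] unfolding right_inverse_def by blast
  obtain N where N: "inverse (real (Suc N)) < \<psi> s" using reals_Archimedean[OF s(2)] by auto
  have "norm (right_inverse \<psi> (1 / real (Suc n)) - right_inverse \<psi> 0) < e" if n: "N \<le> n" for n
  proof -
    have "1 / real (Suc n) \<le> 1 / real (Suc N)" using n by (intro divide_left_mono) auto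
    then have "1 / real (Suc n) < \<psi> s" using N by (simp add: inverse_eq_divide)
    then have 1: "right_inverse \<psi> (1 / real (Suc n)) \<le> s"
      unfolding right_inverse_def using s by (intro cInf_lower right_inverse_bdd) auto
    have "right_inverse \<psi> 0 \<le> right_inverse \<psi> (1 / real (Suc n))"
      unfolding right_inverse_def
    proof (rule cInf_superset_mono)
      show "{s. 0 < s \<and> 1 / real (Suc n) < \<psi> s} \<noteq> {}" using psi_unbounded by auto
      show "{s. 0 < s \<and> 1 / real (Suc n) < \<psi> s} \<subseteq> {s. 0 < s \<and> 0 < \<psi> s}"
        by (auto intro: less_trans[of 0 "1 / real (Suc n)"])
    qed (rule right_inverse_bdd)
    with 1 s show ?thesis unfolding real_norm_def by linarith
  qed
  then show "\<exists>no. \<forall>n\<ge>no. norm (right_inverse \<psi> (1 / real (Suc n)) - right_inverse \<psi> 0) < e" by blast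
qed

end

section \<open>Optional stopping at the first passage\<close>

lemma has_bochner_integral_exp_Icc:
  fixes r :: real assumes "a \<le> b"
  shows "(LBINT s:{a..b}. r * exp (r * (s - a))) = exp (r * (b - a)) - 1"
proof -
  have "has_bochner_integral lborel (\<lambda>s. indicator {a..b} s *\<^sub>R (r * exp (r * (s - a)))) (exp (r * (b - a)) - exp (r * (a - a)))"
    by (rule has_bochner_integral_FTC_Icc[OF assms])
       (auto intro!: derivative_eq_intros continuous_intros simp: has_real_derivative_iff_has_vector_derivative[symmetric])
  then show ?thesis unfolding set_lebesgue_integral_def by (simp add: has_bochner_integral_integral_eq)
qed

lemma set_integral_Ico_Icc:
  fixes f :: "real \<Rightarrow> real"
  assumes [measurable]: "f \<in> borel_measurable borel"
  shows "(LBINT r:{s..<t}. f r) = (LBINT r:{s..t}. f r)"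
  unfolding set_lebesgue_integral_def
proof (rule integral_cong_AE)
  have "AE r in lborel. r \<noteq> t" by (rule AE_lborel_singleton)
  then show "AE r in lborel. indicator {s..<t} r *\<^sub>R f r = indicator {s..t} r *\<^sub>R f r"
    by eventually_elim (auto split: split_indicator)
qed measurable

context spectrally_negative begin

text \<open>
  The process is observed at the times \<open>k * \<delta>\<close> only: \<open>grid_alive c x \<delta> k\<close> says that no passage has
  been seen up to step \<open>k\<close>, and \<open>grid_stopped\<close> is the exponential stopped at the first passage seen.
\<close>

definition grid_alive :: "real \<Rightarrow> real \<Rightarrow> real \<Rightarrow> nat \<Rightarrow> 'a \<Rightarrow> bool" where
  "grid_alive c x \<delta> k \<xi> \<longleftrightarrow> (\<forall>j\<in>{1..k}. x + X (real j * \<delta>) \<xi> \<le> c)"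

definition disc_exp :: "real \<Rightarrow> real \<Rightarrow> real \<Rightarrow> 'a \<Rightarrow> real" where
  "disc_exp \<theta> q s \<xi> = exp (\<theta> * X s \<xi> - q * s)"

primrec grid_stopped :: "real \<Rightarrow> real \<Rightarrow> real \<Rightarrow> real \<Rightarrow> real \<Rightarrow> nat \<Rightarrow> 'a \<Rightarrow> real" where
  "grid_stopped \<theta> q c x \<delta> 0 \<xi> = disc_exp \<theta> q 0 \<xi>"
| "grid_stopped \<theta> q c x \<delta> (Suc k) \<xi> =
     (if grid_alive c x \<delta> k \<xi> then disc_exp \<theta> q (real (Suc k) * \<delta>) \<xi> else grid_stopped \<theta> q c x \<delta> k \<xi>)"

lemma disc_exp_pos: "0 < disc_exp \<theta> q s \<xi>"
  by (simp add: disc_exp_def)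

lemma disc_exp_measurable[measurable]: "0 \<le> s \<Longrightarrow> disc_exp \<theta> q s \<in> borel_measurable M"
  unfolding disc_exp_def by measurable

lemma disc_exp_integral:
  assumes "0 \<le> \<theta>" "0 \<le> s"
  shows "integrable M (disc_exp \<theta> q s)" "expectation (disc_exp \<theta> q s) = exp ((\<psi> \<theta> - q) * s)"
proof -
  have *: "disc_exp \<theta> q s = (\<lambda>\<xi>. exp (- q * s) * exp (\<theta> * X s \<xi>))"
    by (simp add: disc_exp_def fun_eq_iff flip: exp_add)
  show "integrable M (disc_exp \<theta> q s)" unfolding * using integrable_exp[OF assms] by simp
  show "expectation (disc_exp \<theta> q s) = exp ((\<psi> \<theta> - q) * s)"
  proof -
    have "expectation (disc_exp \<theta> q s) = exp (- q * s) * exp (s * \<psi> \<theta>)"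
      unfolding * using expectation_exp[OF assms] by simp
    also have "\<dots> = exp ((\<psi> \<theta> - q) * s)" by (simp add: algebra_simps flip: exp_add)
    finally show ?thesis .
  qed
qed

lemma grid_alive_measurable[measurable]:
  assumes "0 \<le> \<delta>"
  shows "Measurable.pred M (grid_alive c x \<delta> k)"
proof -
  have "(\<lambda>\<xi>. X (real j * \<delta>) \<xi>) \<in> borel_measurable M" for j using assms by simp
  then show ?thesis unfolding grid_alive_def by measurable
qed

lemma grid_stopped_measurable[measurable]:
  "0 \<le> \<delta> \<Longrightarrow> grid_stopped \<theta> q c x \<delta> k \<in> borel_measurable M"
proof (induction k)
  case 0
  have "grid_stopped \<theta> q c x \<delta> 0 = disc_exp \<theta> q 0" by (simp add: fun_eq_iff)
  then show ?case by simp
next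
  case (Suc k)
  note [measurable] = Suc.IH[OF Suc.prems] grid_alive_measurable[OF Suc.prems]
  have [measurable]: "disc_exp \<theta> q (real (Suc k) * \<delta>) \<in> borel_measurable M" using Suc.prems by simp
  show ?case unfolding grid_stopped.simps by measurable
qed

lemma grid_stopped_pos: "0 < grid_stopped \<theta> q c x \<delta> k \<xi>"
  by (induction k) (auto simp: disc_exp_pos)

lemma grid_stopped_alive:
  "grid_alive c x \<delta> k \<xi> \<Longrightarrow> grid_stopped \<theta> q c x \<delta> k \<xi> = disc_exp \<theta> q (real k * \<delta>) \<xi>"
  by (cases k) (auto simp: grid_alive_def)

text \<open>\<open>j\<close> is the step at which observation ends: the horizon \<open>k\<close> or
  the first step above \<open>c\<close>. Step 0 is not tested, in agreement with a passage over
  positive times.\<close>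

lemma grid_stopped_cases:
  "\<exists>j\<le>k. grid_stopped \<theta> q c x \<delta> k \<xi> = disc_exp \<theta> q (real j * \<delta>) \<xi> \<and>
     (j = k \<or> 1 \<le> j \<and> c < x + X (real j * \<delta>) \<xi>) \<and> (\<forall>i. 1 \<le> i \<and> i < j \<longrightarrow> x + X (real i * \<delta>) \<xi> \<le> c)"
proof (induction k)
  case (Suc k)
  then obtain j where j: "j \<le> k" "grid_stopped \<theta> q c x \<delta> k \<xi> = disc_exp \<theta> q (real j * \<delta>) \<xi>"
    "j = k \<or> 1 \<le> j \<and> c < x + X (real j * \<delta>) \<xi>" "\<forall>i. 1 \<le> i \<and> i < j \<longrightarrow> x + X (real i * \<delta>) \<xi> \<le> c"
    by blast
  show ?case
  proof (cases "grid_alive c x \<delta> k \<xi>")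
    case True
    then show ?thesis by (intro exI[of _ "Suc k"]) (auto simp: grid_alive_def)
  next
    case False
    have "1 \<le> j \<and> c < x + X (real j * \<delta>) \<xi>"
    proof (cases "j = k")
      case True
      obtain i where "1 \<le> i" "i \<le> k" "c < x + X (real i * \<delta>) \<xi>"
        using False by (auto simp: grid_alive_def not_le)
      moreover have "i = k" using calculation j(4) True by (metis le_neq_implies_less not_le)
      ultimately show ?thesis using True by simp
    qed (use j in auto)
    then show ?thesis using False j by (intro exI[of _ j]) auto
  qed
qed simp

lemma indep_future_grid_alive:
  assumes d: "0 < \<delta>" and B: "B \<in> sets borel"
  shows "indep_future (real k * \<delta>) {\<xi> \<in> space M. grid_alive c x \<delta> k \<xi> \<and> X (real k * \<delta>) \<xi> \<in> B}"
proof -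
  let ?t = "real k * \<delta>"
  define J where "J = (\<lambda>j. real j * \<delta>) ` {1..k} \<union> {?t}"
  \<comment> \<open>At \<open>?t\<close> both conditions may meet. For \<open>k = 0\<close> only
    \<open>B\<close> is left, since time 0 is not observed.\<close>
  define A where "A u = (if u = ?t then B else UNIV) \<inter> (if 0 < u then {..c - x} else UNIV)" for u
  have "indep_future ?t {\<xi> \<in> space M. \<forall>u\<in>J. X u \<xi> \<in> A u}"
    by (rule indep_future_cylinder) (use d B in \<open>auto simp: J_def A_def\<close>)
  moreover have "{\<xi> \<in> space M. \<forall>u\<in>J. X u \<xi> \<in> A u} = {\<xi> \<in> space M. grid_alive c x \<delta> k \<xi> \<and> X ?t \<xi> \<in> B}"
  proof -
    have "X ?t \<xi> \<le> c - x" if "grid_alive c x \<delta> k \<xi>" "0 < ?t" for \<xi>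
      using that d unfolding grid_alive_def by (auto simp: zero_less_mult_iff dest!: bspec[of _ _ k])
    then show ?thesis using d by (auto simp: J_def A_def grid_alive_def split: if_splits)
  qed
  ultimately show ?thesis by simp
qed

text \<open>The event is decided by time \<open>k * \<delta>\<close>, so the Markov property
  replaces the exponential of the later increment by its mean. The time \<open>s\<close> is not
  confined to the grid, because \<open>grid_mean\<close> interpolates between grid points.\<close>

lemma expectation_grid_alive:
  assumes \<theta>: "0 \<le> \<theta>" and d: "0 < \<delta>" and s: "real k * \<delta> \<le> s"
  shows "integrable M (\<lambda>\<xi>. indicator {\<xi>. grid_alive c x \<delta> k \<xi>} \<xi> * disc_exp \<theta> q s \<xi>)"
    and "expectation (\<lambda>\<xi>. indicator {\<xi>. grid_alive c x \<delta> k \<xi>} \<xi> * disc_exp \<theta> q s \<xi>)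
     = exp ((\<psi> \<theta> - q) * (s - real k * \<delta>)) *
       expectation (\<lambda>\<xi>. indicator {\<xi>. grid_alive c x \<delta> k \<xi>} \<xi> * disc_exp \<theta> q (real k * \<delta>) \<xi>)"
proof -
  let ?t = "real k * \<delta>" and ?I = "indicator {\<xi>. grid_alive c x \<delta> k \<xi>} :: 'a \<Rightarrow> real"
  have t0: "0 \<le> ?t" using d by simp
  note [measurable] = grid_alive_measurable[OF less_imp_le[OF d], of c x k]
  have int: "integrable M (\<lambda>\<xi>. ?I \<xi> * disc_exp \<theta> q s \<xi>)" if "0 \<le> s" for s
  proof (rule Bochner_Integration.integrable_bound[OF disc_exp_integral(1)[OF \<theta> that, of q]])
    show "(\<lambda>\<xi>. ?I \<xi> * disc_exp \<theta> q s \<xi>) \<in> borel_measurable M" using that by measurable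
  qed (auto split: split_indicator)
  show "integrable M (\<lambda>\<xi>. ?I \<xi> * disc_exp \<theta> q s \<xi>)" using int[of s] t0 s by simp
  define F where "F y p = ennreal (exp (\<theta> * y - q * s)) * ennreal (exp (\<theta> * p (s - ?t)))" for y and p :: "real \<Rightarrow> real"
  have [measurable]: "(\<lambda>p. p (s - ?t)) \<in> borel_measurable path_space" using s by (intro measurable_coordinate) simp
  have Fm: "(\<lambda>(y, p). F y p) \<in> borel_measurable (borel \<Otimes>\<^sub>M path_space)" unfolding F_def by measurable
  have "ennreal (expectation (\<lambda>\<xi>. ?I \<xi> * disc_exp \<theta> q s \<xi>)) = (\<integral>\<^sup>+\<xi>. ennreal (?I \<xi> * disc_exp \<theta> q s \<xi>) \<partial>M)"
    using int[of s] t0 s by (intro nn_integral_eq_integral[symmetric]) (auto simp: disc_exp_def)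
  also have "\<dots> = (\<integral>\<^sup>+\<xi>\<in>{\<xi>. grid_alive c x \<delta> k \<xi>}. F (X ?t \<xi>) (path_shift ?t (path \<xi>)) \<partial>M)"
  proof (rule nn_integral_cong)
    fix \<xi>
    have "path_shift ?t (path \<xi>) (s - ?t) = X s \<xi> - X ?t \<xi>" using s t0 by (simp add: path_shift_apply path_apply)
    then have "F (X ?t \<xi>) (path_shift ?t (path \<xi>)) = ennreal (exp (\<theta> * X ?t \<xi> - q * s)) * ennreal (exp (\<theta> * (X s \<xi> - X ?t \<xi>)))"
      by (simp only: F_def)
    also have "\<dots> = ennreal (disc_exp \<theta> q s \<xi>)"
      by (simp add: disc_exp_def algebra_simps flip: ennreal_mult exp_add)
    finally have "F (X ?t \<xi>) (path_shift ?t (path \<xi>)) = ennreal (disc_exp \<theta> q s \<xi>)" .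
    then show "ennreal (?I \<xi> * disc_exp \<theta> q s \<xi>) = F (X ?t \<xi>) (path_shift ?t (path \<xi>)) * indicator {\<xi>. grid_alive c x \<delta> k \<xi>} \<xi>"
      by (auto split: split_indicator)
  qed
  also have "\<dots> = (\<integral>\<^sup>+\<xi>\<in>{\<xi>. grid_alive c x \<delta> k \<xi>}. (\<integral>\<^sup>+\<xi>'. F (X ?t \<xi>) (path \<xi>') \<partial>M) \<partial>M)"
    by (rule markov[OF t0 indep_future_grid_alive[OF d] Fm])
  also have "\<dots> = (\<integral>\<^sup>+\<xi>. ennreal (exp ((\<psi> \<theta> - q) * (s - ?t))) * ennreal (?I \<xi> * disc_exp \<theta> q ?t \<xi>) \<partial>M)"
  proof (rule nn_integral_cong)
    fix \<xi>
    have "(\<integral>\<^sup>+\<xi>'. F (X ?t \<xi>) (path \<xi>') \<partial>M) = ennreal (exp (\<theta> * X ?t \<xi> - q * s)) * ennreal (exp ((s - ?t) * \<psi> \<theta>))"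
      unfolding F_def using s \<theta> nn_integral_exp[of \<theta> "s - ?t"] by (subst nn_integral_cmult) (simp_all add: path_apply)
    also have "\<dots> = ennreal (exp ((\<psi> \<theta> - q) * (s - ?t))) * ennreal (disc_exp \<theta> q ?t \<xi>)"
      by (simp add: disc_exp_def algebra_simps flip: ennreal_mult exp_add)
    finally show "(\<integral>\<^sup>+\<xi>'. F (X ?t \<xi>) (path \<xi>') \<partial>M) * indicator {\<xi>. grid_alive c x \<delta> k \<xi>} \<xi>
       = ennreal (exp ((\<psi> \<theta> - q) * (s - ?t))) * ennreal (?I \<xi> * disc_exp \<theta> q ?t \<xi>)"
      by (auto split: split_indicator)
  qed
  also have "\<dots> = ennreal (exp ((\<psi> \<theta> - q) * (s - ?t))) * (\<integral>\<^sup>+\<xi>. ennreal (?I \<xi> * disc_exp \<theta> q ?t \<xi>) \<partial>M)"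
    using t0 by (intro nn_integral_cmult) measurable
  also have "(\<integral>\<^sup>+\<xi>. ennreal (?I \<xi> * disc_exp \<theta> q ?t \<xi>) \<partial>M) = ennreal (expectation (\<lambda>\<xi>. ?I \<xi> * disc_exp \<theta> q ?t \<xi>))"
    using int[OF t0] by (intro nn_integral_eq_integral) (auto simp: disc_exp_def)
  finally have eq: "ennreal (expectation (\<lambda>\<xi>. ?I \<xi> * disc_exp \<theta> q s \<xi>))
    = ennreal (exp ((\<psi> \<theta> - q) * (s - ?t)) * expectation (\<lambda>\<xi>. ?I \<xi> * disc_exp \<theta> q ?t \<xi>))"
    by (simp add: ennreal_mult')
  have pos: "0 \<le> expectation (\<lambda>\<xi>. ?I \<xi> * disc_exp \<theta> q u \<xi>)" for u
    by (intro integral_nonneg_AE AE_I2) (simp add: disc_exp_def)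
  show "expectation (\<lambda>\<xi>. ?I \<xi> * disc_exp \<theta> q s \<xi>) = exp ((\<psi> \<theta> - q) * (s - ?t)) * expectation (\<lambda>\<xi>. ?I \<xi> * disc_exp \<theta> q ?t \<xi>)"
    using eq pos by (simp add: mult_nonneg_nonneg)
qed

text \<open>Between grid times the event stays frozen at the last one, while the exponential runs
  on; this turns the sum over grid steps into an integral. \<open>reg\<close> provides measurability
  in \<open>s\<close>.\<close>

definition grid_mean :: "real \<Rightarrow> real \<Rightarrow> real \<Rightarrow> real \<Rightarrow> real \<Rightarrow> real \<Rightarrow> real" where
  "grid_mean \<theta> q c x \<delta> s = expectation (\<lambda>\<xi>. indicator {\<xi>. grid_alive c x \<delta> (nat \<lfloor>s / \<delta>\<rfloor>) \<xi>} \<xi> * exp (\<theta> * reg (path \<xi>) s - q * s))"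

text \<open>The index of the last grid time takes countably many values, so joint measurability
  reduces to that of each event.\<close>

lemma grid_alive_floor_measurable:
  assumes d: "0 < \<delta>"
  shows "Measurable.pred (borel \<Otimes>\<^sub>M M) (\<lambda>(s, \<xi>). grid_alive c x \<delta> (nat \<lfloor>s / \<delta>\<rfloor>) \<xi>)"
proof -
  note [measurable] = grid_alive_measurable[OF less_imp_le[OF d]]
  have "(\<lambda>z. grid_alive c x \<delta> (nat \<lfloor>fst z / \<delta>\<rfloor>) (snd z)) \<in> measurable (borel \<Otimes>\<^sub>M M) (count_space UNIV)"
    by (rule measurable_compose_countable[of "\<lambda>k z. grid_alive c x \<delta> k (snd z)" _ _ "\<lambda>z. nat \<lfloor>fst z / \<delta>\<rfloor>"]) measurable
  then show ?thesis by (simp add: case_prod_beta')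
qed

lemma grid_mean_measurable[measurable]:
  assumes d: "0 < \<delta>"
  shows "grid_mean \<theta> q c x \<delta> \<in> borel_measurable borel"
proof -
  note [measurable] = grid_alive_floor_measurable[OF d, of c x]
  have "(\<lambda>s. expectation (\<lambda>\<xi>. if grid_alive c x \<delta> (nat \<lfloor>s / \<delta>\<rfloor>) \<xi> then exp (\<theta> * reg (path \<xi>) s - q * s) else 0)) \<in> borel_measurable borel"
    by measurable
  moreover have "grid_mean \<theta> q c x \<delta> s = expectation (\<lambda>\<xi>. if grid_alive c x \<delta> (nat \<lfloor>s / \<delta>\<rfloor>) \<xi> then exp (\<theta> * reg (path \<xi>) s - q * s) else 0)" for s
    unfolding grid_mean_def by (intro Bochner_Integration.integral_cong) auto
  ultimately show ?thesis by (simp add: fun_eq_iff[symmetric] cong: measurable_cong)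
qed

lemma grid_mean_eq:
  assumes d: "0 < \<delta>" and s: "real k * \<delta> \<le> s" "s < real (Suc k) * \<delta>"
  shows "grid_mean \<theta> q c x \<delta> s = expectation (\<lambda>\<xi>. indicator {\<xi>. grid_alive c x \<delta> k \<xi>} \<xi> * disc_exp \<theta> q s \<xi>)"
proof -
  have "\<lfloor>s / \<delta>\<rfloor> = int k" using s d by (intro floor_unique) (auto simp: field_simps)
  moreover have "0 \<le> s" using s(1) d by (meson mult_nonneg_nonneg of_nat_0_le_iff less_imp_le order_trans)
  ultimately show ?thesis
    unfolding grid_mean_def by (intro Bochner_Integration.integral_cong) (auto simp: reg_path disc_exp_def)
qed

lemma grid_mean_bounds:
  assumes \<theta>: "0 \<le> \<theta>" and d: "0 < \<delta>" and s: "0 \<le> s"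
  shows "0 \<le> grid_mean \<theta> q c x \<delta> s" "grid_mean \<theta> q c x \<delta> s \<le> exp ((\<psi> \<theta> - q) * s)"
proof -
  show "0 \<le> grid_mean \<theta> q c x \<delta> s" unfolding grid_mean_def by (intro integral_nonneg_AE AE_I2) simp
  note [measurable] = grid_alive_measurable[OF less_imp_le[OF d], of c x]
  have "grid_mean \<theta> q c x \<delta> s \<le> expectation (disc_exp \<theta> q s)"
    unfolding grid_mean_def
  proof (rule integral_mono)
    let ?f = "\<lambda>\<xi>. indicator {\<xi>. grid_alive c x \<delta> (nat \<lfloor>s / \<delta>\<rfloor>) \<xi>} \<xi> * exp (\<theta> * reg (path \<xi>) s - q * s)"
    show "integrable M ?f"
      by (rule Bochner_Integration.integrable_bound[OF disc_exp_integral(1)[OF \<theta> s, of q]])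
         (use s in \<open>measurable, auto simp: disc_exp_def reg_path split: split_indicator\<close>)
    show "integrable M (disc_exp \<theta> q s)" using disc_exp_integral[OF \<theta> s] by simp
    show "?f \<xi> \<le> disc_exp \<theta> q s \<xi>" if "\<xi> \<in> space M" for \<xi>
      using that s by (auto simp: disc_exp_def reg_path split: split_indicator)
  qed
  then show "grid_mean \<theta> q c x \<delta> s \<le> exp ((\<psi> \<theta> - q) * s)" using disc_exp_integral(2)[OF \<theta> s] by simp
qed

text \<open>Dynkin's formula on the grid is exact: with \<open>r = \<psi> \<theta> - q\<close> and
  \<open>v\<close> the mean over surviving paths at the start of a cell, the stopped exponential
  gains \<open>v * (exp (r * \<delta>) - 1)\<close>, which is \<open>r\<close> times the integral of
  \<open>grid_mean\<close> over the cell.\<close>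

lemma expectation_grid_stopped:
  assumes \<theta>: "0 \<le> \<theta>" and d: "0 < \<delta>"
  shows "integrable M (grid_stopped \<theta> q c x \<delta> k) \<and>
    expectation (grid_stopped \<theta> q c x \<delta> k) = 1 + (\<psi> \<theta> - q) * (LBINT s:{0..<real k * \<delta>}. grid_mean \<theta> q c x \<delta> s)"
proof (induction k)
  case 0
  have "expectation (disc_exp \<theta> q 0) = 1" using disc_exp_integral(2)[OF \<theta>, of 0 q] by simp
  then show ?case using disc_exp_integral(1)[OF \<theta>, of 0 q] by (simp add: set_lebesgue_integral_def fun_eq_iff[symmetric] cong: integral_cong)
next
  case (Suc k)
  let ?r = "\<psi> \<theta> - q" and ?a = "real k * \<delta>" and ?b = "real (Suc k) * \<delta>"
  let ?I = "indicator {\<xi>. grid_alive c x \<delta> k \<xi>} :: 'a \<Rightarrow> real"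
  have ab: "0 \<le> ?a" "?a \<le> ?b" using d by auto
  note i1 = expectation_grid_alive(1)[OF \<theta> d ab(2), where c=c and x=x and q=q]
  note i0 = expectation_grid_alive(1)[OF \<theta> d order_refl[of "real k * \<delta>"], where c=c and x=x and q=q]
  define v where "v = expectation (\<lambda>\<xi>. ?I \<xi> * disc_exp \<theta> q ?a \<xi>)"
  \<comment> \<open>The stopped exponential moves only while no passage has been seen, and then its
    old value is \<open>disc_exp\<close> at \<open>?a\<close>.\<close>
  have st: "grid_stopped \<theta> q c x \<delta> (Suc k) = (\<lambda>\<xi>. grid_stopped \<theta> q c x \<delta> k \<xi> + (?I \<xi> * disc_exp \<theta> q ?b \<xi> - ?I \<xi> * disc_exp \<theta> q ?a \<xi>))"
    by (auto simp: fun_eq_iff grid_stopped_alive simp del: of_nat_Suc split: split_indicator)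
  have gi: "set_integrable lborel {u..<w} (grid_mean \<theta> q c x \<delta>)" if "0 \<le> u" for u w
  proof (rule set_integrable_bounded)
    show "\<bar>grid_mean \<theta> q c x \<delta> s\<bar> \<le> exp (\<bar>?r\<bar> * w)" if "s \<in> {u..<w}" for s
    proof -
      have s: "0 \<le> s" "s \<le> w" using that \<open>0 \<le> u\<close> by auto
      have "?r * s \<le> \<bar>?r\<bar> * s" using s by (intro mult_right_mono) auto
      also have "\<dots> \<le> \<bar>?r\<bar> * w" using s by (intro mult_left_mono) auto
      finally have "exp (?r * s) \<le> exp (\<bar>?r\<bar> * w)" by simp
      then show ?thesis using grid_mean_bounds[OF \<theta> d s(1), of q c x] by linarith
    qed
  qed (use d in auto)
  have "(LBINT s:{?a..<?b}. ?r * grid_mean \<theta> q c x \<delta> s) = (LBINT s:{?a..<?b}. v * (?r * exp (?r * (s - ?a))))"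
  proof (intro set_lebesgue_integral_cong ballI allI impI)
    fix s assume s: "s \<in> {?a..<?b}"
    then show "?r * grid_mean \<theta> q c x \<delta> s = v * (?r * exp (?r * (s - ?a)))"
      using expectation_grid_alive(2)[OF \<theta> d, where k=k and s=s and c=c and x=x and q=q] grid_mean_eq[OF d, of k s \<theta> q c x] by (simp add: v_def)
  qed simp
  also have "\<dots> = v * (exp (?r * (?b - ?a)) - 1)"
    using has_bochner_integral_exp_Icc[OF ab(2), of ?r] by (simp add: set_integral_Ico_Icc del: of_nat_Suc)
  also have "\<dots> = expectation (\<lambda>\<xi>. ?I \<xi> * disc_exp \<theta> q ?b \<xi>) - v"
    using expectation_grid_alive(2)[OF \<theta> d ab(2), where c=c and x=x and q=q] by (simp add: v_def algebra_simps)
  finally have step: "?r * (LBINT s:{?a..<?b}. grid_mean \<theta> q c x \<delta> s) = expectation (\<lambda>\<xi>. ?I \<xi> * disc_exp \<theta> q ?b \<xi>) - v"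
    by simp
  have un: "{0..<?b} = {0..<?a} \<union> {?a..<?b}" using ab by auto
  have "(LBINT s:{0..<?b}. grid_mean \<theta> q c x \<delta> s) = (LBINT s:{0..<?a}. grid_mean \<theta> q c x \<delta> s) + (LBINT s:{?a..<?b}. grid_mean \<theta> q c x \<delta> s)"
    unfolding un by (rule set_integral_Un) (use gi[of 0] gi[OF ab(1)] in auto)
  then have "1 + ?r * (LBINT s:{0..<?b}. grid_mean \<theta> q c x \<delta> s)
     = (1 + ?r * (LBINT s:{0..<?a}. grid_mean \<theta> q c x \<delta> s)) + ?r * (LBINT s:{?a..<?b}. grid_mean \<theta> q c x \<delta> s)"
    by (simp add: distrib_left)
  then show ?case
    unfolding st using Suc.IH i0 i1 step by (simp add: v_def del: of_nat_Suc)
qed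

end

section \<open>The passage as seen on ever finer grids\<close>

lemma passage_le:
  assumes "right_cont p" "0 < u" "c < x + p u"
  shows "passage c x p \<le> ereal u"
  unfolding passage_eq_Inf[OF assms(1)] using assms(2,3) by (intro Inf_lower) auto

text \<open>The path exceeds \<open>c\<close> at some \<open>r < w\<close> and, by right-continuity,
  on an interval \<open>[r, r + e)\<close>; every grid with mesh below \<open>e\<close> has a point
  in it, and mesh below \<open>w - r\<close> keeps that point before \<open>w\<close>.\<close>

lemma passage_grid_hit:
  assumes p: "right_cont p" and w: "passage c x p < ereal w"
  obtains d where "0 < d" "\<And>\<delta>. 0 < \<delta> \<Longrightarrow> \<delta> < d \<Longrightarrow> \<exists>i\<ge>1. real i * \<delta> < w \<and> c < x + p (real i * \<delta>)"
proof -
  obtain r where r: "0 < r" "r < w" "c < x + p r"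
    using w le_passage[OF p, of w c x] by (meson not_le)
  obtain e where e: "0 < e" "\<And>u. r \<le> u \<Longrightarrow> u < r + e \<Longrightarrow> c - x < p u"
    using right_cont_gtD[OF p, of r "c - x"] r by auto
  show ?thesis
  proof (rule that[of "min e (w - r)"])
    show "0 < min e (w - r)" using e r by simp
    fix \<delta> :: real assume \<delta>: "0 < \<delta>" "\<delta> < min e (w - r)"
    \<comment> \<open>The first grid point not before \<open>r\<close>.\<close>
    define i where "i = nat \<lceil>r / \<delta>\<rceil>"
    have pos: "0 < r / \<delta>" using r \<delta> by simp
    have ri: "real i = real_of_int \<lceil>r / \<delta>\<rceil>" using pos by (simp add: i_def)
    have "r / \<delta> \<le> real i" "real i < r / \<delta> + 1" unfolding ri by linarith+
    then have i: "r \<le> real i * \<delta>" "real i * \<delta> < r + \<delta>" using \<delta> by (auto simp: field_simps)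
    have "1 \<le> i" using pos unfolding i_def by linarith
    moreover have "real i * \<delta> < w" using i \<delta> by simp
    moreover have "c < x + p (real i * \<delta>)" using e(2)[OF i(1)] i(2) \<delta> by simp
    ultimately show "\<exists>i\<ge>1. real i * \<delta> < w \<and> c < x + p (real i * \<delta>)" by blast
  qed
qed

lemma eventually_small_step: "0 < d \<Longrightarrow> eventually (\<lambda>n. t / real (Suc n) < d) sequentially"
proof -
  assume "0 < d"
  have "(\<lambda>n. t * inverse (real (Suc n))) \<longlonglongrightarrow> t * 0" by (intro tendsto_mult_left LIMSEQ_inverse_real_of_nat)
  then have "eventually (\<lambda>n. t * inverse (real (Suc n)) < d) sequentially" using \<open>0 < d\<close> by (intro order_tendstoD(2)) auto
  then show ?thesis by (simp add: divide_inverse)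
qed

context levy begin

text \<open>A path has a single passage time, which is a Lebesgue null set of \<open>s\<close>, and
  Fubini turns this around. It permits exchanging \<open><\<close> and \<open>\<le>\<close> between
  \<open>s\<close> and the passage time under time integrals.\<close>

lemma AE_passage_neq: "AE s in lborel. AE \<xi> in M. passage c x (path \<xi>) \<noteq> ereal s"
proof -
  interpret lM: pair_sigma_finite lborel M ..
  have [measurable]: "(\<lambda>(s, \<xi>). if passage c x (path \<xi>) = ereal s then 1 else 0 :: ennreal) \<in> borel_measurable (lborel \<Otimes>\<^sub>M M)"
    by measurable
  have "(\<integral>\<^sup>+s. (\<integral>\<^sup>+\<xi>. (if passage c x (path \<xi>) = ereal s then 1 else 0) \<partial>M) \<partial>lborel)
     = (\<integral>\<^sup>+\<xi>. (\<integral>\<^sup>+s. (if passage c x (path \<xi>) = ereal s then 1 else 0) \<partial>lborel) \<partial>M)"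
    by (rule lM.Fubini'[symmetric]) measurable
  also have "\<dots> = (\<integral>\<^sup>+\<xi>. 0 \<partial>M)"
  proof (rule nn_integral_cong)
    fix \<xi>
    have "AE s in lborel. s \<noteq> real_of_ereal (passage c x (path \<xi>))" by (rule AE_lborel_singleton)
    then have "AE s in lborel. (if passage c x (path \<xi>) = ereal s then 1 else 0) = (0::ennreal)"
      by eventually_elim auto
    then show "(\<integral>\<^sup>+s. (if passage c x (path \<xi>) = ereal s then 1 else 0) \<partial>lborel) = (0::ennreal)"
      by (subst nn_integral_0_iff_AE) auto
  qed
  finally have "(\<integral>\<^sup>+s. (\<integral>\<^sup>+\<xi>. (if passage c x (path \<xi>) = ereal s then 1 else 0) \<partial>M) \<partial>lborel) = (0::ennreal)"
    by simp
  then have "AE s in lborel. (\<integral>\<^sup>+\<xi>. (if passage c x (path \<xi>) = ereal s then 1 else 0) \<partial>M) = (0::ennreal)"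
    by (subst (asm) nn_integral_0_iff_AE) auto
  then show ?thesis
  proof eventually_elim
    fix s :: real assume "(\<integral>\<^sup>+\<xi>. (if passage c x (path \<xi>) = ereal s then 1 else 0) \<partial>M) = (0::ennreal)"
    then have "AE \<xi> in M. (if passage c x (path \<xi>) = ereal s then 1 else 0) = (0::ennreal)"
      by (subst (asm) nn_integral_0_iff_AE) auto
    then show "AE \<xi> in M. passage c x (path \<xi>) \<noteq> ereal s" by eventually_elim (auto split: if_splits)
  qed
qed

end

context spectrally_negative begin

definition alive_mean :: "real \<Rightarrow> real \<Rightarrow> real \<Rightarrow> real \<Rightarrow> real \<Rightarrow> real" where
  "alive_mean \<theta> q c x s = expectation (\<lambda>\<xi>. if ereal s \<le> passage c x (path \<xi>) then exp (\<theta> * reg (path \<xi>) s - q * s) else 0)"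

lemma alive_mean_measurable[measurable]: "alive_mean \<theta> q c x \<in> borel_measurable borel"
proof -
  have "(\<lambda>s. expectation (\<lambda>\<xi>. if ereal s \<le> passage c x (path \<xi>) then exp (\<theta> * reg (path \<xi>) s - q * s) else 0)) \<in> borel_measurable borel"
    by measurable
  then show ?thesis by (simp add: alive_mean_def[abs_def])
qed

lemma integrable_alive:
  assumes "0 \<le> \<theta>" "0 \<le> s"
  shows "integrable M (\<lambda>\<xi>. if ereal s \<le> passage c x (path \<xi>) then exp (\<theta> * reg (path \<xi>) s - q * s) else 0)"
proof (rule Bochner_Integration.integrable_bound[OF disc_exp_integral(1)[OF assms, of q]])
  show "AE \<xi> in M. norm (if ereal s \<le> passage c x (path \<xi>) then exp (\<theta> * reg (path \<xi>) s - q * s) else 0) \<le> norm (disc_exp \<theta> q s \<xi>)"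
    using assms(2) by (intro AE_I2) (auto simp: disc_exp_def reg_path)
qed measurable

lemma alive_mean_nonneg: "0 \<le> alive_mean \<theta> q c x s"
  unfolding alive_mean_def by (intro integral_nonneg_AE AE_I2) simp

text \<open>The time at which the grid stops is never before the passage (capped at
  \<open>t\<close>) and converges to it, so right-continuity of the path suffices.\<close>

lemma grid_stopped_tendsto:
  assumes xi: "\<xi> \<in> space M" and t: "0 < t"
  shows "(\<lambda>n. grid_stopped \<theta> q c x (t / real (Suc n)) (Suc n) \<xi>) \<longlonglongrightarrow>
    disc_exp \<theta> q (real_of_ereal (min (passage c x (path \<xi>)) (ereal t))) \<xi>"
proof -
  define T where "T = passage c x (path \<xi>)"
  define m where "m = real_of_ereal (min T (ereal t))"
  have p: "right_cont (path \<xi>)" by (rule right_cont_path[OF xi])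
  have T0: "0 \<le> T" by (simp add: T_def passage_nonneg)
  have mm: "ereal m = min T (ereal t)" using T0 t by (cases T) (auto simp: m_def min_def)
  have m0: "0 \<le> m" using T0 t mm by (metis ereal_less_eq(5) less_imp_le min.bounded_iff)
  have "\<exists>j. \<forall>n. j n \<le> Suc n \<and> grid_stopped \<theta> q c x (t / real (Suc n)) (Suc n) \<xi> = disc_exp \<theta> q (real (j n) * (t / real (Suc n))) \<xi> \<and>
     (j n = Suc n \<or> 1 \<le> j n \<and> c < x + X (real (j n) * (t / real (Suc n))) \<xi>) \<and>
     (\<forall>i. 1 \<le> i \<and> i < j n \<longrightarrow> x + X (real i * (t / real (Suc n))) \<xi> \<le> c)"
    using grid_stopped_cases[where \<xi>=\<xi> and \<theta>=\<theta> and q=q and c=c and x=x] by (intro choice allI) blast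
  then obtain j where j: "\<And>n. j n \<le> Suc n"
      "\<And>n. grid_stopped \<theta> q c x (t / real (Suc n)) (Suc n) \<xi> = disc_exp \<theta> q (real (j n) * (t / real (Suc n))) \<xi>"
      "\<And>n. j n = Suc n \<or> 1 \<le> j n \<and> c < x + X (real (j n) * (t / real (Suc n))) \<xi>"
      "\<And>n i. 1 \<le> i \<Longrightarrow> i < j n \<Longrightarrow> x + X (real i * (t / real (Suc n))) \<xi> \<le> c"
    by blast
  define u where "u n = real (j n) * (t / real (Suc n))" for n
  have ut: "u n \<le> t" for n
  proof -
    have "u n \<le> real (Suc n) * (t / real (Suc n))" unfolding u_def using j(1)[of n] t by (intro mult_right_mono) auto
    then show ?thesis by simp
  qed
  have um: "m \<le> u n" for n
  proof (cases "j n = Suc n")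
    case True
    then have "u n = t" by (simp add: u_def)
    then have "ereal m \<le> ereal (u n)" using mm by simp
    then show ?thesis by simp
  next
    case False
    then have c: "1 \<le> j n" "c < x + X (u n) \<xi>" using j(3)[of n] by (auto simp: u_def)
    then have "0 < u n" using t by (auto simp: u_def)
    then have "T \<le> ereal (u n)" unfolding T_def using c by (intro passage_le[OF p]) (auto simp: path_apply)
    then have "ereal m \<le> ereal (u n)" using mm by (simp add: min_le_iff_disj)
    then show ?thesis by simp
  qed
  have "u \<longlonglongrightarrow> m"
  proof (cases "ereal t \<le> T")
    case True
    then have "m = t" using mm by (simp add: min_absorb2)
    then have "u n = m" for n using ut[of n] um[of n] by simp
    then have "u = (\<lambda>_. m)" by auto
    then show ?thesis by simp
  next
    case False
    then have Tm: "T = ereal m" "m < t" using mm by (auto simp: min_def split: if_splits)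
    show ?thesis
    proof (rule LIMSEQ_I)
      fix e :: real assume e: "0 < e"
      have "passage c x (path \<xi>) < ereal (min (m + e) t)" using Tm e by (simp add: T_def[symmetric])
      then obtain d where d: "0 < d" "\<And>\<delta>. 0 < \<delta> \<Longrightarrow> \<delta> < d \<Longrightarrow> \<exists>i\<ge>1. real i * \<delta> < min (m + e) t \<and> c < x + path \<xi> (real i * \<delta>)"
        by (rule passage_grid_hit[OF p]) blast
      have "norm (u n - m) < e" if n: "t / real (Suc n) < d" for n
      proof -
        have \<delta>: "0 < t / real (Suc n)" using t by simp
        obtain i where i: "1 \<le> i" "real i * (t / real (Suc n)) < min (m + e) t" "c < x + path \<xi> (real i * (t / real (Suc n)))"
          using d(2)[OF \<delta> n] by blast
        have "c < x + X (real i * (t / real (Suc n))) \<xi>" using i(3) t by (simp add: path_apply)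
        then have "\<not> i < j n" using j(4)[OF i(1), of n] by fastforce
        then have "u n \<le> real i * (t / real (Suc n))" unfolding u_def using \<delta> by (intro mult_right_mono) auto
        then show ?thesis using i(2) um[of n] by simp
      qed
      then show "\<exists>no. \<forall>n\<ge>no. norm (u n - m) < e"
        using eventually_small_step[OF d(1), of t] unfolding eventually_sequentially by blast
    qed
  qed
  note um_lim = this
  have "continuous (at m within {m..}) (path \<xi>)"
    using p m0 by (simp add: continuous_within at_within_Ici_at_right right_cont_def)
  then have "(\<lambda>n. path \<xi> (u n)) \<longlonglongrightarrow> path \<xi> m"
    by (rule continuous_within_tendsto_compose'[OF _ _ um_lim]) (use um in simp)
  moreover have "path \<xi> (u n) = X (u n) \<xi>" for n using um[of n] m0 by (simp add: path_apply)
  ultimately have "(\<lambda>n. X (u n) \<xi>) \<longlonglongrightarrow> X m \<xi>" using m0 by (simp add: path_apply)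
  then have "(\<lambda>n. disc_exp \<theta> q (u n) \<xi>) \<longlonglongrightarrow> disc_exp \<theta> q m \<xi>"
    unfolding disc_exp_def using um_lim by (intro tendsto_intros)
  then show ?thesis unfolding u_def j(2)[symmetric] by (simp only: m_def T_def)
qed

text \<open>If \<open>s\<close> precedes the passage, no grid sees one up to \<open>s\<close>; if
  \<open>s\<close> follows it, every fine grid does. Equality, the undecided case, is excluded by
  assumption.\<close>

lemma grid_mean_tendsto:
  assumes \<theta>: "0 \<le> \<theta>" and t: "0 < t" and s: "0 < s"
    and ne: "AE \<xi> in M. passage c x (path \<xi>) \<noteq> ereal s"
  shows "(\<lambda>n. grid_mean \<theta> q c x (t / real (Suc n)) s) \<longlonglongrightarrow> alive_mean \<theta> q c x s"
  unfolding grid_mean_def alive_mean_def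
proof (rule integral_dominated_convergence[where w="disc_exp \<theta> q s"])
  have s0: "0 \<le> s" using s by simp
  show "integrable M (disc_exp \<theta> q s)" by (rule disc_exp_integral(1)[OF \<theta> s0])
  show "(\<lambda>\<xi>. if ereal s \<le> passage c x (path \<xi>) then exp (\<theta> * reg (path \<xi>) s - q * s) else 0) \<in> borel_measurable M"
    by measurable
  show "(\<lambda>\<xi>. indicator {\<xi>. grid_alive c x (t / real (Suc n)) (nat \<lfloor>s / (t / real (Suc n))\<rfloor>) \<xi>} \<xi> *
      exp (\<theta> * reg (path \<xi>) s - q * s)) \<in> borel_measurable M" for n
  proof -
    have [measurable]: "Measurable.pred M (grid_alive c x (t / real (Suc n)) (nat \<lfloor>s / (t / real (Suc n))\<rfloor>))"
      using t by (intro grid_alive_measurable) simp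
    show ?thesis by measurable
  qed
  show "AE \<xi> in M. norm (indicator {\<xi>. grid_alive c x (t / real (Suc n)) (nat \<lfloor>s / (t / real (Suc n))\<rfloor>) \<xi>} \<xi> *
      exp (\<theta> * reg (path \<xi>) s - q * s)) \<le> disc_exp \<theta> q s \<xi>" for n
    using s0 by (intro AE_I2) (auto simp: disc_exp_def reg_path split: split_indicator)
  show "AE \<xi> in M. (\<lambda>n. indicator {\<xi>. grid_alive c x (t / real (Suc n)) (nat \<lfloor>s / (t / real (Suc n))\<rfloor>) \<xi>} \<xi> *
      exp (\<theta> * reg (path \<xi>) s - q * s)) \<longlonglongrightarrow> (if ereal s \<le> passage c x (path \<xi>) then exp (\<theta> * reg (path \<xi>) s - q * s) else 0)"
    using ne AE_space
  proof eventually_elim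
    fix \<xi> assume ne: "passage c x (path \<xi>) \<noteq> ereal s" and xi: "\<xi> \<in> space M"
    have p: "right_cont (path \<xi>)" by (rule right_cont_path[OF xi])
    have fl: "i \<le> nat \<lfloor>s / \<delta>\<rfloor> \<longleftrightarrow> real i * \<delta> \<le> s" if "0 < \<delta>" for i \<delta>
      using that s by (simp add: le_nat_iff le_floor_iff pos_le_divide_eq)
    let ?f = "\<lambda>n. indicator {\<xi>. grid_alive c x (t / real (Suc n)) (nat \<lfloor>s / (t / real (Suc n))\<rfloor>) \<xi>} \<xi> * exp (\<theta> * reg (path \<xi>) s - q * s)"
    show "?f \<longlonglongrightarrow> (if ereal s \<le> passage c x (path \<xi>) then exp (\<theta> * reg (path \<xi>) s - q * s) else 0)"
    proof (cases "ereal s \<le> passage c x (path \<xi>)")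
      case True
      then have less: "ereal s < passage c x (path \<xi>)" using ne by simp
      have "grid_alive c x (t / real (Suc n)) (nat \<lfloor>s / (t / real (Suc n))\<rfloor>) \<xi>" for n
        unfolding grid_alive_def
      proof
        fix j assume j: "j \<in> {1..nat \<lfloor>s / (t / real (Suc n))\<rfloor>}"
        have \<delta>: "0 < t / real (Suc n)" using t by simp
        have u: "0 < real j * (t / real (Suc n))" "real j * (t / real (Suc n)) \<le> s"
        proof -
          have "0 < real j" using j by auto
          then show "0 < real j * (t / real (Suc n))" using \<delta> by (rule mult_pos_pos)
          show "real j * (t / real (Suc n)) \<le> s" using j fl[OF \<delta>, of j] by auto
        qed
        have "x + reg (path \<xi>) (real j * (t / real (Suc n))) \<le> c"
        proof (rule less_passage_le[OF p u(1)])
          have "ereal (real j * (t / real (Suc n))) \<le> ereal s" using u(2) by simp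
          then show "ereal (real j * (t / real (Suc n))) < passage c x (path \<xi>)" using less by (rule order_le_less_trans)
        qed
        then show "x + X (real j * (t / real (Suc n))) \<xi> \<le> c" using u xi by (simp add: reg_path less_imp_le)
      qed
      then show ?thesis using True by simp
    next
      case False
      then have less: "passage c x (path \<xi>) < ereal s" by simp
      obtain d where d: "0 < d" "\<And>\<delta>. 0 < \<delta> \<Longrightarrow> \<delta> < d \<Longrightarrow> \<exists>i\<ge>1. real i * \<delta> < s \<and> c < x + path \<xi> (real i * \<delta>)"
        by (rule passage_grid_hit[OF p less]) blast
      have "?f n = 0" if n: "t / real (Suc n) < d" for n
      proof -
        have \<delta>: "0 < t / real (Suc n)" using t by simp
        obtain i where i: "1 \<le> i" "real i * (t / real (Suc n)) < s" "c < x + path \<xi> (real i * (t / real (Suc n)))"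
          using d(2)[OF \<delta> n] by blast
        then have "i \<le> nat \<lfloor>s / (t / real (Suc n))\<rfloor>" using fl[OF \<delta>] by auto
        moreover have "c < x + X (real i * (t / real (Suc n))) \<xi>" using i(3) t by (simp add: path_apply)
        ultimately have "\<not> grid_alive c x (t / real (Suc n)) (nat \<lfloor>s / (t / real (Suc n))\<rfloor>) \<xi>"
          unfolding grid_alive_def using i(1) by (auto simp: not_le simp del: of_nat_Suc intro!: bexI[of _ i])
        then show ?thesis by simp
      qed
      then have "eventually (\<lambda>n. ?f n = 0) sequentially"
        using eventually_small_step[OF d(1), of t] by (auto elim: eventually_mono)
      then show ?thesis using False by (simp add: tendsto_eventually)
    qed
  qed
qed

text \<open>Turns second moments of stopped exponentials into first moments, which
  \<open>expectation_grid_stopped\<close> computes.\<close>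

lemma grid_stopped_square: "(grid_stopped \<theta> q c x \<delta> k \<xi>)\<^sup>2 = grid_stopped (2 * \<theta>) (2 * q) c x \<delta> k \<xi>"
proof -
  have "(disc_exp \<theta> q s \<xi>)\<^sup>2 = disc_exp (2 * \<theta>) (2 * q) s \<xi>" for s
    unfolding disc_exp_def by (simp add: power2_eq_square algebra_simps flip: exp_add)
  then show ?thesis by (induction k) auto
qed

lemma grid_mean_Icc_bound:
  assumes \<theta>: "0 \<le> \<theta>" and d: "0 < \<delta>" and s: "s \<in> {0..t}"
  shows "\<bar>grid_mean \<theta> q c x \<delta> s\<bar> \<le> exp (\<bar>\<psi> \<theta> - q\<bar> * t)"
proof -
  have s': "0 \<le> s" "s \<le> t" using s by auto
  have "(\<psi> \<theta> - q) * s \<le> \<bar>\<psi> \<theta> - q\<bar> * s" using s' by (intro mult_right_mono) auto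
  also have "\<dots> \<le> \<bar>\<psi> \<theta> - q\<bar> * t" using s' by (intro mult_left_mono) auto
  finally have "exp ((\<psi> \<theta> - q) * s) \<le> exp (\<bar>\<psi> \<theta> - q\<bar> * t)" by simp
  then show ?thesis using grid_mean_bounds[OF \<theta> d s'(1), of q c x] by linarith
qed

text \<open>The limit of \<open>expectation_grid_stopped\<close> along the meshes
  \<open>t / (n + 1)\<close>: bounded second moments handle the stopped exponentials, dominated
  convergence the time integral.\<close>

lemma dynkin:
  fixes c x :: real
  assumes \<theta>: "0 \<le> \<theta>" and t: "0 < t"
  defines "m \<equiv> \<lambda>\<xi>. real_of_ereal (min (passage c x (path \<xi>)) (ereal t))"
  shows "expectation (\<lambda>\<xi>. exp (\<theta> * reg (path \<xi>) (m \<xi>) - q * m \<xi>)) = 1 + (\<psi> \<theta> - q) * (LBINT s:{0..<t}. alive_mean \<theta> q c x s)"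
proof -
  let ?d = "\<lambda>n. t / real (Suc n)"
  let ?Z = "\<lambda>\<xi>. exp (\<theta> * reg (path \<xi>) (m \<xi>) - q * m \<xi>)"
  have d: "0 < ?d n" for n using t by simp
  have td: "real (Suc n) * ?d n = t" for n by simp
  have [measurable]: "m \<in> borel_measurable M" unfolding m_def by measurable
  define Y where "Y n \<xi> = grid_stopped \<theta> q c x (?d n) (Suc n) \<xi>" for n \<xi>
  have m0: "0 \<le> m \<xi>" for \<xi>
    unfolding m_def using passage_nonneg[of c x "path \<xi>"] t by (intro real_of_ereal_pos) (auto simp: min_def)
  define r2 where "r2 = \<psi> (2 * \<theta>) - 2 * q"
  \<comment> \<open>A bound, uniform in the mesh, for the value that
    \<open>expectation_grid_stopped\<close> gives with \<open>2 * \<theta>\<close> and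
    \<open>2 * q\<close>.\<close>
  define C where "C = 1 + \<bar>r2\<bar> * (exp (\<bar>r2\<bar> * t) * t)"
  have int_bound: "\<bar>LBINT s:{0..<t}. grid_mean \<theta>' q' c x (?d n) s\<bar> \<le> exp (\<bar>\<psi> \<theta>' - q'\<bar> * t) * t" if "0 \<le> \<theta>'" for \<theta>' q' n
  proof -
    let ?g = "grid_mean \<theta>' q' c x (?d n)"
    have gi: "set_integrable lborel {0..<t} ?g"
      by (rule set_integrable_bounded[OF grid_mean_measurable[OF d], where C="exp (\<bar>\<psi> \<theta>' - q'\<bar> * t)"]) (use grid_mean_Icc_bound[OF that d] in auto)
    have ci: "set_integrable lborel {0..<t} (\<lambda>_. exp (\<bar>\<psi> \<theta>' - q'\<bar> * t))"
      by (rule set_integrable_bounded[where C="exp (\<bar>\<psi> \<theta>' - q'\<bar> * t)"]) auto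
    have "\<bar>LBINT s:{0..<t}. ?g s\<bar> \<le> (LBINT s:{0..<t}. \<bar>?g s\<bar>)" using set_integral_norm_bound[OF gi] by simp
    also have "\<dots> \<le> (LBINT s:{0..<t}. exp (\<bar>\<psi> \<theta>' - q'\<bar> * t))"
      by (rule set_integral_mono[OF set_integrable_abs[OF gi] ci]) (use grid_mean_Icc_bound[OF that d] in auto)
    also have "\<dots> = exp (\<bar>\<psi> \<theta>' - q'\<bar> * t) * t" using t by (simp add: set_lebesgue_integral_def)
    finally show ?thesis .
  qed
  have lim1: "(\<lambda>n. expectation (Y n)) \<longlonglongrightarrow> expectation ?Z"
  proof (rule tendsto_expectation_bounded_square(2)[where C=C])
    show "Y n \<in> borel_measurable M" for n unfolding Y_def using d by (intro grid_stopped_measurable less_imp_le)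
    show "?Z \<in> borel_measurable M" by measurable
    show "0 \<le> Y n \<xi>" for n \<xi> unfolding Y_def by (intro less_imp_le grid_stopped_pos)
    show "AE \<xi> in M. (\<lambda>n. Y n \<xi>) \<longlonglongrightarrow> ?Z \<xi>"
    proof (rule AE_I2)
      fix \<xi> assume xi: "\<xi> \<in> space M"
      have "disc_exp \<theta> q (m \<xi>) \<xi> = ?Z \<xi>" using xi m0 by (simp add: disc_exp_def reg_path)
      then show "(\<lambda>n. Y n \<xi>) \<longlonglongrightarrow> ?Z \<xi>" using grid_stopped_tendsto[OF xi t, of \<theta> q c x] unfolding Y_def m_def by simp
    qed
    show "(\<integral>\<^sup>+\<xi>. ennreal ((Y n \<xi>)\<^sup>2) \<partial>M) \<le> ennreal C" for n
    proof -
      have \<theta>2: "0 \<le> 2 * \<theta>" using \<theta> by simp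
      note E = expectation_grid_stopped[OF \<theta>2 d, of "2 * q" c x n "Suc n", unfolded td]
      have "(\<integral>\<^sup>+\<xi>. ennreal ((Y n \<xi>)\<^sup>2) \<partial>M) = ennreal (expectation (grid_stopped (2 * \<theta>) (2 * q) c x (?d n) (Suc n)))"
        unfolding Y_def grid_stopped_square
        by (rule nn_integral_eq_integral) (use E grid_stopped_pos in \<open>blast intro: less_imp_le AE_I2\<close>)+
      also have "\<dots> \<le> ennreal C"
      proof (rule ennreal_leI)
        have "r2 * (LBINT s:{0..<t}. grid_mean (2 * \<theta>) (2 * q) c x (?d n) s) \<le> \<bar>r2\<bar> * (exp (\<bar>r2\<bar> * t) * t)"
        proof -
          let ?L = "LBINT s:{0..<t}. grid_mean (2 * \<theta>) (2 * q) c x (?d n) s"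
          have "r2 * ?L \<le> \<bar>r2\<bar> * \<bar>?L\<bar>" by (simp only: abs_mult[symmetric] abs_ge_self)
          also have "\<dots> \<le> \<bar>r2\<bar> * (exp (\<bar>r2\<bar> * t) * t)"
            using int_bound[OF \<theta>2, of "2 * q" n] unfolding r2_def by (intro mult_left_mono) auto
          finally show ?thesis .
        qed
        then show "expectation (grid_stopped (2 * \<theta>) (2 * q) c x (?d n) (Suc n)) \<le> C"
          using E by (simp add: C_def r2_def del: grid_stopped.simps of_nat_Suc)
      qed
      finally show ?thesis .
    qed
  qed
  have "(\<lambda>n. LBINT s:{0..<t}. grid_mean \<theta> q c x (?d n) s) \<longlonglongrightarrow> (LBINT s:{0..<t}. alive_mean \<theta> q c x s)"
    unfolding set_lebesgue_integral_def
  proof (rule integral_dominated_convergence[where w="\<lambda>s. indicator {0..<t} s * exp (\<bar>\<psi> \<theta> - q\<bar> * t)"])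
    show "(\<lambda>s. indicator {0..<t} s *\<^sub>R alive_mean \<theta> q c x s) \<in> borel_measurable lborel" by measurable
    show "(\<lambda>s. indicator {0..<t} s *\<^sub>R grid_mean \<theta> q c x (?d n) s) \<in> borel_measurable lborel" for n
      using grid_mean_measurable[OF d] by measurable
    show "integrable lborel (\<lambda>s. indicator {0..<t} s * exp (\<bar>\<psi> \<theta> - q\<bar> * t))" using t by simp
    show "AE s in lborel. norm (indicator {0..<t} s *\<^sub>R grid_mean \<theta> q c x (?d n) s) \<le> indicator {0..<t} s * exp (\<bar>\<psi> \<theta> - q\<bar> * t)" for n
      using grid_mean_Icc_bound[OF \<theta> d] by (intro AE_I2) (auto split: split_indicator)
    have "AE s in lborel. s \<noteq> (0::real)" by (rule AE_lborel_singleton)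
    with AE_passage_neq[of c x]
    show "AE s in lborel. (\<lambda>n. indicator {0..<t} s *\<^sub>R grid_mean \<theta> q c x (?d n) s) \<longlonglongrightarrow> indicator {0..<t} s *\<^sub>R alive_mean \<theta> q c x s"
    proof eventually_elim
      fix s assume "AE \<xi> in M. passage c x (path \<xi>) \<noteq> ereal s" "s \<noteq> 0"
      then show "(\<lambda>n. indicator {0..<t} s *\<^sub>R grid_mean \<theta> q c x (?d n) s) \<longlonglongrightarrow> indicator {0..<t} s *\<^sub>R alive_mean \<theta> q c x s"
        using grid_mean_tendsto[OF \<theta> t, of s c x q] by (cases "s \<in> {0..<t}") auto
    qed
  qed
  then have "(\<lambda>n. 1 + (\<psi> \<theta> - q) * (LBINT s:{0..<t}. grid_mean \<theta> q c x (?d n) s)) \<longlonglongrightarrow> 1 + (\<psi> \<theta> - q) * (LBINT s:{0..<t}. alive_mean \<theta> q c x s)"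
    by (intro tendsto_intros)
  moreover have "expectation (Y n) = 1 + (\<psi> \<theta> - q) * (LBINT s:{0..<t}. grid_mean \<theta> q c x (?d n) s)" for n
    using expectation_grid_stopped[OF \<theta> d, of q c x n "Suc n", unfolded td] by (simp add: Y_def[abs_def] del: grid_stopped.simps of_nat_Suc)
  ultimately show ?thesis using lim1 by (simp add: LIMSEQ_unique)
qed

end

section \<open>The potential of the killed process\<close>

lemma real_measurable_scale:
  assumes "is_scale_function \<psi> q W"
  shows "W \<in> borel_measurable borel"
proof -
  have "W = (\<lambda>x. if x \<in> {0..} then W x else 0)"
    using assms by (auto simp: is_scale_function_def fun_eq_iff)
  moreover have "(\<lambda>x. if x \<in> {0..} then W x else 0) \<in> borel_measurable borel"
    using assms by (intro borel_measurable_continuous_on_if) (auto simp: is_scale_function_def)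
  ultimately show ?thesis by simp
qed

context spectrally_negative begin

text \<open>Up to the passage the path is at most \<open>c\<close>, hence so is its left limit, and
  without a positive jump also its value at the passage. A value below \<open>c\<close> there would,
  by right-continuity, postpone the passage. For a passage at time 0 the upper bound is
  \<open>x \<le> c\<close>.\<close>

lemma passage_position:
  assumes xc: "x \<le> c"
  shows "AE \<xi> in M. \<forall>m. passage c x (path \<xi>) = ereal m \<longrightarrow> x + X m \<xi> = c"
proof -
  have "AE \<xi> in M. no_positive_jumps (\<lambda>t. X t \<xi>)"
    using spectrally_negative by (simp add: spectrally_negative_levy_def)
  then show ?thesis using X_zero AE_space
  proof (eventually_elim, intro allI impI)
    fix \<xi> m assume npj: "no_positive_jumps (\<lambda>t. X t \<xi>)" and x0: "X 0 \<xi> = 0" and xi: "\<xi> \<in> space M"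
      and m: "passage c x (path \<xi>) = ereal m"
    have p: "right_cont (path \<xi>)" by (rule right_cont_path[OF xi])
    have m0: "0 \<le> m" using passage_nonneg[of c x "path \<xi>"] m by simp
    have before: "x + X r \<xi> \<le> c" if "0 < r" "r < m" for r
      using less_passage_le[OF p that(1), of c x] that m xi by (simp add: reg_path)
    have "x + X m \<xi> \<le> c"
    proof (cases "m = 0")
      case False
      then have m1: "0 < m" using m0 by simp
      have "cadlag_path (\<lambda>t. X t \<xi>)" using levy xi by (simp add: levy_process_def)
      then obtain l where l: "((\<lambda>t. X t \<xi>) \<longlongrightarrow> l) (at_left m)" using m1 by (auto simp: cadlag_path_def)
      have "eventually (\<lambda>r. X r \<xi> \<le> c - x) (at_left m)"
        unfolding eventually_at_left_field using m1 before by (intro exI[of _ 0]) (auto simp: algebra_simps)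
      then have "l \<le> c - x" using l by (intro tendsto_upperbound[OF l]) auto
      moreover have "X m \<xi> \<le> l" using npj l m1 by (auto simp: no_positive_jumps_def)
      ultimately show ?thesis by simp
    qed (use x0 xc in simp)
    moreover have "c \<le> x + X m \<xi>"
    proof (rule ccontr)
      assume "\<not> c \<le> x + X m \<xi>"
      then have lt: "path \<xi> m < c - x" using m0 by (simp add: path_apply)
      have "(path \<xi> \<longlongrightarrow> path \<xi> m) (at_right m)" using p m0 by (simp add: right_cont_def)
      then have "eventually (\<lambda>r. path \<xi> r < c - x) (at_right m)" using lt by (rule order_tendstoD(2))
      then obtain b where b: "m < b" "\<And>r. m < r \<Longrightarrow> r < b \<Longrightarrow> path \<xi> r < c - x"
        unfolding eventually_at_right_field by auto
      have "x + path \<xi> r \<le> c" if "0 < r" "r < b" for r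
      proof -
        consider "r < m" | "r = m" | "m < r" by linarith
        then show ?thesis
        proof cases
          case 1 then show ?thesis using before[of r] that by (simp add: path_apply)
        next
          case 2 then show ?thesis using lt by simp
        next
          case 3 then show ?thesis using b(2)[of r] that by simp
        qed
      qed
      then have "ereal b \<le> passage c x (path \<xi>)" unfolding le_passage[OF p] by blast
      then show False using m b by simp
    qed
    ultimately show "x + X m \<xi> = c" by simp
  qed
qed

definition exit_laplace :: "real \<Rightarrow> real \<Rightarrow> real \<Rightarrow> real" where
  "exit_laplace q c x = expectation (\<lambda>\<xi>. if passage c x (path \<xi>) < \<infinity> then exp (- q * real_of_ereal (passage c x (path \<xi>))) else 0)"

text \<open>Before the passage the exponential is at most \<open>exp (\<theta> * (c - x))\<close>,
  and at the passage its undiscounted part equals this (\<open>passage_position\<close>). On paths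
  without passage the discount \<open>q > 0\<close> sends the limit to 0.\<close>

lemma dynkin_limit:
  assumes \<theta>: "0 \<le> \<theta>" and q: "0 < q" and xc: "x \<le> c"
  shows "(\<lambda>n. 1 + (\<psi> \<theta> - q) * (LBINT s:{0..<real (Suc n)}. alive_mean \<theta> q c x s)) \<longlonglongrightarrow> exp (\<theta> * (c - x)) * exit_laplace q c x"
proof -
  define m where "m n \<xi> = real_of_ereal (min (passage c x (path \<xi>)) (ereal (real (Suc n))))" for n \<xi>
  let ?e = "\<lambda>\<xi>. if passage c x (path \<xi>) < \<infinity> then exp (- q * real_of_ereal (passage c x (path \<xi>))) else 0"
  let ?Z = "\<lambda>n \<xi>. exp (\<theta> * reg (path \<xi>) (m n \<xi>) - q * m n \<xi>)"
  have "(\<lambda>n. expectation (?Z n)) \<longlonglongrightarrow> expectation (\<lambda>\<xi>. exp (\<theta> * (c - x)) * ?e \<xi>)"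
  proof (rule integral_dominated_convergence[where w="\<lambda>_. exp (\<theta> * (c - x))"])
    show "(\<lambda>\<xi>. exp (\<theta> * (c - x)) * ?e \<xi>) \<in> borel_measurable M" by measurable
    show "?Z n \<in> borel_measurable M" for n unfolding m_def by measurable
    have key: "AE \<xi> in M. \<forall>n. ?Z n \<xi> \<le> exp (\<theta> * (c - x)) * exp (- q * m n \<xi>) \<and>
        (passage c x (path \<xi>) \<le> ereal (real (Suc n)) \<longrightarrow> ?Z n \<xi> = exp (\<theta> * (c - x)) * ?e \<xi>) \<and>
        (\<not> passage c x (path \<xi>) \<le> ereal (real (Suc n)) \<longrightarrow> m n \<xi> = real (Suc n)) \<and> 0 \<le> m n \<xi>"
      using passage_position[OF xc] AE_space
    proof (eventually_elim, intro allI)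
      fix \<xi> n assume pos: "\<forall>m. passage c x (path \<xi>) = ereal m \<longrightarrow> x + X m \<xi> = c" and xi: "\<xi> \<in> space M"
      let ?T = "passage c x (path \<xi>)"
      show "?Z n \<xi> \<le> exp (\<theta> * (c - x)) * exp (- q * m n \<xi>) \<and>
        (?T \<le> ereal (real (Suc n)) \<longrightarrow> ?Z n \<xi> = exp (\<theta> * (c - x)) * ?e \<xi>) \<and>
        (\<not> ?T \<le> ereal (real (Suc n)) \<longrightarrow> m n \<xi> = real (Suc n)) \<and> 0 \<le> m n \<xi>"
      proof (cases "?T \<le> ereal (real (Suc n))")
        case True
        then obtain T where T: "?T = ereal T" using passage_nonneg[of c x "path \<xi>"] by (cases ?T) auto
        have T0: "0 \<le> T" using passage_nonneg[of c x "path \<xi>"] T by simp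
        have mT: "m n \<xi> = T" using True T by (simp add: m_def min_absorb1)
        have "X T \<xi> = c - x" using pos T by force
        then have "reg (path \<xi>) T = c - x" using reg_path[OF xi T0] by simp
        then have "?Z n \<xi> = exp (\<theta> * (c - x)) * exp (- q * m n \<xi>)"
          unfolding mT by (simp flip: exp_add)
        moreover have "\<dots> = exp (\<theta> * (c - x)) * ?e \<xi>" using T mT by simp
        ultimately show ?thesis using True mT T0 by simp
      next
        case False
        then have mS: "m n \<xi> = real (Suc n)" by (simp add: m_def min_absorb2)
        have "x + reg (path \<xi>) (real (Suc n)) \<le> c"
          using False by (intro less_passage_le[OF right_cont_path[OF xi]]) auto
        then have "\<theta> * reg (path \<xi>) (real (Suc n)) \<le> \<theta> * (c - x)" using \<theta> by (intro mult_left_mono) auto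
        then have "?Z n \<xi> \<le> exp (\<theta> * (c - x) + - q * m n \<xi>)" unfolding mS by simp
        then show ?thesis using False mS unfolding exp_add by simp
      qed
    qed
    show "AE \<xi> in M. norm (?Z n \<xi>) \<le> exp (\<theta> * (c - x))" for n
      using key
    proof eventually_elim
      fix \<xi> assume *: "\<forall>n. ?Z n \<xi> \<le> exp (\<theta> * (c - x)) * exp (- q * m n \<xi>) \<and>
        (passage c x (path \<xi>) \<le> ereal (real (Suc n)) \<longrightarrow> ?Z n \<xi> = exp (\<theta> * (c - x)) * ?e \<xi>) \<and>
        (\<not> passage c x (path \<xi>) \<le> ereal (real (Suc n)) \<longrightarrow> m n \<xi> = real (Suc n)) \<and> 0 \<le> m n \<xi>"
      then have "0 \<le> m n \<xi>" by blast
      then have "exp (- q * m n \<xi>) \<le> 1" using q by simp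
      then have "exp (\<theta> * (c - x)) * exp (- q * m n \<xi>) \<le> exp (\<theta> * (c - x)) * 1" by (intro mult_left_mono) auto
      moreover have "?Z n \<xi> \<le> exp (\<theta> * (c - x)) * exp (- q * m n \<xi>)" using * by blast
      ultimately show "norm (?Z n \<xi>) \<le> exp (\<theta> * (c - x))" by (simp only: real_norm_def abs_exp_cancel)
    qed
    show "AE \<xi> in M. (\<lambda>n. ?Z n \<xi>) \<longlonglongrightarrow> exp (\<theta> * (c - x)) * ?e \<xi>"
      using key
    proof eventually_elim
      fix \<xi> assume *: "\<forall>n. ?Z n \<xi> \<le> exp (\<theta> * (c - x)) * exp (- q * m n \<xi>) \<and>
        (passage c x (path \<xi>) \<le> ereal (real (Suc n)) \<longrightarrow> ?Z n \<xi> = exp (\<theta> * (c - x)) * ?e \<xi>) \<and>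
        (\<not> passage c x (path \<xi>) \<le> ereal (real (Suc n)) \<longrightarrow> m n \<xi> = real (Suc n)) \<and> 0 \<le> m n \<xi>"
      show "(\<lambda>n. ?Z n \<xi>) \<longlonglongrightarrow> exp (\<theta> * (c - x)) * ?e \<xi>"
      proof (cases "passage c x (path \<xi>)")
        case (real T)
        obtain N :: nat where N: "T \<le> real N" using real_arch_simple by blast
        have "?Z n \<xi> = exp (\<theta> * (c - x)) * ?e \<xi>" if "N \<le> n" for n
        proof -
          have "passage c x (path \<xi>) \<le> ereal (real (Suc n))" using real N that by simp
          then show ?thesis using * by blast
        qed
        then have "eventually (\<lambda>n. ?Z n \<xi> = exp (\<theta> * (c - x)) * ?e \<xi>) sequentially"
          unfolding eventually_sequentially by blast
        then show ?thesis by (rule tendsto_eventually)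
      next
        case PInf
        have le: "?Z n \<xi> \<le> exp (\<theta> * (c - x)) * exp (- q * real (Suc n))" for n
        proof -
          have "m n \<xi> = real (Suc n)" using * PInf by auto
          then show ?thesis using * by metis
        qed
        have "(\<lambda>n. exp (\<theta> * (c - x)) * exp (- q) ^ Suc n) \<longlonglongrightarrow> exp (\<theta> * (c - x)) * 0"
          using q by (intro tendsto_mult_left LIMSEQ_Suc LIMSEQ_power_zero) auto
        moreover have e: "exp (- q) ^ Suc n = exp (- q * real (Suc n))" for n
          by (subst exp_of_nat_mult[symmetric]) (simp only: mult.commute)
        ultimately have up: "(\<lambda>n. exp (\<theta> * (c - x)) * exp (- q * real (Suc n))) \<longlonglongrightarrow> 0"
          by (simp only: e mult_zero_right)
        have "(\<lambda>n. ?Z n \<xi>) \<longlonglongrightarrow> 0"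
        proof (rule tendsto_sandwich[OF _ _ tendsto_const up])
          show "eventually (\<lambda>n. 0 \<le> ?Z n \<xi>) sequentially" by simp
          show "eventually (\<lambda>n. ?Z n \<xi> \<le> exp (\<theta> * (c - x)) * exp (- q * real (Suc n))) sequentially"
            by (intro always_eventually allI le)
        qed
        then show ?thesis using PInf by simp
      next
        case MInf
        then show ?thesis using passage_nonneg[of c x "path \<xi>"] by simp
      qed
    qed
  qed simp
  moreover have "expectation (?Z n) = 1 + (\<psi> \<theta> - q) * (LBINT s:{0..<real (Suc n)}. alive_mean \<theta> q c x s)" for n
    unfolding m_def using dynkin[OF \<theta>, of "real (Suc n)" c x q] by simp
  ultimately show ?thesis by (simp add: exit_laplace_def)
qed

text \<open>At \<open>\<theta> = right_inverse \<psi> q\<close> the factor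
  \<open>\<psi> \<theta> - q\<close> is 0, and only the boundary term of \<open>dynkin_limit\<close>
  remains.\<close>

lemma exit_laplace_pos:
  assumes q: "0 < q" and xc: "x \<le> c"
  shows "exit_laplace q c x = exp (- right_inverse \<psi> q * (c - x))"
proof -
  let ?P = "right_inverse \<psi> q"
  have "(\<lambda>n::nat. 1 :: real) \<longlonglongrightarrow> exp (?P * (c - x)) * exit_laplace q c x"
    using dynkin_limit[OF right_inverse_nonneg[of q] q xc] psi_right_inverse[OF q] by simp
  then have "exp (?P * (c - x)) * exit_laplace q c x = 1" by (simp add: LIMSEQ_const_iff)
  moreover have "exit_laplace q c x = exp (- ?P * (c - x)) * (exp (?P * (c - x)) * exit_laplace q c x)"
    by (simp flip: mult.assoc exp_add)
  ultimately show ?thesis by simp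
qed

lemma alive_mean_le:
  assumes "0 \<le> \<theta>" "0 \<le> s"
  shows "alive_mean \<theta> q c x s \<le> exp ((\<psi> \<theta> - q) * s)"
proof -
  have "alive_mean \<theta> q c x s \<le> expectation (disc_exp \<theta> q s)"
    unfolding alive_mean_def
    by (rule integral_mono[OF integrable_alive[OF assms] disc_exp_integral(1)[OF assms]])
       (use assms in \<open>auto simp: disc_exp_def reg_path\<close>)
  then show ?thesis using disc_exp_integral(2)[OF assms] by simp
qed

text \<open>Solves \<open>dynkin_limit\<close> for the time integral, dividing by
  \<open>\<psi> \<theta> - q\<close>, which is positive to the right of the inverse.\<close>

lemma nn_integral_alive_mean_pos:
  assumes q: "0 < q" and \<theta>: "right_inverse \<psi> q < \<theta>" and xc: "x \<le> c"
  shows "(\<integral>\<^sup>+s\<in>{0..}. ennreal (alive_mean \<theta> q c x s) \<partial>lborel)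
     = ennreal ((exp ((\<theta> - right_inverse \<psi> q) * (c - x)) - 1) / (\<psi> \<theta> - q))"
proof -
  have \<theta>0: "0 \<le> \<theta>" and r: "0 < \<psi> \<theta> - q" using psi_gt[OF \<theta>] q by auto
  let ?a = "alive_mean \<theta> q c x" and ?J = "\<lambda>n. LBINT s:{0..<real (Suc n)}. alive_mean \<theta> q c x s"
  let ?R = "(exp ((\<theta> - right_inverse \<psi> q) * (c - x)) - 1) / (\<psi> \<theta> - q)"
  have fin: "(\<integral>\<^sup>+s\<in>{0..<real (Suc n)}. ennreal (?a s) \<partial>lborel) = ennreal (?J n)" for n
  proof -
    have "set_integrable lborel {0..<real (Suc n)} ?a"
    proof (rule set_integrable_bounded[where C="exp ((\<psi> \<theta> - q) * real (Suc n))"])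
      fix s assume s: "s \<in> {0..<real (Suc n)}"
      have "?a s \<le> exp ((\<psi> \<theta> - q) * s)" using alive_mean_le[OF \<theta>0] s by auto
      also have "\<dots> \<le> exp ((\<psi> \<theta> - q) * real (Suc n))" using s r by (simp add: mult_left_mono)
      finally show "\<bar>?a s\<bar> \<le> exp ((\<psi> \<theta> - q) * real (Suc n))" using alive_mean_nonneg[of \<theta> q c x s] by simp
    qed auto
    then have "(\<integral>\<^sup>+s. ennreal (indicator {0..<real (Suc n)} s *\<^sub>R ?a s) \<partial>lborel) = ennreal (?J n)"
      unfolding set_integrable_def set_lebesgue_integral_def using alive_mean_nonneg
      by (intro nn_integral_eq_integral) (auto simp: mult_nonneg_nonneg)
    moreover have "ennreal (indicator {0..<real (Suc n)} s *\<^sub>R ?a s) = ennreal (?a s) * indicator {0..<real (Suc n)} s" for s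
      by (auto split: split_indicator)
    ultimately show ?thesis by simp
  qed
  have "(\<lambda>n. \<integral>\<^sup>+s\<in>{0..<real (Suc n)}. ennreal (?a s) \<partial>lborel) \<longlonglongrightarrow> (\<integral>\<^sup>+s\<in>{0..}. ennreal (?a s) \<partial>lborel)"
  proof (rule nn_integral_LIMSEQ)
    show "incseq (\<lambda>n s. ennreal (?a s) * indicator {0..<real (Suc n)} s)"
      by (auto simp: incseq_def le_fun_def split: split_indicator)
    show "(\<lambda>s. ennreal (?a s) * indicator {0..<real (Suc n)} s) \<in> borel_measurable lborel" for n by measurable
    show "(\<lambda>n. ennreal (?a s) * indicator {0..<real (Suc n)} s) \<longlonglongrightarrow> ennreal (?a s) * indicator {0..} s" for s
    proof (rule tendsto_eventually)
      obtain N :: nat where "s \<le> real N" using real_arch_simple by blast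
      then have "\<forall>n\<ge>N. ennreal (?a s) * indicator {0..<real (Suc n)} s = ennreal (?a s) * indicator {0..} s"
        by (auto split: split_indicator)
      then show "eventually (\<lambda>n. ennreal (?a s) * indicator {0..<real (Suc n)} s = ennreal (?a s) * indicator {0..} s) sequentially"
        by (auto simp: eventually_sequentially)
    qed
  qed
  moreover have "(\<lambda>n. ennreal (?J n)) \<longlonglongrightarrow> ennreal ?R"
  proof (rule tendsto_ennrealI)
    have "(\<lambda>n. ((1 + (\<psi> \<theta> - q) * ?J n) - 1) / (\<psi> \<theta> - q)) \<longlonglongrightarrow> (exp (\<theta> * (c - x)) * exit_laplace q c x - 1) / (\<psi> \<theta> - q)"
      using r by (intro tendsto_intros dynkin_limit[OF \<theta>0 q xc]) auto
    moreover have "exp (\<theta> * (c - x)) * exit_laplace q c x = exp ((\<theta> - right_inverse \<psi> q) * (c - x))"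
      unfolding exit_laplace_pos[OF q xc] by (simp add: algebra_simps flip: exp_add)
    ultimately show "?J \<longlonglongrightarrow> ?R" using r by simp
  qed
  ultimately show ?thesis unfolding fin by (rule LIMSEQ_unique)
qed

text \<open>\<open>dynkin_limit\<close> relies on the discount, so \<open>q = 0\<close> is reached
  along \<open>q = 1 / (n + 1)\<close>: the integrands increase to the undiscounted one, and the
  right-hand sides converge by \<open>right_inverse_tendsto\<close>.\<close>

lemma nn_integral_alive_mean:
  assumes q: "0 \<le> q" and \<theta>: "right_inverse \<psi> q < \<theta>" and xc: "x \<le> c"
  shows "(\<integral>\<^sup>+s\<in>{0..}. ennreal (alive_mean \<theta> q c x s) \<partial>lborel)
     = ennreal ((exp ((\<theta> - right_inverse \<psi> q) * (c - x)) - 1) / (\<psi> \<theta> - q))"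
proof (cases "q = 0")
  case False
  then show ?thesis using nn_integral_alive_mean_pos[OF _ \<theta> xc] q by simp
next
  case True
  let ?q = "\<lambda>n. 1 / real (Suc n)"
  have \<theta>': "right_inverse \<psi> 0 < \<theta>" using \<theta> True by simp
  have r: "0 < \<psi> \<theta>" using psi_gt(2)[OF \<theta>'] by simp
  have q0: "?q \<longlonglongrightarrow> 0" using LIMSEQ_inverse_real_of_nat by (simp add: inverse_eq_divide)
  have mean_q: "alive_mean \<theta> q c x s = exp (- q * s) * alive_mean \<theta> 0 c x s" for q s
  proof -
    have "(\<lambda>\<xi>. if ereal s \<le> passage c x (path \<xi>) then exp (\<theta> * reg (path \<xi>) s - q * s) else 0)
      = (\<lambda>\<xi>. exp (- q * s) * (if ereal s \<le> passage c x (path \<xi>) then exp (\<theta> * reg (path \<xi>) s - 0 * s) else 0))"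
      by (auto simp: fun_eq_iff simp flip: exp_add)
    then show ?thesis unfolding alive_mean_def by simp
  qed
  let ?a = "alive_mean \<theta> 0 c x"
  have "(\<lambda>n. \<integral>\<^sup>+s\<in>{0..}. ennreal (alive_mean \<theta> (?q n) c x s) \<partial>lborel) \<longlonglongrightarrow> (\<integral>\<^sup>+s\<in>{0..}. ennreal (?a s) \<partial>lborel)"
  proof (rule nn_integral_LIMSEQ)
    show "incseq (\<lambda>n s. ennreal (alive_mean \<theta> (?q n) c x s) * indicator {0..} s)"
    proof (intro incseq_SucI le_funI)
      fix n s
      show "ennreal (alive_mean \<theta> (?q n) c x s) * indicator {0..} s \<le> ennreal (alive_mean \<theta> (?q (Suc n)) c x s) * indicator {0..} s"
      proof (cases "0 \<le> s")
        case True
        have "?q (Suc n) \<le> ?q n" by (rule divide_left_mono) auto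
        then have "?q (Suc n) * s \<le> ?q n * s" using True by (rule mult_right_mono)
        then have "exp (- ?q n * s) \<le> exp (- ?q (Suc n) * s)" by simp
        then have "alive_mean \<theta> (?q n) c x s \<le> alive_mean \<theta> (?q (Suc n)) c x s"
          unfolding mean_q[of "?q n"] mean_q[of "?q (Suc n)"] using alive_mean_nonneg by (intro mult_right_mono) auto
        then show ?thesis by (auto simp: ennreal_leI split: split_indicator)
      qed simp
    qed
    show "(\<lambda>s. ennreal (alive_mean \<theta> (?q n) c x s) * indicator {0..} s) \<in> borel_measurable lborel" for n by measurable
    show "(\<lambda>n. ennreal (alive_mean \<theta> (?q n) c x s) * indicator {0..} s) \<longlonglongrightarrow> ennreal (?a s) * indicator {0..} s" for s
    proof -
      have "(\<lambda>n. exp (- ?q n * s) * ?a s) \<longlonglongrightarrow> exp (- 0 * s) * ?a s" by (intro tendsto_intros q0)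
      then have "(\<lambda>n. alive_mean \<theta> (?q n) c x s) \<longlonglongrightarrow> ?a s" by (subst mean_q) simp
      then show ?thesis by (auto split: split_indicator)
    qed
  qed
  moreover have "(\<lambda>n. \<integral>\<^sup>+s\<in>{0..}. ennreal (alive_mean \<theta> (?q n) c x s) \<partial>lborel)
     \<longlonglongrightarrow> ennreal ((exp ((\<theta> - right_inverse \<psi> 0) * (c - x)) - 1) / (\<psi> \<theta> - 0))"
  proof (rule Lim_transform_eventually)
    show "(\<lambda>n. ennreal ((exp ((\<theta> - right_inverse \<psi> (?q n)) * (c - x)) - 1) / (\<psi> \<theta> - ?q n)))
       \<longlonglongrightarrow> ennreal ((exp ((\<theta> - right_inverse \<psi> 0) * (c - x)) - 1) / (\<psi> \<theta> - 0))"
      using r by (intro tendsto_intros tendsto_ennrealI right_inverse_tendsto q0) auto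
    have "eventually (\<lambda>n. right_inverse \<psi> (?q n) < \<theta>) sequentially"
      by (rule order_tendstoD(2)[OF right_inverse_tendsto \<theta>'])
    then show "eventually (\<lambda>n. ennreal ((exp ((\<theta> - right_inverse \<psi> (?q n)) * (c - x)) - 1) / (\<psi> \<theta> - ?q n))
       = (\<integral>\<^sup>+s\<in>{0..}. ennreal (alive_mean \<theta> (?q n) c x s) \<partial>lborel)) sequentially"
      by eventually_elim (rule nn_integral_alive_mean_pos[symmetric, OF _ _ xc], auto)
  qed
  ultimately show ?thesis unfolding True by (rule LIMSEQ_unique)
qed

text \<open>For \<open>q = 0\<close>, obtained by dominated convergence, this is the probability
  that a passage occurs at all.\<close>

lemma exit_laplace_eq:
  assumes q: "0 \<le> q" and xc: "x \<le> c"
  shows "exit_laplace q c x = exp (- right_inverse \<psi> q * (c - x))"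
proof (cases "q = 0")
  case False
  then show ?thesis using exit_laplace_pos[OF _ xc] q by simp
next
  case True
  let ?q = "\<lambda>n. 1 / real (Suc n)"
  have q0: "?q \<longlonglongrightarrow> 0" using LIMSEQ_inverse_real_of_nat by (simp add: inverse_eq_divide)
  have "(\<lambda>n. exit_laplace (?q n) c x) \<longlonglongrightarrow> exit_laplace 0 c x"
    unfolding exit_laplace_def
  proof (rule integral_dominated_convergence[where w="\<lambda>_. 1"])
    show "AE \<xi> in M. norm (if passage c x (path \<xi>) < \<infinity> then exp (- ?q n * real_of_ereal (passage c x (path \<xi>))) else 0) \<le> 1" for n
      using passage_nonneg by (intro AE_I2) (auto simp: real_of_ereal_pos)
    show "AE \<xi> in M. (\<lambda>n. if passage c x (path \<xi>) < \<infinity> then exp (- ?q n * real_of_ereal (passage c x (path \<xi>))) else 0)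
       \<longlonglongrightarrow> (if passage c x (path \<xi>) < \<infinity> then exp (- 0 * real_of_ereal (passage c x (path \<xi>))) else 0)"
    proof (rule AE_I2)
      fix \<xi>
      have "(\<lambda>n. exp (- ?q n * real_of_ereal (passage c x (path \<xi>)))) \<longlonglongrightarrow> exp (- 0 * real_of_ereal (passage c x (path \<xi>)))"
        by (intro tendsto_intros q0)
      then show "(\<lambda>n. if passage c x (path \<xi>) < \<infinity> then exp (- ?q n * real_of_ereal (passage c x (path \<xi>))) else 0)
       \<longlonglongrightarrow> (if passage c x (path \<xi>) < \<infinity> then exp (- 0 * real_of_ereal (passage c x (path \<xi>))) else 0)"
        by (cases "passage c x (path \<xi>) < \<infinity>") (simp_all only: if_True if_False tendsto_const)
    qed
  qed measurable
  moreover have "exit_laplace (?q n) c x = exp (- right_inverse \<psi> (?q n) * (c - x))" for n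
    by (rule exit_laplace_pos[OF _ xc]) simp
  moreover have "(\<lambda>n. exp (- right_inverse \<psi> (?q n) * (c - x))) \<longlonglongrightarrow> exp (- right_inverse \<psi> 0 * (c - x))"
    by (intro tendsto_intros right_inverse_tendsto)
  ultimately show ?thesis unfolding True by (simp add: LIMSEQ_unique)
qed

text \<open>A non-integrable integrand would have Bochner integral 0, but the prescribed value is
  positive.\<close>

lemma scale_laplace:
  assumes W: "is_scale_function \<psi> q W" and q: "0 \<le> q" and \<theta>: "right_inverse \<psi> q < \<theta>"
  shows "(\<integral>\<^sup>+y. ennreal (exp (- \<theta> * y)) * ennreal (W y) \<partial>lborel) = ennreal (1 / (\<psi> \<theta> - q))"
proof -
  have eq: "(LBINT y:{0..}. exp (- \<theta> * y) * W y) = 1 / (\<psi> \<theta> - q)"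
    using W \<theta> by (simp add: is_scale_function_def)
  have W0: "\<And>y. 0 \<le> W y" "\<And>y. y < 0 \<Longrightarrow> W y = 0" using W by (auto simp: is_scale_function_def)
  have ne: "1 / (\<psi> \<theta> - q) \<noteq> 0" using psi_gt(2)[OF \<theta> q] by simp
  have "integrable lborel (\<lambda>y. indicator {0..} y *\<^sub>R (exp (- \<theta> * y) * W y))"
  proof (rule ccontr)
    assume "\<not> ?thesis"
    then have "(LBINT y:{0..}. exp (- \<theta> * y) * W y) = 0"
      unfolding set_lebesgue_integral_def by (rule not_integrable_integral_eq)
    then show False using eq ne by simp
  qed
  then have "(\<integral>\<^sup>+y. ennreal (indicator {0..} y *\<^sub>R (exp (- \<theta> * y) * W y)) \<partial>lborel) = ennreal (1 / (\<psi> \<theta> - q))"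
    unfolding eq[symmetric] set_lebesgue_integral_def using W0 by (intro nn_integral_eq_integral) auto
  moreover have "ennreal (indicator {0..} y *\<^sub>R (exp (- \<theta> * y) * W y)) = ennreal (exp (- \<theta> * y)) * ennreal (W y)" for y
    using W0 by (auto simp: ennreal_mult split: split_indicator)
  ultimately show ?thesis by simp
qed

text \<open>Stated with \<open>s \<le> passage\<close>, the event to which the Markov property at
  \<open>s\<close> applies. For almost every \<open>s\<close> it agrees almost surely with strict
  survival.\<close>

definition potential :: "real \<Rightarrow> real \<Rightarrow> real \<Rightarrow> (real \<Rightarrow> ennreal) \<Rightarrow> ennreal" where
  "potential q c x g = (\<integral>\<^sup>+s. (\<integral>\<^sup>+\<xi>. (if 0 < s \<and> ereal s \<le> passage c x (path \<xi>)
      then ennreal (exp (- q * s)) * g (x + reg (path \<xi>) s) else 0) \<partial>M) \<partial>lborel)"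

lemma potential_exp:
  assumes q: "0 \<le> q" and \<theta>: "right_inverse \<psi> q < \<theta>" and xc: "x \<le> c"
  shows "potential q c x (\<lambda>y. ennreal (exp (\<theta> * y)))
    = ennreal (exp (\<theta> * x)) * ennreal ((exp ((\<theta> - right_inverse \<psi> q) * (c - x)) - 1) / (\<psi> \<theta> - q))"
proof -
  have \<theta>0: "0 \<le> \<theta>" using psi_gt(1)[OF \<theta> q] by simp
  have "potential q c x (\<lambda>y. ennreal (exp (\<theta> * y))) = (\<integral>\<^sup>+s. ennreal (exp (\<theta> * x)) * (ennreal (alive_mean \<theta> q c x s) * indicator {0..} s) \<partial>lborel)"
    unfolding potential_def
  proof (rule nn_integral_cong_AE)
    have "AE s in lborel. s \<noteq> (0::real)" by (rule AE_lborel_singleton)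
    then show "AE s in lborel. (\<integral>\<^sup>+\<xi>. (if 0 < s \<and> ereal s \<le> passage c x (path \<xi>)
      then ennreal (exp (- q * s)) * ennreal (exp (\<theta> * (x + reg (path \<xi>) s))) else 0) \<partial>M)
      = ennreal (exp (\<theta> * x)) * (ennreal (alive_mean \<theta> q c x s) * indicator {0..} s)"
    proof eventually_elim
      fix s :: real assume s: "s \<noteq> 0"
      show "(\<integral>\<^sup>+\<xi>. (if 0 < s \<and> ereal s \<le> passage c x (path \<xi>)
        then ennreal (exp (- q * s)) * ennreal (exp (\<theta> * (x + reg (path \<xi>) s))) else 0) \<partial>M)
        = ennreal (exp (\<theta> * x)) * (ennreal (alive_mean \<theta> q c x s) * indicator {0..} s)"
      proof (cases "0 < s")
        case True
        let ?f = "\<lambda>\<xi>. if ereal s \<le> passage c x (path \<xi>) then exp (\<theta> * reg (path \<xi>) s - q * s) else 0"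
        have "(\<integral>\<^sup>+\<xi>. (if 0 < s \<and> ereal s \<le> passage c x (path \<xi>)
          then ennreal (exp (- q * s)) * ennreal (exp (\<theta> * (x + reg (path \<xi>) s))) else 0) \<partial>M)
          = (\<integral>\<^sup>+\<xi>. ennreal (exp (\<theta> * x)) * ennreal (?f \<xi>) \<partial>M)"
          using True by (intro nn_integral_cong) (auto simp: algebra_simps simp flip: ennreal_mult exp_add)
        also have "\<dots> = ennreal (exp (\<theta> * x)) * (\<integral>\<^sup>+\<xi>. ennreal (?f \<xi>) \<partial>M)"
          by (rule nn_integral_cmult) measurable
        also have "(\<integral>\<^sup>+\<xi>. ennreal (?f \<xi>) \<partial>M) = ennreal (alive_mean \<theta> q c x s)"
          unfolding alive_mean_def using integrable_alive[OF \<theta>0, of s c x q] True by (intro nn_integral_eq_integral) auto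
        finally show ?thesis using True by simp
      qed (use s in simp)
    qed
  qed
  also have "\<dots> = ennreal (exp (\<theta> * x)) * (\<integral>\<^sup>+s\<in>{0..}. ennreal (alive_mean \<theta> q c x s) \<partial>lborel)"
    by (rule nn_integral_cmult) measurable
  finally show ?thesis unfolding nn_integral_alive_mean[OF q \<theta> xc] .
qed

text \<open>In the variable \<open>z = c - y\<close> all measures live on the half-line, and the
  potential has the transform \<open>(exp (- \<Phi> (c - x)) - exp (- \<theta> (c - x))) / (\<psi>
  \<theta> - q)\<close>. The first term belongs to a multiple of \<open>W\<close>, the second to
  \<open>W\<close> shifted by \<open>c - x\<close>. The shifted part stands on the left to keep both
  sides nonnegative.\<close>

lemma potential_formula:
  assumes q: "0 \<le> q" and xc: "x \<le> c" and W: "is_scale_function \<psi> q W"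
    and g[measurable]: "g \<in> borel_measurable borel"
  shows "potential q c x g + nn_conv (\<lambda>y. ennreal (W y)) g x
     = ennreal (exp (- right_inverse \<psi> q * (c - x))) * nn_conv (\<lambda>y. ennreal (W y)) g c"
proof -
  let ?\<Phi> = "right_inverse \<psi> q"
  have Wm[measurable]: "W \<in> borel_measurable borel" by (rule real_measurable_scale[OF W])
  have W0: "W y = 0" if "y < 0" for y using W that by (simp add: is_scale_function_def)
  interpret lM: pair_sigma_finite lborel M ..
  define h where "h = (\<lambda>(s, \<xi>). if 0 < s \<and> ereal s \<le> passage c x (path \<xi>) then ennreal (exp (- q * s)) else 0)"
  have [measurable]: "h \<in> borel_measurable (lborel \<Otimes>\<^sub>M M)" unfolding h_def by measurable
  define Z where "Z = (\<lambda>(s, \<xi>). c - x - reg (path \<xi>) s)"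
  have [measurable]: "Z \<in> borel_measurable (lborel \<Otimes>\<^sub>M M)" unfolding Z_def by measurable
  \<comment> \<open>\<open>M1\<close> is the potential, \<open>M2\<close> the shifted scale function
    and \<open>N\<close> the multiple of \<open>W\<close>, all as measures in
    \<open>z\<close>.\<close>
  define M1 where "M1 = distr (density (lborel \<Otimes>\<^sub>M M) h) borel Z"
  define M2 where "M2 = density lborel (\<lambda>z. ennreal (W (z - (c - x))))"
  define N where "N = density lborel (\<lambda>z. ennreal (exp (- ?\<Phi> * (c - x)) * W z))"
  have sets: "sets M1 = sets borel" "sets M2 = sets borel" "sets N = sets borel" by (simp_all add: M1_def M2_def N_def)
  have i1: "(\<integral>\<^sup>+z. f z \<partial>M1) = potential q c x (\<lambda>y. f (c - y))" if [measurable]: "f \<in> borel_measurable borel" for f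
  proof -
    have "(\<integral>\<^sup>+z. f z \<partial>M1) = (\<integral>\<^sup>+w. h w * f (Z w) \<partial>(lborel \<Otimes>\<^sub>M M))"
      unfolding M1_def by (simp add: nn_integral_distr nn_integral_density)
    also have "\<dots> = (\<integral>\<^sup>+s. (\<integral>\<^sup>+\<xi>. h (s, \<xi>) * f (Z (s, \<xi>)) \<partial>M) \<partial>lborel)"
      by (rule nn_integral_fst[symmetric]) measurable
    also have "\<dots> = potential q c x (\<lambda>y. f (c - y))"
      unfolding potential_def h_def Z_def by (intro nn_integral_cong) (auto simp: algebra_simps)
    finally show ?thesis .
  qed
  have i2: "(\<integral>\<^sup>+z. f z \<partial>M2) = (\<integral>\<^sup>+z. ennreal (W z) * f (z + (c - x)) \<partial>lborel)" if [measurable]: "f \<in> borel_measurable borel" for f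
  proof -
    have "(\<integral>\<^sup>+z. f z \<partial>M2) = (\<integral>\<^sup>+z. ennreal (W (z - (c - x))) * f z \<partial>lborel)"
      unfolding M2_def by (simp add: nn_integral_density)
    also have "\<dots> = (\<integral>\<^sup>+z. (\<lambda>z. ennreal (W (z - (c - x))) * f z) (z + (c - x)) \<partial>lborel)"
      by (rule nn_integral_lborel_shift[symmetric]) measurable
    finally show ?thesis by simp
  qed
  have i3: "(\<integral>\<^sup>+z. f z \<partial>N) = ennreal (exp (- ?\<Phi> * (c - x))) * (\<integral>\<^sup>+z. ennreal (W z) * f z \<partial>lborel)" if [measurable]: "f \<in> borel_measurable borel" for f
    unfolding N_def by (simp add: nn_integral_density ennreal_mult' mult.assoc nn_integral_cmult)
  have eqm: "emeasure M1 A + emeasure M2 A = emeasure N A" if "A \<in> sets borel" for A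
  proof (rule laplace_unique_add[OF sets _ _ _ _ _ that, where ?\<theta>0.0 = ?\<Phi>])
    \<comment> \<open>The position is known to be at most \<open>c\<close> strictly before the
      passage; equality of \<open>s\<close> with the passage time is a null event for almost all
      \<open>s\<close>.\<close>
    have "AE w in lborel \<Otimes>\<^sub>M M. h w > 0 \<longrightarrow> 0 \<le> Z w"
    proof (rule lM.AE_pair_measure)
      show "{w \<in> space (lborel \<Otimes>\<^sub>M M). 0 < h w \<longrightarrow> 0 \<le> Z w} \<in> sets (lborel \<Otimes>\<^sub>M M)" by measurable
      show "AE s in lborel. AE \<xi> in M. 0 < h (s, \<xi>) \<longrightarrow> 0 \<le> Z (s, \<xi>)"
        using AE_passage_neq[of c x]
      proof eventually_elim
        fix s assume "AE \<xi> in M. passage c x (path \<xi>) \<noteq> ereal s"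
        then show "AE \<xi> in M. 0 < h (s, \<xi>) \<longrightarrow> 0 \<le> Z (s, \<xi>)"
          using AE_space
        proof eventually_elim
          fix \<xi> assume *: "passage c x (path \<xi>) \<noteq> ereal s" "\<xi> \<in> space M"
          show "0 < h (s, \<xi>) \<longrightarrow> 0 \<le> Z (s, \<xi>)"
          proof
            assume "0 < h (s, \<xi>)"
            then have "0 < s" "ereal s < passage c x (path \<xi>)" using * by (auto simp: h_def split: if_splits)
            then show "0 \<le> Z (s, \<xi>)" using less_passage_le[OF right_cont_path[OF *(2)], of s c x] by (simp add: Z_def)
          qed
        qed
      qed
    qed
    then have "AE w in density (lborel \<Otimes>\<^sub>M M) h. 0 \<le> Z w" by (subst AE_density) auto
    then show "AE z in M1. 0 \<le> z" unfolding M1_def by (subst AE_distr_iff) auto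
    have "W (z - (c - x)) = 0" if "z < 0" for z using that xc by (intro W0) simp
    then show "AE z in M2. 0 \<le> z" unfolding M2_def
      by (subst AE_density) (auto intro!: AE_I2 simp: not_less[symmetric] simp del: not_less)
    show "AE z in N. 0 \<le> z" unfolding N_def
      by (subst AE_density) (auto intro!: AE_I2 simp: W0 not_less[symmetric] simp del: not_less)
    fix \<theta> assume \<theta>: "?\<Phi> < \<theta>"
    let ?d = "\<psi> \<theta> - q"
    have d: "0 < ?d" using psi_gt(2)[OF \<theta> q] by simp
    note WL = scale_laplace[OF W q \<theta>]
    have l3: "(\<integral>\<^sup>+z. ennreal (exp (- \<theta> * z)) \<partial>N) = ennreal (exp (- ?\<Phi> * (c - x)) * (1 / ?d))"
    proof -
      have "(\<integral>\<^sup>+z. ennreal (exp (- \<theta> * z)) \<partial>N) = ennreal (exp (- ?\<Phi> * (c - x))) * (\<integral>\<^sup>+z. ennreal (W z) * ennreal (exp (- \<theta> * z)) \<partial>lborel)"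
        by (rule i3) measurable
      also have "(\<integral>\<^sup>+z. ennreal (W z) * ennreal (exp (- \<theta> * z)) \<partial>lborel) = ennreal (1 / ?d)"
        unfolding WL[symmetric] by (intro nn_integral_cong mult.commute)
      finally show ?thesis by (simp only: ennreal_mult' exp_ge_zero)
    qed
    then show "(\<integral>\<^sup>+z. ennreal (exp (- \<theta> * z)) \<partial>N) < \<infinity>" by simp
    have l2: "(\<integral>\<^sup>+z. ennreal (exp (- \<theta> * z)) \<partial>M2) = ennreal (exp (- \<theta> * (c - x)) * (1 / ?d))"
    proof -
      have "(\<integral>\<^sup>+z. ennreal (exp (- \<theta> * z)) \<partial>M2) = (\<integral>\<^sup>+z. ennreal (W z) * ennreal (exp (- \<theta> * (z + (c - x)))) \<partial>lborel)"
        by (rule i2) measurable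
      also have "\<dots> = (\<integral>\<^sup>+z. ennreal (exp (- \<theta> * (c - x))) * (ennreal (exp (- \<theta> * z)) * ennreal (W z)) \<partial>lborel)"
      proof (rule nn_integral_cong)
        fix z
        have "exp (- \<theta> * (z + (c - x))) = exp (- \<theta> * (c - x)) * exp (- \<theta> * z)" by (simp add: algebra_simps flip: exp_add)
        then show "ennreal (W z) * ennreal (exp (- \<theta> * (z + (c - x)))) = ennreal (exp (- \<theta> * (c - x))) * (ennreal (exp (- \<theta> * z)) * ennreal (W z))"
          by (simp add: ennreal_mult ac_simps)
      qed
      also have "\<dots> = ennreal (exp (- \<theta> * (c - x))) * ennreal (1 / ?d)"
        unfolding WL[symmetric] by (rule nn_integral_cmult) measurable
      finally show ?thesis by (simp only: ennreal_mult' exp_ge_zero)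
    qed
    have l1: "(\<integral>\<^sup>+z. ennreal (exp (- \<theta> * z)) \<partial>M1)
      = ennreal (exp (- \<theta> * (c - x)) * ((exp ((\<theta> - ?\<Phi>) * (c - x)) - 1) / ?d))"
    proof -
      have "(\<integral>\<^sup>+z. ennreal (exp (- \<theta> * z)) \<partial>M1) = potential q c x (\<lambda>y. ennreal (exp (- \<theta> * (c - y))))"
        by (rule i1) measurable
      also have "\<dots> = ennreal (exp (- \<theta> * c)) * potential q c x (\<lambda>y. ennreal (exp (\<theta> * y)))"
      proof -
        have e: "ennreal (exp (- \<theta> * (c - y))) = ennreal (exp (- \<theta> * c)) * ennreal (exp (\<theta> * y))" for y
          by (simp add: algebra_simps flip: ennreal_mult exp_add)
        have "potential q c x (\<lambda>y. ennreal (exp (- \<theta> * (c - y))))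
          = (\<integral>\<^sup>+s. (\<integral>\<^sup>+\<xi>. ennreal (exp (- \<theta> * c)) * (if 0 < s \<and> ereal s \<le> passage c x (path \<xi>)
              then ennreal (exp (- q * s)) * ennreal (exp (\<theta> * (x + reg (path \<xi>) s))) else 0) \<partial>M) \<partial>lborel)"
          unfolding potential_def e by (intro nn_integral_cong) (auto simp: ac_simps)
        also have "\<dots> = ennreal (exp (- \<theta> * c)) * potential q c x (\<lambda>y. ennreal (exp (\<theta> * y)))"
          unfolding potential_def by (simp add: nn_integral_cmult)
        finally show ?thesis .
      qed
      also have "\<dots> = ennreal (exp (- \<theta> * c)) * (ennreal (exp (\<theta> * x)) * ennreal ((exp ((\<theta> - ?\<Phi>) * (c - x)) - 1) / ?d))"
        unfolding potential_exp[OF q \<theta> xc] ..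
      also have "\<dots> = ennreal (exp (- \<theta> * (c - x)) * ((exp ((\<theta> - ?\<Phi>) * (c - x)) - 1) / ?d))"
        by (simp add: algebra_simps flip: ennreal_mult' exp_add mult.assoc)
      finally show ?thesis .
    qed
    have "0 \<le> (\<theta> - ?\<Phi>) * (c - x)" using \<theta> xc by simp
    then have nn: "0 \<le> exp (- \<theta> * (c - x)) * ((exp ((\<theta> - ?\<Phi>) * (c - x)) - 1) / ?d)" using d by simp
    have "exp (- \<theta> * (c - x)) * ((exp ((\<theta> - ?\<Phi>) * (c - x)) - 1) / ?d) + exp (- \<theta> * (c - x)) * (1 / ?d)
       = exp (- \<theta> * (c - x)) * exp ((\<theta> - ?\<Phi>) * (c - x)) * (1 / ?d)"
    proof -
      have "a * ((b - 1) / d) + a * (1 / d) = a * b * (1 / d)" for a b d :: real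
        by (simp add: diff_divide_distrib right_diff_distrib)
      then show ?thesis .
    qed
    also have "exp (- \<theta> * (c - x)) * exp ((\<theta> - ?\<Phi>) * (c - x)) = exp (- ?\<Phi> * (c - x))"
      by (simp add: algebra_simps flip: exp_add)
    finally show "(\<integral>\<^sup>+z. ennreal (exp (- \<theta> * z)) \<partial>M1) + (\<integral>\<^sup>+z. ennreal (exp (- \<theta> * z)) \<partial>M2) = (\<integral>\<^sup>+z. ennreal (exp (- \<theta> * z)) \<partial>N)"
      unfolding l1 l2 l3 using nn d by (subst ennreal_plus[symmetric]) auto
  qed
  define f where "f z = g (c - z)" for z
  have fm[measurable]: "f \<in> borel_measurable borel" unfolding f_def by measurable
  have refl: "(\<integral>\<^sup>+z. ennreal (W z) * g (a - z) \<partial>lborel) = nn_conv (\<lambda>y. ennreal (W y)) g a" for a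
  proof -
    have "nn_conv (\<lambda>y. ennreal (W y)) g a = (\<integral>\<^sup>+z. (\<lambda>z. ennreal (W (a - z)) * g z) (a + (-1) * z) \<partial>lborel)"
      unfolding nn_conv_def by (subst nn_integral_real_affine[of _ "-1" a]) simp_all
    then show ?thesis by simp
  qed
  have "(\<integral>\<^sup>+z. f z \<partial>M1) + (\<integral>\<^sup>+z. f z \<partial>M2) = (\<integral>\<^sup>+z. f z \<partial>N)"
    by (rule nn_integral_emeasure_add) (use sets eqm fm in \<open>simp_all cong: measurable_cong_sets\<close>)
  then have "potential q c x (\<lambda>y. f (c - y)) + (\<integral>\<^sup>+z. ennreal (W z) * f (z + (c - x)) \<partial>lborel)
    = ennreal (exp (- ?\<Phi> * (c - x))) * (\<integral>\<^sup>+z. ennreal (W z) * f z \<partial>lborel)"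
    unfolding i1[OF fm] i2[OF fm] i3[OF fm] .
  moreover have "c - (z + (c - x)) = x - z" for z by simp
  ultimately show ?thesis unfolding f_def using refl by simp
qed

section \<open>Perturbation of the killing rate\<close>

text \<open>A shift by a variable time evaluates the path at variable times, which calls for
  \<open>reg\<close>; on the sample space \<open>path_shift_reg\<close> identifies the result with
  \<open>path_shift\<close>.\<close>

lemma measurable_path_shift_joint:
  "(\<lambda>z. restrict (\<lambda>u. reg (path (snd z)) (fst z + u) - reg (path (snd z)) (fst z)) {0..}) \<in> measurable (borel \<Otimes>\<^sub>M M) path_space"
  (is "?f \<in> _")
proof -
  have [measurable]: "(\<lambda>z. path (snd z)) \<in> measurable (borel \<Otimes>\<^sub>M M) path_space" by measurable
  have "(\<lambda>z. reg (path (snd z)) (fst z + u) - reg (path (snd z)) (fst z)) \<in> borel_measurable (borel \<Otimes>\<^sub>M M)" for u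
    by measurable
  then have "?f \<in> measurable (borel \<Otimes>\<^sub>M M) (PiM {0..} (\<lambda>_. borel))"
    by (intro measurable_restrict)
  then show ?thesis by (simp add: path_space_def)
qed

lemma path_shift_reg:
  assumes "\<xi> \<in> space M" "0 \<le> s"
  shows "path_shift s (path \<xi>) = restrict (\<lambda>u. reg (path \<xi>) (s + u) - reg (path \<xi>) s) {0..}"
  unfolding path_shift_def using assms by (auto simp: fun_eq_iff reg_eq right_cont_path)

text \<open>Fubini brings the time integral outside; at almost every fixed \<open>s\<close> the
  Markov property then replaces the functional of the shifted path by its mean from the starting
  point \<open>x + X s\<close>.\<close>

lemma potential_markov:
  assumes [measurable]: "k \<in> borel_measurable borel" and G: "(\<lambda>(y, p). G y p) \<in> borel_measurable (borel \<Otimes>\<^sub>M path_space)"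
  shows "(\<integral>\<^sup>+\<xi>. (\<integral>\<^sup>+s\<in>{s. 0 < s \<and> ereal s < passage c x (path \<xi>)}. ennreal (exp (- q * s)) *
       (k (x + path \<xi> s) * G (x + path \<xi> s) (path_shift s (path \<xi>))) \<partial>lborel) \<partial>M)
     = potential q c x (\<lambda>y. k y * (\<integral>\<^sup>+\<xi>. G y (path \<xi>) \<partial>M))"
    and "(\<lambda>\<xi>. \<integral>\<^sup>+s\<in>{s. 0 < s \<and> ereal s < passage c x (path \<xi>)}. ennreal (exp (- q * s)) *
       (k (x + path \<xi> s) * G (x + path \<xi> s) (path_shift s (path \<xi>))) \<partial>lborel) \<in> borel_measurable M"
proof -
  interpret lM: pair_sigma_finite lborel M ..
  define sh where "sh = (\<lambda>s \<xi>. restrict (\<lambda>u. reg (path \<xi>) (s + u) - reg (path \<xi>) s) {0..})"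
  have [measurable]: "(\<lambda>z. sh (fst z) (snd z)) \<in> measurable (borel \<Otimes>\<^sub>M M) path_space"
    using measurable_path_shift_joint by (simp add: sh_def)
  have Gm[measurable]: "(\<lambda>z. G (f z) (g z)) \<in> borel_measurable N"
    if [measurable]: "f \<in> borel_measurable N" "g \<in> measurable N path_space" for f g and N :: "'c measure"
    using measurable_compose[OF measurable_Pair[OF that] G] by simp
  define D where "D = (\<lambda>s \<xi>. if 0 < s \<and> ereal s < passage c x (path \<xi>) then ennreal (exp (- q * s)) *
      (k (x + reg (path \<xi>) s) * G (x + reg (path \<xi>) s) (sh s \<xi>)) else 0)"
  have Dm[measurable]: "(\<lambda>z. D (fst z) (snd z)) \<in> borel_measurable (borel \<Otimes>\<^sub>M M)" unfolding D_def by measurable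
  have Dm': "(\<lambda>(s, \<xi>). D s \<xi>) \<in> borel_measurable (lborel \<Otimes>\<^sub>M M)" using Dm by (simp add: case_prod_beta' cong: measurable_cong_sets)
  have inner: "(\<integral>\<^sup>+s\<in>{s. 0 < s \<and> ereal s < passage c x (path \<xi>)}. ennreal (exp (- q * s)) *
       (k (x + path \<xi> s) * G (x + path \<xi> s) (path_shift s (path \<xi>))) \<partial>lborel) = (\<integral>\<^sup>+s. D s \<xi> \<partial>lborel)"
    if xi: "\<xi> \<in> space M" for \<xi>
  proof (rule nn_integral_cong)
    fix s
    show "ennreal (exp (- q * s)) * (k (x + path \<xi> s) * G (x + path \<xi> s) (path_shift s (path \<xi>))) *
        indicator {s. 0 < s \<and> ereal s < passage c x (path \<xi>)} s = D s \<xi>"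
      using path_shift_reg[OF xi, of s] reg_eq[OF right_cont_path[OF xi], of s]
      by (cases "0 < s") (auto simp: D_def sh_def split: split_indicator)
  qed
  have "(\<lambda>\<xi>. \<integral>\<^sup>+s. D s \<xi> \<partial>lborel) \<in> borel_measurable M"
  proof -
    have "(\<lambda>(\<xi>, s). D s \<xi>) \<in> borel_measurable (M \<Otimes>\<^sub>M lborel)"
      using measurable_compose[OF measurable_pair_swap' Dm'] by (simp add: case_prod_beta')
    then show ?thesis by (rule lborel.borel_measurable_nn_integral)
  qed
  then show "(\<lambda>\<xi>. \<integral>\<^sup>+s\<in>{s. 0 < s \<and> ereal s < passage c x (path \<xi>)}. ennreal (exp (- q * s)) *
       (k (x + path \<xi> s) * G (x + path \<xi> s) (path_shift s (path \<xi>))) \<partial>lborel) \<in> borel_measurable M"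
    by (subst measurable_cong[OF inner])
  have "(\<integral>\<^sup>+\<xi>. (\<integral>\<^sup>+s\<in>{s. 0 < s \<and> ereal s < passage c x (path \<xi>)}. ennreal (exp (- q * s)) *
       (k (x + path \<xi> s) * G (x + path \<xi> s) (path_shift s (path \<xi>))) \<partial>lborel) \<partial>M) = (\<integral>\<^sup>+\<xi>. (\<integral>\<^sup>+s. D s \<xi> \<partial>lborel) \<partial>M)"
    by (rule nn_integral_cong[OF inner])
  also have "\<dots> = (\<integral>\<^sup>+s. (\<integral>\<^sup>+\<xi>. D s \<xi> \<partial>M) \<partial>lborel)"
    by (rule lM.Fubini'[OF Dm'])
  also have "\<dots> = potential q c x (\<lambda>y. k y * (\<integral>\<^sup>+\<xi>. G y (path \<xi>) \<partial>M))"
    unfolding potential_def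
  proof (rule nn_integral_cong_AE, use AE_passage_neq[of c x] in eventually_elim)
    fix s assume ne: "AE \<xi> in M. passage c x (path \<xi>) \<noteq> ereal s"
    show "(\<integral>\<^sup>+\<xi>. D s \<xi> \<partial>M) = (\<integral>\<^sup>+\<xi>. (if 0 < s \<and> ereal s \<le> passage c x (path \<xi>)
      then ennreal (exp (- q * s)) * (k (x + reg (path \<xi>) s) * (\<integral>\<^sup>+\<xi>'. G (x + reg (path \<xi>) s) (path \<xi>') \<partial>M)) else 0) \<partial>M)"
    proof (cases "0 < s")
      case True
      then have s: "0 \<le> s" by simp
      define F where "F y p = ennreal (exp (- q * s)) * (k (x + y) * G (x + y) p)" for y p
      have "(\<integral>\<^sup>+\<xi>. D s \<xi> \<partial>M) = (\<integral>\<^sup>+\<xi>\<in>{\<xi>. ereal s \<le> passage c x (path \<xi>)}. F (X s \<xi>) (path_shift s (path \<xi>)) \<partial>M)"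
      proof (rule nn_integral_cong_AE, use ne AE_space in eventually_elim)
        fix \<xi> assume "passage c x (path \<xi>) \<noteq> ereal s" and xi: "\<xi> \<in> space M"
        then have "ereal s < passage c x (path \<xi>) \<longleftrightarrow> ereal s \<le> passage c x (path \<xi>)" by (auto simp: order_le_less)
        then show "D s \<xi> = F (X s \<xi>) (path_shift s (path \<xi>)) * indicator {\<xi>. ereal s \<le> passage c x (path \<xi>)} \<xi>"
          using True path_shift_reg[OF xi s] reg_path[OF xi s] by (auto simp: D_def F_def sh_def split: split_indicator)
      qed
      also have "\<dots> = (\<integral>\<^sup>+\<xi>\<in>{\<xi>. ereal s \<le> passage c x (path \<xi>)}. (\<integral>\<^sup>+\<xi>'. F (X s \<xi>) (path \<xi>') \<partial>M) \<partial>M)"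
      proof (rule markov[OF s])
        show "indep_future s {\<xi> \<in> space M. ereal s \<le> passage c x (path \<xi>) \<and> X s \<xi> \<in> B}" if "B \<in> sets borel" for B
          by (rule indep_future_alive[OF s that])
        show "(\<lambda>(y, p). F y p) \<in> borel_measurable (borel \<Otimes>\<^sub>M path_space)" unfolding F_def by measurable
      qed
      also have "\<dots> = (\<integral>\<^sup>+\<xi>. (if 0 < s \<and> ereal s \<le> passage c x (path \<xi>)
        then ennreal (exp (- q * s)) * (k (x + reg (path \<xi>) s) * (\<integral>\<^sup>+\<xi>'. G (x + reg (path \<xi>) s) (path \<xi>') \<partial>M)) else 0) \<partial>M)"
      proof (rule nn_integral_cong)
        fix \<xi> assume xi: "\<xi> \<in> space M"
        have "(\<integral>\<^sup>+\<xi>'. F (X s \<xi>) (path \<xi>') \<partial>M) = ennreal (exp (- q * s)) * (k (x + X s \<xi>) * (\<integral>\<^sup>+\<xi>'. G (x + X s \<xi>) (path \<xi>') \<partial>M))"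
          unfolding F_def by (simp add: nn_integral_cmult)
        then show "(\<integral>\<^sup>+\<xi>'. F (X s \<xi>) (path \<xi>') \<partial>M) * indicator {\<xi>. ereal s \<le> passage c x (path \<xi>)} \<xi> =
          (if 0 < s \<and> ereal s \<le> passage c x (path \<xi>)
          then ennreal (exp (- q * s)) * (k (x + reg (path \<xi>) s) * (\<integral>\<^sup>+\<xi>'. G (x + reg (path \<xi>) s) (path \<xi>') \<partial>M)) else 0)"
          using True reg_path[OF xi s] by (auto split: split_indicator)
      qed
      finally show ?thesis .
    qed (simp add: D_def)
  qed
  finally show "(\<integral>\<^sup>+\<xi>. (\<integral>\<^sup>+s\<in>{s. 0 < s \<and> ereal s < passage c x (path \<xi>)}. ennreal (exp (- q * s)) *
       (k (x + path \<xi> s) * G (x + path \<xi> s) (path_shift s (path \<xi>))) \<partial>lborel) \<partial>M)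
     = potential q c x (\<lambda>y. k y * (\<integral>\<^sup>+\<xi>. G y (path \<xi>) \<partial>M))" .
qed

text \<open>The expectation of a pathwise Feynman-Kac identity, in a form that serves the exit and
  the occupation functional alike; \<open>G0\<close> stands for the functional at the constant rate
  \<open>\<phi>\<close>.\<close>

lemma potential_perturbation:
  assumes [measurable]: "\<omega> \<in> borel_measurable borel"
    and G: "(\<lambda>(y, p). G y p) \<in> borel_measurable (borel \<Otimes>\<^sub>M path_space)"
    and G0[measurable]: "(\<lambda>\<xi>. G0 (path \<xi>)) \<in> borel_measurable M"
    and fk: "\<And>p. right_cont p \<Longrightarrow> G x p
     + (\<integral>\<^sup>+s\<in>{s. 0 < s \<and> ereal s < passage c x p}. ennreal (exp (- \<phi> * s)) *
           (ennreal (\<omega> (x + p s) - \<phi>) * G (x + p s) (path_shift s p)) \<partial>lborel)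
   = G0 p
     + (\<integral>\<^sup>+s\<in>{s. 0 < s \<and> ereal s < passage c x p}. ennreal (exp (- \<phi> * s)) *
           (ennreal (\<phi> - \<omega> (x + p s)) * G (x + p s) (path_shift s p)) \<partial>lborel)"
  shows "(\<integral>\<^sup>+\<xi>. G x (path \<xi>) \<partial>M) + potential \<phi> c x (\<lambda>y. ennreal (\<omega> y - \<phi>) * (\<integral>\<^sup>+\<xi>. G y (path \<xi>) \<partial>M))
     = (\<integral>\<^sup>+\<xi>. G0 (path \<xi>) \<partial>M) + potential \<phi> c x (\<lambda>y. ennreal (\<phi> - \<omega> y) * (\<integral>\<^sup>+\<xi>. G y (path \<xi>) \<partial>M))"
proof -
  have k: "(\<lambda>y. ennreal (\<omega> y - \<phi>)) \<in> borel_measurable borel" "(\<lambda>y. ennreal (\<phi> - \<omega> y)) \<in> borel_measurable borel"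
    by measurable
  have [measurable]: "(\<lambda>\<xi>. G x (path \<xi>)) \<in> borel_measurable M"
    using measurable_compose[OF measurable_Pair[OF measurable_const measurable_path] G] by simp
  note m = potential_markov(2)[OF k(1) G, where c=c and x=x and q=\<phi>] potential_markov(2)[OF k(2) G, where c=c and x=x and q=\<phi>]
  show ?thesis
    unfolding potential_markov(1)[OF k(1) G, symmetric] potential_markov(1)[OF k(2) G, symmetric]
    by (subst (1 2) nn_integral_add[symmetric]) (use m fk[OF right_cont_path] in \<open>auto intro!: nn_integral_cong\<close>)
qed

lemma expectation_exit_functional_const:
  "(\<integral>\<^sup>+\<xi>. exit_functional (\<lambda>_. q) c x (path \<xi>) \<partial>M) = ennreal (exit_laplace q c x)" if q: "0 \<le> q"
proof -
  let ?e = "\<lambda>\<xi>. if passage c x (path \<xi>) < \<infinity> then exp (- q * real_of_ereal (passage c x (path \<xi>))) else 0"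
  have "exit_functional (\<lambda>_. q) c x (path \<xi>) = ennreal (?e \<xi>)" for \<xi>
  proof (cases "passage c x (path \<xi>)")
    case (real T)
    moreover have "0 \<le> T" using passage_nonneg[of c x "path \<xi>"] real by simp
    ultimately show ?thesis
      by (simp add: exit_functional_def cost_ereal set_lebesgue_integral_def mult.commute)
  qed (use passage_nonneg[of c x "path \<xi>"] in \<open>simp_all add: exit_functional_def\<close>)
  moreover have "integrable M ?e"
    using q passage_nonneg by (intro integrable_const_bound[where B=1] AE_I2) (auto simp: real_of_ereal_pos)
  ultimately show ?thesis
    unfolding exit_laplace_def by (simp only:) (rule nn_integral_eq_integral, auto)
qed

lemma expectation_occupation_functional_const:
  assumes f[measurable]: "f \<in> borel_measurable borel"
  shows "(\<integral>\<^sup>+\<xi>. occupation_functional (\<lambda>_. q) f c x (path \<xi>) \<partial>M) = potential q c x f"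
proof -
  have one: "(\<lambda>(y, p). 1 :: ennreal) \<in> borel_measurable (borel \<Otimes>\<^sub>M path_space)" by simp
  have "occupation_functional (\<lambda>_. q) f c x (path \<xi>) =
     (\<integral>\<^sup>+s\<in>{s. 0 < s \<and> ereal s < passage c x (path \<xi>)}. ennreal (exp (- q * s)) * (f (x + path \<xi> s) * 1) \<partial>lborel)"
    if "\<xi> \<in> space M" for \<xi>
    unfolding occupation_functional_def
    by (rule nn_integral_cong)
       (use that in \<open>auto simp: cost_ereal set_lebesgue_integral_def mult.commute[of q] reg_eq right_cont_path split: split_indicator\<close>)
  then have "(\<integral>\<^sup>+\<xi>. occupation_functional (\<lambda>_. q) f c x (path \<xi>) \<partial>M) =
     (\<integral>\<^sup>+\<xi>. (\<integral>\<^sup>+s\<in>{s. 0 < s \<and> ereal s < passage c x (path \<xi>)}. ennreal (exp (- q * s)) * (f (x + path \<xi> s) * 1) \<partial>lborel) \<partial>M)"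
    by (rule nn_integral_cong)
  also have "\<dots> = potential q c x (\<lambda>y. f y * (\<integral>\<^sup>+\<xi>. 1 \<partial>M))"
    by (rule potential_markov(1)[OF f one])
  finally show ?thesis by (simp add: emeasure_space_1)
qed

end

section \<open>Volterra equations with a scale function kernel\<close>

lemma scale_function_simps:
  assumes "is_scale_function \<psi> q W"
  shows "0 \<le> W y" "y < 0 \<Longrightarrow> W y = 0" "y \<le> z \<Longrightarrow> W y \<le> W z"
proof -
  have 1: "0 \<le> W y" for y using assms by (auto simp: is_scale_function_def)
  have 2: "y < 0 \<Longrightarrow> W y = 0" for y using assms by (auto simp: is_scale_function_def)
  show "0 \<le> W y" "y < 0 \<Longrightarrow> W y = 0" by (fact 1, fact 2)
  show "W y \<le> W z" if "y \<le> z"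
  proof (cases "y < 0")
    case False
    then show ?thesis using assms that by (auto simp: is_scale_function_def intro: mono_onD)
  qed (use 1 2 in simp)
qed

lemma integrable_bounded_support:
  fixes f :: "real \<Rightarrow> real"
  assumes "f \<in> borel_measurable borel" "\<And>z. z \<in> {a..b} \<Longrightarrow> \<bar>f z\<bar> \<le> C" "\<And>z. z \<notin> {a..b} \<Longrightarrow> f z = 0"
  shows "integrable lborel f"
proof -
  have "set_integrable lborel {a..b} f" by (rule set_integrable_bounded) (use assms in auto)
  moreover have "(\<lambda>z. indicator {a..b} z *\<^sub>R f z) = f" using assms(3) by (auto simp: fun_eq_iff split: split_indicator)
  ultimately show ?thesis by (simp add: set_integrable_def)
qed

text \<open>\<open>W\<close> vanishes on the negative half-line and so cuts the integral at
  \<open>x\<close> by itself. For \<open>x < y\<close> the oriented integral and the integral over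
  the line are both 0.\<close>

lemma interval_integral_scale_eq:
  assumes W: "is_scale_function \<psi> q W" and [measurable]: "g \<in> borel_measurable borel"
  shows "(LBINT z=ereal y..ereal x. W (x - z) * g z) = (\<integral>z. W (x - z) * (indicator {y..} z * g z) \<partial>lborel)"
proof -
  have [measurable]: "W \<in> borel_measurable borel" by (rule real_measurable_scale[OF W])
  note W0 = scale_function_simps(2)[OF W]
  have ne: "AE z in lborel. z \<noteq> x" "AE z in lborel. z \<noteq> y" by (rule AE_lborel_singleton)+
  show ?thesis
  proof (cases "y \<le> x")
    case True
    have "(LBINT z:{y<..<x}. W (x - z) * g z) = (\<integral>z. W (x - z) * (indicator {y..} z * g z) \<partial>lborel)"
      unfolding set_lebesgue_integral_def
    proof (rule integral_cong_AE)
      show "AE z in lborel. indicator {y<..<x} z *\<^sub>R (W (x - z) * g z) = W (x - z) * (indicator {y..} z * g z)"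
        using ne by eventually_elim (auto simp: W0 split: split_indicator)
    qed measurable
    then show ?thesis using True by (simp add: interval_lebesgue_integral_def)
  next
    case False
    have "(LBINT z:{x<..<y}. W (x - z) * g z) = 0"
      unfolding set_lebesgue_integral_def by (intro integral_eq_zero_AE AE_I2) (auto simp: W0 split: split_indicator)
    moreover have "(\<integral>z. W (x - z) * (indicator {y..} z * g z) \<partial>lborel) = 0"
      using False by (intro integral_eq_zero_AE AE_I2) (auto simp: W0 split: split_indicator)
    ultimately show ?thesis using False by (simp add: interval_lebesgue_integral_def)
  qed
qed

text \<open>For \<open>a \<le> z \<le> x \<le> c\<close> monotonicity of \<open>W\<close> bounds the
  kernel \<open>W (x - z) * k z\<close> by \<open>W (c - a) * K\<close>, so
  \<open>volterra_homogeneous_zero\<close> applies; below \<open>a\<close> the integrand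
  vanishes.\<close>

lemma volterra_scale_zero:
  assumes W: "is_scale_function \<psi> q W"
    and [measurable]: "k \<in> borel_measurable borel" "d \<in> borel_measurable borel"
    and k: "\<And>z. z \<in> {a..c} \<Longrightarrow> \<bar>k z\<bar> \<le> K" and d: "\<And>z. z \<in> {a..c} \<Longrightarrow> \<bar>d z\<bar> \<le> S"
    and eq: "\<And>x. x \<le> c \<Longrightarrow> d x = (\<integral>z. W (x - z) * (indicator {a..} z * k z * d z) \<partial>lborel)"
    and xc: "x \<le> c"
  shows "d x = 0"
proof (cases "x < a")
  case True
  then show ?thesis unfolding eq[OF xc] using scale_function_simps(2)[OF W]
    by (intro integral_eq_zero_AE AE_I2) (auto split: split_indicator)
next
  case False
  have [measurable]: "W \<in> borel_measurable borel" by (rule real_measurable_scale[OF W])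
  note W0 = scale_function_simps[OF W]
  have K: "0 \<le> K" using k[of a] False xc by (intro order_trans[OF abs_ge_zero]) auto
  have S: "0 \<le> S" using d[of a] False xc by (intro order_trans[OF abs_ge_zero]) auto
  \<comment> \<open>The added 1 keeps the constant positive when the kernel bound is 0.\<close>
  define C where "C = W (c - a) * K + 1"
  have C: "0 < C" using K W0(1)[of "c - a"] by (simp add: C_def add_nonneg_pos)
  show ?thesis
  proof (rule volterra_homogeneous_zero[OF C S d])
    fix x assume x: "x \<in> {a..c}"
    let ?f = "\<lambda>z. W (x - z) * (indicator {a..} z * k z * d z)"
    have fle: "\<bar>?f z\<bar> \<le> indicator {a..x} z * (C * \<bar>d z\<bar>)" for z
    proof (cases "z \<in> {a..x}")
      case True
      have "W (x - z) * \<bar>k z\<bar> \<le> W (c - a) * K"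
        using True x k[of z] W0 by (intro mult_mono) auto
      then have "W (x - z) * \<bar>k z\<bar> * \<bar>d z\<bar> \<le> C * \<bar>d z\<bar>"
        unfolding C_def by (intro mult_right_mono) auto
      then show ?thesis using True W0(1) by (simp add: abs_mult mult.assoc)
    next
      case False
      then show ?thesis using W0(2)[of "x - z"] by (auto split: split_indicator)
    qed
    have gb: "\<bar>indicator {a..x} z * (C * \<bar>d z\<bar>)\<bar> \<le> C * S" if "z \<in> {a..x}" for z
      using that d[of z] x C by (auto simp: abs_mult intro!: mult_left_mono)
    have gi: "integrable lborel (\<lambda>z. indicator {a..x} z * (C * \<bar>d z\<bar>))"
      by (rule integrable_bounded_support[OF _ gb]) auto
    have fi: "integrable lborel ?f"
      by (rule Bochner_Integration.integrable_bound[OF gi]) (use fle in \<open>auto intro: order_trans[OF _ abs_ge_self]\<close>)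
    have "\<bar>d x\<bar> \<le> (\<integral>z. \<bar>?f z\<bar> \<partial>lborel)" unfolding eq[OF atLeastAtMost_iff[THEN iffD1, OF x, THEN conjunct2]] by (rule integral_abs_bound)
    also have "\<dots> \<le> (\<integral>z. indicator {a..x} z * (C * \<bar>d z\<bar>) \<partial>lborel)"
      using fi gi fle by (intro integral_mono) auto
    also have "\<dots> = C * (LBINT z:{a..x}. \<bar>d z\<bar>)"
      unfolding set_lebesgue_integral_def by (subst integral_mult_right_zero[symmetric]) (simp add: ac_simps)
    finally show "\<bar>d x\<bar> \<le> C * (LBINT z:{a..x}. \<bar>d z\<bar>)" .
  qed (use False xc in auto)
qed

lemma omega_H_equation:
  assumes H: "is_omega_H_function \<psi> W \<phi> \<omega> \<H>" and W: "is_scale_function \<psi> q W"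
    and [measurable]: "\<omega> \<in> borel_measurable borel"
  shows "\<H> x = exp (right_inverse \<psi> \<phi> * x) + (\<integral>z. W (x - z) * (indicator {0..} z * (\<omega> z - \<phi>) * \<H> z) \<partial>lborel)"
proof -
  have [measurable]: "\<H> \<in> borel_measurable borel" using H by (simp add: is_omega_H_function_def)
  have "\<H> x = exp (right_inverse \<psi> \<phi> * x) + (LBINT z=0..ereal x. W (x - z) * (\<omega> z - \<phi>) * \<H> z)"
    using H unfolding is_omega_H_function_def by blast
  also have "(LBINT z=0..ereal x. W (x - z) * (\<omega> z - \<phi>) * \<H> z) = (LBINT z=ereal 0..ereal x. W (x - z) * ((\<omega> z - \<phi>) * \<H> z))"
    unfolding zero_ereal_def mult.assoc ..
  also have "(LBINT z=ereal 0..ereal x. W (x - z) * ((\<omega> z - \<phi>) * \<H> z)) = (\<integral>z. W (x - z) * (indicator {0..} z * ((\<omega> z - \<phi>) * \<H> z)) \<partial>lborel)"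
    by (rule interval_integral_scale_eq[OF W]) measurable
  finally show ?thesis by (simp only: mult.assoc)
qed

lemma locally_bounded_Icc:
  assumes "locally_bounded f"
  obtains B where "0 \<le> B" "\<And>z. z \<in> {a..b} \<Longrightarrow> \<bar>f z\<bar> \<le> B"
proof -
  have "bounded (f ` {a..b})" using assms by (simp add: locally_bounded_def)
  then obtain B where "\<And>z. z \<in> {a..b} \<Longrightarrow> \<bar>f z\<bar> \<le> B" unfolding bounded_iff by fastforce
  then show ?thesis by (intro that[of "max B 0"]) (auto intro: order_trans[OF _ max.cobounded1])
qed

text \<open>The integrand lives on \<open>{a..x}\<close>: beyond \<open>x\<close> the kernel
  vanishes, and below \<open>a\<close> the nonpositive \<open>h\<close> becomes 0 in
  \<open>ennreal\<close>. There it is bounded, so the convolution is a finite real integral, in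
  which \<open>max 0 (h z)\<close> repeats the truncation by \<open>ennreal\<close>.\<close>

lemma nn_conv_scale_real:
  assumes W: "is_scale_function \<psi> q W"
    and [measurable]: "h \<in> borel_measurable borel" "A \<in> borel_measurable borel"
    and A: "\<And>z. z \<in> {a..x} \<Longrightarrow> A z = ennreal (u z)" and [measurable]: "u \<in> borel_measurable borel"
    and u: "\<And>z. 0 \<le> u z" "\<And>z. z \<in> {a..x} \<Longrightarrow> u z \<le> S"
    and h: "\<And>z. z < a \<Longrightarrow> h z \<le> 0" "\<And>z. z \<in> {a..x} \<Longrightarrow> h z \<le> K"
  shows "integrable lborel (\<lambda>z. W (x - z) * (max 0 (h z) * u z))"
    and "nn_conv (\<lambda>y. ennreal (W y)) (\<lambda>z. ennreal (h z) * A z) x = ennreal (\<integral>z. W (x - z) * (max 0 (h z) * u z) \<partial>lborel)"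
proof -
  have [measurable]: "W \<in> borel_measurable borel" by (rule real_measurable_scale[OF W])
  note W0 = scale_function_simps[OF W]
  let ?f = "\<lambda>z. W (x - z) * (max 0 (h z) * u z)"
  show i: "integrable lborel ?f"
  proof (rule integrable_bounded_support[where a=a and b=x])
    show "?f \<in> borel_measurable borel" by measurable
    show "\<bar>?f z\<bar> \<le> W (x - a) * (max 0 K * S)" if z: "z \<in> {a..x}" for z
    proof -
      have "max 0 (h z) * u z \<le> max 0 K * S" using u[of z] h(2)[of z] z by (intro mult_mono) auto
      moreover have "W (x - z) \<le> W (x - a)" using z by (intro W0) auto
      ultimately have "?f z \<le> W (x - a) * (max 0 K * S)" using u(1)[of z] W0(1) by (intro mult_mono[OF _ \<open>max 0 (h z) * u z \<le> max 0 K * S\<close>]) auto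
      then show ?thesis using u(1)[of z] W0(1) by (simp add: abs_mult)
    qed
    show "?f z = 0" if "z \<notin> {a..x}" for z using that h(1)[of z] W0(2)[of "x - z"] by (cases "z < a") auto
  qed
  have "nn_conv (\<lambda>y. ennreal (W y)) (\<lambda>z. ennreal (h z) * A z) x = (\<integral>\<^sup>+z. ennreal (?f z) \<partial>lborel)"
    unfolding nn_conv_def
  proof (rule nn_integral_cong)
    fix z
    have m: "ennreal (max 0 (h z)) = ennreal (h z)" by (simp add: max_def ennreal_neg)
    show "ennreal (W (x - z)) * (ennreal (h z) * A z) = ennreal (?f z)"
    proof (cases "z \<in> {a..x}")
      case True
      then show ?thesis using W0(1) u(1) by (simp add: A m ennreal_mult)
    next
      case False
      then show ?thesis using h(1)[of z] W0(2)[of "x - z"] by (cases "z < a") (auto simp: ennreal_neg)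
    qed
  qed
  also have "\<dots> = ennreal (\<integral>z. ?f z \<partial>lborel)"
    using i W0(1) u(1) by (intro nn_integral_eq_integral) auto
  finally show "nn_conv (\<lambda>y. ennreal (W y)) (\<lambda>z. ennreal (h z) * A z) x = ennreal (\<integral>z. ?f z \<partial>lborel)" .
qed

text \<open>Boundedness of \<open>A\<close> makes all terms finite, so that
  \<open>potential_formula\<close> can be used with subtraction. The part with
  \<open>W (x - z)\<close> is the Volterra operator; the part with \<open>W (c - z)\<close> depends
  on \<open>x\<close> only through \<open>exp (- \<Phi> (c - x))\<close> and is collected in
  \<open>\<kappa>\<close>. At \<open>x = c\<close> the two parts cancel, whence the value
  there.\<close>

lemma (in spectrally_negative) resolvent_volterra:
  assumes W: "is_scale_function \<psi> \<phi> W" and \<phi>: "0 \<le> \<phi>"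
    and wm[measurable]: "\<omega> \<in> borel_measurable borel" and w: "\<And>z. z \<in> {0..c} \<Longrightarrow> \<bar>\<omega> z\<bar> \<le> K" "\<And>z. z \<le> 0 \<Longrightarrow> \<omega> z = \<phi>"
    and Am[measurable]: "A \<in> borel_measurable borel" and A: "\<And>z. z \<le> c \<Longrightarrow> A z \<le> ennreal S" and S: "0 \<le> S"
    and b: "\<And>x. x \<le> c \<Longrightarrow> 0 \<le> b x"
    and eq: "\<And>x. x \<le> c \<Longrightarrow> A x + potential \<phi> c x (\<lambda>y. ennreal (\<omega> y - \<phi>) * A y) = ennreal (b x) + potential \<phi> c x (\<lambda>y. ennreal (\<phi> - \<omega> y) * A y)"
  obtains \<kappa> where "\<And>x. x \<le> c \<Longrightarrow> enn2real (A x) = b x + exp (- right_inverse \<psi> \<phi> * (c - x)) * \<kappa>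
       + (\<integral>z. W (x - z) * (indicator {0..} z * (\<omega> z - \<phi>) * enn2real (A z)) \<partial>lborel)"
     "enn2real (A c) = b c"
proof -
  define a where "a z = enn2real (A z)" for z
  have [measurable]: "a \<in> borel_measurable borel" unfolding a_def by measurable
  have Aa: "A z = ennreal (a z)" if "z \<le> c" for z
    unfolding a_def using A[OF that] by (intro ennreal_enn2real[symmetric]) (auto simp: le_less_trans ennreal_less_top)
  have a0: "0 \<le> a z" for z by (simp add: a_def)
  have aS: "a z \<le> S" if "z \<le> c" for z using A[OF that] unfolding Aa[OF that] using S by simp
  define v where "v h x = (\<integral>z. W (x - z) * (max 0 (h z) * a z) \<partial>lborel)" for h x
  let ?p = "\<lambda>x. exp (- right_inverse \<psi> \<phi> * (c - x))"
  have v0: "0 \<le> v h x" for h x unfolding v_def using scale_function_simps(1)[OF W] a0 by (intro integral_nonneg_AE AE_I2) auto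
  have key: "integrable lborel (\<lambda>z. W (x - z) * (max 0 (h z) * a z)) \<and>
     v h x \<le> ?p x * v h c \<and>
     potential \<phi> c x (\<lambda>y. ennreal (h y) * A y) = ennreal (?p x * v h c - v h x)"
    if x: "x \<le> c" and [measurable]: "h \<in> borel_measurable borel" and h: "\<And>z. z \<le> 0 \<Longrightarrow> h z = 0" "\<And>z. z \<in> {0..c} \<Longrightarrow> h z \<le> K + \<phi>" for x h
  proof -
    have nc: "integrable lborel (\<lambda>z. W (x - z) * (max 0 (h z) * a z)) \<and> nn_conv (\<lambda>y. ennreal (W y)) (\<lambda>z. ennreal (h z) * A z) x = ennreal (v h x)" if "x \<le> c" for x
      unfolding v_def
      using nn_conv_scale_real[OF W, where h=h and A=A and u=a and a=0 and x=x and S=S and K="K + \<phi>"] that Aa aS a0 h by auto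
    have "potential \<phi> c x (\<lambda>y. ennreal (h y) * A y) + ennreal (v h x) = ennreal (?p x) * ennreal (v h c)"
      using potential_formula[OF \<phi> x W, of "\<lambda>y. ennreal (h y) * A y"] nc[OF x] nc[OF order_refl] by simp
    then have e: "potential \<phi> c x (\<lambda>y. ennreal (h y) * A y) + ennreal (v h x) = ennreal (?p x * v h c)"
      using v0 by (simp add: ennreal_mult)
    then have "ennreal (v h x) \<le> ennreal (?p x * v h c)" by (metis add.commute le_iff_add)
    then have le: "v h x \<le> ?p x * v h c" using v0[of h c] by simp
    have "potential \<phi> c x (\<lambda>y. ennreal (h y) * A y) = (potential \<phi> c x (\<lambda>y. ennreal (h y) * A y) + ennreal (v h x)) - ennreal (v h x)"
      by simp
    also have "\<dots> = ennreal (?p x * v h c - v h x)" unfolding e using v0 by (simp add: ennreal_minus)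
    finally show ?thesis using nc[OF x] le by simp
  qed
  let ?hp = "\<lambda>y. \<omega> y - \<phi>" and ?hm = "\<lambda>y. \<phi> - \<omega> y"
  have hK: "\<omega> z - \<phi> \<le> K + \<phi>" "\<phi> - \<omega> z \<le> K + \<phi>" if "z \<in> {0..c}" for z
    using w(1)[OF that] \<phi> by linarith+
  define \<kappa> where "\<kappa> = v ?hm c - v ?hp c"
  have main: "a x = b x + ?p x * \<kappa> + (v ?hp x - v ?hm x)" if x: "x \<le> c" for x
  proof -
    have p: "v ?hp x \<le> ?p x * v ?hp c \<and> potential \<phi> c x (\<lambda>y. ennreal (?hp y) * A y) = ennreal (?p x * v ?hp c - v ?hp x)"
      using key[OF x, of ?hp] w(2) hK by auto
    have m: "v ?hm x \<le> ?p x * v ?hm c \<and> potential \<phi> c x (\<lambda>y. ennreal (?hm y) * A y) = ennreal (?p x * v ?hm c - v ?hm x)"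
      using key[OF x, of ?hm] w(2) hK by auto
    have "ennreal (a x) + ennreal (?p x * v ?hp c - v ?hp x) = ennreal (b x) + ennreal (?p x * v ?hm c - v ?hm x)"
      using eq[OF x] p m Aa[OF x] by simp
    then have "ennreal (a x + (?p x * v ?hp c - v ?hp x)) = ennreal (b x + (?p x * v ?hm c - v ?hm x))"
      using p m a0 b[OF x] by (simp flip: ennreal_plus)
    then have "a x + (?p x * v ?hp c - v ?hp x) = b x + (?p x * v ?hm c - v ?hm x)"
      using p m a0[of x] b[OF x] by (subst (asm) ennreal_inj) auto
    then show ?thesis by (simp add: \<kappa>_def algebra_simps)
  qed
  have diff: "v ?hp x - v ?hm x = (\<integral>z. W (x - z) * (indicator {0..} z * (\<omega> z - \<phi>) * a z) \<partial>lborel)" if x: "x \<le> c" for x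
  proof -
    have "v ?hp x - v ?hm x = (\<integral>z. W (x - z) * (max 0 (?hp z) * a z) - W (x - z) * (max 0 (?hm z) * a z) \<partial>lborel)"
      unfolding v_def using key[OF x, of ?hp] key[OF x, of ?hm] w(2) hK
      by (intro Bochner_Integration.integral_diff[symmetric]) auto
    also have "\<dots> = (\<integral>z. W (x - z) * (indicator {0..} z * (\<omega> z - \<phi>) * a z) \<partial>lborel)"
    proof (rule Bochner_Integration.integral_cong[OF refl])
      fix z
      \<comment> \<open>The two truncations recombine to \<open>\<omega> - \<phi>\<close>, which is
        0 for \<open>z \<le> 0\<close>; hence the indicator.\<close>
      have "max 0 (\<omega> z - \<phi>) - max 0 (\<phi> - \<omega> z) = indicator {0..} z * (\<omega> z - \<phi>)"
        using w(2)[of z] by (auto simp: max_def split: split_indicator)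
      then show "W (x - z) * (max 0 (?hp z) * a z) - W (x - z) * (max 0 (?hm z) * a z) = W (x - z) * (indicator {0..} z * (\<omega> z - \<phi>) * a z)"
        by (simp flip: right_diff_distrib left_diff_distrib)
    qed
    finally show ?thesis .
  qed
  show ?thesis
  proof (rule that)
    show "enn2real (A x) = b x + ?p x * \<kappa> + (\<integral>z. W (x - z) * (indicator {0..} z * (\<omega> z - \<phi>) * enn2real (A z)) \<partial>lborel)" if "x \<le> c" for x
      using main[OF that] diff[OF that] by (simp add: a_def)
    show "enn2real (A c) = b c" using main[OF order_refl] by (simp add: \<kappa>_def a_def)
  qed
qed

lemma integrable_scale_conv:
  assumes W: "is_scale_function \<psi> q W"
    and [measurable]: "k \<in> borel_measurable borel" "u \<in> borel_measurable borel"
    and k: "\<And>z. z \<in> {a..c} \<Longrightarrow> \<bar>k z\<bar> \<le> K" and u: "\<And>z. z \<in> {a..c} \<Longrightarrow> \<bar>u z\<bar> \<le> S" and xc: "x \<le> c"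
  shows "integrable lborel (\<lambda>z. W (x - z) * (indicator {a..} z * k z * u z))"
proof (rule integrable_bounded_support[where a=a and b=x])
  have [measurable]: "W \<in> borel_measurable borel" by (rule real_measurable_scale[OF W])
  note W0 = scale_function_simps[OF W]
  show "(\<lambda>z. W (x - z) * (indicator {a..} z * k z * u z)) \<in> borel_measurable borel" by measurable
  show "\<bar>W (x - z) * (indicator {a..} z * k z * u z)\<bar> \<le> W (x - a) * (K * S)" if z: "z \<in> {a..x}" for z
  proof -
    have zc: "z \<in> {a..c}" using z xc by auto
    have "\<bar>k z\<bar> * \<bar>u z\<bar> \<le> K * S"
      using k[OF zc] u[OF zc] by (rule mult_mono) (use k[OF zc] in auto)
    moreover have "W (x - z) \<le> W (x - a)" using z by (intro W0) auto
    ultimately have "W (x - z) * (\<bar>k z\<bar> * \<bar>u z\<bar>) \<le> W (x - a) * (K * S)"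
      using W0(1) by (intro mult_mono[OF _ \<open>\<bar>k z\<bar> * \<bar>u z\<bar> \<le> K * S\<close>]) auto
    then show ?thesis using z W0(1) by (simp add: abs_mult)
  qed
  show "W (x - z) * (indicator {a..} z * k z * u z) = 0" if "z \<notin> {a..x}" for z
    using that W0(2)[of "x - z"] by (cases "z < a") auto
qed

text \<open>\<open>\<H>\<close> solves the same equation with forcing \<open>exp (\<Phi> x)\<close>,
  so \<open>u - L * \<H>\<close> is a bounded solution of the homogeneous one.\<close>

lemma volterra_multiple_of_H:
  assumes W: "is_scale_function \<psi> q W" and H: "is_omega_H_function \<psi> W \<phi> \<omega> \<H>"
    and [measurable]: "\<omega> \<in> borel_measurable borel" "u \<in> borel_measurable borel"
    and w: "\<And>z. z \<in> {0..c} \<Longrightarrow> \<bar>\<omega> z\<bar> \<le> K" and u: "\<And>z. z \<in> {0..c} \<Longrightarrow> \<bar>u z\<bar> \<le> S"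
    and eq: "\<And>x. x \<le> c \<Longrightarrow> u x = L * exp (right_inverse \<psi> \<phi> * x) + (\<integral>z. W (x - z) * (indicator {0..} z * (\<omega> z - \<phi>) * u z) \<partial>lborel)"
    and xc: "x \<le> c"
  shows "u x = L * \<H> x"
proof -
  have Hm[measurable]: "\<H> \<in> borel_measurable borel" and Hb: "locally_bounded \<H>" using H by (auto simp: is_omega_H_function_def)
  obtain B where B: "0 \<le> B" "\<And>z. z \<in> {0..c} \<Longrightarrow> \<bar>\<H> z\<bar> \<le> B" using locally_bounded_Icc[OF Hb, of 0 c] by blast
  have kb: "\<bar>\<omega> z - \<phi>\<bar> \<le> K + \<bar>\<phi>\<bar>" if "z \<in> {0..c}" for z using w[OF that] by linarith
  have km: "(\<lambda>z. \<omega> z - \<phi>) \<in> borel_measurable borel" by measurable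
  have "u x - L * \<H> x = 0"
  proof (rule volterra_scale_zero[OF W km _ kb _ _ xc, where d="\<lambda>x. u x - L * \<H> x"])
    show "(\<lambda>x. u x - L * \<H> x) \<in> borel_measurable borel" by measurable
    show "\<bar>u z - L * \<H> z\<bar> \<le> S + \<bar>L\<bar> * B" if "z \<in> {0..c}" for z
    proof -
      have "\<bar>u z - L * \<H> z\<bar> \<le> \<bar>u z\<bar> + \<bar>L * \<H> z\<bar>" by (rule abs_triangle_ineq4)
      also have "\<bar>L * \<H> z\<bar> \<le> \<bar>L\<bar> * B" unfolding abs_mult using B(2)[OF that] by (intro mult_left_mono) auto
      finally show ?thesis using u[OF that] by linarith
    qed
    fix x assume x: "x \<le> c"
    let ?I = "\<lambda>u. \<integral>z. W (x - z) * (indicator {0..} z * (\<omega> z - \<phi>) * u z) \<partial>lborel"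
    note iu = integrable_scale_conv[OF W km _ kb u x]
    note iH = integrable_scale_conv[OF W km Hm kb B(2) x]
    have "?I u - L * ?I \<H> = (\<integral>z. W (x - z) * (indicator {0..} z * (\<omega> z - \<phi>) * u z) - L * (W (x - z) * (indicator {0..} z * (\<omega> z - \<phi>) * \<H> z)) \<partial>lborel)"
      using iu iH by simp
    also have "\<dots> = ?I (\<lambda>z. u z - L * \<H> z)"
      by (intro Bochner_Integration.integral_cong) (auto simp: algebra_simps)
    finally have I: "?I u - L * ?I \<H> = ?I (\<lambda>z. u z - L * \<H> z)" .
    have "u x = L * exp (right_inverse \<psi> \<phi> * x) + ?I u" by (rule eq[OF x])
    moreover have "L * \<H> x = L * exp (right_inverse \<psi> \<phi> * x) + L * ?I \<H>"
      unfolding distrib_left[symmetric] by (rule arg_cong[OF omega_H_equation[OF H W]]) measurable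
    ultimately show "u x - L * \<H> x = ?I (\<lambda>z. u z - L * \<H> z)" using I by linarith
  qed
  then show ?thesis by simp
qed

lemma cost_nonneg: "(\<And>y. 0 \<le> \<omega> y) \<Longrightarrow> 0 \<le> cost \<omega> x p T"
  unfolding cost_def set_lebesgue_integral_def by (intro integral_nonneg_AE AE_I2) simp

text \<open>At the constant rate \<open>\<phi>\<close> the mean is
  \<open>exp (- \<Phi> (c - x))\<close>, a multiple of \<open>exp (\<Phi> x)\<close>, so the
  perturbed mean is a multiple of \<open>\<H>\<close>. Its value at \<open>c\<close> is 1, which
  both fixes the multiple and shows \<open>\<H> c \<noteq> 0\<close>.\<close>

lemma (in spectrally_negative) exit_identity:
  assumes W: "is_scale_function \<psi> \<phi> W" and \<phi>: "0 \<le> \<phi>" and H: "is_omega_H_function \<psi> W \<phi> \<omega> \<H>"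
    and wm[measurable]: "\<omega> \<in> borel_measurable borel" and w: "\<And>y. 0 \<le> \<omega> y" "locally_bounded \<omega>" "\<And>y. y \<le> 0 \<Longrightarrow> \<omega> y = \<phi>"
    and xc: "x \<le> c"
  shows "\<H> c \<noteq> 0" "(\<integral>\<^sup>+\<xi>. exit_functional \<omega> c x (path \<xi>) \<partial>M) = ennreal (\<H> x / \<H> c)" "0 \<le> \<H> x / \<H> c"
proof -
  obtain B where B: "0 \<le> B" "\<And>z. z \<in> {0..c} \<Longrightarrow> \<bar>\<omega> z\<bar> \<le> B" using locally_bounded_Icc[OF w(2), of 0 c] by blast
  have K: "\<bar>\<omega> y\<bar> \<le> max B \<phi>" if "y \<le> c" for y
    using B(2)[of y] w(3)[of y] \<phi> that by (cases "y \<le> 0") auto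
  define A where "A y = (\<integral>\<^sup>+\<xi>. exit_functional \<omega> c y (path \<xi>) \<partial>M)" for y
  have Am[measurable]: "A \<in> borel_measurable borel" unfolding A_def by measurable
  have A1: "A y \<le> ennreal 1" for y
  proof -
    have "exit_functional \<omega> c y p \<le> 1" for p using cost_nonneg[OF w(1)] by (simp add: exit_functional_def)
    then have "A y \<le> (\<integral>\<^sup>+\<xi>. 1 \<partial>M)" unfolding A_def by (intro nn_integral_mono)
    then show ?thesis by (simp add: emeasure_space_1)
  qed
  have eq: "A x + potential \<phi> c x (\<lambda>y. ennreal (\<omega> y - \<phi>) * A y)
      = ennreal (exp (- right_inverse \<psi> \<phi> * (c - x))) + potential \<phi> c x (\<lambda>y. ennreal (\<phi> - \<omega> y) * A y)" if "x \<le> c" for x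
  proof -
    have "(\<lambda>(y, p). exit_functional \<omega> c y p) \<in> borel_measurable (borel \<Otimes>\<^sub>M path_space)" by measurable
    moreover have "(\<lambda>\<xi>. exit_functional (\<lambda>_. \<phi>) c x (path \<xi>)) \<in> borel_measurable M" by measurable
    ultimately have "A x + potential \<phi> c x (\<lambda>y. ennreal (\<omega> y - \<phi>) * A y)
      = (\<integral>\<^sup>+\<xi>. exit_functional (\<lambda>_. \<phi>) c x (path \<xi>) \<partial>M) + potential \<phi> c x (\<lambda>y. ennreal (\<phi> - \<omega> y) * A y)"
      unfolding A_def by (rule potential_perturbation[OF wm _ _ exit_functional_feynman_kac[OF _ wm K]])
    then show ?thesis using that by (simp add: expectation_exit_functional_const[OF \<phi>] exit_laplace_eq[OF \<phi>])
  qed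
  obtain \<kappa> where \<kappa>: "\<And>x. x \<le> c \<Longrightarrow> enn2real (A x) = exp (- right_inverse \<psi> \<phi> * (c - x)) + exp (- right_inverse \<psi> \<phi> * (c - x)) * \<kappa>
       + (\<integral>z. W (x - z) * (indicator {0..} z * (\<omega> z - \<phi>) * enn2real (A z)) \<partial>lborel)"
     "enn2real (A c) = exp (- right_inverse \<psi> \<phi> * (c - c))"
    by (rule resolvent_volterra[OF W \<phi> wm B(2) w(3) Am A1 _ _ eq]) auto
  \<comment> \<open>From \<open>exp (- \<Phi> (c - x)) = exp (- \<Phi> c) * exp (\<Phi> x)\<close>;
    the sum \<open>1 + \<kappa>\<close> joins the unperturbed mean and the boundary part of the
    potential.\<close>
  define L where "L = exp (- right_inverse \<psi> \<phi> * c) * (1 + \<kappa>)"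
  have AH: "enn2real (A x) = L * \<H> x" if "x \<le> c" for x
  proof (rule volterra_multiple_of_H[OF W H wm _ B(2) _ _ that])
    show "(\<lambda>x. enn2real (A x)) \<in> borel_measurable borel" by measurable
    show "\<bar>enn2real (A z)\<bar> \<le> 1" for z using enn2real_mono[OF A1[of z]] by simp
    fix x assume x: "x \<le> c"
    have "exp (- right_inverse \<psi> \<phi> * (c - x)) = exp (- right_inverse \<psi> \<phi> * c) * exp (right_inverse \<psi> \<phi> * x)"
      by (simp add: algebra_simps flip: exp_add)
    then show "enn2real (A x) = L * exp (right_inverse \<psi> \<phi> * x) + (\<integral>z. W (x - z) * (indicator {0..} z * (\<omega> z - \<phi>) * enn2real (A z)) \<partial>lborel)"
      unfolding L_def \<kappa>(1)[OF x] by (simp add: algebra_simps)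
  qed
  have "L * \<H> c = 1" using AH[of c] \<kappa>(2) by simp
  then show Hc: "\<H> c \<noteq> 0" by auto
  have "L = 1 / \<H> c" using \<open>L * \<H> c = 1\<close> Hc by (simp add: field_simps)
  then have e: "enn2real (A x) = \<H> x / \<H> c" using AH[OF xc] by simp
  have "A x \<noteq> top" using A1[of x] by (metis ennreal_neq_top neq_top_trans)
  then show "(\<integral>\<^sup>+\<xi>. exit_functional \<omega> c x (path \<xi>) \<partial>M) = ennreal (\<H> x / \<H> c)"
    unfolding A_def[symmetric] e[symmetric] by (simp add: less_top)
  show "0 \<le> \<H> x / \<H> c" unfolding e[symmetric] by simp
qed

section \<open>The scale function of a state-dependent rate\<close>

text \<open>
  The Picard iterates are jointly measurable in both arguments. Since the equation has only one
  solution, this makes the given solution jointly measurable, which its definition does not require.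
\<close>

primrec omega_scale_iter :: "(real \<Rightarrow> real) \<Rightarrow> (real \<Rightarrow> real) \<Rightarrow> nat \<Rightarrow> real \<Rightarrow> real \<Rightarrow> ennreal" where
  "omega_scale_iter W \<omega> 0 x y = 0"
| "omega_scale_iter W \<omega> (Suc n) x y = ennreal (W (x - y)) + (\<integral>\<^sup>+z. ennreal (W (x - z)) * (ennreal (\<omega> z) * omega_scale_iter W \<omega> n z y) \<partial>lborel)"

lemma omega_scale_iter_measurable:
  assumes [measurable]: "W \<in> borel_measurable borel" "\<omega> \<in> borel_measurable borel"
  shows "(\<lambda>v. omega_scale_iter W \<omega> n (fst v) (snd v)) \<in> borel_measurable (borel \<Otimes>\<^sub>M borel)"
proof (induction n)
  case (Suc n)
  have [measurable]: "(\<lambda>v. omega_scale_iter W \<omega> n (f v) (g v)) \<in> borel_measurable N"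
    if [measurable]: "f \<in> borel_measurable N" "g \<in> borel_measurable N" for f g and N :: "'c measure"
    using measurable_compose[OF measurable_Pair[OF that] Suc.IH] by simp
  show ?case by simp
qed simp

lemma omega_scale_iter_mono: "omega_scale_iter W \<omega> n x y \<le> omega_scale_iter W \<omega> (Suc n) x y"
proof (induction n arbitrary: x)
  case (Suc n)
  show ?case
    unfolding omega_scale_iter.simps(2)[of _ _ "Suc n"] omega_scale_iter.simps(2)[of _ _ n]
    by (intro add_left_mono nn_integral_mono mult_left_mono) (use Suc.IH in auto)
qed simp

lemma omega_scale_iter_zero:
  assumes W: "is_scale_function \<psi> q W"
  shows "x < y \<Longrightarrow> omega_scale_iter W \<omega> n x y = 0"
proof (induction n arbitrary: x)
  case (Suc n)
  have "ennreal (W (x - z)) * (ennreal (\<omega> z) * omega_scale_iter W \<omega> n z y) = 0" for z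
    using scale_function_simps(2)[OF W, of "x - z"] Suc by (cases "z < y") auto
  then have "(\<integral>\<^sup>+z. ennreal (W (x - z)) * (ennreal (\<omega> z) * omega_scale_iter W \<omega> n z y) \<partial>lborel) = (\<integral>\<^sup>+z. 0 \<partial>(lborel :: real measure))"
    by (intro nn_integral_cong)
  then show ?case using scale_function_simps(2)[OF W, of "x - y"] Suc.prems by simp
qed simp

text \<open>The same weighted norm as in \<open>volterra_iteration_bound\<close>: with exponent
  \<open>2 * C\<close> the integral operator contributes at most half of the bound, uniformly in
  \<open>n\<close>.\<close>

lemma omega_scale_iter_bound:
  assumes W: "is_scale_function \<psi> q W"
    and w: "\<And>z. z \<in> {a..b} \<Longrightarrow> \<omega> z \<le> K" and K: "0 \<le> K"
    and xy: "a \<le> y" "y \<le> x" "x \<le> b"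
  shows "omega_scale_iter W \<omega> n x y \<le> ennreal (W (b - a) * exp (2 * (W (b - a) * K + 1) * (x - y)))"
  using xy(2,3)
proof (induction n arbitrary: x)
  case (Suc n)
  note W0 = scale_function_simps[OF W]
  define C0 where "C0 = W (b - a)"
  define C where "C = C0 * K + 1"
  have C0: "0 \<le> C0" and C: "0 < C" using W0(1) K by (auto simp: C0_def C_def intro: add_nonneg_pos)
  let ?r = "2 * C"
  have "(\<integral>\<^sup>+z. ennreal (W (x - z)) * (ennreal (\<omega> z) * omega_scale_iter W \<omega> n z y) \<partial>lborel)
     \<le> (\<integral>\<^sup>+z. ennreal (C0 / 2) * (ennreal (?r * exp (?r * (z - y))) * indicator {y..x} z) \<partial>lborel)"
  proof (rule nn_integral_mono)
    fix z
    show "ennreal (W (x - z)) * (ennreal (\<omega> z) * omega_scale_iter W \<omega> n z y) \<le> ennreal (C0 / 2) * (ennreal (?r * exp (?r * (z - y))) * indicator {y..x} z)"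
    proof (cases "z \<in> {y..x}")
      case True
      then have z: "y \<le> z" "z \<le> b" "z \<in> {a..b}" "a \<le> z" "z \<le> x" using Suc.prems xy(1) by auto
      have "ennreal (W (x - z)) \<le> ennreal C0" unfolding C0_def using z Suc.prems by (intro ennreal_leI W0) auto
      moreover have "ennreal (\<omega> z) \<le> ennreal K" using w[OF z(3)] by (rule ennreal_leI)
      moreover have "omega_scale_iter W \<omega> n z y \<le> ennreal (C0 * exp (?r * (z - y)))"
        using Suc.IH[OF z(1,2)] by (simp add: C0_def C_def)
      ultimately have "ennreal (W (x - z)) * (ennreal (\<omega> z) * omega_scale_iter W \<omega> n z y)
         \<le> ennreal C0 * (ennreal K * ennreal (C0 * exp (?r * (z - y))))" by (intro mult_mono) auto
      also have "\<dots> = ennreal (C0 * (K * (C0 * exp (?r * (z - y)))))" using C0 K by (simp add: ennreal_mult)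
      also have "\<dots> \<le> ennreal (C0 / 2 * (?r * exp (?r * (z - y))))"
      proof (rule ennreal_leI)
        have "(C0 * K) * (C0 * exp (?r * (z - y))) \<le> C * (C0 * exp (?r * (z - y)))"
          using C0 by (intro mult_right_mono) (auto simp: C_def)
        then show "C0 * (K * (C0 * exp (?r * (z - y)))) \<le> C0 / 2 * (?r * exp (?r * (z - y)))" by (simp add: ac_simps)
      qed
      also have "\<dots> = ennreal (C0 / 2) * ennreal (?r * exp (?r * (z - y)))"
        using C0 by (intro ennreal_mult') simp
      finally show ?thesis using True by (simp only: indicator_simps mult_1_right)
    next
      case False
      then show ?thesis using omega_scale_iter_zero[OF W, of z y \<omega> n] W0(2)[of "x - z"] by (cases "z < y") auto
    qed
  qed
  also have "\<dots> = ennreal (C0 / 2) * (\<integral>\<^sup>+z\<in>{y..x}. ennreal (?r * exp (?r * (z - y))) \<partial>lborel)"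
    by (rule nn_integral_cmult) measurable
  also have "(\<integral>\<^sup>+z\<in>{y..x}. ennreal (?r * exp (?r * (z - y))) \<partial>lborel) = ennreal (exp (?r * (x - y)) - exp (?r * (y - y)))"
    by (rule nn_integral_FTC_Icc) (use C Suc.prems in \<open>auto intro!: derivative_eq_intros simp: has_real_derivative_iff_has_vector_derivative[symmetric]\<close>)
  also have "ennreal (C0 / 2) * ennreal (exp (?r * (x - y)) - exp (?r * (y - y))) = ennreal (C0 / 2 * (exp (?r * (x - y)) - 1))"
    using C0 by (subst ennreal_mult') simp_all
  finally have le: "(\<integral>\<^sup>+z. ennreal (W (x - z)) * (ennreal (\<omega> z) * omega_scale_iter W \<omega> n z y) \<partial>lborel)
     \<le> ennreal (C0 / 2 * (exp (?r * (x - y)) - 1))" .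
  have "W (x - y) \<le> C0" unfolding C0_def using Suc.prems xy by (intro W0) auto
  then have "omega_scale_iter W \<omega> (Suc n) x y \<le> ennreal C0 + ennreal (C0 / 2 * (exp (?r * (x - y)) - 1))"
    unfolding omega_scale_iter.simps using le by (intro add_mono ennreal_leI) auto
  also have "\<dots> = ennreal (C0 + C0 / 2 * (exp (?r * (x - y)) - 1))"
    using C0 C Suc.prems by (intro ennreal_plus[symmetric]) auto
  \<comment> \<open>The integral uses half of the bound; the other half absorbs the remaining
    \<open>C0 / 2\<close>, as the weight is at least 1.\<close>
  also have "\<dots> \<le> ennreal (C0 * exp (?r * (x - y)))"
  proof (rule ennreal_leI)
    have "1 \<le> exp (?r * (x - y))" using C Suc.prems by simp
    then have "C0 * 1 \<le> C0 * exp (?r * (x - y))" using C0 by (intro mult_left_mono)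
    then show "C0 + C0 / 2 * (exp (?r * (x - y)) - 1) \<le> C0 * exp (?r * (x - y))" by (simp add: field_simps)
  qed
  finally show ?case by (simp add: C0_def C_def)
qed simp

text \<open>The supremum \<open>s\<close> of the iterates solves the equation by monotone
  convergence and is locally bounded, so for each \<open>y\<close> it coincides with
  \<open>\<W>\<close> by uniqueness. Joint measurability, the sign, and a bound uniform in
  \<open>y\<close> are then read off from \<open>s\<close>.\<close>

lemma omega_scale_properties:
  assumes W: "is_scale_function \<psi> q W" and \<W>: "is_omega_scale_function W \<omega> \<W>"
    and wm[measurable]: "\<omega> \<in> borel_measurable borel" and w: "\<And>y. 0 \<le> \<omega> y" "locally_bounded \<omega>"
  shows "(\<lambda>v. \<W> (fst v) (snd v)) \<in> borel_measurable (borel \<Otimes>\<^sub>M borel)"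
    and "0 \<le> \<W> x y" and "x < y \<Longrightarrow> \<W> x y = 0"
    and "ennreal (\<W> x y) = ennreal (W (x - y)) + nn_conv (\<lambda>y. ennreal (W y)) (\<lambda>z. ennreal (\<omega> z) * ennreal (\<W> z y)) x"
    and "\<exists>B\<ge>0. \<forall>x y. a \<le> y \<and> x \<le> b \<longrightarrow> \<W> x y \<le> B"
proof -
  have Wm[measurable]: "W \<in> borel_measurable borel" by (rule real_measurable_scale[OF W])
  note W0 = scale_function_simps[OF W]
  note itm = omega_scale_iter_measurable[OF Wm wm]
  define s where "s x y = (SUP n. omega_scale_iter W \<omega> n x y)" for x y
  have sm: "(\<lambda>v. s (fst v) (snd v)) \<in> borel_measurable (borel \<Otimes>\<^sub>M borel)"
    unfolding s_def by (intro borel_measurable_SUP itm) simp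
  have smy[measurable]: "(\<lambda>x. s x y) \<in> borel_measurable borel" for y
    using measurable_compose[OF measurable_Pair[OF measurable_ident measurable_const] sm, of y] by simp
  have inc: "incseq (\<lambda>n. omega_scale_iter W \<omega> n x y)" for x y by (intro incseq_SucI omega_scale_iter_mono)
  have s0: "s x y = 0" if "x < y" for x y unfolding s_def by (simp add: omega_scale_iter_zero[OF W that])
  have seq: "s x y = ennreal (W (x - y)) + (\<integral>\<^sup>+z. ennreal (W (x - z)) * (ennreal (\<omega> z) * s z y) \<partial>lborel)" for x y
  proof -
    have im: "(\<lambda>z. omega_scale_iter W \<omega> n z y) \<in> borel_measurable borel" for n
      using measurable_compose[OF measurable_Pair[OF measurable_ident measurable_const] itm, of y] by simp
    have "(\<lambda>n. omega_scale_iter W \<omega> n z y) \<longlonglongrightarrow> s z y" for z unfolding s_def by (rule LIMSEQ_SUP[OF inc])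
    then have lim: "(\<lambda>n. ennreal (W (x - z)) * (ennreal (\<omega> z) * omega_scale_iter W \<omega> n z y)) \<longlonglongrightarrow> ennreal (W (x - z)) * (ennreal (\<omega> z) * s z y)" for z
      by (intro ennreal_tendsto_cmult) auto
    have "(\<lambda>n. \<integral>\<^sup>+z. ennreal (W (x - z)) * (ennreal (\<omega> z) * omega_scale_iter W \<omega> n z y) \<partial>lborel) \<longlonglongrightarrow> (\<integral>\<^sup>+z. ennreal (W (x - z)) * (ennreal (\<omega> z) * s z y) \<partial>lborel)"
    proof (rule nn_integral_LIMSEQ[OF _ _ lim])
      show "incseq (\<lambda>n z. ennreal (W (x - z)) * (ennreal (\<omega> z) * omega_scale_iter W \<omega> n z y))"
        by (intro incseq_SucI le_funI mult_left_mono omega_scale_iter_mono) auto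
      show "(\<lambda>z. ennreal (W (x - z)) * (ennreal (\<omega> z) * omega_scale_iter W \<omega> n z y)) \<in> borel_measurable lborel" for n
        using im by measurable
    qed
    then have "(\<lambda>n. omega_scale_iter W \<omega> (Suc n) x y) \<longlonglongrightarrow> ennreal (W (x - y)) + (\<integral>\<^sup>+z. ennreal (W (x - z)) * (ennreal (\<omega> z) * s z y) \<partial>lborel)"
      unfolding omega_scale_iter.simps by (intro tendsto_add tendsto_const)
    moreover have "(\<lambda>n. omega_scale_iter W \<omega> (Suc n) x y) \<longlonglongrightarrow> s x y"
      unfolding s_def by (rule LIMSEQ_Suc[OF LIMSEQ_SUP[OF inc]])
    ultimately show ?thesis by (rule LIMSEQ_unique[symmetric])
  qed
  have bound: "\<exists>B\<ge>0. \<forall>x y. a \<le> y \<and> x \<le> b \<longrightarrow> s x y \<le> ennreal B" for a b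
  proof -
    obtain K where K: "0 \<le> K" "\<And>z. z \<in> {a..b} \<Longrightarrow> \<bar>\<omega> z\<bar> \<le> K" using locally_bounded_Icc[OF w(2), of a b] by blast
    let ?B = "W (b - a) * exp (2 * (W (b - a) * K + 1) * (b - a))"
    have "s x y \<le> ennreal ?B" if xy: "a \<le> y" "x \<le> b" for x y
    proof (cases "y \<le> x")
      case True
      have "omega_scale_iter W \<omega> n x y \<le> ennreal ?B" for n
      proof -
        have "omega_scale_iter W \<omega> n x y \<le> ennreal (W (b - a) * exp (2 * (W (b - a) * K + 1) * (x - y)))"
          by (rule omega_scale_iter_bound[OF W _ K(1) xy(1) True xy(2)]) (use K(2) w(1) in auto)
        also have "\<dots> \<le> ennreal ?B"
        proof (intro ennreal_leI mult_left_mono)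
          have "0 \<le> 2 * (W (b - a) * K + 1)" using W0(1)[of "b - a"] K(1) by simp
          then have "2 * (W (b - a) * K + 1) * (x - y) \<le> 2 * (W (b - a) * K + 1) * (b - a)"
            using xy by (intro mult_left_mono) auto
          then show "exp (2 * (W (b - a) * K + 1) * (x - y)) \<le> exp (2 * (W (b - a) * K + 1) * (b - a))"
            by (simp only: exp_le_cancel_iff)
        qed (rule W0(1))
        finally show ?thesis .
      qed
      then show ?thesis unfolding s_def by (rule SUP_least)
    qed (simp add: s0)
    moreover have "0 \<le> ?B" using W0(1) by simp
    ultimately show ?thesis by blast
  qed
  have \<W>s: "ennreal (\<W> x y) = s x y \<and> 0 \<le> \<W> x y" for x y
  proof -
    have \<W>m[measurable]: "(\<lambda>x. \<W> x y) \<in> borel_measurable borel" and \<W>b: "locally_bounded (\<lambda>x. \<W> x y)"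
      using \<W> unfolding is_omega_scale_function_def by blast+
    have \<W>eq: "\<W> x y = W (x - y) + (\<integral>z. W (x - z) * (indicator {y..} z * \<omega> z * \<W> z y) \<partial>lborel)" for x
    proof -
      have "\<W> x y = W (x - y) + (LBINT z=ereal y..ereal x. W (x - z) * \<omega> z * \<W> z y)"
        using \<W> unfolding is_omega_scale_function_def by blast
      also have "(LBINT z=ereal y..ereal x. W (x - z) * \<omega> z * \<W> z y) = (LBINT z=ereal y..ereal x. W (x - z) * (\<omega> z * \<W> z y))"
        unfolding mult.assoc ..
      also have "\<dots> = (\<integral>z. W (x - z) * (indicator {y..} z * (\<omega> z * \<W> z y)) \<partial>lborel)"
        by (rule interval_integral_scale_eq[OF W]) measurable
      finally show ?thesis by (simp only: mult.assoc)
    qed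
    define u where "u z = enn2real (s z y)" for z
    have um[measurable]: "u \<in> borel_measurable borel" unfolding u_def by measurable
    obtain S where S: "0 \<le> S" "\<And>z. z \<le> x \<Longrightarrow> s z y \<le> ennreal S" using bound[of y x] by blast
    have su: "s z y = ennreal (u z)" if "z \<le> x" for z
      unfolding u_def using S(2)[OF that] by (intro ennreal_enn2real[symmetric]) (auto simp: le_less_trans ennreal_less_top)
    have u0: "0 \<le> u z" for z by (simp add: u_def)
    have uS: "u z \<le> S" if "z \<le> x" for z using S(2)[OF that] unfolding su[OF that] using S(1) by simp
    obtain K where K: "0 \<le> K" "\<And>z. z \<in> {y..x} \<Longrightarrow> \<bar>\<omega> z\<bar> \<le> K" using locally_bounded_Icc[OF w(2), of y x] by blast
    obtain S' where S': "0 \<le> S'" "\<And>z. z \<in> {y..x} \<Longrightarrow> \<bar>\<W> z y\<bar> \<le> S'" using locally_bounded_Icc[OF \<W>b, of y x] by blast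
    have ueq: "u z = W (z - y) + (\<integral>v. W (z - v) * (indicator {y..} v * \<omega> v * u v) \<partial>lborel)" if z: "z \<le> x" for z
    proof -
      let ?h = "\<lambda>v. indicator {y..} v * \<omega> v"
      have e: "nn_conv (\<lambda>y. ennreal (W y)) (\<lambda>v. ennreal (?h v) * s v y) z = ennreal (\<integral>v. W (z - v) * (max 0 (?h v) * u v) \<partial>lborel)"
        using nn_conv_scale_real(2)[OF W, where h="?h" and A="\<lambda>v. s v y" and u=u and a=y and x=z and S=S and K=K] z su uS u0 K(2)
        by (auto simp: abs_le_iff)
      have "s z y = ennreal (W (z - y)) + nn_conv (\<lambda>y. ennreal (W y)) (\<lambda>v. ennreal (?h v) * s v y) z"
        unfolding nn_conv_def using s0 by (subst seq) (auto intro!: arg_cong2[where f="(+)"] nn_integral_cong split: split_indicator)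
      also have "max 0 (?h v) = ?h v" for v using w(1)[of v] by simp
      note e[unfolded this]
      also have "ennreal (W (z - y)) + ennreal (\<integral>v. W (z - v) * (?h v * u v) \<partial>lborel) = ennreal (W (z - y) + (\<integral>v. W (z - v) * (?h v * u v) \<partial>lborel))"
        using W0(1) w(1) u0 by (intro ennreal_plus[symmetric] integral_nonneg_AE AE_I2) auto
      finally have "ennreal (u z) = ennreal (W (z - y) + (\<integral>v. W (z - v) * (?h v * u v) \<partial>lborel))" using su[OF z] by simp
      moreover have "0 \<le> W (z - y) + (\<integral>v. W (z - v) * (?h v * u v) \<partial>lborel)"
        using W0(1) w(1) u0 by (intro add_nonneg_nonneg integral_nonneg_AE AE_I2) auto
      ultimately show ?thesis using u0[of z] by simp
    qed
    \<comment> \<open>Uniqueness is applied on \<open>{y..x}\<close>, where \<open>\<omega>\<close>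
      and both solutions are bounded.\<close>
    have "\<W> x y - u x = 0"
    proof (rule volterra_scale_zero[OF W wm _ K(2) _ _ order_refl, where d="\<lambda>z. \<W> z y - u z" and a=y])
      show "(\<lambda>z. \<W> z y - u z) \<in> borel_measurable borel" by measurable
      show "\<bar>\<W> z y - u z\<bar> \<le> S' + S" if "z \<in> {y..x}" for z using S'(2)[OF that] uS[of z] u0[of z] that by auto
      fix z assume z: "z \<le> x"
      have "integrable lborel (\<lambda>v. W (z - v) * (indicator {y..} v * \<omega> v * \<W> v y))"
        by (rule integrable_scale_conv[OF W wm \<W>m K(2) S'(2) z])
      moreover have "integrable lborel (\<lambda>v. W (z - v) * (indicator {y..} v * \<omega> v * u v))"
        by (rule integrable_scale_conv[OF W wm um K(2) _ z, where S=S]) (use uS u0 in auto)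
      ultimately have "(\<integral>v. W (z - v) * (indicator {y..} v * \<omega> v * \<W> v y) \<partial>lborel) - (\<integral>v. W (z - v) * (indicator {y..} v * \<omega> v * u v) \<partial>lborel)
         = (\<integral>v. W (z - v) * (indicator {y..} v * \<omega> v * \<W> v y) - W (z - v) * (indicator {y..} v * \<omega> v * u v) \<partial>lborel)"
        by (rule Bochner_Integration.integral_diff[symmetric])
      also have "\<dots> = (\<integral>v. W (z - v) * (indicator {y..} v * \<omega> v * (\<W> v y - u v)) \<partial>lborel)"
        by (simp only: right_diff_distrib)
      finally show "\<W> z y - u z = (\<integral>v. W (z - v) * (indicator {y..} v * \<omega> v * (\<W> v y - u v)) \<partial>lborel)"
        using \<W>eq[of z] ueq[OF z] by linarith
    qed
    then have "\<W> x y = u x" by simp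
    then show ?thesis using su[of x] u0[of x] by simp
  qed
  have \<W>e: "\<W> x y = enn2real (s x y)" for x y
    using \<W>s[of x y] by (metis enn2real_ennreal)
  show "(\<lambda>v. \<W> (fst v) (snd v)) \<in> borel_measurable (borel \<Otimes>\<^sub>M borel)"
    unfolding \<W>e using sm by measurable
  show "0 \<le> \<W> x y" using \<W>s by simp
  show "x < y \<Longrightarrow> \<W> x y = 0" by (simp add: \<W>e s0)
  have \<W>s': "ennreal (\<W> x y) = s x y" for x y using \<W>s by simp
  show "ennreal (\<W> x y) = ennreal (W (x - y)) + nn_conv (\<lambda>y. ennreal (W y)) (\<lambda>z. ennreal (\<omega> z) * ennreal (\<W> z y)) x"
    unfolding nn_conv_def \<W>s' by (rule seq)
  obtain B where B: "0 \<le> B" "\<And>x y. a \<le> y \<Longrightarrow> x \<le> b \<Longrightarrow> s x y \<le> ennreal B" using bound[of a b] by blast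
  have "\<W> x y \<le> B" if "a \<le> y" "x \<le> b" for x y using B(2)[OF that] B(1) unfolding \<W>s'[symmetric] by simp
  then show "\<exists>B\<ge>0. \<forall>x y. a \<le> y \<and> x \<le> b \<longrightarrow> \<W> x y \<le> B" using B(1) by blast
qed

section \<open>The occupation identity\<close>

context spectrally_negative begin

lemma right_inverse_mono:
  assumes "p \<le> q" shows "right_inverse \<psi> p \<le> right_inverse \<psi> q"
  unfolding right_inverse_def
  by (rule cInf_superset_mono) (use assms psi_unbounded[of q] right_inverse_bdd in auto)

text \<open>In transforms this is
  \<open>1 / (\<psi> - q) = 1 / \<psi> + q / (\<psi> (\<psi> - q))\<close>, valid to the right of
  both inverses. Equal measures have densities that agree almost everywhere, which is enough under a
  convolution.\<close>

lemma scale_function_change: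
  assumes W0: "is_scale_function \<psi> 0 W0" and W: "is_scale_function \<psi> q W" and q: "0 \<le> q"
  shows "AE u in lborel. ennreal (W u) = ennreal (W0 u) + ennreal q * nn_conv (\<lambda>y. ennreal (W y)) (\<lambda>y. ennreal (W0 y)) u"
proof -
  let ?w = "\<lambda>y. ennreal (W y)" and ?wz = "\<lambda>y. ennreal (W0 y)"
  have [measurable]: "W \<in> borel_measurable borel" "W0 \<in> borel_measurable borel"
    using real_measurable_scale W W0 by auto
  have z0: "W y = 0" "W0 y = 0" if "y < 0" for y
    using scale_function_simps(2)[OF W that] scale_function_simps(2)[OF W0 that] by auto
  have cz: "nn_conv ?w ?wz u = 0" if "u < 0" for u
  proof -
    have "?w (u - z) * ?wz z = 0" for z using that z0 by (cases "z < 0") auto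
    then show ?thesis unfolding nn_conv_def by (simp only:) simp
  qed
  let ?c = "\<lambda>u. ennreal q * nn_conv ?w ?wz u"
  have "emeasure (density lborel ?wz) A + emeasure (density lborel ?c) A = emeasure (density lborel ?w) A" if A: "A \<in> sets borel" for A
  proof (rule laplace_unique_add[where ?\<theta>0.0 = "right_inverse \<psi> q"])
    have "AE z in lborel. W0 z \<noteq> 0 \<longrightarrow> 0 \<le> z" "AE z in lborel. W z \<noteq> 0 \<longrightarrow> 0 \<le> z" "AE z in lborel. ?c z \<noteq> 0 \<longrightarrow> 0 \<le> z"
      using z0 cz by (auto intro!: AE_I2 simp: not_less[symmetric] simp del: not_less)
    then show "AE z in density lborel ?wz. 0 \<le> z" "AE z in density lborel ?c. 0 \<le> z" "AE z in density lborel ?w. 0 \<le> z"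
      by (subst AE_density; auto)+
    fix \<theta> assume \<theta>: "right_inverse \<psi> q < \<theta>"
    then have \<theta>0: "right_inverse \<psi> 0 < \<theta>" using right_inverse_mono[OF q] by simp
    have pq: "q < \<psi> \<theta>" by (rule psi_gt(2)[OF \<theta> q])
    let ?e = "\<lambda>z. ennreal (exp (- \<theta> * z))"
    have d: "(\<integral>\<^sup>+z. ?e z \<partial>density lborel f) = (\<integral>\<^sup>+z. ?e z * f z \<partial>lborel)" if [measurable]: "f \<in> borel_measurable borel" for f
      by (subst nn_integral_density) (auto simp: mult.commute)
    have l0: "(\<integral>\<^sup>+z. ?e z \<partial>density lborel ?wz) = ennreal (1 / \<psi> \<theta>)"
      using scale_laplace[OF W0 order_refl \<theta>0] by (subst d) auto
    have l: "(\<integral>\<^sup>+z. ?e z \<partial>density lborel ?w) = ennreal (1 / (\<psi> \<theta> - q))"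
      using scale_laplace[OF W q \<theta>] by (subst d) auto
    have lc: "(\<integral>\<^sup>+z. ?e z \<partial>density lborel ?c) = ennreal (q * (1 / (\<psi> \<theta> - q) * (1 / \<psi> \<theta>)))"
    proof -
      have "(\<integral>\<^sup>+z. ?e z \<partial>density lborel ?c) = (\<integral>\<^sup>+z. ennreal q * (?e z * nn_conv ?w ?wz z) \<partial>lborel)"
        by (subst d) (auto simp: ac_simps)
      also have "\<dots> = ennreal q * ((\<integral>\<^sup>+x. ?e x * ?w x \<partial>lborel) * (\<integral>\<^sup>+x. ?e x * ?wz x \<partial>lborel))"
      proof -
        have "?w \<in> borel_measurable borel" "?wz \<in> borel_measurable borel" by measurable
        note L = nn_integral_exp_nn_conv[OF this, of \<theta>]
        show ?thesis unfolding L[symmetric] by (rule nn_integral_cmult) measurable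
      qed
      also have "\<dots> = ennreal (q * (1 / (\<psi> \<theta> - q) * (1 / \<psi> \<theta>)))"
      proof -
        have nn: "0 \<le> 1 / (\<psi> \<theta> - q)" "0 \<le> 1 / \<psi> \<theta>" using q pq by auto
        show ?thesis
          unfolding scale_laplace[OF W q \<theta>] scale_laplace[OF W0 order_refl \<theta>0] diff_zero
          by (simp only: ennreal_mult[OF nn] ennreal_mult[OF q mult_nonneg_nonneg[OF nn]])
      qed
      finally show ?thesis .
    qed
    show "(\<integral>\<^sup>+z. ?e z \<partial>density lborel ?wz) + (\<integral>\<^sup>+z. ?e z \<partial>density lborel ?c) = (\<integral>\<^sup>+z. ?e z \<partial>density lborel ?w)"
      unfolding l l0 lc using q pq by (subst ennreal_plus[symmetric]) (auto simp: field_simps)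
    show "(\<integral>\<^sup>+z. ?e z \<partial>density lborel ?w) < \<infinity>" unfolding l by simp
  qed (use A in auto)
  then have "emeasure (density lborel (\<lambda>u. ?wz u + ?c u)) A = emeasure (density lborel ?w) A" if "A \<in> sets borel" for A
    using that by (simp add: emeasure_density nn_integral_add distrib_right)
  then have "density lborel (\<lambda>u. ?wz u + ?c u) = density lborel ?w"
    by (intro measure_eqI) auto
  then have "AE u in lborel. ?wz u + ?c u = ?w u"
    by (intro sigma_finite_measure.density_unique[OF sigma_finite_lborel]) auto
  then show ?thesis by eventually_elim simp
qed

text \<open>Convolving the equation of \<open>G\<close> with \<open>W\<close> and removing the mixed
  convolutions by \<open>scale_function_change\<close> exchanges the kernel \<open>W0\<close> for
  \<open>W\<close> and the rate \<open>\<omega>\<close> for \<open>\<omega> - q\<close>. The term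
  with \<open>q\<close> stands on the left to avoid a subtraction.\<close>

lemma omega_conv_change:
  assumes W0: "is_scale_function \<psi> 0 W0" and W: "is_scale_function \<psi> q W" and q: "0 \<le> q"
    and [measurable]: "f \<in> borel_measurable borel" "\<omega> \<in> borel_measurable borel" "G \<in> borel_measurable borel"
    and G: "\<And>x. G x = nn_conv (\<lambda>y. ennreal (W0 y)) f x + nn_conv (\<lambda>y. ennreal (W0 y)) (\<lambda>z. ennreal (\<omega> z) * G z) x"
  shows "G x + ennreal q * nn_conv (\<lambda>y. ennreal (W y)) G x
    = nn_conv (\<lambda>y. ennreal (W y)) f x + nn_conv (\<lambda>y. ennreal (W y)) (\<lambda>z. ennreal (\<omega> z) * G z) x"
proof -
  let ?w = "\<lambda>y. ennreal (W y)" and ?wz = "\<lambda>y. ennreal (W0 y)" and ?g = "\<lambda>z. ennreal (\<omega> z) * G z"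
  have [measurable]: "W \<in> borel_measurable borel" "W0 \<in> borel_measurable borel"
    using real_measurable_scale W W0 by auto
  let ?v = "\<lambda>u. ?wz u + ennreal q * nn_conv ?w ?wz u"
  have *: "nn_conv ?w h x = nn_conv ?wz h x + ennreal q * nn_conv ?w (nn_conv ?wz h) x"
    if [measurable]: "h \<in> borel_measurable borel" for h
  proof -
    have "nn_conv ?w h x = nn_conv ?v h x" by (rule nn_conv_cong_AE[OF scale_function_change[OF W0 W q]])
    also have "\<dots> = nn_conv ?wz h x + nn_conv (\<lambda>u. ennreal q * nn_conv ?w ?wz u) h x" by (rule nn_conv_add(1)) measurable
    also have "nn_conv (\<lambda>u. ennreal q * nn_conv ?w ?wz u) h x = ennreal q * nn_conv (nn_conv ?w ?wz) h x"
      by (rule nn_conv_cmult(1)) measurable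
    also have "nn_conv (nn_conv ?w ?wz) h x = nn_conv ?w (nn_conv ?wz h) x" by (rule nn_conv_assoc) measurable
    finally show ?thesis .
  qed
  have "nn_conv ?w G x = nn_conv ?w (\<lambda>x. nn_conv ?wz f x + nn_conv ?wz ?g x) x"
    by (rule arg_cong[where f="\<lambda>h. nn_conv ?w h x"]) (rule ext, rule G)
  also have "\<dots> = nn_conv ?w (nn_conv ?wz f) x + nn_conv ?w (nn_conv ?wz ?g) x"
    by (rule nn_conv_add(2)) measurable
  finally have c: "nn_conv ?w G x = nn_conv ?w (nn_conv ?wz f) x + nn_conv ?w (nn_conv ?wz ?g) x" .
  have gm: "?g \<in> borel_measurable borel" by measurable
  show ?thesis
    unfolding c *[OF gm] *[of f, OF \<open>f \<in> borel_measurable borel\<close>] G[of x] distrib_left by (simp only: ac_simps)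
qed

text \<open>Bounded \<open>A\<close> keeps everything finite. The mean occupation \<open>V\<close>
  and the integral \<open>g\<close> of \<open>\<W> x\<close> over \<open>A\<close> both solve
  Volterra equations with kernel \<open>W \<phi>\<close>; their forcing terms \<open>- F\<close> and
  \<open>F\<close> cancel in \<open>V + g\<close>, which leaves a multiple of
  \<open>exp (\<Phi> x)\<close>. So \<open>V + g\<close> is a multiple of \<open>\<H>\<close>, and
  as \<open>V\<close> is 0 at \<open>c\<close>, the factor is \<open>g c / \<H> c\<close>.\<close>

lemma occupation_identity:
  assumes scale: "\<And>q. 0 \<le> q \<Longrightarrow> is_scale_function \<psi> q (W q)" and \<phi>: "0 \<le> \<phi>"
    and H: "is_omega_H_function \<psi> (W \<phi>) \<phi> \<omega> \<H>" and \<W>: "is_omega_scale_function (W 0) \<omega> \<W>"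
    and wm[measurable]: "\<omega> \<in> borel_measurable borel" and w: "\<And>y. 0 \<le> \<omega> y" "locally_bounded \<omega>" "\<And>y. y \<le> 0 \<Longrightarrow> \<omega> y = \<phi>"
    and xc: "x \<le> c" and A[measurable]: "A \<in> sets borel" and Ac: "A \<subseteq> {a..c}"
  shows "integrable lborel (\<lambda>y. indicator A y * (\<H> x / \<H> c * \<W> c y - \<W> x y))"
    and "(\<integral>\<^sup>+\<xi>. occupation_functional \<omega> (indicator A) c x (path \<xi>) \<partial>M)
       = ennreal (\<integral>y. indicator A y * (\<H> x / \<H> c * \<W> c y - \<W> x y) \<partial>lborel)"
    and "0 \<le> (\<integral>y. indicator A y * (\<H> x / \<H> c * \<W> c y - \<W> x y) \<partial>lborel)"
proof -
  note S0 = scale[OF order_refl] and S\<phi> = scale[OF \<phi>]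
  have [measurable]: "W 0 \<in> borel_measurable borel" "W \<phi> \<in> borel_measurable borel"
    using real_measurable_scale S0 S\<phi> by auto
  note Wp = omega_scale_properties[OF S0 \<W> wm w(1,2)]
  have Wm2[measurable (raw)]: "(\<lambda>v. \<W> (f v) (g v)) \<in> borel_measurable N"
    if [measurable]: "f \<in> borel_measurable N" "g \<in> borel_measurable N" for f g and N :: "'c measure"
    using measurable_compose[OF measurable_Pair[OF that] Wp(1)] by simp
  let ?f = "indicator A :: real \<Rightarrow> ennreal"
  let ?fr = "indicator A :: real \<Rightarrow> real"
  obtain B where B: "0 \<le> B" "\<And>x y. a \<le> y \<Longrightarrow> x \<le> c \<Longrightarrow> \<W> x y \<le> B" using Wp(5)[of a c] by blast
  have iW: "integrable lborel (\<lambda>y. ?fr y * \<W> x y)" if "x \<le> c" for x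
  proof (rule integrable_bounded_support[where a=a and b=c])
    show "\<bar>?fr y * \<W> x y\<bar> \<le> B" if "y \<in> {a..c}" for y
      using B Wp(2) that \<open>x \<le> c\<close> by (auto split: split_indicator)
    show "?fr y * \<W> x y = 0" if "y \<notin> {a..c}" for y using that Ac by (auto split: split_indicator)
  qed measurable
  define G where "G x = (\<integral>\<^sup>+y. ennreal (\<W> x y) * ?f y \<partial>lborel)" for x
  define g where "g x = (\<integral>y. ?fr y * \<W> x y \<partial>lborel)" for x
  have Gm[measurable]: "G \<in> borel_measurable borel" unfolding G_def by measurable
  have gm[measurable]: "g \<in> borel_measurable borel" unfolding g_def by measurable
  have g0: "0 \<le> g x" for x unfolding g_def using Wp(2) by (intro integral_nonneg_AE AE_I2) auto
  have Gg: "G x = ennreal (g x)" if "x \<le> c" for x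
  proof -
    have "G x = (\<integral>\<^sup>+y. ennreal (?fr y * \<W> x y) \<partial>lborel)"
      unfolding G_def by (intro nn_integral_cong) (auto split: split_indicator)
    also have "\<dots> = ennreal (g x)" unfolding g_def using iW[OF that] Wp(2) by (intro nn_integral_eq_integral) auto
    finally show ?thesis .
  qed
  \<comment> \<open>The maximum covers \<open>c < a\<close>, where \<open>A\<close> is
    empty.\<close>
  define Sg where "Sg = B * (max a c - a)"
  have gS: "g x \<le> Sg" if "x \<le> c" for x
  proof -
    have "g x \<le> (\<integral>y. indicator {a..c} y * B \<partial>lborel)"
      unfolding g_def
    proof (rule integral_mono[OF iW[OF that]])
      show "integrable lborel (\<lambda>y. indicator {a..c} y * B)"
        by (rule integrable_bounded_support[where a=a and b=c and C=B]) (use B(1) in auto)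
      show "?fr y * \<W> x y \<le> indicator {a..c} y * B" for y
        using B Ac that by (auto split: split_indicator)
    qed
    also have "\<dots> \<le> Sg" using B(1) by (auto simp: Sg_def max_def mult.commute)
    finally show ?thesis .
  qed
  have Sg0: "0 \<le> Sg" using B(1) by (simp add: Sg_def max_def)
  have ga: "g x = 0" if "x < a" for x
  proof -
    have "?fr y * \<W> x y = 0" for y using that Ac Wp(3)[of x y] by (auto split: split_indicator)
    then show ?thesis unfolding g_def by (simp only:) simp
  qed
  \<comment> \<open>The equation of \<open>\<W>\<close> in its first variable, integrated over
    \<open>y\<close> in \<open>A\<close> with Fubini for the inner integral.\<close>
  have Geq: "G x = nn_conv (\<lambda>y. ennreal (W 0 y)) ?f x + nn_conv (\<lambda>y. ennreal (W 0 y)) (\<lambda>z. ennreal (\<omega> z) * G z) x" for x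
  proof -
    have "G x = (\<integral>\<^sup>+y. ennreal (W 0 (x - y)) * ?f y + (\<integral>\<^sup>+z. ennreal (W 0 (x - z)) * (ennreal (\<omega> z) * ennreal (\<W> z y)) * ?f y \<partial>lborel) \<partial>lborel)"
      unfolding G_def by (intro nn_integral_cong, subst Wp(4)) (simp add: nn_conv_def distrib_right nn_integral_multc)
    also have "\<dots> = nn_conv (\<lambda>y. ennreal (W 0 y)) ?f x + (\<integral>\<^sup>+y. (\<integral>\<^sup>+z. ennreal (W 0 (x - z)) * (ennreal (\<omega> z) * ennreal (\<W> z y)) * ?f y \<partial>lborel) \<partial>lborel)"
      unfolding nn_conv_def by (rule nn_integral_add) measurable
    also have "(\<integral>\<^sup>+y. (\<integral>\<^sup>+z. ennreal (W 0 (x - z)) * (ennreal (\<omega> z) * ennreal (\<W> z y)) * ?f y \<partial>lborel) \<partial>lborel)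
      = (\<integral>\<^sup>+z. (\<integral>\<^sup>+y. ennreal (W 0 (x - z)) * (ennreal (\<omega> z) * ennreal (\<W> z y)) * ?f y \<partial>lborel) \<partial>lborel)"
      by (rule lborel_pair.Fubini') measurable
    also have "\<dots> = nn_conv (\<lambda>y. ennreal (W 0 y)) (\<lambda>z. ennreal (\<omega> z) * G z) x"
      unfolding nn_conv_def G_def
    proof (rule nn_integral_cong)
      fix z
      have "(\<integral>\<^sup>+y. ennreal (W 0 (x - z)) * (ennreal (\<omega> z) * ennreal (\<W> z y)) * ?f y \<partial>lborel)
        = (\<integral>\<^sup>+y. (ennreal (W 0 (x - z)) * ennreal (\<omega> z)) * (ennreal (\<W> z y) * ?f y) \<partial>lborel)"
        by (simp only: ac_simps)
      also have "\<dots> = (ennreal (W 0 (x - z)) * ennreal (\<omega> z)) * (\<integral>\<^sup>+y. ennreal (\<W> z y) * ?f y \<partial>lborel)"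
        by (rule nn_integral_cmult) measurable
      finally show "(\<integral>\<^sup>+y. ennreal (W 0 (x - z)) * (ennreal (\<omega> z) * ennreal (\<W> z y)) * ?f y \<partial>lborel)
        = ennreal (W 0 (x - z)) * (ennreal (\<omega> z) * (\<integral>\<^sup>+y. ennreal (\<W> z y) * ?f y \<partial>lborel))" by (simp only: mult.assoc)
    qed
    finally show ?thesis .
  qed
  \<comment> \<open>The convolution of \<open>W \<phi>\<close> with the indicator of
    \<open>A\<close>, in the form that \<open>nn_conv_scale_real\<close> delivers.\<close>
  define F where "F x = (\<integral>z. W \<phi> (x - z) * (max 0 (indicator {a..} z) * ?fr z) \<partial>lborel)" for x
  have F: "nn_conv (\<lambda>y. ennreal (W \<phi> y)) ?f x = ennreal (F x) \<and> 0 \<le> F x" for x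
  proof
    have "nn_conv (\<lambda>y. ennreal (W \<phi> y)) (\<lambda>z. ennreal (indicator {a..} z) * ?f z) x = ennreal (F x)"
      unfolding F_def by (rule nn_conv_scale_real(2)[OF S\<phi>, where S=1 and K=1 and a=a]) (auto split: split_indicator)
    moreover have "(\<lambda>z. ennreal (indicator {a..} z) * ?f z) = ?f" using Ac by (auto simp: fun_eq_iff split: split_indicator)
    ultimately show "nn_conv (\<lambda>y. ennreal (W \<phi> y)) ?f x = ennreal (F x)" by simp
    show "0 \<le> F x" unfolding F_def using scale_function_simps(1)[OF S\<phi>] by (intro integral_nonneg_AE AE_I2) auto
  qed
  obtain B1 where B1: "0 \<le> B1" "\<And>z. z \<in> {min a 0..c} \<Longrightarrow> \<bar>\<omega> z\<bar> \<le> B1" using locally_bounded_Icc[OF w(2), of "min a 0" c] by blast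
  have wb: "\<bar>\<omega> z\<bar> \<le> B1" if "z \<in> {0..c}" for z using B1(2)[of z] that by auto
  have wK: "\<bar>\<omega> y\<bar> \<le> max B1 \<phi>" if "y \<le> c" for y
    using wb[of y] w(3)[of y] \<phi> that by (cases "y \<le> 0") auto
  have geq: "g x = F x + (\<integral>z. W \<phi> (x - z) * (indicator {0..} z * (\<omega> z - \<phi>) * g z) \<partial>lborel)" if x: "x \<le> c" for x
  proof -
    \<comment> \<open>\<open>G\<close> vanishes below \<open>a\<close>, so cutting both rates off
      there changes no convolution and gives the integrands bounded support.\<close>
    let ?h1 = "\<lambda>z. indicator {a..} z * \<omega> z" and ?h2 = "\<lambda>z. indicator {a..} z * \<phi>"
    let ?i = "\<lambda>h. \<integral>z. W \<phi> (x - z) * (max 0 (h z) * g z) \<partial>lborel"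
    have nc: "integrable lborel (\<lambda>z. W \<phi> (x - z) * (max 0 (h z) * g z)) \<and>
       nn_conv (\<lambda>y. ennreal (W \<phi> y)) (\<lambda>z. ennreal (h z) * G z) x = ennreal (?i h)"
      if [measurable]: "h \<in> borel_measurable borel" and h: "\<And>z. z < a \<Longrightarrow> h z \<le> 0" "\<And>z. z \<in> {a..x} \<Longrightarrow> h z \<le> max B1 \<phi>" for h
      using nn_conv_scale_real[OF S\<phi>, where h=h and A=G and u=g and a=a and x=x and S=Sg and K="max B1 \<phi>"] Gg gS g0 x h by auto
    have h1: "?h1 z \<le> max B1 \<phi>" if "z \<in> {a..x}" for z using wK[of z] that x by auto
    note n1 = nc[of ?h1, OF _ _ h1]
    have n2: "integrable lborel (\<lambda>z. W \<phi> (x - z) * (max 0 (?h2 z) * g z)) \<and>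
       nn_conv (\<lambda>y. ennreal (W \<phi> y)) (\<lambda>z. ennreal (?h2 z) * G z) x = ennreal (?i ?h2)" by (rule nc) auto
    have G0: "G z = 0" if "z < a" "z \<le> c" for z using Gg[OF that(2)] ga[OF that(1)] by simp
    have r: "nn_conv (\<lambda>y. ennreal (W \<phi> y)) (\<lambda>z. ennreal (indicator {a..} z * k z) * G z) x = nn_conv (\<lambda>y. ennreal (W \<phi> y)) (\<lambda>z. ennreal (k z) * G z) x" for k
      unfolding nn_conv_def
    proof (rule nn_integral_cong)
      fix z
      show "ennreal (W \<phi> (x - z)) * (ennreal (indicator {a..} z * k z) * G z) = ennreal (W \<phi> (x - z)) * (ennreal (k z) * G z)"
        using G0[of z] scale_function_simps(2)[OF S\<phi>, of "x - z"] x by (cases "z < a"; cases "z \<le> x") auto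
    qed
    have i0: "0 \<le> ?i h" for h using scale_function_simps(1)[OF S\<phi>] g0 by (intro integral_nonneg_AE AE_I2) auto
    have "G x + ennreal \<phi> * nn_conv (\<lambda>y. ennreal (W \<phi> y)) G x
      = nn_conv (\<lambda>y. ennreal (W \<phi> y)) ?f x + nn_conv (\<lambda>y. ennreal (W \<phi> y)) (\<lambda>z. ennreal (\<omega> z) * G z) x"
      by (rule omega_conv_change[OF S0 S\<phi> \<phi> _ wm Gm Geq]) measurable
    moreover have "ennreal \<phi> * nn_conv (\<lambda>y. ennreal (W \<phi> y)) G x = nn_conv (\<lambda>y. ennreal (W \<phi> y)) (\<lambda>z. ennreal \<phi> * G z) x"
      by (rule nn_conv_cmult(2)[symmetric]) measurable
    ultimately have "ennreal (g x) + ennreal (?i ?h2) = ennreal (F x) + ennreal (?i ?h1)"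
      using n1 n2 r[of "\<lambda>_. \<phi>"] r[of \<omega>] F[of x] Gg[OF x] by simp
    then have "ennreal (g x + ?i ?h2) = ennreal (F x + ?i ?h1)" using g0 i0 F[of x] by (simp flip: ennreal_plus)
    then have "g x + ?i ?h2 = F x + ?i ?h1" using g0[of x] i0[of ?h1] i0[of ?h2] F[of x] by (subst (asm) ennreal_inj) auto
    moreover have "?i ?h1 - ?i ?h2 = (\<integral>z. W \<phi> (x - z) * (max 0 (?h1 z) * g z) - W \<phi> (x - z) * (max 0 (?h2 z) * g z) \<partial>lborel)"
      using n1 n2 by (intro Bochner_Integration.integral_diff[symmetric]) auto
    moreover have "\<dots> = (\<integral>z. W \<phi> (x - z) * (indicator {0..} z * (\<omega> z - \<phi>) * g z) \<partial>lborel)"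
    proof (rule Bochner_Integration.integral_cong[OF refl])
      fix z
      have "max 0 (?h1 z) * g z - max 0 (?h2 z) * g z = (\<omega> z - \<phi>) * g z"
        using w(1)[of z] \<phi> ga[of z] by (auto simp: algebra_simps split: split_indicator)
      also have "\<dots> = indicator {0..} z * (\<omega> z - \<phi>) * g z" using w(3)[of z] by (auto split: split_indicator)
      finally show "W \<phi> (x - z) * (max 0 (?h1 z) * g z) - W \<phi> (x - z) * (max 0 (?h2 z) * g z) = W \<phi> (x - z) * (indicator {0..} z * (\<omega> z - \<phi>) * g z)"
        by (simp only: right_diff_distrib[symmetric])
    qed
    ultimately show ?thesis by linarith
  qed
  define V where "V x = (\<integral>\<^sup>+\<xi>. occupation_functional \<omega> ?f c x (path \<xi>) \<partial>M)" for x
  have Vm[measurable]: "V \<in> borel_measurable borel" unfolding V_def by measurable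
  let ?p = "\<lambda>q x. exp (- right_inverse \<psi> q * (c - x))"
  have pot: "potential \<phi> c x ?f = ennreal (?p \<phi> x * F c - F x) \<and> F x \<le> ?p \<phi> x * F c" if x: "x \<le> c" for x
  proof -
    have e: "potential \<phi> c x ?f + ennreal (F x) = ennreal (?p \<phi> x * F c)"
      using potential_formula[OF \<phi> x S\<phi>, of ?f] F[of x] F[of c] by (simp add: ennreal_mult)
    then have "ennreal (F x) \<le> ennreal (?p \<phi> x * F c)" by (metis add.commute le_iff_add)
    then have le: "F x \<le> ?p \<phi> x * F c" using F[of c] by simp
    have "potential \<phi> c x ?f = (potential \<phi> c x ?f + ennreal (F x)) - ennreal (F x)" by simp
    also have "\<dots> = ennreal (?p \<phi> x * F c - F x)" unfolding e using F[of x] by (simp add: ennreal_minus)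
    finally show ?thesis using le by simp
  qed
  \<comment> \<open>Finiteness of \<open>V\<close>: dropping the discount only increases the
    occupation, and at rate 0 \<open>potential_formula\<close> bounds it by the convolution of
    \<open>W 0\<close> with the indicator of \<open>A\<close>, taken at \<open>c\<close>.\<close>
  obtain S1 where S1: "0 \<le> S1" "\<And>x. x \<le> c \<Longrightarrow> V x \<le> ennreal S1"
  proof -
    define S1 where "S1 = (\<integral>z. W 0 (c - z) * (max 0 (indicator {a..} z) * ?fr z) \<partial>lborel)"
    have nS: "nn_conv (\<lambda>y. ennreal (W 0 y)) ?f c = ennreal S1"
    proof -
      have "nn_conv (\<lambda>y. ennreal (W 0 y)) (\<lambda>z. ennreal (indicator {a..} z) * ?f z) c = ennreal S1"
        unfolding S1_def by (rule nn_conv_scale_real(2)[OF S0, where S=1 and K=1 and a=a]) (auto split: split_indicator)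
      moreover have "(\<lambda>z. ennreal (indicator {a..} z) * ?f z) = ?f" using Ac by (auto simp: fun_eq_iff split: split_indicator)
      ultimately show ?thesis by simp
    qed
    have "V x \<le> ennreal S1" if x: "x \<le> c" for x
    proof -
      have "occupation_functional \<omega> ?f c x p \<le> occupation_functional (\<lambda>_. 0) ?f c x p" for p
      proof -
        have "exp (- cost \<omega> x p t) \<le> exp (- cost (\<lambda>_. 0) x p t)" for t
          using cost_nonneg[of \<omega> x p t] w(1) by (simp add: cost_def[of "\<lambda>_. 0"])
        then show ?thesis
          unfolding occupation_functional_def by (intro nn_integral_mono mult_right_mono ennreal_leI) auto
      qed
      then have "V x \<le> potential 0 c x ?f"
        unfolding V_def expectation_occupation_functional_const[symmetric, of ?f, OF borel_measurable_indicator[OF A]] by (intro nn_integral_mono)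
      also have "\<dots> \<le> potential 0 c x ?f + nn_conv (\<lambda>y. ennreal (W 0 y)) ?f x" by simp
      also have "\<dots> = ennreal (?p 0 x) * ennreal S1" unfolding nS[symmetric] by (rule potential_formula[OF order_refl x S0]) measurable
      also have "\<dots> \<le> ennreal 1 * ennreal S1"
        using right_inverse_nonneg[of 0] x by (intro mult_right_mono ennreal_leI) auto
      finally show ?thesis by simp
    qed
    moreover have "0 \<le> S1" unfolding S1_def using scale_function_simps(1)[OF S0] by (intro integral_nonneg_AE AE_I2) auto
    ultimately show ?thesis using that by blast
  qed
  have eq: "V x + potential \<phi> c x (\<lambda>y. ennreal (\<omega> y - \<phi>) * V y)
      = ennreal (?p \<phi> x * F c - F x) + potential \<phi> c x (\<lambda>y. ennreal (\<phi> - \<omega> y) * V y)" if x: "x \<le> c" for x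
  proof -
    have fm: "?f \<in> borel_measurable borel" by measurable
    have "(\<lambda>(y, p). occupation_functional \<omega> ?f c y p) \<in> borel_measurable (borel \<Otimes>\<^sub>M path_space)" by measurable
    moreover have "(\<lambda>\<xi>. occupation_functional (\<lambda>_. \<phi>) ?f c x (path \<xi>)) \<in> borel_measurable M" by measurable
    ultimately have "V x + potential \<phi> c x (\<lambda>y. ennreal (\<omega> y - \<phi>) * V y)
      = (\<integral>\<^sup>+\<xi>. occupation_functional (\<lambda>_. \<phi>) ?f c x (path \<xi>) \<partial>M) + potential \<phi> c x (\<lambda>y. ennreal (\<phi> - \<omega> y) * V y)"
      unfolding V_def by (rule potential_perturbation[OF wm _ _ occupation_functional_feynman_kac[OF _ wm fm wK]])
    then show ?thesis using pot[OF x] by (simp add: expectation_occupation_functional_const)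
  qed
  have bnn: "0 \<le> ?p \<phi> x * F c - F x" if "x \<le> c" for x using pot[OF that] by simp
  obtain \<kappa> where \<kappa>: "\<And>x. x \<le> c \<Longrightarrow> enn2real (V x) = (?p \<phi> x * F c - F x) + ?p \<phi> x * \<kappa>
       + (\<integral>z. W \<phi> (x - z) * (indicator {0..} z * (\<omega> z - \<phi>) * enn2real (V z)) \<partial>lborel)"
     "enn2real (V c) = ?p \<phi> c * F c - F c"
  proof (rule resolvent_volterra[OF S\<phi> \<phi> wm wb w(3) Vm S1(2) S1(1) bnn eq])
    fix \<kappa> assume "\<And>x. x \<le> c \<Longrightarrow> enn2real (V x) = (?p \<phi> x * F c - F x) + ?p \<phi> x * \<kappa>
       + (\<integral>z. W \<phi> (x - z) * (indicator {0..} z * (\<omega> z - \<phi>) * enn2real (V z)) \<partial>lborel)"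
     "enn2real (V c) = ?p \<phi> c * F c - F c"
    then show thesis by (rule that)
  qed
  \<comment> \<open>\<open>F c\<close> comes from the unperturbed potential, \<open>\<kappa>\<close>
    from the perturbation; both are multiplied by \<open>exp (- \<Phi> (c - x))\<close>.\<close>
  define L where "L = exp (- right_inverse \<psi> \<phi> * c) * (F c + \<kappa>)"
  have VS: "enn2real (V z) \<le> S1" if "z \<le> c" for z using enn2real_mono[OF S1(2)[OF that]] S1(1) by simp
  have vg: "enn2real (V x) + g x = L * \<H> x" if "x \<le> c" for x
  proof (rule volterra_multiple_of_H[OF S\<phi> H wm _ wb _ _ that])
    show "(\<lambda>x. enn2real (V x) + g x) \<in> borel_measurable borel" by measurable
    show "\<bar>enn2real (V z) + g z\<bar> \<le> S1 + Sg" if "z \<in> {0..c}" for z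
      using VS[of z] gS[of z] g0[of z] that by simp
    fix x assume x: "x \<le> c"
    have km: "(\<lambda>z. \<omega> z - \<phi>) \<in> borel_measurable borel" by measurable
    have kb: "\<bar>\<omega> z - \<phi>\<bar> \<le> B1 + \<phi>" if "z \<in> {0..c}" for z using wb[OF that] \<phi> by linarith
    have "integrable lborel (\<lambda>z. W \<phi> (x - z) * (indicator {0..} z * (\<omega> z - \<phi>) * enn2real (V z)))"
      by (rule integrable_scale_conv[OF S\<phi> km _ kb _ x, where S=S1]) (use VS in auto)
    moreover have "integrable lborel (\<lambda>z. W \<phi> (x - z) * (indicator {0..} z * (\<omega> z - \<phi>) * g z))"
      by (rule integrable_scale_conv[OF S\<phi> km gm kb _ x, where S=Sg]) (use gS g0 in auto)
    ultimately have "(\<integral>z. W \<phi> (x - z) * (indicator {0..} z * (\<omega> z - \<phi>) * enn2real (V z)) \<partial>lborel) + (\<integral>z. W \<phi> (x - z) * (indicator {0..} z * (\<omega> z - \<phi>) * g z) \<partial>lborel)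
      = (\<integral>z. W \<phi> (x - z) * (indicator {0..} z * (\<omega> z - \<phi>) * enn2real (V z)) + W \<phi> (x - z) * (indicator {0..} z * (\<omega> z - \<phi>) * g z) \<partial>lborel)"
      by (rule Bochner_Integration.integral_add[symmetric])
    also have "\<dots> = (\<integral>z. W \<phi> (x - z) * (indicator {0..} z * (\<omega> z - \<phi>) * (enn2real (V z) + g z)) \<partial>lborel)"
      by (simp only: distrib_left)
    finally have I: "(\<integral>z. W \<phi> (x - z) * (indicator {0..} z * (\<omega> z - \<phi>) * enn2real (V z)) \<partial>lborel) + (\<integral>z. W \<phi> (x - z) * (indicator {0..} z * (\<omega> z - \<phi>) * g z) \<partial>lborel)
       = (\<integral>z. W \<phi> (x - z) * (indicator {0..} z * (\<omega> z - \<phi>) * (enn2real (V z) + g z)) \<partial>lborel)" .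
    have "?p \<phi> x = exp (- right_inverse \<psi> \<phi> * c) * exp (right_inverse \<psi> \<phi> * x)"
      by (simp add: algebra_simps flip: exp_add)
    then have "?p \<phi> x * F c + ?p \<phi> x * \<kappa> = L * exp (right_inverse \<psi> \<phi> * x)" by (simp add: L_def algebra_simps)
    then show "enn2real (V x) + g x = L * exp (right_inverse \<psi> \<phi> * x)
      + (\<integral>z. W \<phi> (x - z) * (indicator {0..} z * (\<omega> z - \<phi>) * (enn2real (V z) + g z)) \<partial>lborel)"
      using \<kappa>(1)[OF x] geq[OF x] I by linarith
  qed
  have Hc: "\<H> c \<noteq> 0" by (rule exit_identity(1)[OF S\<phi> \<phi> H wm w order_refl])
  \<comment> \<open>At \<open>c\<close> the exponential factor \<open>?p \<phi> c\<close> is 1, so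
    \<open>F c\<close> cancels and \<open>V\<close> contributes 0.\<close>
  have "g c = L * \<H> c" using vg[of c] \<kappa>(2) by simp
  then have L: "L = g c / \<H> c" using Hc by (simp add: field_simps)
  have v: "enn2real (V x) = \<H> x / \<H> c * g c - g x" using vg[OF xc] unfolding L by (simp add: mult.commute)
  have e: "indicator A y * (\<H> x / \<H> c * \<W> c y - \<W> x y) = \<H> x / \<H> c * (?fr y * \<W> c y) - ?fr y * \<W> x y" for y
    by (simp add: algebra_simps)
  show "integrable lborel (\<lambda>y. indicator A y * (\<H> x / \<H> c * \<W> c y - \<W> x y))"
    unfolding e using iW[OF order_refl] iW[OF xc] by simp
  have int: "(\<integral>y. indicator A y * (\<H> x / \<H> c * \<W> c y - \<W> x y) \<partial>lborel) = enn2real (V x)"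
    unfolding e v g_def using iW[OF order_refl] iW[OF xc] by simp
  have "V x \<noteq> top" using S1(2)[OF xc] by (metis ennreal_neq_top neq_top_trans)
  then show "(\<integral>\<^sup>+\<xi>. occupation_functional \<omega> ?f c x (path \<xi>) \<partial>M) = ennreal (\<integral>y. indicator A y * (\<H> x / \<H> c * \<W> c y - \<W> x y) \<partial>lborel)"
    unfolding int V_def[symmetric] by (simp add: less_top)
  show "0 \<le> (\<integral>y. indicator A y * (\<H> x / \<H> c * \<W> c y - \<W> x y) \<partial>lborel)" unfolding int by simp
qed

end

section \<open>Translation into the quantities of the statement, and unbounded sets\<close>

lemma (in levy) first_passage_above_eq:
  assumes "\<xi> \<in> space M"
  shows "first_passage_above (started_at x X) c \<xi> = passage c x (path \<xi>)"
proof -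
  have "{t. 0 < t \<and> c < x + path \<xi> t} = {t. 0 < t \<and> c < x + X t \<xi>}" by (auto simp: path_apply)
  then show ?thesis
    unfolding first_passage_above_def started_at_def passage_eq_Inf[OF right_cont_path[OF assms]] by simp
qed

lemma (in levy) interval_integral_eq_cost:
  assumes "\<xi> \<in> space M" "0 \<le> T"
  shows "(LBINT s=0..T. \<omega> (started_at x X s \<xi>)) = cost \<omega> x (path \<xi>) T"
proof -
  have "einterval 0 T = {s. 0 < s \<and> ereal s < T}" by (auto simp: einterval_def)
  then have "(LBINT s=0..T. \<omega> (started_at x X s \<xi>)) = (LBINT s:{s. 0 < s \<and> ereal s < T}. \<omega> (started_at x X s \<xi>))"
    using assms(2) by (simp only: interval_lebesgue_integral_def if_True)
  also have "\<dots> = cost \<omega> x (path \<xi>) T"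
    unfolding cost_def set_lebesgue_integral_def
  proof (rule Bochner_Integration.integral_cong[OF refl])
    fix s :: real
    show "indicator {s. 0 < s \<and> ereal s < T} s *\<^sub>R \<omega> (started_at x X s \<xi>)
        = indicator {s. 0 < s \<and> ereal s < T} s *\<^sub>R \<omega> (x + reg (path \<xi>) s)"
      using reg_path[OF assms(1), of s] by (cases "0 < s") (simp_all add: started_at_def)
  qed
  finally show ?thesis .
qed

lemma exit_functional_finite: "exit_functional \<omega> c x p < \<infinity>"
  by (simp add: exit_functional_def)

context spectrally_negative begin

lemma exit_expectation:
  assumes [measurable]: "\<omega> \<in> borel_measurable borel"
  shows "(LINT \<xi>:{\<xi> \<in> space M. first_passage_above (started_at x X) c \<xi> < \<infinity>}|M.
      exp (- (LBINT s=0..first_passage_above (started_at x X) c \<xi>. \<omega> (started_at x X s \<xi>))))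
    = enn2real (\<integral>\<^sup>+\<xi>. exit_functional \<omega> c x (path \<xi>) \<partial>M)"
proof -
  have "(LINT \<xi>:{\<xi> \<in> space M. first_passage_above (started_at x X) c \<xi> < \<infinity>}|M.
      exp (- (LBINT s=0..first_passage_above (started_at x X) c \<xi>. \<omega> (started_at x X s \<xi>))))
    = (\<integral>\<xi>. enn2real (exit_functional \<omega> c x (path \<xi>)) \<partial>M)"
    unfolding set_lebesgue_integral_def
    by (rule Bochner_Integration.integral_cong[OF refl])
       (auto simp: first_passage_above_eq interval_integral_eq_cost passage_nonneg exit_functional_def split: split_indicator)
  also have "\<dots> = enn2real (\<integral>\<^sup>+\<xi>. ennreal (enn2real (exit_functional \<omega> c x (path \<xi>))) \<partial>M)"
    by (rule integral_eq_nn_integral) auto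
  also have "(\<lambda>\<xi>. ennreal (enn2real (exit_functional \<omega> c x (path \<xi>)))) = (\<lambda>\<xi>. exit_functional \<omega> c x (path \<xi>))"
    using exit_functional_finite by (auto simp: fun_eq_iff)
  finally show ?thesis .
qed

text \<open>Fubini between time and paths; the time 0, which \<open>occupation_functional\<close>
  omits, is a null set.\<close>

lemma occupation_expectation:
  assumes [measurable]: "\<omega> \<in> borel_measurable borel" and w: "\<And>y. 0 \<le> \<omega> y" and A[measurable]: "A \<in> sets borel"
  shows "(\<integral>\<^sup>+t\<in>{0..}. ennreal
      (LINT \<xi>:{\<xi> \<in> space M. ereal t < first_passage_above (started_at x X) c \<xi> \<and> started_at x X t \<xi> \<in> A}|M.
         exp (- (LBINT s=0..ereal t. \<omega> (started_at x X s \<xi>)))) \<partial>lborel)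
    = (\<integral>\<^sup>+\<xi>. occupation_functional \<omega> (indicator A) c x (path \<xi>) \<partial>M)"
proof -
  interpret lM: pair_sigma_finite lborel M ..
  define D where "D = (\<lambda>t \<xi>. if 0 < t \<and> ereal t < passage c x (path \<xi>) then
      ennreal (exp (- cost \<omega> x (path \<xi>) (ereal t))) * indicator A (x + reg (path \<xi>) t) else 0)"
  have Dm: "(\<lambda>(t, \<xi>). D t \<xi>) \<in> borel_measurable (lborel \<Otimes>\<^sub>M M)" unfolding D_def by measurable
  have "(\<integral>\<^sup>+t\<in>{0..}. ennreal
      (LINT \<xi>:{\<xi> \<in> space M. ereal t < first_passage_above (started_at x X) c \<xi> \<and> started_at x X t \<xi> \<in> A}|M.
         exp (- (LBINT s=0..ereal t. \<omega> (started_at x X s \<xi>)))) \<partial>lborel) = (\<integral>\<^sup>+t. (\<integral>\<^sup>+\<xi>. D t \<xi> \<partial>M) \<partial>lborel)"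
  proof (rule nn_integral_cong_AE)
    have "AE t in lborel. t \<noteq> (0::real)" by (rule AE_lborel_singleton)
    then show "AE t in lborel. ennreal
      (LINT \<xi>:{\<xi> \<in> space M. ereal t < first_passage_above (started_at x X) c \<xi> \<and> started_at x X t \<xi> \<in> A}|M.
         exp (- (LBINT s=0..ereal t. \<omega> (started_at x X s \<xi>)))) * indicator {0..} t = (\<integral>\<^sup>+\<xi>. D t \<xi> \<partial>M)"
    proof eventually_elim
      fix t :: real assume t: "t \<noteq> 0"
      show "ennreal
      (LINT \<xi>:{\<xi> \<in> space M. ereal t < first_passage_above (started_at x X) c \<xi> \<and> started_at x X t \<xi> \<in> A}|M.
         exp (- (LBINT s=0..ereal t. \<omega> (started_at x X s \<xi>)))) * indicator {0..} t = (\<integral>\<^sup>+\<xi>. D t \<xi> \<partial>M)"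
      proof (cases "0 < t")
        case True
        let ?d = "\<lambda>\<xi>. if ereal t < passage c x (path \<xi>) \<and> x + reg (path \<xi>) t \<in> A then exp (- cost \<omega> x (path \<xi>) (ereal t)) else 0"
        have st: "started_at x X t \<xi> = x + reg (path \<xi>) t" if "\<xi> \<in> space M" for \<xi>
          using that True by (simp add: started_at_def reg_path)
        have "(LINT \<xi>:{\<xi> \<in> space M. ereal t < first_passage_above (started_at x X) c \<xi> \<and> started_at x X t \<xi> \<in> A}|M.
           exp (- (LBINT s=0..ereal t. \<omega> (started_at x X s \<xi>)))) = (\<integral>\<xi>. ?d \<xi> \<partial>M)"
          unfolding set_lebesgue_integral_def using True
          by (intro Bochner_Integration.integral_cong)
             (auto simp: first_passage_above_eq interval_integral_eq_cost st split: split_indicator)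
        moreover have "integrable M ?d"
          by (rule integrable_const_bound[where B=1]) (use cost_nonneg[OF w] in auto)
        then have "(\<integral>\<^sup>+\<xi>. ennreal (?d \<xi>) \<partial>M) = ennreal (\<integral>\<xi>. ?d \<xi> \<partial>M)" by (rule nn_integral_eq_integral) auto
        moreover have "ennreal (?d \<xi>) = D t \<xi>" for \<xi> using True by (auto simp: D_def)
        ultimately show ?thesis using True by simp
      qed (use t in \<open>simp add: D_def\<close>)
    qed
  qed
  also have "\<dots> = (\<integral>\<^sup>+\<xi>. (\<integral>\<^sup>+t. D t \<xi> \<partial>lborel) \<partial>M)"
    by (rule lM.Fubini'[OF Dm, symmetric])
  also have "\<dots> = (\<integral>\<^sup>+\<xi>. occupation_functional \<omega> (indicator A) c x (path \<xi>) \<partial>M)"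
    unfolding occupation_functional_def D_def by (intro nn_integral_cong) (auto split: split_indicator)
  finally show ?thesis .
qed

text \<open>Carries the identity from bounded sets, where all integrals are finite, to arbitrary
  Borel subsets of \<open>{..c}\<close>.\<close>

lemma occupation_monotone_limit:
  assumes [measurable]: "\<omega> \<in> borel_measurable borel" "\<And>n. A n \<in> sets borel" and inc: "incseq A"
  shows "(\<lambda>n. \<integral>\<^sup>+\<xi>. occupation_functional \<omega> (indicator (A n)) c x (path \<xi>) \<partial>M)
     \<longlonglongrightarrow> (\<integral>\<^sup>+\<xi>. occupation_functional \<omega> (indicator (\<Union>n. A n)) c x (path \<xi>) \<partial>M)"
proof (rule nn_integral_LIMSEQ)
  have mono: "occupation_functional \<omega> (indicator (A m)) c x p \<le> occupation_functional \<omega> (indicator (A n)) c x p" if "m \<le> n" for m n p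
    unfolding occupation_functional_def using incseqD[OF inc that]
    by (intro nn_integral_mono mult_right_mono mult_left_mono) (auto split: split_indicator)
  then show "incseq (\<lambda>n \<xi>. occupation_functional \<omega> (indicator (A n)) c x (path \<xi>))"
    by (auto simp: incseq_def le_fun_def)
  show "(\<lambda>\<xi>. occupation_functional \<omega> (indicator (A n)) c x (path \<xi>)) \<in> borel_measurable M" for n by measurable
  show "(\<lambda>n. occupation_functional \<omega> (indicator (A n)) c x (path \<xi>)) \<longlonglongrightarrow> occupation_functional \<omega> (indicator (\<Union>n. A n)) c x (path \<xi>)" for \<xi>
    unfolding occupation_functional_def
  proof (rule nn_integral_LIMSEQ)
    let ?P = "indicator {t. 0 < t \<and> ereal t < passage c x (path \<xi>)} :: real \<Rightarrow> ennreal"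
    let ?e = "\<lambda>t. ennreal (exp (- cost \<omega> x (path \<xi>) (ereal t)))"
    show "incseq (\<lambda>n t. ?e t * indicator (A n) (x + reg (path \<xi>) t) * ?P t)"
      unfolding incseq_def le_fun_def
    proof (intro allI impI mult_right_mono mult_left_mono)
      fix m n :: nat and t :: real assume "m \<le> n"
      then show "(indicator (A m) (x + reg (path \<xi>) t) :: ennreal) \<le> indicator (A n) (x + reg (path \<xi>) t)"
        using incseqD[OF inc, of m n] by (auto split: split_indicator)
    qed auto
    have [measurable]: "(\<lambda>t. cost \<omega> x (path \<xi>) (ereal t)) \<in> borel_measurable borel" unfolding cost_ereal by measurable
    show "(\<lambda>t. ?e t * indicator (A n) (x + reg (path \<xi>) t) * ?P t) \<in> borel_measurable lborel" for n by measurable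
    show "(\<lambda>n. ?e t * indicator (A n) (x + reg (path \<xi>) t) * ?P t) \<longlonglongrightarrow> ?e t * indicator (\<Union>n. A n) (x + reg (path \<xi>) t) * ?P t" for t
    proof (cases "x + reg (path \<xi>) t \<in> (\<Union>n. A n)")
      case True
      then obtain m where "x + reg (path \<xi>) t \<in> A m" by auto
      then have "x + reg (path \<xi>) t \<in> A n" if "m \<le> n" for n using incseqD[OF inc that] by auto
      then have "eventually (\<lambda>n. x + reg (path \<xi>) t \<in> A n) sequentially" unfolding eventually_sequentially by blast
      then have "eventually (\<lambda>n. ?e t * indicator (A n) (x + reg (path \<xi>) t) * ?P t = ?e t * indicator (\<Union>n. A n) (x + reg (path \<xi>) t) * ?P t) sequentially"
        by eventually_elim (use True in simp)
      then show ?thesis by (rule tendsto_eventually)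
    next
      case False
      then have "indicator (A n) (x + reg (path \<xi>) t) = (0 :: ennreal)" for n by auto
      then show ?thesis using False by simp
    qed
  qed
qed

end

theorem theorem2p5:
  fixes M :: "'a measure"
    and X :: "real \<Rightarrow> 'a \<Rightarrow> real"
    and \<psi> :: "real \<Rightarrow> real"
    and W :: "real \<Rightarrow> real \<Rightarrow> real"
    and \<omega> :: "real \<Rightarrow> real"
    and \<phi> :: real
    and \<H> :: "real \<Rightarrow> real"
    and \<W> :: "real \<Rightarrow> real \<Rightarrow> real"
  assumes "spectrally_negative_levy M X"
    and "is_laplace_exponent M X \<psi>"
    and "\<And>q. 0 \<le> q \<Longrightarrow> is_scale_function \<psi> q (W q)"
    and "\<omega> \<in> borel_measurable borel"
    and "\<And>x. 0 \<le> \<omega> x"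
    and "locally_bounded \<omega>"
    and "0 \<le> \<phi>"
    and "\<And>x. x \<le> 0 \<Longrightarrow> \<omega> x = \<phi>"
    and "is_omega_H_function \<psi> (W \<phi>) \<phi> \<omega> \<H>"
    and "is_omega_scale_function (W 0) \<omega> \<W>"
  shows "(\<forall>x c. x \<le> c \<longrightarrow>
            (LINT \<xi>:{\<xi> \<in> space M. first_passage_above (started_at x X) c \<xi> < \<infinity>}|M.
               exp (- (LBINT s=0..first_passage_above (started_at x X) c \<xi>.
                         \<omega> (started_at x X s \<xi>))))
            = \<H> x / \<H> c) \<and>
         (\<forall>x c. x \<le> c \<longrightarrow>
            (\<lambda>y. \<H> x / \<H> c * \<W> c y - \<W> x y) \<in> borel_measurable borel \<and>
            (AE y in lborel. y \<le> c \<longrightarrow> 0 \<le> \<H> x / \<H> c * \<W> c y - \<W> x y) \<and>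
            (\<forall>A\<in>sets borel. A \<subseteq> {..c} \<longrightarrow>
               (\<integral>\<^sup>+t\<in>{0..}. ennreal
                  (LINT \<xi>:{\<xi> \<in> space M. ereal t < first_passage_above (started_at x X) c \<xi> \<and>
                                       started_at x X t \<xi> \<in> A}|M.
                     exp (- (LBINT s=0..ereal t. \<omega> (started_at x X s \<xi>)))) \<partial>lborel)
               = (\<integral>\<^sup>+y\<in>A. ennreal (\<H> x / \<H> c * \<W> c y - \<W> x y) \<partial>lborel)))"
proof -
  note wm[measurable] = assms(4)
  have lv: "levy_process M X" using assms(1) by (simp add: spectrally_negative_levy_def)
  interpret spectrally_negative M X \<psi>
    using lv assms(1,2)
    by (intro spectrally_negative.intro spectrally_negative_axioms.intro levy.intro levy_axioms.intro)
       (simp_all add: levy_process_def)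
  show ?thesis
  proof (intro conjI allI impI ballI)
    fix x c :: real assume xc: "x \<le> c"
    have ex: "(\<integral>\<^sup>+\<xi>. exit_functional \<omega> c x (path \<xi>) \<partial>M) = ennreal (\<H> x / \<H> c)" "0 \<le> \<H> x / \<H> c"
      by (rule exit_identity[where W="W \<phi>" and \<phi>=\<phi>]; fact assms assms(3)[OF assms(7)] xc)+
    show "(LINT \<xi>:{\<xi> \<in> space M. first_passage_above (started_at x X) c \<xi> < \<infinity>}|M.
               exp (- (LBINT s=0..first_passage_above (started_at x X) c \<xi>. \<omega> (started_at x X s \<xi>)))) = \<H> x / \<H> c"
      unfolding exit_expectation[OF wm] ex(1) using ex(2) by simp
  next
    fix x c :: real assume xc: "x \<le> c"
    define h where "h y = \<H> x / \<H> c * \<W> c y - \<W> x y" for y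
    note Wp = omega_scale_properties[OF assms(3)[OF order_refl] assms(10,4,5,6)]
    have \<W>m: "(\<lambda>y. \<W> u y) \<in> borel_measurable borel" for u
      using measurable_compose[OF measurable_Pair[OF measurable_const measurable_ident] Wp(1), of u] by simp
    have hm[measurable]: "h \<in> borel_measurable borel"
      using \<W>m[of c] \<W>m[of x] unfolding h_def by measurable
    then show "(\<lambda>y. \<H> x / \<H> c * \<W> c y - \<W> x y) \<in> borel_measurable borel" by (simp add: h_def[abs_def])
    have occ: "integrable lborel (\<lambda>y. indicator A y * h y)"
      "(\<integral>\<^sup>+\<xi>. occupation_functional \<omega> (indicator A) c x (path \<xi>) \<partial>M) = ennreal (\<integral>y. indicator A y * h y \<partial>lborel)"
      "0 \<le> (\<integral>y. indicator A y * h y \<partial>lborel)"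
      if A: "A \<in> sets borel" "A \<subseteq> {a..c}" for A a
      unfolding h_def
      by (rule occupation_identity[where W=W and \<phi>=\<phi> and \<omega>=\<omega> and a=a]; fact assms xc A)+
    \<comment> \<open>Tested on the bounded set where \<open>h < 0\<close>: the integral of
      \<open>h\<close> over it is nonnegative, being a mean occupation, and nonpositive by the
      choice of the set.\<close>
    have AEh: "AE y in lborel. y \<le> c \<longrightarrow> 0 \<le> h y"
    proof -
      have "AE y in lborel. y \<in> {- real n..c} \<longrightarrow> 0 \<le> h y" for n
      proof -
        define A where "A = {y \<in> {- real n..c}. h y < 0}"
        have [measurable]: "A \<in> sets borel" unfolding A_def by measurable
        have sub: "A \<subseteq> {- real n..c}" by (auto simp: A_def)
        have i: "integrable lborel (\<lambda>y. indicator A y * h y)" by (rule occ(1)[OF _ sub]) measurable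
        have nonneg: "0 \<le> (\<integral>y. indicator A y * h y \<partial>lborel)" by (rule occ(3)[OF _ sub]) measurable
        have "0 \<le> - (indicator A y * h y)" for y by (auto simp: A_def split: split_indicator)
        note neg = this
        have "0 \<le> (\<integral>y. - (indicator A y * h y) \<partial>lborel)" by (intro integral_nonneg_AE AE_I2 neg)
        then have "(\<integral>y. - (indicator A y * h y) \<partial>lborel) = 0" using nonneg i by simp
        then have "AE y in lborel. - (indicator A y * h y) = 0"
          by (subst (asm) integral_nonneg_eq_0_iff_AE) (use i neg in auto)
        then show ?thesis by eventually_elim (auto simp: A_def not_less split: split_indicator_asm)
      qed
      then have "AE y in lborel. \<forall>n. y \<in> {- real n..c} \<longrightarrow> 0 \<le> h y" by (subst AE_all_countable) (rule allI)
      then show ?thesis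
      proof eventually_elim
        fix y assume *: "\<forall>n. y \<in> {- real n..c} \<longrightarrow> 0 \<le> h y"
        obtain n :: nat where "- y \<le> real n" using real_arch_simple by blast
        then show "y \<le> c \<longrightarrow> 0 \<le> h y" using *[rule_format, of n] by auto
      qed
    qed
    then show "AE y in lborel. y \<le> c \<longrightarrow> 0 \<le> \<H> x / \<H> c * \<W> c y - \<W> x y" by (simp add: h_def)
    fix A :: "real set" assume A[measurable]: "A \<in> sets borel" and Ac: "A \<subseteq> {..c}"
    \<comment> \<open>Bounded pieces to which \<open>occ\<close> applies; they exhaust
      \<open>A\<close> because \<open>A\<close> lies below \<open>c\<close>.\<close>
    define B where "B n = A \<inter> {- real n..c}" for n
    have Bm[measurable]: "B n \<in> sets borel" for n unfolding B_def by measurable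
    have Bi: "incseq B" unfolding B_def incseq_def by auto
    have BU: "(\<Union>n. B n) = A"
    proof
      show "A \<subseteq> (\<Union>n. B n)"
      proof
        fix y assume y: "y \<in> A"
        obtain n :: nat where "- y \<le> real n" using real_arch_simple by blast
        then show "y \<in> (\<Union>n. B n)" using y Ac by (auto simp: B_def intro!: exI[of _ n])
      qed
    qed (auto simp: B_def)
    have Bsub: "B n \<subseteq> {- real n..c}" for n by (auto simp: B_def)
    have "(\<integral>\<^sup>+\<xi>. occupation_functional \<omega> (indicator (B n)) c x (path \<xi>) \<partial>M) = (\<integral>\<^sup>+y\<in>B n. ennreal (h y) \<partial>lborel)" for n
    proof -
      have "(\<integral>\<^sup>+y\<in>B n. ennreal (h y) \<partial>lborel) = (\<integral>\<^sup>+y. ennreal (indicator (B n) y * h y) \<partial>lborel)"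
        by (intro nn_integral_cong) (auto split: split_indicator)
      also have "\<dots> = ennreal (\<integral>y. indicator (B n) y * h y \<partial>lborel)"
      proof (rule nn_integral_eq_integral[OF occ(1)[OF Bm Bsub]])
        show "AE y in lborel. 0 \<le> indicator (B n) y * h y" using AEh by eventually_elim (auto simp: B_def split: split_indicator)
      qed
      finally show ?thesis unfolding occ(2)[OF Bm Bsub] by simp
    qed
    then have "(\<lambda>n. \<integral>\<^sup>+y\<in>B n. ennreal (h y) \<partial>lborel) \<longlonglongrightarrow> (\<integral>\<^sup>+\<xi>. occupation_functional \<omega> (indicator A) c x (path \<xi>) \<partial>M)"
      using occupation_monotone_limit[OF wm Bm Bi, of c x] unfolding BU by simp
    moreover have "(\<lambda>n. \<integral>\<^sup>+y\<in>B n. ennreal (h y) \<partial>lborel) \<longlonglongrightarrow> (\<integral>\<^sup>+y\<in>A. ennreal (h y) \<partial>lborel)"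
    proof (rule nn_integral_LIMSEQ)
      show "incseq (\<lambda>n y. ennreal (h y) * indicator (B n) y)"
        using incseqD[OF Bi] by (auto simp: incseq_def le_fun_def split: split_indicator)
      show "(\<lambda>y. ennreal (h y) * indicator (B n) y) \<in> borel_measurable lborel" for n by measurable
      show "(\<lambda>n. ennreal (h y) * indicator (B n) y) \<longlonglongrightarrow> ennreal (h y) * indicator A y" for y
      proof (intro ennreal_tendsto_cmult)
        have "(\<lambda>n. indicator (B n) y :: ennreal) \<longlonglongrightarrow> indicator (\<Union>n. B n) y" by (rule LIMSEQ_indicator_incseq[OF Bi])
        then show "(\<lambda>n. indicator (B n) y :: ennreal) \<longlonglongrightarrow> indicator A y" unfolding BU .
      qed simp
    qed
    ultimately show "(\<integral>\<^sup>+t\<in>{0..}. ennreal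
                  (LINT \<xi>:{\<xi> \<in> space M. ereal t < first_passage_above (started_at x X) c \<xi> \<and>
                                       started_at x X t \<xi> \<in> A}|M.
                     exp (- (LBINT s=0..ereal t. \<omega> (started_at x X s \<xi>)))) \<partial>lborel)
               = (\<integral>\<^sup>+y\<in>A. ennreal (\<H> x / \<H> c * \<W> c y - \<W> x y) \<partial>lborel)"
      unfolding occupation_expectation[OF wm assms(5) A] h_def by (rule LIMSEQ_unique)
  qed
qed

end
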